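(* Let $\mathcal A=(A_{-2},A_{-1},l_1,l_2,l_3,a)$ be a split Lie $2$-algebroid with structure function $\mu$, let $H\in\Gamma(A_{-1}\odot A_{-2})$ and $K\in\Gamma(\wedge^3A_{-2})$, and suppose $H+K$ is a Maurer-Cartan element of the associated homotopy Poisson algebra $(\mathrm{Sym}(\mathcal A[-3]),[\cdot]_S,[\cdot,\cdot]_S,[\cdot,\cdot,\cdot]_S)$, i.e. $$[H+K]_S+\tfrac12[H+K,H+K]_S+\tfrac16[H+K,H+K,H+K]_S=0.$$ Define, for $\alpha^2,\beta^2,\gamma^2\in\Gamma(A_{-2}^* )$ and $\beta^1\in\Gamma(A_{-1}^* )$, $$\mathfrak l_1^H=l_1^*,\qquad \mathfrak a_H=a\circ H^\sharp,\qquad \mathfrak l_2^H(\alpha^2,\beta^2)=L^1_{H^\sharp(\alpha^2)}\beta^2-L^1_{H^\sharp(\beta^2)}\alpha^2,$$ $$\mathfrak l_2^H(\alpha^2,\beta^1)=L^1_{H^\sharp(\alpha^2)}\beta^1-L^2_{H^\natural(\beta^1)}\alpha^2-\mathrm d\big(H(\alpha^2,\beta^1)\big),$$ $$\mathfrak l_3^{H,K}(\alpha^2,\beta^2,\gamma^2)=-L^2_{K^\flat(\alpha^2,\beta^2)}\gamma^2-L^2_{K^\flat(\gamma^2,\alpha^2)}\beta^2-L^2_{K^\flat(\beta^2,\gamma^2)}\alpha^2-2\,\mathrm d\big(K(\alpha^2,\beta^2,\gamma^2)\big)+L^3_{H^\sharp(\alpha^2),H^\sharp(\beta^2)}\gamma^2+L^3_{H^\sharp(\beta^2),H^\sharp(\gamma^2)}\alpha^2+L^3_{H^\sharp(\gamma^2),H^\sharp(\alpha^2)}\beta^2.$$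 Then: (i) $\mathcal A^*[3]=(A_{-1}^*[3],A_{-2}^*[3],\mathfrak l^H_1,\mathfrak l^H_2,\mathfrak l^{H,K}_3,\mathfrak a_H)$ is a split Lie $2$-algebroid; (ii) $(H^\sharp,-H^\natural,-K^\flat)$ is a morphism from the split Lie $2$-algebroid $\mathcal A^*[3]$ of (i) to the split Lie $2$-algebroid $\mathcal A$; (iii) $(\mathcal A,\mathcal A^*[3])$ is a split Lie $2$-bialgebroid if and only if $$\{\mu^{(2,1,1)},\{\mu^{(0,3,1)},H\}\}=0,\quad \{\mu^{(1,2,1)},\{\mu^{(0,3,1)},H\}\}=0,\quad \{\mu^{(0,3,1)},\{\mu^{(2,1,1)},K\}\}=0.$$
   Context: **Lie 2-algebra.** A Lie $2$-algebra $(V_{-2},V_{-1},\mathrm{d},l_2,l_3)$ is a 2-term $L_\infty[1]$-algebra: a linear map $\mathrm{d}:V_{-2}\to V_{-1}$, graded symmetric bilinear $l_2:V_i\times V_j\to V_{i+j+1}$, $-3\le i+j\le -2$ (skew on $V_{-1}\times V_{-1}$, and $l_2(x,m)=l_2(m,x)$ for $x\in V_{-1},m\in V_{-2}$), and a totally skew trilinear $l_3:V_{-1}^{\times 3}\to V_{-2}$, with, for $x,y,z,w\in V_{-1}$, $m,n\in V_{-2}$: $\mathrm{d}l_2(x,m)=l_2(x,\mathrm{d}m)$; $l_2(\mathrm{d}m,n)=-l_2(m,\mathrm{d}n)$; $\mathrm{d}l_3(x,y,z)=l_2(x,l_2(y,z))-l_2(l_2(x,y),z)-l_2(y,l_2(x,z))$;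 $l_3(x,y,\mathrm{d}m)=l_2(x,l_2(y,m))-l_2(l_2(x,y),m)-l_2(y,l_2(x,m))$; and $l_2(x,l_3(y,z,w))-l_2(y,l_3(x,z,w))+l_2(z,l_3(x,y,w))-l_2(l_3(x,y,z),w)-l_3(l_2(x,y),z,w)-l_3(y,l_2(x,z),w)-l_3(y,z,l_2(x,w))+l_3(x,l_2(y,z),w)+l_3(x,z,l_2(y,w))-l_3(x,y,l_2(z,w))=0$. A **morphism** $(F_1,F_2,F_3):V\to V'$ of Lie 2-algebras: linear $F_1:V_{-1}\to V'_{-1}$, $F_2:V_{-2}\to V'_{-2}$ with $F_1\mathrm d=\mathrm d'F_2$, and skew bilinear $F_3:V_{-1}\times V_{-1}\to V'_{-2}$ with $F_1l_2(x,y)-l_2'(F_1x,F_1y)=\mathrm d'F_3(x,y)$, $F_2l_2(x,m)-l_2'(F_1x,F_2m)=F_3(x,\mathrm dm)$, and $-F_2l_3(x,y,z)+l_2'(F_1x,F_3(y,z))-l_2'(F_1y,F_3(x,z))+l_2'(F_3(x,y),F_1z)-F_3(l_2(x,y),z)+F_3(x,l_2(y,z))-F_3(y,l_2(x,z))+l_3'(F_1x,F_1y,F_1z)=0$. **Split Lie 2-algebroid.** A graded vector bundle $\mathcal{A}=A_{-1}\oplus A_{-2}$ over $M$ with a bundle map $a:A_{-1}\to TM$ and brackets $l_1,l_2,l_3$ such that $(\Gamma(A_{-2}),\Gamma(A_{-1}),l_1,l_2,l_3)$ is a Lie 2-algebra, $l_2(X^1,fY)=fl_2(X^1,Y)+a(X^1)(f)Y$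 for $X^1\in\Gamma(A_{-1})$, $Y\in\Gamma(\mathcal A)$, $f\in C^\infty(M)$, and $l_1,l_3$ are $C^\infty(M)$-linear. A morphism of split Lie 2-algebroids over the same base consists of bundle maps $F^1:A_{-1}\to A_{-1}'$, $F^2:A_{-2}\to A'_{-2}$, $F^3:\wedge^2A_{-1}\to A'_{-2}$ with $a'\circ F^1=a$ that form a morphism of the underlying Lie 2-algebras. On $\mathcal A^*[3]$ the degree $-1$ part is $A_{-2}^*$ and the degree $-2$ part is $A_{-1}^*$. **Big bracket.** $\mathcal M=T^*[3](A_{-1}\oplus A_{-2})$ has local Darboux coordinates $(x^i,\xi^j,\theta^k,p_i,\xi_j,\theta_k)$ of degrees $(0,1,2,3,2,1)$ and tridegrees $(0,0,0),(0,1,0),(1,1,0),(1,1,1),(1,0,1),(0,0,1)$; $\xi^j,\theta^k$ are local frames of $A_{-1}^*,A_{-2}^*$ and $\xi_j,\theta_k$ the dual frames of $A_{-1},A_{-2}$. The Poisson bracket has degree $-3$: $\{F,G\}=-(-1)^{(|F|-3)(|G|-3)}\{G,F\}$, $\{F,GH\}=\{F,G\}H+(-1)^{(|F|-3)|G|}G\{F,H\}$, graded Jacobi, nonzero coordinate brackets $\{x^i,p_j\}=\{\xi^i,\xi_j\}=\{\theta_j,\theta^i\}=\delta^i_j$. A split Lie 2-algebroid structure $(l_1,l_2,l_3,a)$ on $\mathcal A$ is equivalent to a degree $4$ function $\mu=\mu^{(2,1,1)}+\mu^{(1,2,1)}+\mu^{(0,3,1)}$ (components by tridegree) with $\{\mu,\mu\}=0$,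 the structure function, via $l_1(X^2)=-\{\mu^{(2,1,1)},X^2\}$, $l_2(X^1,Y)=-\{\{\mu^{(1,2,1)},X^1\},Y\}$, $l_3(X^1,Y^1,Z^1)=-\{\{\{\mu^{(0,3,1)},X^1\},Y^1\},Z^1\}$, $a(X^1)(f)=-\{\{\mu^{(1,2,1)},X^1\},f\}$. Likewise a structure $(\mathfrak l_1,\mathfrak l_2,\mathfrak l_3,\mathfrak a)$ on $\mathcal A^*[3]$ is equivalent to a degree $4$ function $\gamma=\gamma^{(2,1,1)}+\gamma^{(1,1,2)}+\gamma^{(0,1,3)}$ with $\{\gamma,\gamma\}=0$, via $\mathfrak l_1(\alpha^1)=-\{\gamma^{(2,1,1)},\alpha^1\}$, $\mathfrak l_2(\alpha^2,\beta)=-\{\{\gamma^{(1,1,2)},\alpha^2\},\beta\}$, $\mathfrak l_3(\alpha^2,\beta^2,\gamma^2)=-\{\{\{\gamma^{(0,1,3)},\alpha^2\},\beta^2\},\gamma^2\}$, $\mathfrak a(\alpha^2)(f)=-\{\{\gamma^{(1,1,2)},\alpha^2\},f\}$. (Superscript $i$ on $X^i,\alpha^i$ means a section of $A_{-i},A_{-i}^*$.) The pair $(\mathcal A,\mathcal A^*[3])$ is a **split Lie 2-bialgebroid** if $\mu^{(2,1,1)}=\gamma^{(2,1,1)}$ and $\{\mu+\gamma-\mu^{(2,1,1)},\mu+\gamma-\mu^{(2,1,1)}\}=0$. The structure in (i) corresponds to $\gamma_{H,K}=\mu^{(2,1,1)}+\{\mu^{(1,2,1)},H\}+\{\mu^{(1,2,1)},K\}+\frac12\{\{\mu^{(0,3,1)},H\},H\}$.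 **Symmetric algebra.** $\mathrm{Sym}(\mathcal A[-3])$ is the graded commutative algebra over $C^\infty(M)$ (product $\odot$) generated by $\Gamma(A_{-2})$ in degree $1$ and $\Gamma(A_{-1})$ in degree $2$, a subalgebra of $C^\infty(\mathcal M)$, with brackets $[P]_S=-\{\mu^{(2,1,1)},P\}$, $[P,Q]_S=-\{\{\mu^{(1,2,1)},P\},Q\}$, $[P,Q,R]_S=-\{\{\{\mu^{(0,3,1)},P\},Q\},R\}$. Its degree $3$ part is $\Gamma(A_{-1}\odot A_{-2})\oplus\Gamma(\wedge^3A_{-2})$. For $\alpha\in\Gamma(\mathcal A^* )$, $\iota_\alpha$ is contraction (a graded derivation: even for $\alpha\in\Gamma(A_{-1}^* )$, odd for $\alpha\in\Gamma(A_{-2}^* )$), and $P(\alpha_1,\dots,\alpha_p)=\iota_{\alpha_p}\cdots\iota_{\alpha_1}P$. Set $\langle H^\natural(\alpha^1),\alpha^2\rangle=H(\alpha^1,\alpha^2)=H(\alpha^2,\alpha^1)=\langle H^\sharp(\alpha^2),\alpha^1\rangle$, so $H^\natural:A_{-1}^*\to A_{-2}$, $H^\sharp:A_{-2}^*\to A_{-1}$; and $\langle K^\flat(\alpha^2,\beta^2),\gamma^2\rangle=K(\alpha^2,\beta^2,\gamma^2)$, so $K^\flat:\wedge^2A_{-2}^*\to A_{-2}$. **Lie derivatives.** $\langle L^1_{X^1}\alpha^i,Y^i\rangle=a(X^1)\langle Y^i,\alpha^i\rangle-\langle\alpha^i,l_2(X^1,Y^i)\rangle$ ($i=1,2$); $\langle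 L^2_{X^2}\alpha^2,Y^1\rangle=-\langle\alpha^2,l_2(X^2,Y^1)\rangle$; $\langle L^3_{X^1,Y^1}\alpha^2,Z^1\rangle=-\langle\alpha^2,l_3(X^1,Y^1,Z^1)\rangle$; $\mathrm df\in\Gamma(A_{-1}^* )$ is $\langle\mathrm df,X^1\rangle=a(X^1)(f)$. *)

theory Defs
  imports
    "HOL-Analysis.Analysis"
    "HOL-Library.Function_Algebras"
    "HOL-Library.Multiset"
begin

section \<open>Pointwise real vector spaces of functions\<close>

text \<open>Sections, covectors and graded functions are all functions, with pointwise operations.\<close>

instantiation "fun" :: (type, real_vector) real_vector
begin

definition scaleR_fun :: "real \<Rightarrow> ('a \<Rightarrow> 'b) \<Rightarrow> 'a \<Rightarrow> 'b" where
  "scaleR_fun c f = (\<lambda>x. c *\<^sub>R f x)"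

instance
  by standard (simp_all add: scaleR_fun_def fun_eq_iff scaleR_add_right scaleR_add_left)

end

lemma scaleR_fun_apply [simp]: "(c *\<^sub>R f) x = c *\<^sub>R f x"
  by (simp add: scaleR_fun_def)

definition lin_on :: "'u::real_vector set \<Rightarrow> 'w::real_vector set \<Rightarrow> ('u \<Rightarrow> 'w) \<Rightarrow> bool" where
  "lin_on U W f \<longleftrightarrow>
     (\<forall>u\<in>U. f u \<in> W) \<and>
     (\<forall>u\<in>U. \<forall>v\<in>U. f (u + v) = f u + f v) \<and>
     (\<forall>u\<in>U. \<forall>c. f (c *\<^sub>R u) = c *\<^sub>R f u)"

definition bilin_on ::
  "'u::real_vector set \<Rightarrow> 'v::real_vector set \<Rightarrow> 'w::real_vector set \<Rightarrow> ('u \<Rightarrow> 'v \<Rightarrow> 'w) \<Rightarrow> bool" where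
  "bilin_on U V W f \<longleftrightarrow>
     (\<forall>v\<in>V. lin_on U W (\<lambda>u. f u v)) \<and> (\<forall>u\<in>U. lin_on V W (f u))"

definition skew2_on ::
  "'u::real_vector set \<Rightarrow> 'w::real_vector set \<Rightarrow> ('u \<Rightarrow> 'u \<Rightarrow> 'w) \<Rightarrow> bool" where
  "skew2_on U W f \<longleftrightarrow> bilin_on U U W f \<and> (\<forall>u\<in>U. \<forall>v\<in>U. f u v = - f v u)"

definition skew3_on ::
  "'u::real_vector set \<Rightarrow> 'w::real_vector set \<Rightarrow> ('u \<Rightarrow> 'u \<Rightarrow> 'u \<Rightarrow> 'w) \<Rightarrow> bool" where
  "skew3_on U W f \<longleftrightarrow>
     (\<forall>u\<in>U. \<forall>v\<in>U. lin_on U W (\<lambda>w. f w u v) \<and> lin_on U W (\<lambda>w. f u w v) \<and> lin_on U W (f u v)) \<and>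
     (\<forall>u\<in>U. \<forall>v\<in>U. \<forall>w\<in>U. f u v w = - f v u w \<and> f u v w = - f u w v)"


section \<open>Lie 2-algebras\<close>

text \<open>
  The graded symmetric bracket is split into its two components: \<open>lbr2\<close> on
  \<open>V\<^sub>-\<^sub>1 \<times> V\<^sub>-\<^sub>1\<close> and \<open>lact\<close> on \<open>V\<^sub>-\<^sub>1 \<times> V\<^sub>-\<^sub>2\<close>; the value on \<open>(m, x)\<close> with \<open>m\<close> of degree
  \<open>-2\<close> is by graded symmetry the one on \<open>(x, m)\<close>, so it is written \<open>lact L x m\<close>.
\<close>

record ('v, 'u) lie2 =
  deg1 :: "'v set"
  deg2 :: "'u set"
  ldiff :: "'u \<Rightarrow> 'v"
  lbr2 :: "'v \<Rightarrow> 'v \<Rightarrow> 'v"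
  lact :: "'v \<Rightarrow> 'u \<Rightarrow> 'u"
  lbr3 :: "'v \<Rightarrow> 'v \<Rightarrow> 'v \<Rightarrow> 'u"

locale lie2_algebra =
  fixes L :: "('v::real_vector, 'u::real_vector) lie2"
  assumes subspace_deg1: "subspace (deg1 L)"
    and subspace_deg2: "subspace (deg2 L)"
    and ldiff_linear: "lin_on (deg2 L) (deg1 L) (ldiff L)"
    and lbr2_skew: "skew2_on (deg1 L) (deg1 L) (lbr2 L)"
    and lact_bilinear: "bilin_on (deg1 L) (deg2 L) (deg2 L) (lact L)"
    and lbr3_skew: "skew3_on (deg1 L) (deg2 L) (lbr3 L)"
    and ldiff_lact: "\<lbrakk>x \<in> deg1 L; m \<in> deg2 L\<rbrakk> \<Longrightarrow> ldiff L (lact L x m) = lbr2 L x (ldiff L m)"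
    and lact_ldiff: "\<lbrakk>m \<in> deg2 L; n \<in> deg2 L\<rbrakk> \<Longrightarrow> lact L (ldiff L m) n = - lact L (ldiff L n) m"
    and ldiff_lbr3: "\<lbrakk>x \<in> deg1 L; y \<in> deg1 L; z \<in> deg1 L\<rbrakk> \<Longrightarrow>
      ldiff L (lbr3 L x y z) =
        lbr2 L x (lbr2 L y z) - lbr2 L (lbr2 L x y) z - lbr2 L y (lbr2 L x z)"
    and lbr3_ldiff: "\<lbrakk>x \<in> deg1 L; y \<in> deg1 L; m \<in> deg2 L\<rbrakk> \<Longrightarrow>
      lbr3 L x y (ldiff L m) =
        lact L x (lact L y m) - lact L (lbr2 L x y) m - lact L y (lact L x m)"
    and coherence: "\<lbrakk>x \<in> deg1 L; y \<in> deg1 L; z \<in> deg1 L; w \<in> deg1 L\<rbrakk> \<Longrightarrow>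
      lact L x (lbr3 L y z w) - lact L y (lbr3 L x z w)
      + lact L z (lbr3 L x y w) - lact L w (lbr3 L x y z)
      - lbr3 L (lbr2 L x y) z w - lbr3 L y (lbr2 L x z) w
      - lbr3 L y z (lbr2 L x w) + lbr3 L x (lbr2 L y z) w
      + lbr3 L x z (lbr2 L y w) - lbr3 L x y (lbr2 L z w) = 0"

locale lie2_morphism =
  fixes L :: "('v::real_vector, 'u::real_vector) lie2"
    and L' :: "('v'::real_vector, 'u'::real_vector) lie2"
    and F1 :: "'v \<Rightarrow> 'v'" and F2 :: "'u \<Rightarrow> 'u'" and F3 :: "'v \<Rightarrow> 'v \<Rightarrow> 'u'"
  assumes F1_linear: "lin_on (deg1 L) (deg1 L') F1"
    and F2_linear: "lin_on (deg2 L) (deg2 L') F2"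
    and F3_skew: "skew2_on (deg1 L) (deg2 L') F3"
    and F_diff: "m \<in> deg2 L \<Longrightarrow> F1 (ldiff L m) = ldiff L' (F2 m)"
    and F_br2: "\<lbrakk>x \<in> deg1 L; y \<in> deg1 L\<rbrakk> \<Longrightarrow>
      F1 (lbr2 L x y) - lbr2 L' (F1 x) (F1 y) = ldiff L' (F3 x y)"
    and F_act: "\<lbrakk>x \<in> deg1 L; m \<in> deg2 L\<rbrakk> \<Longrightarrow>
      F2 (lact L x m) - lact L' (F1 x) (F2 m) = F3 x (ldiff L m)"
    and F_br3: "\<lbrakk>x \<in> deg1 L; y \<in> deg1 L; z \<in> deg1 L\<rbrakk> \<Longrightarrow>
      - F2 (lbr3 L x y z)
      + lact L' (F1 x) (F3 y z) - lact L' (F1 y) (F3 x z) + lact L' (F1 z) (F3 x y)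
      - F3 (lbr2 L x y) z + F3 x (lbr2 L y z) - F3 y (lbr2 L x z)
      + lbr3 L' (F1 x) (F1 y) (F1 z) = 0"


section \<open>Smooth manifolds\<close>

text \<open>
  \<open>\<real>\<^sup>n\<close> is the set of sequences vanishing from index \<open>n\<close> on, so that \<open>n\<close> is a number (possibly
  \<open>0\<close>) and charts have honest coordinates \<open>x\<^sup>0, \<dots>, x\<^sup>n\<^sup>-\<^sup>1\<close>; the product topology
  induces the Euclidean one on it.
\<close>

definition Rn :: "nat \<Rightarrow> (nat \<Rightarrow> real) set" where
  "Rn n = {y. \<forall>i\<ge>n. y i = 0}"

definition partial :: "nat \<Rightarrow> ((nat \<Rightarrow> real) \<Rightarrow> real) \<Rightarrow> (nat \<Rightarrow> real) \<Rightarrow> real" where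
  "partial i g y = deriv (\<lambda>t. g (y(i := t))) (y i)"

text \<open>
  For \<open>D\<close> open in \<open>Rn n\<close>: all iterated partial derivatives exist and are continuous on \<open>D\<close>.
\<close>

definition cinf_on :: "nat \<Rightarrow> (nat \<Rightarrow> real) set \<Rightarrow> ((nat \<Rightarrow> real) \<Rightarrow> real) \<Rightarrow> bool" where
  "cinf_on n D g \<longleftrightarrow>
     (\<forall>js. set js \<subseteq> {..<n} \<longrightarrow>
        continuous_on D (fold partial js g) \<and>
        (\<forall>i<n. \<forall>y\<in>D. (\<lambda>t. fold partial js g (y(i := t))) differentiable at (y i)))"

record 'm smfd =
  mdim :: nat
  atlas :: "('m set \<times> ('m \<Rightarrow> nat \<Rightarrow> real)) set"

locale smooth_manifold =
  fixes M :: "'m::{t2_space, second_countable_topology} smfd"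
  assumes atlas_cover: "(\<Union>(U, \<phi>)\<in>atlas M. U) = UNIV"
    and chart_open: "(U, \<phi>) \<in> atlas M \<Longrightarrow>
      open U \<and> openin (top_of_set (Rn (mdim M))) (\<phi> ` U)"
    and chart_homeomorphism: "(U, \<phi>) \<in> atlas M \<Longrightarrow>
      homeomorphism U (\<phi> ` U) \<phi> (inv_into U \<phi>)"
    and transition_smooth: "\<lbrakk>(U, \<phi>) \<in> atlas M; (V, \<psi>) \<in> atlas M; i < mdim M\<rbrakk> \<Longrightarrow>
      cinf_on (mdim M) (\<phi> ` (U \<inter> V)) (\<lambda>y. \<psi> (inv_into U \<phi> y) i)"

definition smooth_on :: "'m::topological_space smfd \<Rightarrow> 'm set \<Rightarrow> ('m \<Rightarrow> real) \<Rightarrow> bool" where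
  "smooth_on M W f \<longleftrightarrow>
     (\<forall>(U, \<phi>)\<in>atlas M. cinf_on (mdim M) (\<phi> ` (U \<inter> W)) (\<lambda>y. f (inv_into U \<phi> y)))"

definition Cinf :: "'m::topological_space smfd \<Rightarrow> ('m \<Rightarrow> real) set" where
  "Cinf M = {f. smooth_on M UNIV f}"

text \<open>\<open>T\<^sub>xM\<close> as the derivations at \<open>x\<close> of \<open>C\<^sup>\<infinity>(M)\<close>; values outside \<open>C\<^sup>\<infinity>(M)\<close> are irrelevant.\<close>

definition tangent_vectors ::
  "'m::topological_space smfd \<Rightarrow> 'm \<Rightarrow> (('m \<Rightarrow> real) \<Rightarrow> real) set" where
  "tangent_vectors M x =
     {D. (\<forall>f\<in>Cinf M. \<forall>g\<in>Cinf M. D (f + g) = D f + D g) \<and>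
         (\<forall>f\<in>Cinf M. \<forall>c. D (c *\<^sub>R f) = c * D f) \<and>
         (\<forall>f\<in>Cinf M. \<forall>g\<in>Cinf M. D (f * g) = D f * g x + f x * D g)}"


section \<open>Vector bundles\<close>

text \<open>
  The fibres are subspaces of one real vector space, which carries no topology and only serves as
  a common type. The smooth structure is given by local frames, listed as \<open>(U, [e\<^sub>0, \<dots>, e\<^sub>r\<^sub>-\<^sub>1])\<close>.
  The total space itself never occurs; sections are functions on the base.
\<close>

record ('m, 'v) vbundle =
  fib :: "'m \<Rightarrow> 'v set"
  frames :: "('m set \<times> ('m \<Rightarrow> 'v) list) set"

definition basis_at :: "('m, 'v::real_vector) vbundle \<Rightarrow> ('m \<Rightarrow> 'v) list \<Rightarrow> 'm \<Rightarrow> bool" where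
  "basis_at E es x \<longleftrightarrow>
     (let bs = map (\<lambda>e. e x) es
      in distinct bs \<and> independent (set bs) \<and> span (set bs) = fib E x)"

definition frame_coeff :: "('m \<Rightarrow> 'v::real_vector) list \<Rightarrow> nat \<Rightarrow> 'm \<Rightarrow> 'v \<Rightarrow> real" where
  "frame_coeff es j x v = representation ((\<lambda>e. e x) ` set es) v ((es ! j) x)"

definition smooth_section_on ::
  "'m::topological_space smfd \<Rightarrow> ('m, 'v::real_vector) vbundle \<Rightarrow> 'm set \<Rightarrow> ('m \<Rightarrow> 'v) \<Rightarrow> bool" where
  "smooth_section_on M E W s \<longleftrightarrow>
     (\<forall>x\<in>W. s x \<in> fib E x) \<and>
     (\<forall>(U, es)\<in>frames E. \<forall>j<length es. smooth_on M (U \<inter> W) (\<lambda>x. frame_coeff es j x (s x)))"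

definition local_frame ::
  "'m::topological_space smfd \<Rightarrow> ('m, 'v::real_vector) vbundle \<Rightarrow> 'm set \<Rightarrow> ('m \<Rightarrow> 'v) list \<Rightarrow> bool" where
  "local_frame M E W es \<longleftrightarrow>
     (\<forall>e\<in>set es. smooth_section_on M E W e) \<and> (\<forall>x\<in>W. basis_at E es x)"

definition vector_bundle ::
  "'m::topological_space smfd \<Rightarrow> ('m, 'v::real_vector) vbundle \<Rightarrow> bool" where
  "vector_bundle M E \<longleftrightarrow>
     (\<Union>(U, es)\<in>frames E. U) = UNIV \<and>
     (\<forall>(U, es)\<in>frames E. open U \<and> local_frame M E U es)"

definition sections ::
  "'m::topological_space smfd \<Rightarrow> ('m, 'v::real_vector) vbundle \<Rightarrow> ('m \<Rightarrow> 'v) set" where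
  "sections M E = {s. smooth_section_on M E UNIV s}"

definition smul :: "('m \<Rightarrow> real) \<Rightarrow> ('m \<Rightarrow> 'v::real_vector) \<Rightarrow> 'm \<Rightarrow> 'v" where
  "smul f s = (\<lambda>x. f x *\<^sub>R s x)"

definition bundle_map ::
  "'m::topological_space smfd \<Rightarrow> ('m, 'v::real_vector) vbundle \<Rightarrow> ('m, 'w::real_vector) vbundle \<Rightarrow>
    ('m \<Rightarrow> 'v \<Rightarrow> 'w) \<Rightarrow> bool" where
  "bundle_map M E E' F \<longleftrightarrow>
     (\<forall>x. lin_on (fib E x) (fib E' x) (F x)) \<and>
     (\<forall>s\<in>sections M E. (\<lambda>x. F x (s x)) \<in> sections M E')"

text \<open>Bundle maps \<open>\<and>\<^sup>2 E \<rightarrow> E'\<close>.\<close>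

definition bundle_map_wedge2 ::
  "'m::topological_space smfd \<Rightarrow> ('m, 'v::real_vector) vbundle \<Rightarrow> ('m, 'w::real_vector) vbundle \<Rightarrow>
    ('m \<Rightarrow> 'v \<Rightarrow> 'v \<Rightarrow> 'w) \<Rightarrow> bool" where
  "bundle_map_wedge2 M E E' F \<longleftrightarrow>
     (\<forall>x. skew2_on (fib E x) (fib E' x) (F x)) \<and>
     (\<forall>s\<in>sections M E. \<forall>t\<in>sections M E. (\<lambda>x. F x (s x) (t x)) \<in> sections M E')"

text \<open>A covector on the fibre is extended by \<open>0\<close> to the ambient type, to make it unique.\<close>

definition dual_elt ::
  "('m, 'v::real_vector) vbundle \<Rightarrow> ('m \<Rightarrow> 'v) list \<Rightarrow> nat \<Rightarrow> 'm \<Rightarrow> 'v \<Rightarrow> real" where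
  "dual_elt E es j x v = (if v \<in> fib E x then frame_coeff es j x v else 0)"

definition dual_bundle :: "('m, 'v::real_vector) vbundle \<Rightarrow> ('m, 'v \<Rightarrow> real) vbundle" where
  "dual_bundle E =
     \<lparr>fib = (\<lambda>x. {\<alpha>. lin_on (fib E x) UNIV \<alpha> \<and> (\<forall>v. v \<notin> fib E x \<longrightarrow> \<alpha> v = 0)}),
      frames = (\<lambda>(U, es). (U, map (dual_elt E es) [0..<length es])) ` frames E\<rparr>"

definition pairing :: "('m \<Rightarrow> 'v) \<Rightarrow> ('m \<Rightarrow> 'v \<Rightarrow> real) \<Rightarrow> 'm \<Rightarrow> real" where
  "pairing s \<alpha> = (\<lambda>x. \<alpha> x (s x))"

text \<open>The section \<open>\<beta>\<close> of \<open>E\<^sup>*\<close> with \<open>\<langle>\<beta>, s\<rangle> = \<Phi> s\<close> for all sections \<open>s\<close> of \<open>E\<close>.\<close>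

definition dual_section ::
  "'m::topological_space smfd \<Rightarrow> ('m, 'v::real_vector) vbundle \<Rightarrow>
    (('m \<Rightarrow> 'v) \<Rightarrow> 'm \<Rightarrow> real) \<Rightarrow> 'm \<Rightarrow> 'v \<Rightarrow> real" where
  "dual_section M E \<Phi> =
     (THE \<beta>. \<beta> \<in> sections M (dual_bundle E) \<and> (\<forall>s\<in>sections M E. pairing s \<beta> = \<Phi> s))"


section \<open>Split Lie 2-algebroids\<close>

text \<open>\<open>bra2\<close> and \<open>bra2m\<close> are the components of \<open>l\<^sub>2\<close> on \<open>\<Gamma>(A\<^sub>-\<^sub>1) \<times> \<Gamma>(A\<^sub>-\<^sub>1)\<close> and
  \<open>\<Gamma>(A\<^sub>-\<^sub>1) \<times> \<Gamma>(A\<^sub>-\<^sub>2)\<close>; \<open>bun1\<close> and \<open>bun2\<close> are \<open>A\<^sub>-\<^sub>1\<close> and \<open>A\<^sub>-\<^sub>2\<close>.\<close>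

record ('m, 'a, 'b) sl2 =
  bun1 :: "('m, 'a) vbundle"
  bun2 :: "('m, 'b) vbundle"
  bra1 :: "('m \<Rightarrow> 'b) \<Rightarrow> 'm \<Rightarrow> 'a"
  bra2 :: "('m \<Rightarrow> 'a) \<Rightarrow> ('m \<Rightarrow> 'a) \<Rightarrow> 'm \<Rightarrow> 'a"
  bra2m :: "('m \<Rightarrow> 'a) \<Rightarrow> ('m \<Rightarrow> 'b) \<Rightarrow> 'm \<Rightarrow> 'b"
  bra3 :: "('m \<Rightarrow> 'a) \<Rightarrow> ('m \<Rightarrow> 'a) \<Rightarrow> ('m \<Rightarrow> 'a) \<Rightarrow> 'm \<Rightarrow> 'b"
  anchor :: "'m \<Rightarrow> 'a \<Rightarrow> ('m \<Rightarrow> real) \<Rightarrow> real"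

definition rho ::
  "('m, 'a, 'b) sl2 \<Rightarrow> ('m \<Rightarrow> 'a) \<Rightarrow> ('m \<Rightarrow> real) \<Rightarrow> 'm \<Rightarrow> real" where
  "rho A X f = (\<lambda>x. anchor A x (X x) f)"

definition section_lie2 ::
  "'m::topological_space smfd \<Rightarrow> ('m, 'a::real_vector, 'b::real_vector) sl2 \<Rightarrow>
    ('m \<Rightarrow> 'a, 'm \<Rightarrow> 'b) lie2" where
  "section_lie2 M A =
     \<lparr>deg1 = sections M (bun1 A), deg2 = sections M (bun2 A),
      ldiff = bra1 A, lbr2 = bra2 A, lact = bra2m A, lbr3 = bra3 A\<rparr>"

locale split_lie2_algebroid = smooth_manifold M
  for M :: "'m::{t2_space, second_countable_topology} smfd" +
  fixes A :: "('m, 'a::real_vector, 'b::real_vector) sl2"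
  assumes bun1_bundle: "vector_bundle M (bun1 A)"
    and bun2_bundle: "vector_bundle M (bun2 A)"
    and anchor_tangent: "v \<in> fib (bun1 A) x \<Longrightarrow> anchor A x v \<in> tangent_vectors M x"
    and anchor_linear: "f \<in> Cinf M \<Longrightarrow> lin_on (fib (bun1 A) x) UNIV (\<lambda>v. anchor A x v f)"
    and anchor_smooth: "\<lbrakk>X \<in> sections M (bun1 A); f \<in> Cinf M\<rbrakk> \<Longrightarrow> rho A X f \<in> Cinf M"
    and section_lie2_algebra: "lie2_algebra (section_lie2 M A)"
    and leibniz1: "\<lbrakk>X \<in> sections M (bun1 A); Y \<in> sections M (bun1 A); f \<in> Cinf M\<rbrakk> \<Longrightarrow>
      bra2 A X (smul f Y) = smul f (bra2 A X Y) + smul (rho A X f) Y"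
    and leibniz2: "\<lbrakk>X \<in> sections M (bun1 A); m \<in> sections M (bun2 A); f \<in> Cinf M\<rbrakk> \<Longrightarrow>
      bra2m A X (smul f m) = smul f (bra2m A X m) + smul (rho A X f) m"
    and bra1_Cinf: "\<lbrakk>m \<in> sections M (bun2 A); f \<in> Cinf M\<rbrakk> \<Longrightarrow>
      bra1 A (smul f m) = smul f (bra1 A m)"
    and bra3_Cinf: "\<lbrakk>X \<in> sections M (bun1 A); Y \<in> sections M (bun1 A); Z \<in> sections M (bun1 A);
        f \<in> Cinf M\<rbrakk> \<Longrightarrow>
      bra3 A (smul f X) Y Z = smul f (bra3 A X Y Z) \<and>
      bra3 A X (smul f Y) Z = smul f (bra3 A X Y Z) \<and>
      bra3 A X Y (smul f Z) = smul f (bra3 A X Y Z)"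

definition sl2_morphism ::
  "'m::topological_space smfd \<Rightarrow> ('m, 'a::real_vector, 'b::real_vector) sl2 \<Rightarrow>
    ('m, 'c::real_vector, 'd::real_vector) sl2 \<Rightarrow>
    ('m \<Rightarrow> 'a \<Rightarrow> 'c) \<Rightarrow> ('m \<Rightarrow> 'b \<Rightarrow> 'd) \<Rightarrow> ('m \<Rightarrow> 'a \<Rightarrow> 'a \<Rightarrow> 'd) \<Rightarrow> bool" where
  "sl2_morphism M A A' F1 F2 F3 \<longleftrightarrow>
     bundle_map M (bun1 A) (bun1 A') F1 \<and>
     bundle_map M (bun2 A) (bun2 A') F2 \<and>
     bundle_map_wedge2 M (bun1 A) (bun2 A') F3 \<and>
     (\<forall>x. \<forall>v\<in>fib (bun1 A) x. \<forall>f\<in>Cinf M. anchor A' x (F1 x v) f = anchor A x v f) \<and>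
     lie2_morphism (section_lie2 M A) (section_lie2 M A')
       (\<lambda>X x. F1 x (X x)) (\<lambda>Y x. F2 x (Y x)) (\<lambda>X Y x. F3 x (X x) (Y x))"


section \<open>The big bracket\<close>

text \<open>
  Darboux coordinates on \<open>T\<^sup>*[3](A\<^sub>-\<^sub>1 \<oplus> A\<^sub>-\<^sub>2)\<close> besides the \<open>x\<^sup>i\<close>: the odd ones
  \<open>p\<^sub>i\<close>, \<open>\<xi>\<^sup>j\<close>, \<open>\<theta>\<^sub>k\<close> are \<open>P_dn i\<close>, \<open>Xi_up j\<close>, \<open>Th_dn k\<close>, the even ones \<open>\<theta>\<^sup>k\<close>, \<open>\<xi>\<^sub>j\<close> are
  \<open>Th_up k\<close>, \<open>Xi_dn j\<close>. A monomial \<open>(S, m)\<close> is the product of the elements of \<open>S\<close> in the order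
  of increasing \<open>opos\<close>, times the product of \<open>m\<close>. A function in a chart is the family of its
  coefficients, which are functions on the base.
\<close>

datatype ovar = P_dn nat | Xi_up nat | Th_dn nat
datatype evar = Th_up nat | Xi_dn nat

type_synonym gmono = "ovar set \<times> evar multiset"
type_synonym 'm gfun = "gmono \<Rightarrow> 'm \<Rightarrow> real"

fun opos :: "ovar \<Rightarrow> nat" where
  "opos (P_dn i) = 3 * i"
| "opos (Xi_up j) = 3 * j + 1"
| "opos (Th_dn k) = 3 * k + 2"

fun otri :: "ovar \<Rightarrow> nat \<times> nat \<times> nat" where
  "otri (P_dn i) = (1, 1, 1)"
| "otri (Xi_up j) = (0, 1, 0)"
| "otri (Th_dn k) = (0, 0, 1)"

fun etri :: "evar \<Rightarrow> nat \<times> nat \<times> nat" where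
  "etri (Th_up k) = (1, 1, 0)"
| "etri (Xi_dn j) = (1, 0, 1)"

definition tridegree :: "gmono \<Rightarrow> nat \<times> nat \<times> nat" where
  "tridegree = (\<lambda>(S, m). (\<Sum>v\<in>S. otri v) + (\<Sum>v\<in>#m. etri v))"

definition gterm :: "ovar set \<Rightarrow> evar multiset \<Rightarrow> ('m \<Rightarrow> real) \<Rightarrow> 'm gfun" where
  "gterm S m f = (\<lambda>q. if q = (S, m) then f else 0)"

definition osign :: "ovar set \<Rightarrow> ovar set \<Rightarrow> real" where
  "osign S T = (-1) ^ card {(s, t). s \<in> S \<and> t \<in> T \<and> opos t < opos s}"

definition gmult :: "'m gfun \<Rightarrow> 'm gfun \<Rightarrow> 'm gfun" (infixl "\<odot>" 70) where
  "F \<odot> G = (\<lambda>(S, m) x. \<Sum>(T, k)\<in>Pow S \<times> {k. k \<subseteq># m}.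
      osign T (S - T) * F (T, k) x * G (S - T, m - k) x)"

text \<open>\<open>gparity F = (-1)\<^bsup>|F|\<^esup> F\<close> on homogeneous \<open>F\<close>; \<open>odiff\<close> is the left derivative.\<close>

definition gparity :: "'m gfun \<Rightarrow> 'm gfun" where
  "gparity F = (\<lambda>(S, m) x. (-1) ^ card S * F (S, m) x)"

definition odiff :: "ovar \<Rightarrow> 'm gfun \<Rightarrow> 'm gfun" where
  "odiff v F = (\<lambda>(S, m) x.
     if v \<in> S then 0 else (-1) ^ card {s \<in> S. opos s < opos v} * F (insert v S, m) x)"

definition ediff :: "evar \<Rightarrow> 'm gfun \<Rightarrow> 'm gfun" where
  "ediff v F = (\<lambda>(S, m) x. real (Suc (count m v)) * F (S, add_mset v m) x)"

text \<open>
  A Darboux chart: a chart \<open>(cbase, ccoord)\<close> of the base and frames of \<open>A\<^sub>-\<^sub>1\<close> and \<open>A\<^sub>-\<^sub>2\<close>,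
  all on an open subset \<open>cdom\<close> of \<open>cbase\<close>.
\<close>

record ('m, 'a, 'b) dchart =
  cdom :: "'m set"
  cbase :: "'m set"
  ccoord :: "'m \<Rightarrow> nat \<Rightarrow> real"
  fr1 :: "('m \<Rightarrow> 'a) list"
  fr2 :: "('m \<Rightarrow> 'b) list"

definition darboux_chart ::
  "'m::topological_space smfd \<Rightarrow> ('m, 'a::real_vector, 'b::real_vector) sl2 \<Rightarrow>
    ('m, 'a, 'b) dchart \<Rightarrow> bool" where
  "darboux_chart M A c \<longleftrightarrow>
     (cbase c, ccoord c) \<in> atlas M \<and> open (cdom c) \<and> cdom c \<subseteq> cbase c \<and>
     local_frame M (bun1 A) (cdom c) (fr1 c) \<and> local_frame M (bun2 A) (cdom c) (fr2 c)"

definition xdiff :: "('m, 'a, 'b) dchart \<Rightarrow> nat \<Rightarrow> 'm gfun \<Rightarrow> 'm gfun" where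
  "xdiff c i F = (\<lambda>q x.
     partial i (\<lambda>y. F q (inv_into (cbase c) (ccoord c) y)) (ccoord c x))"

text \<open>
  The Poisson bracket of degree \<open>-3\<close> in a Darboux chart. The Leibniz rule and graded symmetry
  give \<open>{F, G} = \<Sum>\<^sub>z {F, z} \<partial>\<^sub>zG\<close> and
  \<open>{F, z} = - (-1)\<^bsup>(|F|-3)(|z|-3)\<^esup> \<Sum>\<^sub>w {z, w} \<partial>\<^sub>wF\<close> with left derivatives; the formula
  results from \<open>{x\<^sup>i, p\<^sub>i} = {\<xi>\<^sup>j, \<xi>\<^sub>j} = {\<theta>\<^sub>k, \<theta>\<^sup>k} = 1\<close>.
\<close>

definition poisson_in ::
  "'m smfd \<Rightarrow> ('m, 'a, 'b) dchart \<Rightarrow> 'm gfun \<Rightarrow> 'm gfun \<Rightarrow> 'm gfun" where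
  "poisson_in M c F G =
     (\<Sum>i<mdim M. xdiff c i F \<odot> odiff (P_dn i) G + odiff (P_dn i) (gparity F) \<odot> xdiff c i G)
     - (\<Sum>j<length (fr1 c). ediff (Xi_dn j) F \<odot> odiff (Xi_up j) G
          + odiff (Xi_up j) (gparity F) \<odot> ediff (Xi_dn j) G)
     - (\<Sum>k<length (fr2 c). odiff (Th_dn k) (gparity F) \<odot> ediff (Th_up k) G
          + ediff (Th_up k) F \<odot> odiff (Th_dn k) G)"

text \<open>
  A function on \<open>T\<^sup>*[3](A\<^sub>-\<^sub>1 \<oplus> A\<^sub>-\<^sub>2)\<close> is given by its local expressions in all Darboux
  charts. Only functions whose local expressions are determined by global data occur below
  (sections, \<open>H\<close>, \<open>K\<close>, structure functions, their brackets), so compatibility of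
  the expressions on overlaps needs no separate condition. Equality is equality in every chart.
\<close>

type_synonym ('m, 'a, 'b) bfun = "('m, 'a, 'b) dchart \<Rightarrow> 'm gfun"

definition big_bracket ::
  "'m smfd \<Rightarrow> ('m, 'a, 'b) bfun \<Rightarrow> ('m, 'a, 'b) bfun \<Rightarrow> ('m, 'a, 'b) bfun" where
  "big_bracket M F G = (\<lambda>c. poisson_in M c (F c) (G c))"

definition beq ::
  "'m::topological_space smfd \<Rightarrow> ('m, 'a::real_vector, 'b::real_vector) sl2 \<Rightarrow>
    ('m, 'a, 'b) bfun \<Rightarrow> ('m, 'a, 'b) bfun \<Rightarrow> bool" where
  "beq M A F G \<longleftrightarrow> (\<forall>c. darboux_chart M A c \<longrightarrow> (\<forall>q. \<forall>x\<in>cdom c. F c q x = G c q x))"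

definition tri :: "nat \<times> nat \<times> nat \<Rightarrow> ('m, 'a, 'b) bfun \<Rightarrow> ('m, 'a, 'b) bfun" where
  "tri t F = (\<lambda>c q. if tridegree q = t then F c q else 0)"

definition mono_in :: "'m smfd \<Rightarrow> ('m, 'a, 'b) dchart \<Rightarrow> gmono \<Rightarrow> bool" where
  "mono_in M c = (\<lambda>(S, m).
     S \<subseteq> P_dn ` {..<mdim M} \<union> Xi_up ` {..<length (fr1 c)} \<union> Th_dn ` {..<length (fr2 c)} \<and>
     set_mset m \<subseteq> Th_up ` {..<length (fr2 c)} \<union> Xi_dn ` {..<length (fr1 c)})"

text \<open>Polynomial functions with smooth coefficients all of whose terms have tridegree in \<open>T\<close>.\<close>

definition bfun_of_tridegrees ::
  "'m::topological_space smfd \<Rightarrow> ('m, 'a::real_vector, 'b::real_vector) sl2 \<Rightarrow>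
    (nat \<times> nat \<times> nat) set \<Rightarrow> ('m, 'a, 'b) bfun \<Rightarrow> bool" where
  "bfun_of_tridegrees M A T F \<longleftrightarrow>
     (\<forall>c. darboux_chart M A c \<longrightarrow>
        finite {q. \<exists>x\<in>cdom c. F c q x \<noteq> 0} \<and>
        (\<forall>q. smooth_on M (cdom c) (F c q)) \<and>
        (\<forall>q. \<forall>x\<in>cdom c. F c q x \<noteq> 0 \<longrightarrow> mono_in M c q \<and> tridegree q \<in> T))"

text \<open>
  Functions on the base, sections of \<open>A\<^sub>-\<^sub>1, A\<^sub>-\<^sub>2, A\<^sub>-\<^sub>1\<^sup>*, A\<^sub>-\<^sub>2\<^sup>*\<close> as functions on
  \<open>T\<^sup>*[3](A\<^sub>-\<^sub>1 \<oplus> A\<^sub>-\<^sub>2)\<close>.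
\<close>

definition fun0 :: "('m \<Rightarrow> real) \<Rightarrow> ('m, 'a, 'b) bfun" where
  "fun0 f = (\<lambda>c. gterm {} {#} f)"

definition sec1 :: "('m \<Rightarrow> 'a::real_vector) \<Rightarrow> ('m, 'a, 'b) bfun" where
  "sec1 X = (\<lambda>c. \<Sum>j<length (fr1 c). gterm {} {#Xi_dn j#} (\<lambda>x. frame_coeff (fr1 c) j x (X x)))"

definition sec2 :: "('m \<Rightarrow> 'b::real_vector) \<Rightarrow> ('m, 'a, 'b) bfun" where
  "sec2 X = (\<lambda>c. \<Sum>k<length (fr2 c). gterm {Th_dn k} {#} (\<lambda>x. frame_coeff (fr2 c) k x (X x)))"

definition cosec1 :: "('m \<Rightarrow> 'a \<Rightarrow> real) \<Rightarrow> ('m, 'a, 'b) bfun" where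
  "cosec1 \<alpha> = (\<lambda>c. \<Sum>j<length (fr1 c). gterm {Xi_up j} {#} (pairing (fr1 c ! j) \<alpha>))"

definition cosec2 :: "('m \<Rightarrow> 'b \<Rightarrow> real) \<Rightarrow> ('m, 'a, 'b) bfun" where
  "cosec2 \<alpha> = (\<lambda>c. \<Sum>k<length (fr2 c). gterm {} {#Th_up k#} (pairing (fr2 c ! k) \<alpha>))"


section \<open>Structure functions and split Lie 2-bialgebroids\<close>

definition structure_function ::
  "'m::topological_space smfd \<Rightarrow> ('m, 'a::real_vector, 'b::real_vector) sl2 \<Rightarrow>
    ('m, 'a, 'b) bfun \<Rightarrow> bool" where
  "structure_function M A \<mu> \<longleftrightarrow>
     bfun_of_tridegrees M A {(2, 1, 1), (1, 2, 1), (0, 3, 1)} \<mu> \<and>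
     beq M A (big_bracket M \<mu> \<mu>) 0 \<and>
     (\<forall>Y\<in>sections M (bun2 A).
        beq M A (sec1 (bra1 A Y)) (- big_bracket M (tri (2, 1, 1) \<mu>) (sec2 Y))) \<and>
     (\<forall>X\<in>sections M (bun1 A). \<forall>Y\<in>sections M (bun1 A).
        beq M A (sec1 (bra2 A X Y))
          (- big_bracket M (big_bracket M (tri (1, 2, 1) \<mu>) (sec1 X)) (sec1 Y))) \<and>
     (\<forall>X\<in>sections M (bun1 A). \<forall>Y\<in>sections M (bun2 A).
        beq M A (sec2 (bra2m A X Y))
          (- big_bracket M (big_bracket M (tri (1, 2, 1) \<mu>) (sec1 X)) (sec2 Y))) \<and>
     (\<forall>X\<in>sections M (bun1 A). \<forall>Y\<in>sections M (bun1 A). \<forall>Z\<in>sections M (bun1 A).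
        beq M A (sec2 (bra3 A X Y Z))
          (- big_bracket M (big_bracket M (big_bracket M (tri (0, 3, 1) \<mu>) (sec1 X)) (sec1 Y))
               (sec1 Z))) \<and>
     (\<forall>X\<in>sections M (bun1 A). \<forall>f\<in>Cinf M.
        beq M A (fun0 (rho A X f))
          (- big_bracket M (big_bracket M (tri (1, 2, 1) \<mu>) (sec1 X)) (fun0 f)))"

text \<open>
  Here \<open>B\<close> is a structure on \<open>A\<^sup>*[3]\<close>, whose degree \<open>-1\<close> part is \<open>A\<^sub>-\<^sub>2\<^sup>*\<close> and whose degree
  \<open>-2\<close> part is \<open>A\<^sub>-\<^sub>1\<^sup>*\<close>; it is encoded by a function on the same graded manifold.
\<close>

definition dual_structure_function ::
  "'m::topological_space smfd \<Rightarrow> ('m, 'a::real_vector, 'b::real_vector) sl2 \<Rightarrow>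
    ('m, 'b \<Rightarrow> real, 'a \<Rightarrow> real) sl2 \<Rightarrow> ('m, 'a, 'b) bfun \<Rightarrow> bool" where
  "dual_structure_function M A B \<gamma> \<longleftrightarrow>
     bfun_of_tridegrees M A {(2, 1, 1), (1, 1, 2), (0, 1, 3)} \<gamma> \<and>
     beq M A (big_bracket M \<gamma> \<gamma>) 0 \<and>
     (\<forall>\<alpha>\<in>sections M (bun2 B).
        beq M A (cosec2 (bra1 B \<alpha>)) (- big_bracket M (tri (2, 1, 1) \<gamma>) (cosec1 \<alpha>))) \<and>
     (\<forall>\<alpha>\<in>sections M (bun1 B). \<forall>\<beta>\<in>sections M (bun1 B).
        beq M A (cosec2 (bra2 B \<alpha> \<beta>))
          (- big_bracket M (big_bracket M (tri (1, 1, 2) \<gamma>) (cosec2 \<alpha>)) (cosec2 \<beta>))) \<and>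
     (\<forall>\<alpha>\<in>sections M (bun1 B). \<forall>\<beta>\<in>sections M (bun2 B).
        beq M A (cosec1 (bra2m B \<alpha> \<beta>))
          (- big_bracket M (big_bracket M (tri (1, 1, 2) \<gamma>) (cosec2 \<alpha>)) (cosec1 \<beta>))) \<and>
     (\<forall>\<alpha>\<in>sections M (bun1 B). \<forall>\<beta>\<in>sections M (bun1 B). \<forall>\<delta>\<in>sections M (bun1 B).
        beq M A (cosec1 (bra3 B \<alpha> \<beta> \<delta>))
          (- big_bracket M (big_bracket M (big_bracket M (tri (0, 1, 3) \<gamma>) (cosec2 \<alpha>)) (cosec2 \<beta>))
               (cosec2 \<delta>))) \<and>
     (\<forall>\<alpha>\<in>sections M (bun1 B). \<forall>f\<in>Cinf M.
        beq M A (fun0 (rho B \<alpha> f))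
          (- big_bracket M (big_bracket M (tri (1, 1, 2) \<gamma>) (cosec2 \<alpha>)) (fun0 f)))"

definition split_lie2_bialgebroid ::
  "'m::{t2_space, second_countable_topology} smfd \<Rightarrow> ('m, 'a::real_vector, 'b::real_vector) sl2 \<Rightarrow>
    ('m, 'b \<Rightarrow> real, 'a \<Rightarrow> real) sl2 \<Rightarrow> bool" where
  "split_lie2_bialgebroid M A B \<longleftrightarrow>
     split_lie2_algebroid M A \<and> split_lie2_algebroid M B \<and>
     bun1 B = dual_bundle (bun2 A) \<and> bun2 B = dual_bundle (bun1 A) \<and>
     (\<exists>\<mu> \<gamma>. structure_function M A \<mu> \<and> dual_structure_function M A B \<gamma> \<and>
        beq M A (tri (2, 1, 1) \<mu>) (tri (2, 1, 1) \<gamma>) \<and>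
        beq M A (big_bracket M (\<mu> + \<gamma> - tri (2, 1, 1) \<mu>) (\<mu> + \<gamma> - tri (2, 1, 1) \<mu>)) 0)"


section \<open>Maurer--Cartan elements\<close>

text \<open>
  Elements of degree 3 of \<open>Sym(A[-3])\<close>, as the multilinear forms
  \<open>P(\<alpha>\<^sub>1, \<dots>, \<alpha>\<^sub>p) = \<iota>\<^bsub>\<alpha>\<^sub>p\<^esub> \<dots> \<iota>\<^bsub>\<alpha>\<^sub>1\<^esub> P\<close> on the dual fibres. \<open>H\<close> takes its argument in
  \<open>A\<^sub>-\<^sub>1\<^sup>*\<close> first.
\<close>

definition sym12_sections ::
  "'m::topological_space smfd \<Rightarrow> ('m, 'a::real_vector, 'b::real_vector) sl2 \<Rightarrow>
    ('m \<Rightarrow> ('a \<Rightarrow> real) \<Rightarrow> ('b \<Rightarrow> real) \<Rightarrow> real) set" where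
  "sym12_sections M A =
     {H. (\<forall>x. bilin_on (fib (dual_bundle (bun1 A)) x) (fib (dual_bundle (bun2 A)) x) UNIV (H x)) \<and>
         (\<forall>\<alpha>\<in>sections M (dual_bundle (bun1 A)). \<forall>\<beta>\<in>sections M (dual_bundle (bun2 A)).
            (\<lambda>x. H x (\<alpha> x) (\<beta> x)) \<in> Cinf M)}"

definition wedge3_sections ::
  "'m::topological_space smfd \<Rightarrow> ('m, 'a::real_vector, 'b::real_vector) sl2 \<Rightarrow>
    ('m \<Rightarrow> ('b \<Rightarrow> real) \<Rightarrow> ('b \<Rightarrow> real) \<Rightarrow> ('b \<Rightarrow> real) \<Rightarrow> real) set" where
  "wedge3_sections M A =
     {K. (\<forall>x. skew3_on (fib (dual_bundle (bun2 A)) x) UNIV (K x)) \<and>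
         (\<forall>\<alpha>\<in>sections M (dual_bundle (bun2 A)). \<forall>\<beta>\<in>sections M (dual_bundle (bun2 A)).
          \<forall>\<delta>\<in>sections M (dual_bundle (bun2 A)).
            (\<lambda>x. K x (\<alpha> x) (\<beta> x) (\<delta> x)) \<in> Cinf M)}"

text \<open>\<open>H = \<Sum> H\<^sup>j\<^sup>k \<xi>\<^sub>j \<theta>\<^sub>k\<close> and \<open>K = \<Sum>\<^bsub>j<k<l\<^esub> K\<^sup>j\<^sup>k\<^sup>l \<theta>\<^sub>j \<theta>\<^sub>k \<theta>\<^sub>l\<close> as functions.\<close>

definition sym12_fun ::
  "('m, 'a::real_vector, 'b::real_vector) sl2 \<Rightarrow>
    ('m \<Rightarrow> ('a \<Rightarrow> real) \<Rightarrow> ('b \<Rightarrow> real) \<Rightarrow> real) \<Rightarrow> ('m, 'a, 'b) bfun" where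
  "sym12_fun A H = (\<lambda>c. \<Sum>j<length (fr1 c). \<Sum>k<length (fr2 c).
     gterm {Th_dn k} {#Xi_dn j#}
       (\<lambda>x. H x (dual_elt (bun1 A) (fr1 c) j x) (dual_elt (bun2 A) (fr2 c) k x)))"

definition wedge3_fun ::
  "('m, 'a::real_vector, 'b::real_vector) sl2 \<Rightarrow>
    ('m \<Rightarrow> ('b \<Rightarrow> real) \<Rightarrow> ('b \<Rightarrow> real) \<Rightarrow> ('b \<Rightarrow> real) \<Rightarrow> real) \<Rightarrow> ('m, 'a, 'b) bfun" where
  "wedge3_fun A K = (\<lambda>c. \<Sum>l<length (fr2 c). \<Sum>k<l. \<Sum>j<k.
     gterm {Th_dn j, Th_dn k, Th_dn l} {#}
       (\<lambda>x. K x (dual_elt (bun2 A) (fr2 c) j x) (dual_elt (bun2 A) (fr2 c) k x)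
              (dual_elt (bun2 A) (fr2 c) l x)))"

definition symbr1 ::
  "'m smfd \<Rightarrow> ('m, 'a, 'b) bfun \<Rightarrow> ('m, 'a, 'b) bfun \<Rightarrow> ('m, 'a, 'b) bfun" where
  "symbr1 M \<mu> P = - big_bracket M (tri (2, 1, 1) \<mu>) P"

definition symbr2 ::
  "'m smfd \<Rightarrow> ('m, 'a, 'b) bfun \<Rightarrow> ('m, 'a, 'b) bfun \<Rightarrow> ('m, 'a, 'b) bfun \<Rightarrow> ('m, 'a, 'b) bfun" where
  "symbr2 M \<mu> P Q = - big_bracket M (big_bracket M (tri (1, 2, 1) \<mu>) P) Q"

definition symbr3 ::
  "'m smfd \<Rightarrow> ('m, 'a, 'b) bfun \<Rightarrow> ('m, 'a, 'b) bfun \<Rightarrow> ('m, 'a, 'b) bfun \<Rightarrow> ('m, 'a, 'b) bfun \<Rightarrow>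
    ('m, 'a, 'b) bfun" where
  "symbr3 M \<mu> P Q R = - big_bracket M (big_bracket M (big_bracket M (tri (0, 3, 1) \<mu>) P) Q) R"

definition maurer_cartan ::
  "'m::topological_space smfd \<Rightarrow> ('m, 'a::real_vector, 'b::real_vector) sl2 \<Rightarrow>
    ('m, 'a, 'b) bfun \<Rightarrow> ('m, 'a, 'b) bfun \<Rightarrow> bool" where
  "maurer_cartan M A \<mu> P \<longleftrightarrow>
     beq M A (symbr1 M \<mu> P + (1/2) *\<^sub>R symbr2 M \<mu> P P + (1/6) *\<^sub>R symbr3 M \<mu> P P P) 0"


section \<open>The structure on the dual induced by a Maurer--Cartan element\<close>

definition H_sharp ::
  "('m, 'a::real_vector, 'b::real_vector) sl2 \<Rightarrow>
    ('m \<Rightarrow> ('a \<Rightarrow> real) \<Rightarrow> ('b \<Rightarrow> real) \<Rightarrow> real) \<Rightarrow> 'm \<Rightarrow> ('b \<Rightarrow> real) \<Rightarrow> 'a" where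
  "H_sharp A H x \<beta> =
     (THE v. v \<in> fib (bun1 A) x \<and> (\<forall>\<alpha>\<in>fib (dual_bundle (bun1 A)) x. \<alpha> v = H x \<alpha> \<beta>))"

definition H_nat ::
  "('m, 'a::real_vector, 'b::real_vector) sl2 \<Rightarrow>
    ('m \<Rightarrow> ('a \<Rightarrow> real) \<Rightarrow> ('b \<Rightarrow> real) \<Rightarrow> real) \<Rightarrow> 'm \<Rightarrow> ('a \<Rightarrow> real) \<Rightarrow> 'b" where
  "H_nat A H x \<alpha> =
     (THE v. v \<in> fib (bun2 A) x \<and> (\<forall>\<beta>\<in>fib (dual_bundle (bun2 A)) x. \<beta> v = H x \<alpha> \<beta>))"

definition K_flat ::
  "('m, 'a::real_vector, 'b::real_vector) sl2 \<Rightarrow>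
    ('m \<Rightarrow> ('b \<Rightarrow> real) \<Rightarrow> ('b \<Rightarrow> real) \<Rightarrow> ('b \<Rightarrow> real) \<Rightarrow> real) \<Rightarrow>
    'm \<Rightarrow> ('b \<Rightarrow> real) \<Rightarrow> ('b \<Rightarrow> real) \<Rightarrow> 'b" where
  "K_flat A K x \<alpha> \<beta> =
     (THE v. v \<in> fib (bun2 A) x \<and> (\<forall>\<delta>\<in>fib (dual_bundle (bun2 A)) x. \<delta> v = K x \<alpha> \<beta> \<delta>))"

text \<open>\<open>L\<^sup>1\<close> on \<open>\<Gamma>(A\<^sub>-\<^sub>1\<^sup>*)\<close> and on \<open>\<Gamma>(A\<^sub>-\<^sub>2\<^sup>*)\<close>.\<close>

definition lieD1_1 ::
  "'m::topological_space smfd \<Rightarrow> ('m, 'a::real_vector, 'b::real_vector) sl2 \<Rightarrow>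
    ('m \<Rightarrow> 'a) \<Rightarrow> ('m \<Rightarrow> 'a \<Rightarrow> real) \<Rightarrow> 'm \<Rightarrow> 'a \<Rightarrow> real" where
  "lieD1_1 M A X \<alpha> =
     dual_section M (bun1 A) (\<lambda>Y. rho A X (pairing Y \<alpha>) - pairing (bra2 A X Y) \<alpha>)"

definition lieD1_2 ::
  "'m::topological_space smfd \<Rightarrow> ('m, 'a::real_vector, 'b::real_vector) sl2 \<Rightarrow>
    ('m \<Rightarrow> 'a) \<Rightarrow> ('m \<Rightarrow> 'b \<Rightarrow> real) \<Rightarrow> 'm \<Rightarrow> 'b \<Rightarrow> real" where
  "lieD1_2 M A X \<alpha> =
     dual_section M (bun2 A) (\<lambda>Y. rho A X (pairing Y \<alpha>) - pairing (bra2m A X Y) \<alpha>)"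

definition lieD2 ::
  "'m::topological_space smfd \<Rightarrow> ('m, 'a::real_vector, 'b::real_vector) sl2 \<Rightarrow>
    ('m \<Rightarrow> 'b) \<Rightarrow> ('m \<Rightarrow> 'b \<Rightarrow> real) \<Rightarrow> 'm \<Rightarrow> 'a \<Rightarrow> real" where
  "lieD2 M A X \<alpha> = dual_section M (bun1 A) (\<lambda>Y. - pairing (bra2m A Y X) \<alpha>)"

definition lieD3 ::
  "'m::topological_space smfd \<Rightarrow> ('m, 'a::real_vector, 'b::real_vector) sl2 \<Rightarrow>
    ('m \<Rightarrow> 'a) \<Rightarrow> ('m \<Rightarrow> 'a) \<Rightarrow> ('m \<Rightarrow> 'b \<Rightarrow> real) \<Rightarrow> 'm \<Rightarrow> 'a \<Rightarrow> real" where
  "lieD3 M A X Y \<alpha> = dual_section M (bun1 A) (\<lambda>Z. - pairing (bra3 A X Y Z) \<alpha>)"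

definition dfun ::
  "'m::topological_space smfd \<Rightarrow> ('m, 'a::real_vector, 'b::real_vector) sl2 \<Rightarrow>
    ('m \<Rightarrow> real) \<Rightarrow> 'm \<Rightarrow> 'a \<Rightarrow> real" where
  "dfun M A f = dual_section M (bun1 A) (\<lambda>X. rho A X f)"

definition dual_sl2 ::
  "'m::topological_space smfd \<Rightarrow> ('m, 'a::real_vector, 'b::real_vector) sl2 \<Rightarrow>
    ('m \<Rightarrow> ('a \<Rightarrow> real) \<Rightarrow> ('b \<Rightarrow> real) \<Rightarrow> real) \<Rightarrow>
    ('m \<Rightarrow> ('b \<Rightarrow> real) \<Rightarrow> ('b \<Rightarrow> real) \<Rightarrow> ('b \<Rightarrow> real) \<Rightarrow> real) \<Rightarrow>
    ('m, 'b \<Rightarrow> real, 'a \<Rightarrow> real) sl2" where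
  "dual_sl2 M A H K =
    (let sharp = (\<lambda>\<alpha> x. H_sharp A H x (\<alpha> x));
         nat = (\<lambda>\<alpha> x. H_nat A H x (\<alpha> x));
         flat = (\<lambda>\<alpha> \<beta> x. K_flat A K x (\<alpha> x) (\<beta> x))
     in
     \<lparr>bun1 = dual_bundle (bun2 A),
      bun2 = dual_bundle (bun1 A),
      bra1 = (\<lambda>\<alpha>. dual_section M (bun2 A) (\<lambda>Y. pairing (bra1 A Y) \<alpha>)),
      bra2 = (\<lambda>\<alpha> \<beta>. lieD1_2 M A (sharp \<alpha>) \<beta> - lieD1_2 M A (sharp \<beta>) \<alpha>),
      bra2m = (\<lambda>\<alpha> \<beta>. lieD1_1 M A (sharp \<alpha>) \<beta> - lieD2 M A (nat \<beta>) \<alpha>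
                 - dfun M A (\<lambda>x. H x (\<beta> x) (\<alpha> x))),
      bra3 = (\<lambda>\<alpha> \<beta> \<delta>.
                 - lieD2 M A (flat \<alpha> \<beta>) \<delta> - lieD2 M A (flat \<delta> \<alpha>) \<beta> - lieD2 M A (flat \<beta> \<delta>) \<alpha>
                 - 2 *\<^sub>R dfun M A (\<lambda>x. K x (\<alpha> x) (\<beta> x) (\<delta> x))
                 + lieD3 M A (sharp \<alpha>) (sharp \<beta>) \<delta> + lieD3 M A (sharp \<beta>) (sharp \<delta>) \<alpha>
                 + lieD3 M A (sharp \<delta>) (sharp \<alpha>) \<beta>),
      anchor = (\<lambda>x \<alpha>. anchor A x (H_sharp A H x \<alpha>))\<rparr>)"

end

theory Submission
  imports Defs "Jordan_Normal_Form.Determinant"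
begin

text \<open>
  In a Darboux chart the big bracket measures the failure of a second order operator \<open>\<Delta>\<close> to be a
  derivation, and \<open>\<Delta>\<^sup>2 = 0\<close> gives its Jacobi identity. The functions in the chart thus form a Lie
  superalgebra graded by the tridegree, and all operations of the theorem are derived brackets in it.

  Write \<open>\<mu> = m\<^sub>1 + m\<^sub>2 + m\<^sub>3\<close> and \<open>\<gamma> = m\<^sub>1 + g\<^sub>2 + g\<^sub>3\<close> with \<open>g\<^sub>2 = {m\<^sub>2, H}\<close> and
  \<open>g\<^sub>3 = {m\<^sub>2, K} + 1/2 {{m\<^sub>3, H}, H}\<close>. Splitting \<open>{\<mu>, \<mu>} = 0\<close> and the Maurer--Cartan equation by
  tridegree gives identities that imply \<open>{\<gamma>, \<gamma>} = 0\<close>. The bracket of two sections of dual bundles is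
  their pairing, so a section is determined by its brackets with sections of the dual bundle. As the
  Lie derivatives are defined by pairings, this identifies the brackets on the dual with the derived
  brackets of \<open>\<gamma>\<close>, whence (i). Likewise \<open>H\<^sup>\<sharp>\<close>, \<open>H\<^sup>\<natural>\<close> and \<open>K\<^sup>\<flat>\<close> are brackets with \<open>H\<close> and \<open>K\<close>, and the
  Maurer--Cartan equation applied to sections becomes (ii). Finally a structure function is determined
  by its derived brackets, so the bialgebroid condition is \<open>{m\<^sub>2, g\<^sub>2} = {m\<^sub>3, g\<^sub>2} = {m\<^sub>2, g\<^sub>3} = 0\<close>, and
  these brackets are \<open>-{m\<^sub>1, {m\<^sub>3, H}}\<close>, \<open>-{m\<^sub>2, {m\<^sub>3, H}}\<close> and, if the second one vanishes,
  \<open>-2 {m\<^sub>3, {m\<^sub>1, K}}\<close>.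
\<close>

section \<open>Odd Poisson brackets\<close>

text \<open>The coefficients in the Maurer-Cartan equation and in \<open>\<gamma>\<close> are those
  of an exponential. As \<open>{H, H} = {H, K} = 0\<close>, one can expand
  \<open>exp {-, H + K}\<close> on \<open>\<mu>\<close> and sort by the middle component of the
  tridegree: degree 0 is the Maurer-Cartan expression up to sign, degree 1 is
  \<open>\<gamma>\<close>, degree 2 is \<open>m\<^sub>2 + {m\<^sub>3, H}\<close>, degree 3 is
  \<open>m\<^sub>3\<close>. The exponential preserves \<open>{\<mu>, \<mu>} = 0\<close>, and the
  part of middle degree 1 then reads
  \<open>{\<gamma>, \<gamma>} + 2 {e, m\<^sub>2 + {m\<^sub>3, H}} = 0\<close> with \<open>e\<close>
  of degree 0; so \<open>e = 0\<close> forces \<open>{\<gamma>, \<gamma>} = 0\<close>. Below, this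
  is unrolled into finitely many identities, where many terms die because no monomial has their
  tridegree. What makes the proof long is the passage between local and global. The bracket exists
  only in charts, whereas the operations on the dual describe global sections by their pairings.
  Their existence needs tensoriality, hence cut-off functions, hence a calculus for smoothness
  defined by iterated partial derivatives; conversely, each local test against a frame vector needs
  a global section through it.\<close>

text \<open>The parity of \<open>F\<close> is encoded by the sign \<open>f\<close> in \<open>P F = f F\<close>; \<open>supersign f g\<close> is \<open>-1\<close> if both signs are \<open>-1\<close>
  and \<open>1\<close> otherwise.\<close>

definition supersign :: "real \<Rightarrow> real \<Rightarrow> real" where
  "supersign f g = (1 + f + g - f * g) / 2"

text \<open>\<open>D a\<close> stands for the derivative in an odd coordinate, \<open>E a\<close>
  for the one in its even conjugate. The rules for \<open>E\<close> are restricted to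
  \<open>C\<close> since \<open>E\<close> includes derivatives along the base, which behave well
  only on smooth coefficients. \<open>P_D\<close> is restricted as well: the parity sign is lost on
  monomials with infinitely many odd variables.\<close>

locale odd_poisson =
  fixes C :: "'g::real_vector set"
    and mul :: "'g \<Rightarrow> 'g \<Rightarrow> 'g" (infixl \<open>\<star>\<close> 70)
    and P :: "'g \<Rightarrow> 'g"
    and E D :: "'i \<Rightarrow> 'g \<Rightarrow> 'g"
    and I :: "'i set"
  assumes subspace_C: "subspace C"
    and mul_C: "F \<in> C \<Longrightarrow> G \<in> C \<Longrightarrow> F \<star> G \<in> C"
    and P_C: "F \<in> C \<Longrightarrow> P F \<in> C"
    and E_C: "F \<in> C \<Longrightarrow> E a F \<in> C"
    and D_C: "F \<in> C \<Longrightarrow> D a F \<in> C"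
    and mul_add_left: "(F + G) \<star> K = F \<star> K + G \<star> K"
    and mul_add_right: "K \<star> (F + G) = K \<star> F + K \<star> G"
    and mul_scaleR_left: "(c *\<^sub>R F) \<star> G = c *\<^sub>R (F \<star> G)"
    and mul_scaleR_right: "F \<star> (c *\<^sub>R G) = c *\<^sub>R (F \<star> G)"
    and mul_assoc: "(F \<star> G) \<star> K = F \<star> (G \<star> K)"
    and P_linear: "linear P"
    and P_mul: "P (F \<star> G) = P F \<star> P G"
    and P_P: "P (P F) = F"
    and D_linear: "linear (D a)"
    and D_mul: "D a (F \<star> G) = D a F \<star> G + P F \<star> D a G"
    and E_add: "F \<in> C \<Longrightarrow> G \<in> C \<Longrightarrow> E a (F + G) = E a F + E a G"
    and E_scaleR: "F \<in> C \<Longrightarrow> E a (c *\<^sub>R F) = c *\<^sub>R E a F"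
    and E_mul: "F \<in> C \<Longrightarrow> G \<in> C \<Longrightarrow> E a (F \<star> G) = E a F \<star> G + F \<star> E a G"
    and E_E: "F \<in> C \<Longrightarrow> E a (E b F) = E b (E a F)"
    and E_D: "F \<in> C \<Longrightarrow> E a (D b F) = D b (E a F)"
    and D_D: "D a (D b F) = - D b (D a F)"
    and P_E: "F \<in> C \<Longrightarrow> P (E a F) = E a (P F)"
    and P_D: "F \<in> C \<Longrightarrow> P (D a F) = - D a (P F)"
    and supercommute: "\<lbrakk>P F = f *\<^sub>R F; P G = g *\<^sub>R G; f = 1 \<or> f = -1; g = 1 \<or> g = -1\<rbrakk>
      \<Longrightarrow> F \<star> G = supersign f g *\<^sub>R (G \<star> F)"
begin

text \<open>The Batalin-Vilkovisky Laplacian of the odd symplectic coordinates; \<open>pb\<close> is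
  the bracket it generates.\<close>

definition \<Delta> :: "'g \<Rightarrow> 'g" where
  "\<Delta> F = (\<Sum>a\<in>I. E a (D a F))"

definition pb :: "'g \<Rightarrow> 'g \<Rightarrow> 'g" where
  "pb F G = (\<Sum>a\<in>I. E a F \<star> D a G + D a (P F) \<star> E a G)"

lemma C_simps [simp]:
  "0 \<in> C" "F \<in> C \<Longrightarrow> G \<in> C \<Longrightarrow> F + G \<in> C" "F \<in> C \<Longrightarrow> c *\<^sub>R F \<in> C" "F \<in> C \<Longrightarrow> - F \<in> C"
  "F \<in> C \<Longrightarrow> G \<in> C \<Longrightarrow> F - G \<in> C"
  using subspace_C by (auto intro: subspace_0 subspace_add subspace_scale subspace_neg subspace_diff)

lemma C_sum [simp]: "(\<And>a. a \<in> J \<Longrightarrow> h a \<in> C) \<Longrightarrow> sum h J \<in> C"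
  using subspace_C by (rule subspace_sum)

declare mul_C [simp] P_C [simp] E_C [simp] D_C [simp] P_P [simp]

lemma bilinear_mul: "bilinear (\<star>)"
  by (auto simp: bilinear_def intro!: linearI mul_add_left mul_add_right mul_scaleR_left mul_scaleR_right)

lemmas mul_linear [simp] =
  bilinear_lzero[OF bilinear_mul] bilinear_rzero[OF bilinear_mul]
  bilinear_lneg[OF bilinear_mul] bilinear_rneg[OF bilinear_mul]

lemmas mul_diff = bilinear_lsub[OF bilinear_mul] bilinear_rsub[OF bilinear_mul]

lemma mul_sum_left: "sum h J \<star> F = (\<Sum>a\<in>J. h a \<star> F)"
  using linear_sum[of "\<lambda>x. x \<star> F" h J] bilinear_mul by (simp add: bilinear_def)

lemma mul_sum_right: "F \<star> sum h J = (\<Sum>a\<in>J. F \<star> h a)"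
  using linear_sum[of "\<lambda>x. F \<star> x" h J] bilinear_mul by (simp add: bilinear_def)

lemmas P_simps [simp] = linear_0[OF P_linear] linear_add[OF P_linear] linear_neg[OF P_linear]
  linear_diff[OF P_linear] linear_scale[OF P_linear]

lemmas D_simps [simp] = linear_0[OF D_linear] linear_add[OF D_linear] linear_neg[OF D_linear]
  linear_diff[OF D_linear] linear_scale[OF D_linear]

lemma E_0 [simp]: "E a 0 = 0"
  using E_scaleR[of 0 a 0] by simp

lemma E_neg [simp]: "F \<in> C \<Longrightarrow> E a (- F) = - E a F"
  using E_scaleR[of F a "-1"] by simp

lemma E_sum: "(\<And>b. b \<in> J \<Longrightarrow> h b \<in> C) \<Longrightarrow> E a (sum h J) = (\<Sum>b\<in>J. E a (h b))"
  by (induction J rule: infinite_finite_induct) (simp_all add: E_add)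

lemma D_sum: "D a (sum h J) = (\<Sum>b\<in>J. D a (h b))"
  by (rule linear_sum[OF D_linear])

lemma P_sum: "P (sum h J) = (\<Sum>b\<in>J. P (h b))"
  by (rule linear_sum[OF P_linear])

lemma Delta_C [simp]: "F \<in> C \<Longrightarrow> \<Delta> F \<in> C"
  by (simp add: \<Delta>_def)

lemma pb_C [simp]: "F \<in> C \<Longrightarrow> G \<in> C \<Longrightarrow> pb F G \<in> C"
  by (simp add: pb_def)

lemma Delta_add [simp]: "F \<in> C \<Longrightarrow> G \<in> C \<Longrightarrow> \<Delta> (F + G) = \<Delta> F + \<Delta> G"
  by (simp add: \<Delta>_def E_add sum.distrib)

lemma Delta_scaleR [simp]: "F \<in> C \<Longrightarrow> \<Delta> (c *\<^sub>R F) = c *\<^sub>R \<Delta> F"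
  by (simp add: \<Delta>_def E_scaleR scaleR_sum_right)

lemma Delta_neg [simp]: "F \<in> C \<Longrightarrow> \<Delta> (- F) = - \<Delta> F"
  using Delta_scaleR[of F "-1"] by simp

lemma P_Delta: "F \<in> C \<Longrightarrow> P (\<Delta> F) = - \<Delta> (P F)"
  by (simp add: \<Delta>_def P_sum P_E P_D sum_negf)

lemma pb_add_left: "F \<in> C \<Longrightarrow> G \<in> C \<Longrightarrow> pb (F + G) K = pb F K + pb G K"
  by (simp add: pb_def E_add mul_add_left sum.distrib)

lemma pb_add_right: "F \<in> C \<Longrightarrow> G \<in> C \<Longrightarrow> pb K (F + G) = pb K F + pb K G"
  by (simp add: pb_def E_add mul_add_right sum.distrib)

lemma pb_scaleR_left: "F \<in> C \<Longrightarrow> pb (c *\<^sub>R F) K = c *\<^sub>R pb F K"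
  by (simp add: pb_def E_scaleR mul_scaleR_left scaleR_sum_right scaleR_add_right)

lemma pb_scaleR_right: "F \<in> C \<Longrightarrow> pb K (c *\<^sub>R F) = c *\<^sub>R pb K F"
  by (simp add: pb_def E_scaleR mul_scaleR_right scaleR_sum_right scaleR_add_right)

lemma pb_neg_left [simp]: "F \<in> C \<Longrightarrow> pb (- F) K = - pb F K"
  using pb_scaleR_left[of F "-1" K] by simp

lemma pb_neg_right [simp]: "F \<in> C \<Longrightarrow> pb K (- F) = - pb K F"
  using pb_scaleR_right[of F K "-1"] by simp

lemma pb_diff_left: "F \<in> C \<Longrightarrow> G \<in> C \<Longrightarrow> pb (F - G) K = pb F K - pb G K"
  using pb_add_left[of F "- G" K] by simp

lemma pb_diff_right: "F \<in> C \<Longrightarrow> G \<in> C \<Longrightarrow> pb K (F - G) = pb K F - pb K G"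
  using pb_add_right[of F "- G" K] by simp

lemma P_pb: "F \<in> C \<Longrightarrow> G \<in> C \<Longrightarrow> P (pb F G) = - pb (P F) (P G)"
  by (simp add: pb_def P_sum P_mul P_E P_D sum_negf[symmetric])

text \<open>The cross terms of \<open>E a\<close> after \<open>D a\<close> are
  \<open>E a (P F) \<star> D a G + D a F \<star> E a G\<close>. Since \<open>P\<close> is an
  involution, they sum to \<open>pb (P F) G\<close>; this is the reason for the \<open>P\<close>
  inside \<open>pb\<close>.\<close>

lemma Delta_mul:
  assumes "F \<in> C" "G \<in> C"
  shows "\<Delta> (F \<star> G) = \<Delta> F \<star> G + P F \<star> \<Delta> G + pb (P F) G"
  using assms
  by (simp add: \<Delta>_def pb_def D_mul E_add E_mul mul_sum_left mul_sum_right sum.distrib add_ac)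

text \<open>The \<open>E a\<close> commute and the \<open>D a\<close> anticommute, so exchanging the
  two summation indices reverses the sign of the double sum.\<close>

lemma Delta_Delta:
  assumes F: "F \<in> C"
  shows "\<Delta> (\<Delta> F) = 0"
proof -
  have "\<Delta> (\<Delta> F) = (\<Sum>a\<in>I. \<Sum>b\<in>I. E a (E b (D a (D b F))))"
    using F by (simp add: \<Delta>_def D_sum E_sum E_D)
  also have "\<dots> = (\<Sum>b\<in>I. \<Sum>a\<in>I. E a (E b (D a (D b F))))"
    by (rule sum.swap)
  also have "\<dots> = (\<Sum>b\<in>I. \<Sum>a\<in>I. - E b (E a (D b (D a F))))"
  proof (intro sum.cong refl)
    fix a b
    show "E a (E b (D a (D b F))) = - E b (E a (D b (D a F)))"
      using F by (subst E_E, simp, subst D_D) simp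
  qed
  also have "\<dots> = - \<Delta> (\<Delta> F)"
    using F by (simp add: \<Delta>_def D_sum E_sum E_D sum_negf)
  finally have "2 *\<^sub>R \<Delta> (\<Delta> F) = 0"
    by (simp add: scaleR_2 eq_neg_iff_add_eq_0)
  then show ?thesis
    by simp
qed

text \<open>Expand \<open>\<Delta> (\<Delta> (P F \<star> G)) = 0\<close> by
  \<open>Delta_mul\<close>. The left factor is \<open>P F\<close> because the defect of
  \<open>\<Delta>\<close> on \<open>P F \<star> G\<close> is exactly \<open>pb F G\<close>.\<close>

lemma Delta_pb:
  assumes "F \<in> C" "G \<in> C"
  shows "\<Delta> (pb F G) = pb (\<Delta> F) G - pb (P F) (\<Delta> G)"
proof -
  have "\<Delta> (\<Delta> (P F \<star> G)) = 0"
    using assms by (simp add: Delta_Delta)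
  then show ?thesis
    using assms by (simp add: Delta_mul Delta_Delta P_Delta pb_add_left eq_neg_iff_add_eq_0 algebra_simps)
qed

text \<open>Since the bracket itself is odd, the sign is governed by the shifted parities
  \<open>- f\<close> and \<open>- g\<close>.\<close>

lemma pb_swap:
  assumes C: "F \<in> C" "G \<in> C" and P: "P F = f *\<^sub>R F" "P G = g *\<^sub>R G"
    and s: "f = 1 \<or> f = -1" "g = 1 \<or> g = -1"
  shows "pb F G = (- supersign (- f) (- g)) *\<^sub>R pb G F"
proof -
  have PE: "P (E a F) = f *\<^sub>R E a F" "P (E a G) = g *\<^sub>R E a G" for a
    using C P by (simp_all add: P_E E_scaleR)
  have PD: "P (D a F) = (- f) *\<^sub>R D a F" "P (D a G) = (- g) *\<^sub>R D a G" for a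
    using C P by (simp_all add: P_D)
  have 1: "E a F \<star> D a G = supersign f (- g) *\<^sub>R (D a G \<star> E a F)" for a
    by (rule supercommute[OF PE(1) PD(2)]) (use s in auto)
  have 2: "D a F \<star> E a G = supersign (- f) g *\<^sub>R (E a G \<star> D a F)" for a
    by (rule supercommute[OF PD(1) PE(2)]) (use s in auto)
  show ?thesis
    unfolding pb_def P 1 D_simps mul_scaleR_left 2 scaleR_sum_right
    using s by (intro sum.cong) (auto simp: supersign_def algebra_simps)
qed

lemma pb_mul_right:
  assumes C: "F \<in> C" "G \<in> C" "K \<in> C" and P: "P F = f *\<^sub>R F" "P G = g *\<^sub>R G"
    and s: "f = 1 \<or> f = -1" "g = 1 \<or> g = -1"
  shows "pb F (G \<star> K) = pb F G \<star> K + supersign (- f) g *\<^sub>R (G \<star> pb F K)"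
proof -
  have PE: "P (E a F) = f *\<^sub>R E a F" for a
    using C P by (simp add: P_E E_scaleR)
  have PD: "P (D a F) = (- f) *\<^sub>R D a F" for a
    using C P by (simp add: P_D)
  have 1: "E a F \<star> (G \<star> K') = supersign f g *\<^sub>R (G \<star> (E a F \<star> K'))" for a K'
    using supercommute[OF PE P(2) s] by (simp add: mul_assoc[symmetric] mul_scaleR_left)
  have "D a F \<star> G = supersign (- f) g *\<^sub>R (G \<star> D a F)" for a
    by (rule supercommute[OF PD P(2)]) (use s in auto)
  then have 2: "D a F \<star> (G \<star> K') = supersign (- f) g *\<^sub>R (G \<star> (D a F \<star> K'))" for a K'
    by (simp add: mul_assoc[symmetric] mul_scaleR_left)
  show ?thesis
    unfolding pb_def mul_sum_left mul_sum_right scaleR_sum_right sum.distrib[symmetric]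
    using s C
    by (intro sum.cong)
      (auto simp: P D_mul E_mul mul_add_left mul_add_right mul_scaleR_left mul_scaleR_right mul_assoc 1 2
        supersign_def algebra_simps)
qed

text \<open>The Jacobi identity is obtained by comparing the two ways to compute \<open>\<Delta> (pb F (G \<star> K))\<close>,
  i.e. \<open>\<Delta>\<close> a derivation of \<open>pb\<close> versus \<open>pb F\<close> a derivation of \<open>\<star>\<close>. The factor \<open>K\<close> survives
  in no product, so the identity holds for all \<open>K\<close>.\<close>

lemma pb_jacobi:
  assumes C: "F \<in> C" "G \<in> C" "K \<in> C" and P: "P F = f *\<^sub>R F" "P G = g *\<^sub>R G"
    and s: "f = 1 \<or> f = -1" "g = 1 \<or> g = -1"
  shows "pb F (pb G K) = pb (pb F G) K + supersign (- f) (- g) *\<^sub>R pb G (pb F K)"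
proof -
  have PDF: "P (\<Delta> F) = (- f) *\<^sub>R \<Delta> F" and PDG: "P (\<Delta> G) = (- g) *\<^sub>R \<Delta> G"
    using C P by (simp_all add: P_Delta)
  have PFG: "P (pb F G) = (- f * g) *\<^sub>R pb F G"
    using C P by (simp add: P_pb pb_scaleR_left pb_scaleR_right)
  have s': "- f = 1 \<or> - f = -1" "- g = 1 \<or> - g = -1"
    using s by auto
  note L = pb_mul_right[OF C(1,2) _ P s] pb_mul_right[OF _ C(2) _ PDF P(2) s'(1) s(2)]
    pb_mul_right[OF C(1) _ _ P(1) PDG s(1) s'(2)]
  have A: "\<Delta> (pb F (G \<star> K)) = pb (\<Delta> F) (G \<star> K)
      - f *\<^sub>R pb F (\<Delta> G \<star> K + g *\<^sub>R (G \<star> \<Delta> K) + g *\<^sub>R pb G K)"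
    using C by (simp add: Delta_pb Delta_mul P pb_scaleR_left mul_scaleR_left)
  have B: "\<Delta> (pb F (G \<star> K)) = \<Delta> (pb F G) \<star> K - (f * g) *\<^sub>R (pb F G \<star> \<Delta> K)
      - (f * g) *\<^sub>R pb (pb F G) K
      + supersign (- f) g *\<^sub>R (\<Delta> G \<star> pb F K + g *\<^sub>R (G \<star> \<Delta> (pb F K)) + g *\<^sub>R pb G (pb F K))"
    using C by (simp add: L(1) Delta_mul P PFG mul_scaleR_left pb_scaleR_left)
  \<comment> \<open>In \<open>A = B\<close> all terms containing \<open>\<Delta>\<close> cancel; the
    three double brackets are what remains.\<close>
  have "(f * g) *\<^sub>R pb F (pb G K) = (f * g) *\<^sub>R pb (pb F G) K - (g * supersign (- f) g) *\<^sub>R pb G (pb F K)"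
    using A[unfolded B] C s
    by (auto simp: L pb_add_right pb_scaleR_right Delta_pb P pb_scaleR_left mul_diff mul_scaleR_left
        mul_scaleR_right supersign_def scaleR_add_right scaleR_diff_right mul_add_left mul_add_right
        algebra_simps)
  then show ?thesis
    using s by (auto simp: supersign_def algebra_simps)
qed

end

section \<open>Derived brackets and Maurer--Cartan elements\<close>

text \<open>\<open>Ev\<close> and \<open>Od\<close> are parities with respect to the Lie bracket,
  opposite to those of functions because the Poisson bracket has odd degree: structure functions, of
  degree 4, lie in \<open>Od\<close>, while \<open>H\<close> and \<open>K\<close>, of degree 3, lie
  in \<open>Ev\<close>.\<close>

locale lie_superalgebra =
  fixes S Ev Od :: "'g::real_vector set" and br :: "'g \<Rightarrow> 'g \<Rightarrow> 'g"
  assumes subspace_S: "subspace S"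
    and Ev_S: "Ev \<subseteq> S" and Od_S: "Od \<subseteq> S"
    and subspace_Ev: "subspace Ev" and subspace_Od: "subspace Od"
    and br_S: "a \<in> S \<Longrightarrow> b \<in> S \<Longrightarrow> br a b \<in> S"
    and br_ee: "a \<in> Ev \<Longrightarrow> b \<in> Ev \<Longrightarrow> br a b \<in> Ev"
    and br_eo: "a \<in> Ev \<Longrightarrow> b \<in> Od \<Longrightarrow> br a b \<in> Od"
    and br_oo: "a \<in> Od \<Longrightarrow> b \<in> Od \<Longrightarrow> br a b \<in> Ev"
    and br_add_left: "a \<in> S \<Longrightarrow> b \<in> S \<Longrightarrow> c \<in> S \<Longrightarrow> br (a + b) c = br a c + br b c"
    and br_add_right: "a \<in> S \<Longrightarrow> b \<in> S \<Longrightarrow> c \<in> S \<Longrightarrow> br a (b + c) = br a b + br a c"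
    and br_scaleR_left: "a \<in> S \<Longrightarrow> b \<in> S \<Longrightarrow> br (r *\<^sub>R a) b = r *\<^sub>R br a b"
    and br_scaleR_right: "a \<in> S \<Longrightarrow> b \<in> S \<Longrightarrow> br a (r *\<^sub>R b) = r *\<^sub>R br a b"
    and swap_oo: "a \<in> Od \<Longrightarrow> b \<in> Od \<Longrightarrow> br a b = br b a"
    and swap_e: "a \<in> Ev \<Longrightarrow> b \<in> Ev \<union> Od \<Longrightarrow> br a b = - br b a"
    and jacobi_oo: "a \<in> Od \<Longrightarrow> b \<in> Od \<Longrightarrow> c \<in> S \<Longrightarrow> br a (br b c) = br (br a b) c - br b (br a c)"
    and jacobi_e: "a \<in> Ev \<Longrightarrow> b \<in> Ev \<union> Od \<Longrightarrow> c \<in> S \<Longrightarrow> br a (br b c) = br (br a b) c + br b (br a c)"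
begin

lemma EvOd_S [simp]: "a \<in> Ev \<Longrightarrow> a \<in> S" "a \<in> Od \<Longrightarrow> a \<in> S"
  using Ev_S Od_S by auto

lemma br_oe: "a \<in> Od \<Longrightarrow> b \<in> Ev \<Longrightarrow> br a b \<in> Od"
  using swap_e[of b a] br_eo[of b a] subspace_neg[OF subspace_Od, of "br b a"] by simp

text \<open>The right factor is put first, so that the simplifier decides the parity of a left-nested
  bracket without backtracking.\<close>

lemma br_parity [simp]:
  "b \<in> Ev \<Longrightarrow> a \<in> Ev \<Longrightarrow> br a b \<in> Ev" "b \<in> Od \<Longrightarrow> a \<in> Od \<Longrightarrow> br a b \<in> Ev"
  "b \<in> Ev \<Longrightarrow> a \<in> Od \<Longrightarrow> br a b \<in> Od" "b \<in> Od \<Longrightarrow> a \<in> Ev \<Longrightarrow> br a b \<in> Od"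
  by (auto intro: br_ee br_oo br_oe br_eo)

declare br_S [simp]

definition "Hom = Ev \<union> Od"

lemma Hom_simps [simp]: "a \<in> Ev \<Longrightarrow> a \<in> Hom" "a \<in> Od \<Longrightarrow> a \<in> Hom"
  "b \<in> Hom \<Longrightarrow> a \<in> Hom \<Longrightarrow> br a b \<in> Hom"
  by (auto simp: Hom_def)

lemma Hom_S [simp]: "a \<in> Hom \<Longrightarrow> a \<in> S"
  by (auto simp: Hom_def)

lemma subspace_simps [simp]:
  "0 \<in> S" "0 \<in> Ev" "0 \<in> Od"
  "a \<in> S \<Longrightarrow> - a \<in> S" "a \<in> Ev \<Longrightarrow> - a \<in> Ev" "a \<in> Od \<Longrightarrow> - a \<in> Od"
  "a \<in> S \<Longrightarrow> r *\<^sub>R a \<in> S" "a \<in> Ev \<Longrightarrow> r *\<^sub>R a \<in> Ev" "a \<in> Od \<Longrightarrow> r *\<^sub>R a \<in> Od"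
  "a \<in> S \<Longrightarrow> b \<in> S \<Longrightarrow> a + b \<in> S" "a \<in> Ev \<Longrightarrow> b \<in> Ev \<Longrightarrow> a + b \<in> Ev"
  "a \<in> Od \<Longrightarrow> b \<in> Od \<Longrightarrow> a + b \<in> Od"
  "a \<in> S \<Longrightarrow> b \<in> S \<Longrightarrow> a - b \<in> S" "a \<in> Ev \<Longrightarrow> b \<in> Ev \<Longrightarrow> a - b \<in> Ev"
  "a \<in> Od \<Longrightarrow> b \<in> Od \<Longrightarrow> a - b \<in> Od"
  using subspace_S subspace_Ev subspace_Od
  by (auto intro: subspace_0 subspace_neg subspace_scale subspace_add subspace_diff)

lemma br_neg_left [simp]: "a \<in> S \<Longrightarrow> b \<in> S \<Longrightarrow> br (- a) b = - br a b"
  using br_scaleR_left[of a b "-1"] by simp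

lemma br_neg_right [simp]: "a \<in> S \<Longrightarrow> b \<in> S \<Longrightarrow> br a (- b) = - br a b"
  using br_scaleR_right[of a b "-1"] by simp

lemma br_diff_left: "a \<in> S \<Longrightarrow> b \<in> S \<Longrightarrow> c \<in> S \<Longrightarrow> br (a - b) c = br a c - br b c"
  using br_add_left[of a "- b" c] by simp

lemma br_diff_right: "a \<in> S \<Longrightarrow> b \<in> S \<Longrightarrow> c \<in> S \<Longrightarrow> br a (b - c) = br a b - br a c"
  using br_add_right[of a b "- c"] by simp

lemma br_zero_left [simp]: "b \<in> S \<Longrightarrow> br 0 b = 0"
  using br_scaleR_left[of 0 b 0] by simp

lemma br_zero_right [simp]: "b \<in> S \<Longrightarrow> br b 0 = 0"
  using br_scaleR_right[of b 0 0] by simp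

lemmas br_linear = br_add_left br_add_right br_diff_left br_diff_right br_scaleR_left br_scaleR_right

lemma swap_e': "a \<in> Od \<Longrightarrow> b \<in> Ev \<Longrightarrow> br a b = - br b a"
  using swap_e[of b a] by simp

lemma jacobi_e': "a \<in> Od \<Longrightarrow> b \<in> Ev \<Longrightarrow> c \<in> S \<Longrightarrow> br a (br b c) = br (br a b) c + br b (br a c)"
  using jacobi_e[of b a c] swap_e[of b a] by simp

text \<open>Right multiplication by \<open>u\<close> is a derivation; on a nested bracket \<open>br (br F u) v\<close> these
  rules move \<open>v\<close> past \<open>u\<close>.\<close>

lemma right_oo:
  "F \<in> Hom \<Longrightarrow> u \<in> Od \<Longrightarrow> v \<in> Od \<Longrightarrow> br (br F u) v = br F (br u v) - br (br F v) u"
  using jacobi_oo[of F u v] swap_oo[of u "br F v"] jacobi_e[of F u v] swap_oo[of u "br F v"]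
    swap_e'[of u "br F v"]
  by (auto simp: Hom_def algebra_simps)

lemma right_e:
  "F \<in> Hom \<Longrightarrow> u \<in> Ev \<Longrightarrow> v \<in> Hom \<Longrightarrow> br (br F u) v = br F (br u v) + br (br F v) u"
  using jacobi_e'[of F u v] jacobi_e[of F u v] swap_e[of u "br F v"]
  by (auto simp: Hom_def algebra_simps)

lemma right_e':
  "F \<in> Hom \<Longrightarrow> u \<in> Od \<Longrightarrow> v \<in> Ev \<Longrightarrow> br (br F u) v = br F (br u v) + br (br F v) u"
  using jacobi_oo[of F u v] jacobi_e[of F u v] swap_oo[of u "br F v"] swap_e'[of u "br F v"]
  by (auto simp: Hom_def algebra_simps)

section \<open>Lie 2-algebra identities for derived brackets\<close>

lemma derived_action:
  assumes "g1 \<in> Od" "g2 \<in> Od" "x \<in> Od" "m \<in> Ev" "br g1 g2 = 0" "br g1 x = 0"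
  shows "br g1 (br (br g2 x) m) = br (br g2 x) (br g1 m)"
  using assms jacobi_e'[of g1 "br g2 x" m] jacobi_oo[of g1 g2 x] by simp

text \<open>\<open>br g1\<close> is carried from \<open>m\<close> over to \<open>n\<close>: past
  \<open>g2\<close> it changes sign because \<open>br g1 g2 = 0\<close>, and the two brackets in
  \<open>z\<close> vanish, so the other terms of the Jacobi identity drop out.\<close>

lemma derived_action_skew:
  assumes o: "g1 \<in> Od" "g2 \<in> Od" and e: "m \<in> Ev" "n \<in> Ev" and g: "br g1 g2 = 0"
    and z: "br (br g2 m) n = 0" "br m (br g1 n) = 0"
  shows "br (br g2 (br g1 m)) n = - br (br g2 (br g1 n)) m"
proof -
  have "br g2 g1 = 0"
    using o g swap_oo by simp
  then have "br g2 (br g1 m) = - br g1 (br g2 m)"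
    using o e jacobi_oo[of g2 g1 m] by simp
  moreover have "br (br g1 (br g2 m)) n = br (br g2 m) (br g1 n)"
    using o e z jacobi_oo[of g1 "br g2 m" n] by simp
  moreover have "br (br g2 m) (br g1 n) = br (br g2 (br g1 n)) m"
    using o e z right_e[of g2 m "br g1 n"] by simp
  ultimately show ?thesis
    using o e by simp
qed

text \<open>The familiar fact that the Jacobiator of a derived bracket is half the triple derived
  bracket of the square. The last argument is arbitrary, so the identity serves both for the bracket
  and for the action.\<close>

lemma derived_square:
  assumes g: "g2 \<in> Od" and x: "x \<in> Od" and y: "y \<in> Od" and z: "z \<in> S"
  shows "br (br (br (br g2 g2) x) y) z =
    2 *\<^sub>R (br (br g2 (br (br g2 x) y)) z - br (br g2 x) (br (br g2 y) z) + br (br g2 y) (br (br g2 x) z))"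
proof -
  have 1: "br (br g2 g2) x = 2 *\<^sub>R br g2 (br g2 x)"
    using right_oo[of g2 g2 x] swap_e[of "br g2 x" g2] g x by (simp add: scaleR_2)
  have 2: "br (br g2 (br g2 x)) y = br g2 (br (br g2 x) y) - br (br g2 x) (br g2 y)"
    using right_e[of g2 "br g2 x" y] swap_e[of "br g2 y" "br g2 x"] g x y by simp
  have 3: "br (br (br g2 x) (br g2 y)) z = br (br g2 x) (br (br g2 y) z) - br (br g2 y) (br (br g2 x) z)"
    using jacobi_e[of "br g2 x" "br g2 y" z] g x y z by simp
  show ?thesis
    using g x y z by (simp add: 1 2 3 br_linear algebra_simps)
qed

text \<open>\<open>sq\<close> trades the square of \<open>g2\<close> in
  \<open>derived_square\<close> for \<open>br g1 g3\<close>, and \<open>br g1\<close> moves through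
  the whole word because it annihilates the three arguments.\<close>

lemma derived_jacobi:
  assumes g: "g1 \<in> Od" "g2 \<in> Od" "g3 \<in> Od" and o: "x \<in> Od" "y \<in> Od" "z \<in> Od"
    and sq: "br g2 g2 + 2 *\<^sub>R br g1 g3 = 0" and z1: "br g1 x = 0" "br g1 y = 0" "br g1 z = 0"
  shows "br g1 (br (br (br g3 x) y) z) =
    br (br g2 x) (br (br g2 y) z) - br (br g2 (br (br g2 x) y)) z - br (br g2 y) (br (br g2 x) z)"
proof -
  have R: "br g1 (br F u) = br (br g1 F) u" if "F \<in> Hom" "u \<in> Od" "br g1 u = 0" for F u
    using that g jacobi_e'[of g1 F u] jacobi_oo[of g1 F u] by (auto simp: Hom_def)
  have "br g1 (br (br (br g3 x) y) z) = br (br (br (br g1 g3) x) y) z"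
    using g o z1 by (simp add: R)
  also have "br g1 g3 = (-1/2) *\<^sub>R br g2 g2"
    using sq by (simp add: add_eq_0_iff2)
  finally show ?thesis
    using g o by (simp add: br_linear derived_square algebra_simps)
qed

text \<open>As in \<open>derived_jacobi\<close>, but \<open>br g1\<close> does not annihilate the
  even argument \<open>m\<close>; it ends up on \<open>m\<close>, while the word on which
  \<open>br g1\<close> would act from outside vanishes by \<open>z3\<close>.\<close>

lemma derived_jacobi_action:
  assumes g: "g1 \<in> Od" "g2 \<in> Od" "g3 \<in> Od" and o: "x \<in> Od" "y \<in> Od" and e: "m \<in> Ev"
    and sq: "br g2 g2 + 2 *\<^sub>R br g1 g3 = 0" and z1: "br g1 x = 0" "br g1 y = 0"
    and z3: "br (br (br g3 x) y) m = 0"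
  shows "br (br (br g3 x) y) (br g1 m) =
    br (br g2 x) (br (br g2 y) m) - br (br g2 (br (br g2 x) y)) m - br (br g2 y) (br (br g2 x) m)"
proof -
  have R: "br g1 (br F u) = br (br g1 F) u" if "F \<in> Hom" "u \<in> Od" "br g1 u = 0" for F u
    using that g jacobi_e'[of g1 F u] jacobi_oo[of g1 F u] by (auto simp: Hom_def)
  let ?F = "br (br g3 x) y"
  have "br ?F (br g1 m) = br (br g1 ?F) m"
    using g o e z3 jacobi_oo[of ?F g1 m] swap_oo[of ?F g1] by simp
  also have "br g1 ?F = br (br (br g1 g3) x) y"
    using g o z1 by (simp add: R)
  also have "br g1 g3 = (-1/2) *\<^sub>R br g2 g2"
    using sq by (simp add: add_eq_0_iff2)
  finally show ?thesis
    using g o e by (simp add: br_linear derived_square algebra_simps)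
qed

text \<open>The coherence law is \<open>br g2 g3 = 0\<close> bracketed on the right with
  \<open>x\<close>, \<open>y\<close>, \<open>z\<close>, \<open>w\<close> in turn. \<open>A\<close>
  to \<open>C\<close> record the first three stages, each argument being distributed over both
  factors.\<close>

lemma derived_coherence:
  assumes g: "g2 \<in> Od" "g3 \<in> Od" and o: "x \<in> Od" "y \<in> Od" "z \<in> Od" "w \<in> Od"
    and g23: "br g2 g3 = 0" and tw: "br (br (br (br g3 x) y) z) w = 0"
  shows "br (br g2 x) (br (br (br g3 y) z) w) - br (br g2 y) (br (br (br g3 x) z) w)
    + br (br g2 z) (br (br (br g3 x) y) w) - br (br g2 w) (br (br (br g3 x) y) z)
    - br (br (br g3 (br (br g2 x) y)) z) w - br (br (br g3 y) (br (br g2 x) z)) w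
    - br (br (br g3 y) z) (br (br g2 x) w) + br (br (br g3 x) (br (br g2 y) z)) w
    + br (br (br g3 x) z) (br (br g2 y) w) - br (br (br g3 x) y) (br (br g2 z) w) = 0"
proof -
  have 1: "br (br g2 (br g3 x)) y = br g2 (br (br g3 x) y) + br (br g2 y) (br g3 x)"
    using g o by (intro right_e) auto
  have 2: "br (br (br g2 x) g3) y = br (br g2 x) (br g3 y) - br (br (br g2 x) y) g3"
    using g o by (intro right_oo) auto
  have 3: "br (br (br g2 x) y) g3 = br g3 (br (br g2 x) y)"
    using g o by (intro swap_oo) auto
  have A: "br g2 (br g3 x) - br (br g2 x) g3 = 0"
    using right_oo[of g2 g3 x] g o g23 by simp
  then have "br (br g2 (br g3 x) - br (br g2 x) g3) y = 0"
    using o by simp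
  then have B: "br g2 (br (br g3 x) y) + br (br g2 y) (br g3 x) - br (br g2 x) (br g3 y)
      + br g3 (br (br g2 x) y) = 0"
    using g o by (simp add: br_linear 1 2 3)
  have 4: "br (br g2 (br (br g3 x) y)) z = br g2 (br (br (br g3 x) y) z) - br (br g2 z) (br (br g3 x) y)"
    using g o by (intro right_oo) auto
  have 5: "br (br (br g2 u) (br g3 v)) z = br (br g2 u) (br (br g3 v) z) - br (br g3 v) (br (br g2 u) z)"
    if "u \<in> Od" "v \<in> Od" for u v
    using right_e[of "br g2 u" "br g3 v" z] swap_e[of "br g3 v" "br (br g2 u) z"] g o that by simp
  from B have "br (br g2 (br (br g3 x) y) + br (br g2 y) (br g3 x) - br (br g2 x) (br g3 y)
      + br g3 (br (br g2 x) y)) z = 0"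
    using o by simp
  then have C: "br g2 (br (br (br g3 x) y) z) - br (br g2 z) (br (br g3 x) y)
     + br (br g2 y) (br (br g3 x) z) - br (br g3 x) (br (br g2 y) z)
     - br (br g2 x) (br (br g3 y) z) + br (br g3 y) (br (br g2 x) z)
     + br (br g3 (br (br g2 x) y)) z = 0"
    using g o by (simp add: br_linear 4 5 algebra_simps)
  \<comment> \<open>In the term where \<open>g2\<close> stands alone in front of the word,
    \<open>w\<close> can only fall on \<open>g2\<close>, since the word with four arguments
    vanishes.\<close>
  have 6: "br (br g2 (br (br (br g3 x) y) z)) w = br (br g2 w) (br (br (br g3 x) y) z)"
    using right_e[of g2 "br (br (br g3 x) y) z" w] g o tw by simp
  have 7: "br (br (br g2 u) (br (br g3 v) t)) w =
      br (br g2 u) (br (br (br g3 v) t) w) - br (br (br g3 v) t) (br (br g2 u) w)"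
    if "u \<in> Od" "v \<in> Od" "t \<in> Od" for u v t
    using right_oo[of "br g2 u" "br (br g3 v) t" w] swap_oo[of "br (br g3 v) t" "br (br g2 u) w"] g o that
    by simp
  from C have "br (br g2 (br (br (br g3 x) y) z) - br (br g2 z) (br (br g3 x) y)
     + br (br g2 y) (br (br g3 x) z) - br (br g3 x) (br (br g2 y) z)
     - br (br g2 x) (br (br g3 y) z) + br (br g3 y) (br (br g2 x) z)
     + br (br g3 (br (br g2 x) y)) z) w = 0"
    using o by simp
  then show ?thesis
    using g o by (simp add: br_linear 6 7 algebra_simps)
qed

end

text \<open>The sum \<open>a + b + c\<close> is the degree of a function and decides its parity.
  \<open>T_zero\<close> lists tridegrees without monomials; \<open>b + c < a\<close> is among them
  because for every coordinate the first component is at most the sum of the other two.\<close>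

locale trigraded_lie = lie_superalgebra S Ev Od br
  for S Ev Od :: "'g::real_vector set" and br :: "'g \<Rightarrow> 'g \<Rightarrow> 'g" +
  fixes T :: "int \<Rightarrow> int \<Rightarrow> int \<Rightarrow> 'g set"
  assumes T_Ev: "F \<in> T a b c \<Longrightarrow> odd (a + b + c) \<Longrightarrow> F \<in> Ev"
    and T_Od: "F \<in> T a b c \<Longrightarrow> even (a + b + c) \<Longrightarrow> F \<in> Od"
    and T_br: "F \<in> T a b c \<Longrightarrow> G \<in> T a' b' c' \<Longrightarrow> br F G \<in> T (a + a' - 1) (b + b' - 1) (c + c' - 1)"
    and T_zero: "F \<in> T a b c \<Longrightarrow> a < 0 \<or> b < 0 \<or> c < 0 \<or> b + c < a \<Longrightarrow> F = 0"
    and T_subspace: "subspace (T a b c)"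

text \<open>\<open>m12\<close>, \<open>m22\<close>, \<open>m23\<close> are the homogeneous
  components of \<open>{\<mu>, \<mu>} = 0\<close>, and \<open>MC1\<close>, \<open>MC2\<close>,
  \<open>MC3\<close> those of the Maurer-Cartan equation, of tridegrees (2, 0, 2), (1, 0, 3) and (0,
  0, 4).\<close>

locale maurer_cartan_datum = trigraded_lie S Ev Od br T
  for S Ev Od :: "'g::real_vector set" and br T +
  fixes m1 m2 m3 H K :: 'g
  assumes m1: "m1 \<in> T 2 1 1" and m2: "m2 \<in> T 1 2 1" and m3: "m3 \<in> T 0 3 1"
    and H: "H \<in> T 1 0 2" and K: "K \<in> T 0 0 3"
    and m12: "br m1 m2 = 0" and m22: "br m2 m2 + 2 *\<^sub>R br m1 m3 = 0" and m23: "br m2 m3 = 0"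
    and MC1: "br m1 H = 0" and MC2: "br m1 K + (1/2) *\<^sub>R br (br m2 H) H = 0"
    and MC3: "br (br m2 H) K + (1/6) *\<^sub>R br (br (br m3 H) H) H = 0"
begin

definition "g2 = br m2 H"

definition "g3 = br m2 K + (1/2) *\<^sub>R br (br m3 H) H"

lemma Od_m [simp]: "m1 \<in> Od" "m2 \<in> Od" "m3 \<in> Od" and Ev_HK [simp]: "H \<in> Ev" "K \<in> Ev"
  using m1 m2 m3 H K by (auto intro: T_Od T_Ev)

lemma g2_T: "g2 \<in> T 1 1 2"
  using T_br[OF m2 H] by (simp add: g2_def)

lemma g3_T: "g3 \<in> T 0 1 3"
proof -
  have "br m2 K \<in> T 0 1 3" "br (br m3 H) H \<in> T 0 1 3"
    using T_br[OF m2 K] T_br[OF T_br[OF m3 H] H] by simp_all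
  then show ?thesis
    by (simp add: g3_def subspace_add subspace_scale T_subspace)
qed

lemma Od_g [simp]: "g2 \<in> Od" "g3 \<in> Od"
  using g2_T g3_T by (auto intro: T_Od)

lemma HK_zero: "br H H = 0" "br H K = 0" "br m3 K = 0" "br (br m3 H) K = 0" "br (br g2 H) H = 0"
    "br m1 m1 = 0" "br m3 m3 = 0"
  using T_zero[OF T_br[OF H H]] T_zero[OF T_br[OF H K]] T_zero[OF T_br[OF m3 K]]
    T_zero[OF T_br[OF T_br[OF m3 H] K]] T_zero[OF T_br[OF T_br[OF g2_T H] H]]
    T_zero[OF T_br[OF m1 m1]] T_zero[OF T_br[OF m3 m3]]
  by simp_all

lemma g12: "br m1 g2 = 0"
  using jacobi_oo[of m1 m2 H] by (simp add: g2_def m12 MC1)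

lemma m1_K: "br m1 K = (-1/2) *\<^sub>R br g2 H"
  using MC2 by (simp add: g2_def add_eq_0_iff2)

lemma g2_K: "br g2 K = (-1/6) *\<^sub>R br (br (br m3 H) H) H"
  using MC3 by (simp add: g2_def add_eq_0_iff2)

lemma m2_m2: "br m2 m2 = (-2) *\<^sub>R br m1 m3"
  using m22 by (simp add: add_eq_0_iff2)

lemma m1_H: "F \<in> Hom \<Longrightarrow> br m1 (br F H) = br (br m1 F) H"
  using jacobi_oo[of m1 F H] jacobi_e'[of m1 F H] by (auto simp: Hom_def MC1)

text \<open>Right bracketing with \<open>H\<close> is a derivation that commutes with
  \<open>br m1\<close> by \<open>MC1\<close>; apply it to \<open>m22\<close>.\<close>

lemma m2_g2: "br m2 g2 = - br m1 (br m3 H)"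
proof -
  have "2 *\<^sub>R br m2 g2 = br (br m2 m2) H"
    using right_e'[of m2 m2 H] swap_oo[of m2 g2] by (simp add: g2_def[symmetric] scaleR_2)
  also have "\<dots> = (-2) *\<^sub>R br m1 (br m3 H)"
    by (simp add: m2_m2 br_linear m1_H)
  finally have "2 *\<^sub>R (br m2 g2 + br m1 (br m3 H)) = 0"
    by (simp add: algebra_simps)
  then show ?thesis
    by (simp add: eq_neg_iff_add_eq_0)
qed

text \<open>The derivative of \<open>m23\<close> in the direction of \<open>H\<close>.\<close>

lemma m3_g2: "br m3 g2 = - br m2 (br m3 H)"
  using right_e'[of m2 m3 H] swap_oo[of m3 g2]
  by (simp add: m23 g2_def[symmetric] eq_neg_iff_add_eq_0 add.commute)

text \<open>Both summands of \<open>g3\<close> are hit by \<open>br m1\<close>: the one with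
  \<open>K\<close> is evaluated by \<open>MC2\<close>, the one with \<open>H\<close> by
  differentiating \<open>m2_g2\<close> once more. The two copies of \<open>br m2 (br g2 H)\<close>
  cancel.\<close>

lemma g22: "br g2 g2 + 2 *\<^sub>R br m1 g3 = 0"
proof -
  have 1: "br m1 (br m2 K) = (1/2) *\<^sub>R br m2 (br g2 H)"
    using jacobi_oo[of m1 m2 K] by (simp add: m12 m1_K br_linear)
  have "br m1 (br (br m3 H) H) = br (br m1 (br m3 H)) H"
    by (simp add: m1_H)
  also have "\<dots> = - br (br m2 g2) H"
    by (simp add: m2_g2)
  also have "\<dots> = - br m2 (br g2 H) - br g2 g2"
    using right_e'[of m2 g2 H] by (simp add: g2_def[symmetric])
  finally have 2: "br m1 (br (br m3 H) H) = - br m2 (br g2 H) - br g2 g2" .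
  show ?thesis
    by (simp add: g3_def br_linear 1 2 scaleR_add_right scaleR_diff_right)
qed

text \<open>Second and third derivatives of \<open>m23\<close> along \<open>H\<close>, with binomial
  coefficients. The third has no term with a second derivative of \<open>g2\<close>, as that
  vanishes by tridegree.\<close>

lemma
  shows m2_NH: "br m2 (br (br m3 H) H) = - 2 *\<^sub>R br g2 (br m3 H) - br (br g2 H) m3"
    and m2_NHH: "br m2 (br (br (br m3 H) H) H) = - 3 *\<^sub>R br g2 (br (br m3 H) H) - 3 *\<^sub>R br (br g2 H) (br m3 H)"
proof -
  have R: "br (br F G) H = br F (br G H) + br (br F H) G" if "F \<in> Hom" "G \<in> Od" for F G
    using that by (intro right_e') auto
  have "br m2 (br m3 H) + br g2 m3 = 0"
    using R[of m2 m3] by (simp add: m23 g2_def)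
  then have "br (br m2 (br m3 H) + br g2 m3) H = 0"
    by simp
  then have *: "br m2 (br (br m3 H) H) + 2 *\<^sub>R br g2 (br m3 H) + br (br g2 H) m3 = 0"
    by (simp add: br_linear R g2_def[symmetric] scaleR_2 algebra_simps)
  then show "br m2 (br (br m3 H) H) = - 2 *\<^sub>R br g2 (br m3 H) - br (br g2 H) m3"
    by (simp add: algebra_simps eq_neg_iff_add_eq_0)
  from * have "br (br m2 (br (br m3 H) H) + 2 *\<^sub>R br g2 (br m3 H) + br (br g2 H) m3) H = 0"
    by simp
  then have "br m2 (br (br (br m3 H) H) H) + 3 *\<^sub>R br g2 (br (br m3 H) H) + 3 *\<^sub>R br (br g2 H) (br m3 H) = 0"
    by (simp add: br_linear R g2_def[symmetric] HK_zero algebra_simps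
        scaleR_add_left[of 1 2, simplified])
  then show "br m2 (br (br (br m3 H) H) H) = - 3 *\<^sub>R br g2 (br (br m3 H) H) - 3 *\<^sub>R br (br g2 H) (br m3 H)"
    by (simp add: algebra_simps eq_neg_iff_add_eq_0)
qed

text \<open>Bracket \<open>MC3\<close>, in the form \<open>g2_K\<close>, with \<open>m2\<close>. The
  left side splits by Jacobi, the right side is \<open>m2_NHH\<close>; after \<open>MC2\<close> is
  inserted, six copies of \<open>br g2 g3\<close> remain.\<close>

lemma g23: "br g2 g3 = 0"
proof -
  have 1: "br m2 (br g2 K) = br (br m2 g2) K - br g2 (br m2 K)"
    by (rule jacobi_oo) simp_all
  have 2: "br (br m2 g2) K = - br (br m1 K) (br m3 H)"
    using right_e'[of m1 "br m3 H" K] by (simp add: m2_g2 HK_zero)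
  have 3: "br (br g2 H) (br m3 H) = (-2) *\<^sub>R br (br m1 K) (br m3 H)"
    by (simp add: m1_K br_linear)
  have "(-6) *\<^sub>R br m2 (br g2 K) = br m2 (br (br (br m3 H) H) H)"
    by (simp add: g2_K br_linear)
  then have "6 *\<^sub>R br g2 g3 = 0"
    by (simp add: m2_NHH 1 2 3 g3_def br_linear algebra_simps)
  then show ?thesis
    by simp
qed

text \<open>Under the assumption \<open>br g2 m3\<close> vanishes by \<open>m3_g2\<close>. The
  derivatives of \<open>g2\<close> are then multiples of \<open>br m1 K\<close> by
  \<open>MC2\<close>, and the \<open>K\<close> summand of \<open>g3\<close> is computed from the
  square of \<open>m2\<close>, so that only \<open>br m3 (br m1 K)\<close> is left.\<close>

lemma m2_g3:
  assumes "br m2 (br m3 H) = 0"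
  shows "br m2 g3 = (-2) *\<^sub>R br m3 (br m1 K)"
proof -
  have H2: "br g2 H = (-2) *\<^sub>R br m1 K"
    by (simp add: m1_K)
  have "br g2 m3 = 0"
    using assms m3_g2 swap_oo[of g2 m3] by simp
  then have 1: "br g2 (br m3 H) = 2 *\<^sub>R br m3 (br m1 K)"
    using right_e'[of g2 m3 H] swap_oo[of m3 "br m1 K"] by (simp add: H2 br_linear)
  have "2 *\<^sub>R br m2 (br m2 K) = br (br m2 m2) K"
    using jacobi_oo[of m2 m2 K] by (simp add: scaleR_2 eq_diff_eq)
  also have "\<dots> = (-2) *\<^sub>R br m3 (br m1 K)"
    using right_e'[of m1 m3 K] swap_oo[of "br m1 K" m3] by (simp add: m2_m2 br_linear HK_zero)
  finally have "2 *\<^sub>R (br m2 (br m2 K) + br m3 (br m1 K)) = 0"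
    by (simp add: algebra_simps)
  then have "br m2 (br m2 K) = - br m3 (br m1 K)"
    by (simp add: eq_neg_iff_add_eq_0)
  then show ?thesis
    by (simp add: g3_def br_linear m2_NH H2 1 swap_oo[of "br m1 K" m3] algebra_simps)
qed

theorem bialgebroid_conditions:
  "br m2 g2 = 0 \<and> br m3 g2 = 0 \<and> br m2 g3 = 0 \<longleftrightarrow>
    br m1 (br m3 H) = 0 \<and> br m2 (br m3 H) = 0 \<and> br m3 (br m1 K) = 0"
  using m2_g3 by (auto simp: m2_g2 m3_g2)

end

section \<open>The twisted derived brackets\<close>

context maurer_cartan_datum
begin

text \<open>Naming convention for this part: \<open>a\<close>, \<open>b\<close>, \<open>d\<close> of
  tridegree (1, 1, 0) play the role of sections of the dual of the degree -2 bundle,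
  \<open>p\<close> of the dual of the degree -1 bundle, \<open>x\<close> and \<open>y\<close> of the
  degree -1 and degree -2 bundles, and \<open>f\<close> of functions.\<close>

lemma T_EvOd:
  "a \<in> T 1 1 0 \<Longrightarrow> a \<in> Od" "p \<in> T 0 1 0 \<Longrightarrow> p \<in> Ev"
  "x \<in> T 1 0 1 \<Longrightarrow> x \<in> Od" "y \<in> T 0 0 1 \<Longrightarrow> y \<in> Ev" "f \<in> T 0 0 0 \<Longrightarrow> f \<in> Od"
  by (auto intro: T_Ev T_Od)

lemma T_closed:
  "a \<in> T 1 1 0 \<Longrightarrow> br H a \<in> T 1 0 1"
  "p \<in> T 0 1 0 \<Longrightarrow> br H p \<in> T 0 0 1"
  "a \<in> T 1 1 0 \<Longrightarrow> b \<in> T 1 1 0 \<Longrightarrow> br (br K a) b \<in> T 0 0 1"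
  "a \<in> T 1 1 0 \<Longrightarrow> b \<in> T 1 1 0 \<Longrightarrow> d \<in> T 1 1 0 \<Longrightarrow> br (br (br K a) b) d \<in> T 0 0 0"
  "p \<in> T 0 1 0 \<Longrightarrow> br m1 p \<in> T 1 1 0"
  "a \<in> T 1 1 0 \<Longrightarrow> b \<in> T 1 1 0 \<Longrightarrow> br (br g2 a) b \<in> T 1 1 0"
  "a \<in> T 1 1 0 \<Longrightarrow> p \<in> T 0 1 0 \<Longrightarrow> br (br g2 a) p \<in> T 0 1 0"
  "a \<in> T 1 1 0 \<Longrightarrow> f \<in> T 0 0 0 \<Longrightarrow> br (br g2 a) f \<in> T 0 0 0"
  "a \<in> T 1 1 0 \<Longrightarrow> b \<in> T 1 1 0 \<Longrightarrow> d \<in> T 1 1 0 \<Longrightarrow> br (br (br g3 a) b) d \<in> T 0 1 0"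
  using T_br[OF H, of a 1 1 0] T_br[OF H, of p 0 1 0] T_br[OF T_br[OF K], of a 1 1 0 b 1 1 0]
    T_br[OF T_br[OF T_br[OF K]], of a 1 1 0 b 1 1 0 d 1 1 0] T_br[OF m1, of p 0 1 0]
    T_br[OF T_br[OF g2_T], of a 1 1 0 b 1 1 0] T_br[OF T_br[OF g2_T], of a 1 1 0 p 0 1 0]
    T_br[OF T_br[OF g2_T], of a 1 1 0 f 0 0 0]
    T_br[OF T_br[OF T_br[OF g3_T]], of a 1 1 0 b 1 1 0 d 1 1 0]
  by simp_all

text \<open>Counting tridegrees: \<open>br a b\<close> would have (1, 1, -1), \<open>br x y\<close>
  would have (0, -1, 1), \<open>br y p\<close> would have (-1, 0, 0), and so on.\<close>

lemma
  shows van_aa: "a \<in> T 1 1 0 \<Longrightarrow> b \<in> T 1 1 0 \<Longrightarrow> br a b = 0"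
    and van_ap: "a \<in> T 1 1 0 \<Longrightarrow> p \<in> T 0 1 0 \<Longrightarrow> br a p = 0"
    and van_pa: "a \<in> T 1 1 0 \<Longrightarrow> p \<in> T 0 1 0 \<Longrightarrow> br p a = 0"
    and van_xx: "x \<in> T 1 0 1 \<Longrightarrow> x' \<in> T 1 0 1 \<Longrightarrow> br x x' = 0"
    and van_xy: "x \<in> T 1 0 1 \<Longrightarrow> y \<in> T 0 0 1 \<Longrightarrow> br x y = 0"
    and van_xa: "x \<in> T 1 0 1 \<Longrightarrow> a \<in> T 1 1 0 \<Longrightarrow> br x a = 0"
    and van_ax: "x \<in> T 1 0 1 \<Longrightarrow> a \<in> T 1 1 0 \<Longrightarrow> br a x = 0"
    and van_yp: "y \<in> T 0 0 1 \<Longrightarrow> p \<in> T 0 1 0 \<Longrightarrow> br y p = 0"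
    and van_xf: "x \<in> T 1 0 1 \<Longrightarrow> f \<in> T 0 0 0 \<Longrightarrow> br x f = 0"
    and van_Hf: "f \<in> T 0 0 0 \<Longrightarrow> br H f = 0"
    and van_Hx: "x \<in> T 1 0 1 \<Longrightarrow> br H x = 0"
    and van_Hy: "y \<in> T 0 0 1 \<Longrightarrow> br H y = 0"
    and van_m1a: "a \<in> T 1 1 0 \<Longrightarrow> br m1 a = 0"
    and van_m2aa: "a \<in> T 1 1 0 \<Longrightarrow> b \<in> T 1 1 0 \<Longrightarrow> br (br m2 a) b = 0"
    and van_m2ap: "a \<in> T 1 1 0 \<Longrightarrow> p \<in> T 0 1 0 \<Longrightarrow> br (br m2 a) p = 0"
    and van_m2af: "a \<in> T 1 1 0 \<Longrightarrow> f \<in> T 0 0 0 \<Longrightarrow> br (br m2 a) f = 0"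
    and van_m3aa: "a \<in> T 1 1 0 \<Longrightarrow> b \<in> T 1 1 0 \<Longrightarrow> br (br m3 a) b = 0"
    and van_Kap: "a \<in> T 1 1 0 \<Longrightarrow> p \<in> T 0 1 0 \<Longrightarrow> br (br K a) p = 0"
    and van_g2pp: "p \<in> T 0 1 0 \<Longrightarrow> p' \<in> T 0 1 0 \<Longrightarrow> br (br g2 p) p' = 0"
    and van_g3aap: "a \<in> T 1 1 0 \<Longrightarrow> b \<in> T 1 1 0 \<Longrightarrow> p \<in> T 0 1 0 \<Longrightarrow> br (br (br g3 a) b) p = 0"
  by (rule T_zero, (assumption | rule m1 m2 m3 H K g2_T g3_T T_br)+, simp)+

lemma br_H_swap:
  "F \<in> Hom \<Longrightarrow> u \<in> Hom \<Longrightarrow> br (br F H) u = br F (br H u) + br (br F u) H"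
  by (rule right_e) (auto simp: Hom_def)

lemma br_odd_swap:
  "F \<in> Hom \<Longrightarrow> u \<in> Od \<Longrightarrow> v \<in> Od \<Longrightarrow> br u v = 0 \<Longrightarrow> br (br F u) v = - br (br F v) u"
  using right_oo[of F u v] by auto

text \<open>Moving \<open>H\<close> outwards past \<open>a\<close> and \<open>b\<close> replaces one
  argument at a time by its bracket with \<open>H\<close>, the analogue of the sharp map; the term
  with both arguments directly on \<open>m2\<close> vanishes.\<close>

lemma g2_aa:
  assumes a: "a \<in> T 1 1 0" and b: "b \<in> T 1 1 0"
  shows "br (br g2 a) b = br (br m2 (br H a)) b - br (br m2 (br H b)) a"
proof -
  note [simp] = T_EvOd(1)[OF a] T_EvOd(1)[OF b]
  have "br (br g2 a) b = br (br m2 (br H a)) b + br (br (br m2 a) H) b"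
    by (simp add: g2_def br_H_swap[of m2 a] br_linear)
  also have "br (br (br m2 a) H) b = br (br m2 a) (br H b)"
    by (simp add: br_H_swap[of "br m2 a" b] van_m2aa[OF a b])
  also have "\<dots> = - br (br m2 (br H b)) a"
    using van_ax[OF T_closed(1)[OF b] a] by (intro br_odd_swap) simp_all
  finally show ?thesis
    by simp
qed

lemma g2_ap:
  assumes a: "a \<in> T 1 1 0" and p: "p \<in> T 0 1 0"
  shows "br (br g2 a) p = br (br m2 (br H a)) p + br (br m2 a) (br H p)"
proof -
  note [simp] = T_EvOd(1)[OF a] T_EvOd(2)[OF p]
  have "br (br g2 a) p = br (br m2 (br H a)) p + br (br (br m2 a) H) p"
    by (simp add: g2_def br_H_swap[of m2 a] br_linear)
  also have "br (br (br m2 a) H) p = br (br m2 a) (br H p)"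
    by (simp add: br_H_swap[of "br m2 a" p] van_m2ap[OF a p])
  finally show ?thesis .
qed

text \<open>In the following five identities the left hand sides pair the derived brackets of
  \<open>m1 + g2 + g3\<close> with a section of \<open>A\<close>, the right hand sides are the Lie derivative formulas.\<close>

lemma dual_bra1:
  assumes p: "p \<in> T 0 1 0" and y: "y \<in> T 0 0 1"
  shows "- br y (br m1 p) = br (br m1 y) p"
proof -
  note [simp] = T_EvOd(2)[OF p] T_EvOd(4)[OF y]
  show ?thesis
    using jacobi_e[of y m1 p] swap_e[of y m1] van_yp[OF y p] by simp
qed

lemma dual_anchor:
  assumes a: "a \<in> T 1 1 0" and f: "f \<in> T 0 0 0"
  shows "br (br g2 a) f = br (br m2 (br H a)) f"
proof -
  note [simp] = T_EvOd(1)[OF a] T_EvOd(5)[OF f]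
  have "br (br g2 a) f = br (br m2 (br H a)) f + br (br (br m2 a) H) f"
    by (simp add: g2_def br_H_swap[of m2 a] br_linear)
  also have "br (br (br m2 a) H) f = 0"
    by (simp add: br_H_swap[of "br m2 a" f] van_m2af[OF a f] van_Hf[OF f])
  finally show ?thesis
    by simp
qed

text \<open>The defining formula of the Lie derivative along \<open>x\<close>: up to sign,
  \<open>br (br m2 x)\<close> is the anchor on the function \<open>br y b\<close> and the bracket on
  \<open>y\<close>, and bracketing with \<open>b\<close> is the pairing.\<close>

lemma lieD_bracket:
  assumes "x \<in> Od" "y \<in> Ev" "b \<in> Od"
  shows "br y (br (br m2 x) b) = br (br m2 x) (br y b) - br (br (br m2 x) y) b"
  using assms jacobi_e[of "br m2 x" y b] by simp

lemma dual_bra2: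
  assumes a: "a \<in> T 1 1 0" and b: "b \<in> T 1 1 0" and y: "y \<in> T 0 0 1"
  shows "- br y (br (br g2 a) b) =
    - br (br m2 (br H a)) (br y b) + br (br (br m2 (br H a)) y) b
    + br (br m2 (br H b)) (br y a) - br (br (br m2 (br H b)) y) a"
proof -
  note [simp] = T_EvOd(1)[OF a] T_EvOd(1)[OF b] T_EvOd(4)[OF y]
  show ?thesis
    using lieD_bracket[of "br H a" y b] lieD_bracket[of "br H b" y a]
    by (simp add: g2_aa[OF a b] br_linear)
qed

lemma X_m2_a:
  assumes x: "x \<in> T 1 0 1" and a: "a \<in> T 1 1 0"
  shows "br x (br m2 a) = br (br m2 x) a"
proof -
  note [simp] = T_EvOd(1)[OF a] T_EvOd(3)[OF x]
  show ?thesis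
    using jacobi_oo[of x m2 a] swap_oo[of x m2] van_xa[OF x a] by simp
qed

lemma dual_bra2m:
  assumes a: "a \<in> T 1 1 0" and p: "p \<in> T 0 1 0" and x: "x \<in> T 1 0 1"
  shows "br x (br (br g2 a) p) =
    br (br m2 (br H a)) (br x p) - br (br (br m2 (br H a)) x) p
    + br (br (br m2 x) (br H p)) a - br (br m2 x) (br (br H a) p)"
proof -
  note [simp] = T_EvOd(1)[OF a] T_EvOd(2)[OF p] T_EvOd(3)[OF x]
  have 1: "br x (br (br m2 (br H a)) p) = br (br m2 (br H a)) (br x p) - br (br (br m2 (br H a)) x) p"
    using jacobi_e[of "br m2 (br H a)" x p] by simp
  have 2: "br x (br (br m2 a) (br H p)) = br (br (br m2 x) a) (br H p)"
    using jacobi_e'[of x "br m2 a" "br H p"] by (simp add: X_m2_a[OF x a] van_xy[OF x T_closed(2)[OF p]])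
  have 3: "br (br (br m2 x) (br H p)) a = br (br m2 x) (br (br H p) a) + br (br (br m2 x) a) (br H p)"
    by (intro right_e) simp_all
  have 4: "br (br H a) p = br (br H p) a"
    using right_e'[of H a p] van_ap[OF a p] by simp
  show ?thesis
    by (simp add: g2_ap[OF a p] br_linear 1 2 3 4)
qed

lemma aa_swap:
  assumes a: "a \<in> T 1 1 0" and b: "b \<in> T 1 1 0" and F: "F \<in> Hom"
  shows "br (br F a) b = - br (br F b) a"
  using F T_EvOd(1)[OF a] T_EvOd(1)[OF b] van_aa[OF a b] by (rule br_odd_swap)

text \<open>Each argument falls either on \<open>m2\<close> or on \<open>K\<close>. Words with two
  arguments on \<open>m2\<close> vanish, which leaves one word with none there and three with one;
  the cyclic order absorbs a sign.\<close>

lemma m2K_word: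
  assumes a: "a \<in> T 1 1 0" and b: "b \<in> T 1 1 0" and d: "d \<in> T 1 1 0"
  shows "br (br (br (br m2 K) a) b) d = br m2 (br (br (br K a) b) d) + br (br m2 d) (br (br K a) b)
    + br (br m2 b) (br (br K d) a) + br (br m2 a) (br (br K b) d)"
proof -
  note [simp] = T_EvOd(1)[OF a] T_EvOd(1)[OF b] T_EvOd(1)[OF d]
  have 1: "br (br m2 K) a = br m2 (br K a) + br (br m2 a) K"
    by (intro right_e) simp_all
  have 2: "br (br m2 (br K a)) b = br m2 (br (br K a) b) - br (br m2 b) (br K a)"
    "br (br (br m2 a) K) b = br (br m2 a) (br K b)"
    using right_oo[of m2 "br K a" b] right_e[of "br m2 a" K b] van_m2aa[OF a b] by simp_all
  have 3: "br (br m2 (br (br K a) b)) d = br m2 (br (br (br K a) b) d) + br (br m2 d) (br (br K a) b)"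
    "br (br (br m2 b) (br K a)) d = br (br m2 b) (br (br K a) d)"
    "br (br (br m2 a) (br K b)) d = br (br m2 a) (br (br K b) d)"
    using right_e[of m2 "br (br K a) b" d] right_oo[of "br m2 b" "br K a" d]
      right_oo[of "br m2 a" "br K b" d] van_m2aa[OF b d] van_m2aa[OF a d] by simp_all
  show ?thesis
    by (simp add: br_linear 1 2 3 aa_swap[OF a d, of K])
qed

text \<open>A Leibniz formula in which \<open>a\<close> may be absorbed by any one of the copies of
  \<open>H\<close>; no further terms occur because \<open>br H (br H a) = 0\<close>. Hence the
  factors 2 and 3.\<close>

lemma H_word:
  assumes F: "F \<in> Hom" and a: "a \<in> T 1 1 0"
  shows "br (br (br F H) H) a = br (br (br F a) H) H + 2 *\<^sub>R br (br F (br H a)) H"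
    and "br (br (br (br F H) H) H) a = br (br (br (br F a) H) H) H + 3 *\<^sub>R br (br (br F (br H a)) H) H"
proof -
  note [simp] = F T_EvOd(1)[OF a] van_Hx[OF T_closed(1)[OF a]]
  have h: "br (br G H) (br H a) = br (br G (br H a)) H" if "G \<in> Hom" for G
    using that br_H_swap[of G "br H a"] by simp
  show *: "br (br (br F H) H) a = br (br (br F a) H) H + 2 *\<^sub>R br (br F (br H a)) H"
    by (simp add: br_H_swap[of _ a] br_linear h scaleR_2)
  show "br (br (br (br F H) H) H) a = br (br (br (br F a) H) H) H + 3 *\<^sub>R br (br (br F (br H a)) H) H"
    by (simp add: br_H_swap[of "br (br F H) H"] * br_linear h scaleR_add_left[of 1 2, simplified])
qed

text \<open>In the expansion of the words below, all terms vanish in which two of \<open>a, b, d\<close> act directly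
  on \<open>m3\<close>.\<close>

lemma m3_words:
  assumes a: "a \<in> T 1 1 0" and b: "b \<in> T 1 1 0" and d: "d \<in> T 1 1 0"
  defines "W \<equiv> br (br (br m3 (br H a)) (br H b)) d + br (br (br m3 (br H b)) (br H d)) a
      + br (br (br m3 (br H d)) (br H a)) b"
  shows "br (br (br (br (br m3 H) H) a) b) d = 2 *\<^sub>R W"
    and "br (br (br (br (br (br m3 H) H) H) a) b) d =
      6 *\<^sub>R (br W H + br (br (br m3 (br H a)) (br H b)) (br H d))"
proof -
  note [simp] = T_EvOd(1)[OF a] T_EvOd(1)[OF b] T_EvOd(1)[OF d]
  note hat = T_closed(1)[OF a] T_closed(1)[OF b] T_closed(1)[OF d]
  note hh [simp] = hat[THEN van_Hx]
  have s1: "br (br F u) (br H v) = - br (br F (br H v)) u"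
    if "F \<in> Hom" "u \<in> T 1 1 0" "v \<in> T 1 1 0" for F u v
    using that T_EvOd(1) van_ax[OF T_closed(1)] by (intro br_odd_swap) auto
  have s2: "br (br F (br H u)) (br H v) = - br (br F (br H v)) (br H u)"
    if "F \<in> Hom" "u \<in> T 1 1 0" "v \<in> T 1 1 0" for F u v
    using that T_EvOd(1) van_xx[OF T_closed(1) T_closed(1)] by (intro br_odd_swap) auto
  have z: "br (br (br m3 u) (br H v)) w = 0" "br (br (br m3 (br H v)) u) w = 0"
    if u: "u \<in> T 1 1 0" and v: "v \<in> T 1 1 0" and w: "w \<in> T 1 1 0" for u v w
  proof -
    note [simp] = T_EvOd(1)[OF u] T_EvOd(1)[OF v] T_EvOd(1)[OF w]
    have "br (br (br m3 u) (br H v)) w = - br (br (br m3 u) w) (br H v)"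
      using s1[of "br m3 u" w v] v w by simp
    then show 1: "br (br (br m3 u) (br H v)) w = 0"
      by (simp add: van_m3aa[OF u w])
    show "br (br (br m3 (br H v)) u) w = 0"
      using 1 s1[of m3 u v] u v by simp
  qed
  \<comment> \<open>\<open>c1\<close> and \<open>c2\<close> bring the surviving words into the
    cyclic order used in \<open>W\<close>; both transpositions involve odd elements with vanishing
    mutual bracket.\<close>
  have c1: "br (br (br m3 a) (br H b)) (br H d) = br (br (br m3 (br H b)) (br H d)) a"
    using s1[of m3 a b] s1[of "br m3 (br H b)" a d] a b d by simp
  have c2: "br (br (br m3 (br H a)) b) (br H d) = br (br (br m3 (br H d)) (br H a)) b"
    using s1[of "br m3 (br H a)" b d] s2[of m3 a d] a b d by simp
  have h: "br (br G H) (br H v) = br (br G (br H v)) H" if "G \<in> Hom" "v \<in> T 1 1 0" for G v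
    using that br_H_swap[of G "br H v"] T_EvOd(1)[of v] van_Hx[OF T_closed(1)] by simp
  have 1: "br (br (br (br m3 H) H) a) b
      = 2 *\<^sub>R (br (br (br m3 a) (br H b)) H + br (br (br m3 (br H a)) b) H + br (br m3 (br H a)) (br H b))"
    by (simp add: H_word(1)[of m3 a] H_word(1)[of "br m3 a" b] br_H_swap[of _ b] a b br_linear
        van_m3aa[OF a b] h scaleR_2 algebra_simps)
  then show "br (br (br (br (br m3 H) H) a) b) d = 2 *\<^sub>R W"
    by (simp add: br_linear br_H_swap[of _ d] z a b d c1 c2 h W_def algebra_simps)
  have 2: "br (br (br (br (br m3 H) H) H) a) b
      = 3 *\<^sub>R (br (br (br (br m3 a) (br H b)) H) H + br (br (br (br m3 (br H a)) b) H) H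
        + 2 *\<^sub>R br (br (br m3 (br H a)) (br H b)) H)"
    by (simp add: H_word(2)[of m3 a] H_word(2)[of "br m3 a" b] H_word(1)[of "br m3 (br H a)" b] a b br_linear
        van_m3aa[OF a b] algebra_simps)
  then show "br (br (br (br (br (br m3 H) H) H) a) b) d =
      6 *\<^sub>R (br W H + br (br (br m3 (br H a)) (br H b)) (br H d))"
    by (simp add: br_linear H_word(1)[of _ d] br_H_swap[of _ d] z a b d c1 c2 h W_def algebra_simps
        scaleR_add_left[of 3 3, simplified])
qed

lemma g3_word:
  assumes a: "a \<in> T 1 1 0" and b: "b \<in> T 1 1 0" and d: "d \<in> T 1 1 0"
  shows "br (br (br g3 a) b) d = br (br (br (br m2 K) a) b) d + (1/2) *\<^sub>R br (br (br (br (br m3 H) H) a) b) d"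
proof -
  note [simp] = T_EvOd(1)[OF a] T_EvOd(1)[OF b] T_EvOd(1)[OF d]
  show ?thesis
    by (simp add: g3_def br_linear)
qed

lemma dual_bra3:
  assumes a: "a \<in> T 1 1 0" and b: "b \<in> T 1 1 0" and d: "d \<in> T 1 1 0" and x: "x \<in> T 1 0 1"
  shows "br x (br (br (br g3 a) b) d) =
    br (br (br m2 x) (br (br K a) b)) d + br (br (br m2 x) (br (br K d) a)) b
    + br (br (br m2 x) (br (br K b) d)) a - 2 *\<^sub>R br (br m2 x) (br (br (br K a) b) d)
    + br (br (br (br m3 (br H a)) (br H b)) x) d + br (br (br (br m3 (br H b)) (br H d)) x) a
    + br (br (br (br m3 (br H d)) (br H a)) x) b"
proof -
  note [simp] = T_EvOd(1)[OF a] T_EvOd(1)[OF b] T_EvOd(1)[OF d] T_EvOd(3)[OF x]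
  have f: "br x (br m2 h) = br (br m2 x) h" if h: "h \<in> T 0 0 0" for h
  proof -
    note [simp] = T_EvOd(5)[OF h]
    show ?thesis
      using jacobi_oo[of x m2 h] swap_oo[of x m2] van_xf[OF x h] by simp
  qed
  have k: "br x (br (br m2 w) (br (br K u) v)) =
      br (br (br m2 x) (br (br K u) v)) w - br (br m2 x) (br (br (br K u) v) w)"
    if u: "u \<in> T 1 1 0" and v: "v \<in> T 1 1 0" and w: "w \<in> T 1 1 0" for u v w
  proof -
    note [simp] = T_EvOd(1)[OF u] T_EvOd(1)[OF v] T_EvOd(1)[OF w]
    have "br x (br (br m2 w) (br (br K u) v)) = br (br (br m2 x) w) (br (br K u) v)"
      using jacobi_e'[of x "br m2 w" "br (br K u) v"] X_m2_a[OF x w] van_xy[OF x T_closed(3)[OF u v]] by simp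
    then show ?thesis
      using right_e[of "br m2 x" "br (br K u) v" w] by simp
  qed
  \<comment> \<open>By total skewness the full contraction of \<open>K\<close> is cyclic, so its
    image under \<open>br (br m2 x)\<close> is counted once by \<open>f\<close> and minus once by
    each of three instances of \<open>k\<close>. This \<open>1 - 3\<close> is the coefficient -2 of
    the differential of \<open>K\<close> in the definition of the ternary bracket.\<close>
  have cyc: "br (br (br K d) a) b = br (br (br K a) b) d" "br (br (br K b) d) a = br (br (br K a) b) d"
    using aa_swap[OF d a, of K] aa_swap[OF d b, of "br K a"] aa_swap[OF b d, of K] aa_swap[OF b a, of "br K d"]
      aa_swap[OF d a, of K] aa_swap[OF d b, of "br K a"]
    by simp_all
  have m: "br x (br M w) = br (br M x) w" if M: "M \<in> Od" and w: "w \<in> T 1 1 0" for M w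
  proof -
    note [simp] = M T_EvOd(1)[OF w]
    show ?thesis
      using right_oo[of M x w] jacobi_oo[of x M w] swap_oo[of x M] van_xa[OF x w] by simp
  qed
  show ?thesis
    by (simp add: g3_word[OF a b d] m2K_word[OF a b d] m3_words(1)[OF a b d] br_linear f T_closed(4)[OF a b d]
        k a b d cyc m algebra_simps scaleR_2[of "br (br m2 x) (br (br (br K a) b) d)"])
qed

section \<open>The Maurer-Cartan equation as morphism identities\<close>

lemma morphism_differential:
  assumes p: "p \<in> T 0 1 0"
  shows "br H (br m1 p) = br m1 (br H p)"
  using jacobi_e[of H m1 p] swap_e[of H m1] T_EvOd(2)[OF p] by (simp add: MC1)

lemma m2HH_word:
  assumes a: "a \<in> T 1 1 0"
  shows "br (br (br m2 H) H) a = br (br (br m2 a) H) H + 2 *\<^sub>R br (br m2 (br H a)) H"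
  using a by (intro H_word) simp_all

lemma MC2_left:
  assumes a: "a \<in> T 1 1 0" and u: "u \<in> Hom"
  shows "br (br (br m1 K) a) u = - (1/2) *\<^sub>R br (br (br (br m2 H) H) a) u"
  using u T_EvOd(1)[OF a] by (simp add: m1_K g2_def br_linear)

text \<open>This is \<open>MC2\<close> contracted with \<open>a\<close> and \<open>b\<close>. On the
  left \<open>br m1\<close> passes both arguments; on the right \<open>H_word\<close> produces a
  factor 2 that cancels the 1/2, and the terms with \<open>H\<close> outside combine to the bracket
  of \<open>g2\<close>.\<close>

lemma morphism_bracket:
  assumes a: "a \<in> T 1 1 0" and b: "b \<in> T 1 1 0"
  shows "- br H (br (br g2 a) b) + br (br m2 (br H a)) (br H b) = - br m1 (br (br K a) b)"
proof -
  note [simp] = T_EvOd(1)[OF a] T_EvOd(1)[OF b]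
  note hat = T_closed(1)[OF a] T_closed(1)[OF b]
  note [simp] = hat[THEN van_Hx]
  have 1: "br (br (br m1 K) a) b = br m1 (br (br K a) b)"
    using right_e[of m1 K a] right_oo[of m1 "br K a" b] van_m1a[OF a] van_m1a[OF b] by simp
  have h: "br (br G H) (br H b) = br (br G (br H b)) H" if "G \<in> Hom" for G
    using that br_H_swap[of G "br H b"] by simp
  have 2: "br (br (br (br m2 H) H) a) b = 2 *\<^sub>R (br (br (br m2 a) (br H b)) H
      + br (br (br m2 (br H a)) b) H + br (br m2 (br H a)) (br H b))"
    using H_word(1)[of "br m2 a" b] by (simp add: m2HH_word a b br_H_swap[of _ b] br_linear h van_m2aa[OF a b] algebra_simps scaleR_2)
  have 3: "br (br m2 a) (br H b) = - br (br m2 (br H b)) a"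
    using van_ax[OF hat(2) a] by (intro br_odd_swap) simp_all
  have 4: "br H (br (br g2 a) b) = - br (br (br g2 a) b) H"
    by (intro swap_e) (simp_all add: Hom_def[symmetric])
  show ?thesis
    unfolding 4 using MC2_left[OF a, of b]
    by (simp add: 1 2 3 g2_aa[OF a b] br_linear algebra_simps)
qed

text \<open>\<open>MC2\<close> contracted with \<open>a\<close> and \<open>p\<close>. Unlike
  \<open>a\<close>, the element \<open>p\<close> is not annihilated by \<open>br m1\<close>, so
  \<open>br m1\<close> comes to rest on it.\<close>

lemma morphism_action:
  assumes a: "a \<in> T 1 1 0" and p: "p \<in> T 0 1 0"
  shows "br H (br (br g2 a) p) - br (br m2 (br H a)) (br H p) = br (br K a) (br m1 p)"
proof -
  note [simp] = T_EvOd(1)[OF a] T_EvOd(2)[OF p]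
  note [simp] = van_Hx[OF T_closed(1)[OF a]] van_Hy[OF T_closed(2)[OF p]]
  have 1: "br (br (br m1 K) a) p = br (br K a) (br m1 p)"
    using right_e[of m1 K a] right_e'[of m1 "br K a" p] van_m1a[OF a] van_Kap[OF a p]
      swap_oo[of "br m1 p" "br K a"] by simp
  have h: "br (br G H) (br H p) = br (br G (br H p)) H" if "G \<in> Hom" for G
    using that br_H_swap[of G "br H p"] by simp
  have 2: "br (br (br (br m2 H) H) a) p = 2 *\<^sub>R (br (br (br m2 a) (br H p)) H
      + br (br (br m2 (br H a)) p) H + br (br m2 (br H a)) (br H p))"
    by (simp add: m2HH_word a br_H_swap[of _ p] br_linear h van_m2ap[OF a p] algebra_simps scaleR_2)
  have 4: "br H (br (br g2 a) p) = - br (br (br g2 a) p) H"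
    by (intro swap_e) (simp_all add: Hom_def[symmetric])
  have "br (br K a) (br m1 p) = - (br (br (br m2 a) (br H p)) H
      + br (br (br m2 (br H a)) p) H + br (br m2 (br H a)) (br H p))"
    using MC2_left[OF a, of p] by (simp add: 1 2 algebra_simps)
  then show ?thesis
    unfolding 4 by (simp add: g2_ap[OF a p] br_linear)
qed

text \<open>This is \<open>MC3\<close> contracted with three arguments. \<open>m3_words\<close>
  evaluates its cubic term; the terms in which \<open>H\<close> stands outside add up to the word of
  \<open>g3\<close> bracketed with \<open>H\<close>, and the others are the remaining terms of the
  morphism condition.\<close>

lemma morphism_bra3:
  assumes a: "a \<in> T 1 1 0" and b: "b \<in> T 1 1 0" and d: "d \<in> T 1 1 0"
  shows "br H (br (br (br g3 a) b) d)
    - br (br m2 (br H a)) (br (br K b) d) + br (br m2 (br H b)) (br (br K a) d)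
    - br (br m2 (br H d)) (br (br K a) b)
    + br (br K (br (br g2 a) b)) d - br (br K a) (br (br g2 b) d) + br (br K b) (br (br g2 a) d)
    - br (br (br m3 (br H a)) (br H b)) (br H d) = 0"
proof -
  note [simp] = T_EvOd(1)[OF a] T_EvOd(1)[OF b] T_EvOd(1)[OF d]
  define W where "W = br (br (br m3 (br H a)) (br H b)) d + br (br (br m3 (br H b)) (br H d)) a
      + br (br (br m3 (br H d)) (br H a)) b"
  have [simp]: "W \<in> Ev"
    by (simp add: W_def)
  have g2: "br g2 u = br m2 (br H u) + br (br m2 u) H" if "u \<in> Od" for u
    using that by (simp add: g2_def br_H_swap[of m2 u])
  \<comment> \<open>The arguments spread over \<open>g2\<close> and \<open>K\<close>; the term with
    all three on \<open>g2\<close> vanishes by tridegree.\<close>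
  have E: "br (br (br (br g2 K) a) b) d = br g2 (br (br (br K a) b) d)
      + br (br g2 d) (br (br K a) b) - br (br g2 b) (br (br K a) d) + br (br (br g2 b) d) (br K a)
      + br (br g2 a) (br (br K b) d) - br (br (br g2 a) d) (br K b) + br (br (br g2 a) b) (br K d)"
  proof -
    have 1: "br (br g2 K) a = br g2 (br K a) + br (br g2 a) K"
      by (intro right_e) simp_all
    have 2: "br (br g2 (br K a)) b = br g2 (br (br K a) b) - br (br g2 b) (br K a)"
      "br (br (br g2 a) K) b = br (br g2 a) (br K b) + br (br (br g2 a) b) K"
      by (intro right_oo right_e; simp)+
    have 3: "br (br g2 (br (br K a) b)) d = br g2 (br (br (br K a) b) d) + br (br g2 d) (br (br K a) b)"
      "br (br (br g2 b) (br K a)) d = br (br g2 b) (br (br K a) d) - br (br (br g2 b) d) (br K a)"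
      "br (br (br g2 a) (br K b)) d = br (br g2 a) (br (br K b) d) - br (br (br g2 a) d) (br K b)"
      "br (br (br (br g2 a) b) K) d = br (br (br g2 a) b) (br K d) + br (br (br (br g2 a) b) d) K"
      by (intro right_oo right_e; simp)+
    have "br (br (br g2 a) b) d = 0"
      by (rule T_zero[OF T_br[OF T_closed(6)[OF a b] d]]) simp
    then show ?thesis
      by (simp add: br_linear 1 2 3)
  qed
  have MC: "br (br (br (br g2 K) a) b) d = - (br W H + br (br (br m3 (br H a)) (br H b)) (br H d))"
    using m3_words(2)[OF a b d] by (simp add: g2_K br_linear W_def)
  have f: "br g2 (br (br (br K a) b) d) = br (br m2 (br (br (br K a) b) d)) H"
    using br_H_swap[of m2 "br (br (br K a) b) d"] van_Hf[OF T_closed(4)[OF a b d]] by (simp add: g2_def)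
  have k: "br (br g2 w) (br (br K u) v) =
      br (br m2 (br H w)) (br (br K u) v) + br (br (br m2 w) (br (br K u) v)) H"
    if u: "u \<in> T 1 1 0" and v: "v \<in> T 1 1 0" and w: "w \<in> T 1 1 0" for u v w
    using T_EvOd(1)[OF u] T_EvOd(1)[OF v] T_EvOd(1)[OF w] van_Hy[OF T_closed(3)[OF u v]]
      br_H_swap[of "br m2 w" "br (br K u) v"]
    by (simp add: g2 br_linear)
  have s: "br (br K u) (br (br g2 v) w) = br (br (br g2 v) w) (br K u)"
    if u: "u \<in> T 1 1 0" and v: "v \<in> T 1 1 0" and w: "w \<in> T 1 1 0" for u v w
    using T_EvOd(1)[OF u] T_EvOd(1)[OF v] T_EvOd(1)[OF w] by (intro swap_oo) simp_all
  have t: "br (br K (br (br g2 a) b)) d = - br (br (br g2 a) b) (br K d)"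
    using br_odd_swap[of K "br (br g2 a) b" d] van_aa[OF T_closed(6)[OF a b] d] s[OF d a b] by simp
  have H3: "br H (br (br (br g3 a) b) d) = - br (br (br (br g3 a) b) d) H"
    by (intro swap_e) (simp_all add: Hom_def[symmetric])
  have W: "br (br (br g3 a) b) d = br (br (br (br m2 K) a) b) d + W"
    by (simp add: g3_word[OF a b d] m3_words(1)[OF a b d] W_def)
  have "br (br (br (br (br m2 K) a) b) d) H = br g2 (br (br (br K a) b) d)
      + br (br (br m2 d) (br (br K a) b)) H - br (br (br m2 b) (br (br K a) d)) H
      + br (br (br m2 a) (br (br K b) d)) H"
    by (simp add: m2K_word[OF a b d] aa_swap[OF d a, of K] br_linear f)
  note L = this
  note M = add_implies_diff[OF trans[OF add.commute MC[unfolded E]]]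
  show ?thesis
    unfolding H3 by (simp add: M L k a b d s t W br_linear)
qed

end

section \<open>The graded algebra of a Darboux chart\<close>

lemma sum_fun_apply: "sum h A x = (\<Sum>a\<in>A. h a x)"
  by (induction A rule: infinite_finite_induct) simp_all

lemma finite_submultisets [simp]: "finite {k. k \<subseteq># m}"
proof (induction m)
  case (add v m)
  have "{k. k \<subseteq># add_mset v m} \<subseteq> {k. k \<subseteq># m} \<union> add_mset v ` {k. k \<subseteq># m}"
  proof
    fix k
    assume k: "k \<in> {k. k \<subseteq># add_mset v m}"
    show "k \<in> {k. k \<subseteq># m} \<union> add_mset v ` {k. k \<subseteq># m}"
    proof (cases "v \<in># k")
      case True
      then have "k = add_mset v (k - {#v#})" "k - {#v#} \<subseteq># m"
        using k by (auto simp: subset_eq_diff_conv)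
      then show ?thesis
        by blast
    next
      case False
      then have "k \<subseteq># m"
        using k by (metis diff_single_trivial mem_Collect_eq subset_eq_diff_conv add_mset_add_single)
      then show ?thesis
        by simp
    qed
  qed
  then show ?case
    using add by (auto intro: finite_subset)
qed simp

lemma multiset_diff_simps:
  "k \<subseteq># m \<Longrightarrow> m - (m - k) = k"
  "k \<subseteq># m \<Longrightarrow> k - i \<subseteq># m - i"
  "k \<subseteq># m \<Longrightarrow> add_mset v m - k = add_mset v (m - k)"
  for k :: "'b multiset"
  by (simp_all add: multiset_eq_iff subseteq_mset_def diff_le_mono Suc_diff_le)

lemma inj_opos: "opos u = opos v \<longleftrightarrow> u = v"
  by (cases u; cases v) (auto, presburger+)

text \<open>As a double product, the sign is visibly multiplicative over disjoint unions in either
  argument.\<close>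

lemma osign_prod:
  assumes "finite A" "finite B"
  shows "osign A B = (\<Prod>a\<in>A. \<Prod>b\<in>B. if opos b < opos a then -1 else 1)"
proof -
  have "(\<Prod>a\<in>A. \<Prod>b\<in>B. if opos b < opos a then -1 else 1 :: real) =
      (\<Prod>p\<in>A \<times> B. if p \<in> {(a, b). opos b < opos a} then -1 else 1)"
    by (auto simp: prod.cartesian_product intro!: prod.cong)
  also have "\<dots> = (-1) ^ card (A \<times> B \<inter> {(a, b). opos b < opos a})"
    using assms by (simp add: prod.If_cases)
  also have "A \<times> B \<inter> {(a, b). opos b < opos a} = {(s, t). s \<in> A \<and> t \<in> B \<and> opos t < opos s}"
    by auto
  finally show ?thesis
    by (simp add: osign_def)
qed

lemma osign_Un_left:
  assumes "finite A" "finite B" "finite C" "A \<inter> B = {}"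
  shows "osign (A \<union> B) C = osign A C * osign B C"
  using assms by (simp add: osign_prod prod.union_disjoint)

lemma osign_Un_right:
  assumes "finite A" "finite B" "finite C" "A \<inter> B = {}"
  shows "osign C (A \<union> B) = osign C A * osign C B"
  using assms by (simp add: osign_prod prod.union_disjoint prod.distrib)

text \<open>A pair of distinct variables is inverted in exactly one of the two orders, so the two
  signs differ by one factor -1 per pair.\<close>

lemma osign_swap:
  assumes "finite A" "finite B" "A \<inter> B = {}"
  shows "osign A B = (-1) ^ (card A * card B) * osign B A"
proof -
  have "osign A B = (\<Prod>a\<in>A. \<Prod>b\<in>B. - 1 * (if opos a < opos b then -1 else 1))"
    unfolding osign_prod[OF assms(1,2)] using assms(3)
    by (intro prod.cong refl) (auto simp: not_less le_less inj_opos)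
  also have "\<dots> = (-1) ^ (card A * card B) * (\<Prod>a\<in>A. \<Prod>b\<in>B. if opos a < opos b then -1 else 1)"
    unfolding prod.distrib prod_constant power_mult[symmetric] by (simp add: mult.commute)
  also have "(\<Prod>a\<in>A. \<Prod>b\<in>B. if opos a < opos b then -1 else 1 :: real) = osign B A"
    unfolding osign_prod[OF assms(2,1)] by (rule prod.swap)
  finally show ?thesis .
qed

lemma osign_empty [simp]: "osign {} A = 1" "osign A {} = 1"
  by (simp_all add: osign_def)

lemma osign_square [simp]: "osign A B * osign A B = 1" "osign A B * (osign A B * z) = z"
  by (simp_all add: osign_def mult.assoc[symmetric] power_mult_distrib[symmetric])

lemma osign_singleton: "osign {v} S = (-1) ^ card {s \<in> S. opos s < opos v}"
proof -
  have "{(s, t). s \<in> {v} \<and> t \<in> S \<and> opos t < opos s} = Pair v ` {s \<in> S. opos s < opos v}"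
    by auto
  then show ?thesis
    by (simp add: osign_def card_image inj_on_def)
qed

lemma odiff_osign: "odiff v F (S, m) x = (if v \<in> S then 0 else osign {v} S * F (insert v S, m) x)"
  by (simp add: odiff_def osign_singleton)

lemma gmult_double_sum:
  "gmult F G (S, m) x = (\<Sum>T\<in>Pow S. osign T (S - T) * (\<Sum>k | k \<subseteq># m. F (T, k) x * G (S - T, m - k) x))"
  by (simp add: gmult_def sum.cartesian_product[symmetric] sum_distrib_left mult.assoc)

lemma gmult_infinite: "infinite S \<Longrightarrow> gmult F G (S, m) x = 0"
  by (simp add: gmult_double_sum)

lemma gmult_bilinear:
  "gmult (F + G) K = gmult F K + gmult G K"
  "gmult K (F + G) = gmult K F + gmult K G"
  "gmult (c *\<^sub>R F) G = c *\<^sub>R gmult F G"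
  "gmult F (c *\<^sub>R G) = c *\<^sub>R gmult F G"
  by (auto simp: fun_eq_iff gmult_double_sum algebra_simps sum.distrib sum_distrib_left)

text \<open>The cocycle identity behind associativity: both sides count the inversions between the
  three blocks \<open>A\<close>, \<open>T - A\<close> and \<open>S - T\<close>.\<close>

lemma osign_assoc:
  assumes "finite S" "T \<subseteq> S" "A \<subseteq> T"
  shows "osign T (S - T) * osign A (T - A) = osign A (S - A) * osign (T - A) (S - T)"
proof -
  have fin: "finite T" "finite A" "finite (T - A)" "finite (S - T)"
    using assms by (auto intro: finite_subset)
  have e: "S - A = (T - A) \<union> (S - T)" "T = A \<union> (T - A)"
    using assms by auto
  have "osign T (S - T) = osign A (S - T) * osign (T - A) (S - T)"
    by (subst e(2), rule osign_Un_left) (use fin in auto)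
  moreover have "osign A (S - A) = osign A (T - A) * osign A (S - T)"
    by (subst e(1), rule osign_Un_right) (use fin in auto)
  ultimately show ?thesis
    by simp
qed

lemma diff_diff_submultiset: "i \<subseteq># k \<Longrightarrow> k \<subseteq># m \<Longrightarrow> m - i - (k - i) = m - (k :: 'b multiset)"
  by (metis diff_diff_add_mset subset_mset.add_diff_inverse)

lemma gmult_assoc: "gmult (gmult F G) K = gmult F (gmult G K)"
proof (intro ext)
  fix q :: gmono and x
  obtain S m where q: "q = (S, m)"
    by (cases q)
  show "gmult (gmult F G) K q x = gmult F (gmult G K) q x"
  proof (cases "finite S")
    case False
    then show ?thesis
      by (simp add: q gmult_infinite)
  next
    case True
    let ?f = "\<lambda>A B C i j l. F (A, i) x * G (B, j) x * K (C, l) x"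
    have "gmult (gmult F G) K q x =
      (\<Sum>(T, k)\<in>Pow S \<times> {k. k \<subseteq># m}. \<Sum>(A, i)\<in>Pow T \<times> {i. i \<subseteq># k}.
        osign T (S - T) * osign A (T - A) * ?f A (T - A) (S - T) i (k - i) (m - k))"
      by (auto simp: q gmult_def sum_distrib_left sum_distrib_right mult_ac intro!: sum.cong)
    also have "\<dots> = (\<Sum>((T, k), (A, i))\<in>(SIGMA (T, k):Pow S \<times> {k. k \<subseteq># m}. Pow T \<times> {i. i \<subseteq># k}).
        osign T (S - T) * osign A (T - A) * ?f A (T - A) (S - T) i (k - i) (m - k))"
      by (rule trans[OF _ sum.Sigma]) (auto simp: split_def True finite_subset[OF _ True])
    also have "\<dots> = (\<Sum>((A, i), (B, j))\<in>(SIGMA (A, i):Pow S \<times> {k. k \<subseteq># m}. Pow (S - A) \<times> {j. j \<subseteq># m - i}).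
        osign A (S - A) * osign B (S - A - B) * ?f A B (S - A - B) i j (m - i - j))"
    \<comment> \<open>Splitting off \<open>T\<close> and then \<open>A\<close> inside it is the same
      as splitting off \<open>A\<close> and then \<open>B = T - A\<close>: both describe ordered
      partitions of the monomial into three parts.\<close>
    proof (rule sum.reindex_bij_witness[where
          i = "\<lambda>((A, i), (B, j)). ((A \<union> B, i + j), (A, i))" and
          j = "\<lambda>((T, k), (A, i)). ((A, i), (T - A, k - i))"], goal_cases)
      case (1 p)
      then show ?case
        by (auto simp: split_def)
    next
      case (2 p)
      then show ?case
        by (auto simp: split_def multiset_diff_simps dest: subset_mset.order_trans)
    next
      case (3 p)
      then show ?case
        by (auto simp: split_def)
    next
      case (4 p)
      then show ?case
        by (auto simp: split_def subset_mset.le_diff_conv2 add.commute dest: subset_mset.order_trans)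
    next
      case (5 p)
      then obtain T k A i where p: "p = ((T, k), (A, i))" "T \<subseteq> S" "k \<subseteq># m" "A \<subseteq> T" "i \<subseteq># k"
        by auto
      moreover have "S - A - (T - A) = S - T"
        using p by auto
      ultimately show ?case
        using osign_assoc[OF True, of T A] by (simp add: diff_diff_submultiset)
    qed
    also have "\<dots> = (\<Sum>(A, i)\<in>Pow S \<times> {k. k \<subseteq># m}. \<Sum>(B, j)\<in>Pow (S - A) \<times> {j. j \<subseteq># m - i}.
        osign A (S - A) * osign B (S - A - B) * ?f A B (S - A - B) i j (m - i - j))"
      by (rule trans[OF sum.Sigma[symmetric]]) (auto simp: split_def True finite_subset[OF _ True])
    also have "\<dots> = gmult F (gmult G K) q x"
      by (auto simp: q gmult_def sum_distrib_left sum_distrib_right mult_ac intro!: sum.cong)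
    finally show ?thesis .
  qed
qed

lemma gparity_mult: "gparity (gmult F G) = gmult (gparity F) (gparity G)"
proof (intro ext)
  fix q :: gmono and x
  obtain S m where q: "q = (S, m)"
    by (cases q)
  have "(-1) ^ card S = (-1) ^ card T * ((-1::real) ^ card (S - T))" if "T \<subseteq> S" "finite S" for T
    using that card_Un_disjoint[of T "S - T"] finite_subset[of T S]
    by (auto simp: power_add[symmetric] Un_absorb1)
  then show "gparity (gmult F G) q x = gmult (gparity F) (gparity G) q x"
    by (cases "finite S") (auto simp: q gparity_def gmult_infinite, auto simp: gmult_def sum_distrib_left mult_ac intro!: sum.cong)
qed

lemma gmult_supercommute:
  assumes F: "gparity F = f *\<^sub>R F" and G: "gparity G = g *\<^sub>R G" and s: "f = 1 \<or> f = -1" "g = 1 \<or> g = -1"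
  shows "gmult F G = supersign f g *\<^sub>R gmult G F"
proof (intro ext)
  fix q :: gmono and x
  obtain S m where q: "q = (S, m)"
    by (cases q)
  show "gmult F G q x = (supersign f g *\<^sub>R gmult G F) q x"
  proof (cases "finite S")
    case False
    then show ?thesis
      by (simp add: q gmult_infinite)
  next
    case True
    \<comment> \<open>A function of pure parity has nonzero coefficients only at monomials of that
      parity, so the sign of \<open>osign_swap\<close> is the same for all contributing
      terms.\<close>
    have F': "F (T, k) x = 0 \<or> (-1) ^ card T = f" and G': "G (T, k) x = 0 \<or> (-1) ^ card T = g" for T k
      using fun_cong[OF fun_cong[OF F], of "(T, k)" x] fun_cong[OF fun_cong[OF G], of "(T, k)" x]
      by (auto simp: gparity_def)
    have e: "(-1) ^ (a * b) = supersign ((-1) ^ a) ((-1) ^ b)" for a b :: nat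
      by (cases "even a"; cases "even b") (auto simp: supersign_def)
    have "gmult F G q x = (\<Sum>(T, k)\<in>Pow S \<times> {k. k \<subseteq># m}.
        osign (S - T) T * F (S - T, m - k) x * G (T, k) x)"
      unfolding q gmult_def prod.case
      by (rule sum.reindex_bij_witness[where i = "\<lambda>(T, k). (S - T, m - k)" and j = "\<lambda>(T, k). (S - T, m - k)"])
        (auto simp: double_diff multiset_diff_simps)
    also have "\<dots> = (supersign f g *\<^sub>R gmult G F) q x"
      unfolding q gmult_def scaleR_fun_apply prod.case real_scaleR_def sum_distrib_left
    proof (intro sum.cong refl, clarify)
      fix T k
      assume T: "T \<subseteq> S"
      have "osign (S - T) T = supersign ((-1) ^ card (S - T)) ((-1) ^ card T) * osign T (S - T)"
        using T True osign_swap[of "S - T" T] finite_subset[of T S] by (auto simp: e)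
      then show "osign (S - T) T * F (S - T, m - k) x * G (T, k) x =
          supersign f g * (osign T (S - T) * G (T, k) x * F (S - T, m - k) x)"
        using F'[of "S - T" "m - k"] G'[of T k] by auto
    qed
    finally show ?thesis .
  qed
qed

text \<open>The exponent of \<open>v\<close> in a monomial is the sum of its exponents in the two
  factors; the numerical factor of the derivative is distributed accordingly.\<close>

lemma ediff_mult: "ediff v (gmult F G) = gmult (ediff v F) G + gmult F (ediff v G)"
proof (intro ext)
  fix q :: gmono and x
  obtain S m where q: "q = (S, m)"
    by (cases q)
  have *: "real (Suc (count m v)) * (\<Sum>k | k \<subseteq># add_mset v m. c k * d (add_mset v m - k)) =
      (\<Sum>k | k \<subseteq># m. real (Suc (count k v)) * c (add_mset v k) * d (m - k)) +
      (\<Sum>k | k \<subseteq># m. c k * (real (Suc (count (m - k) v)) * d (add_mset v (m - k))))"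
    for c d :: "evar multiset \<Rightarrow> real"
  proof -
    let ?m = "add_mset v m"
    have "(\<Sum>k | k \<subseteq># m. real (Suc (count k v)) * c (add_mset v k) * d (m - k)) =
        (\<Sum>k | k \<subseteq># ?m \<and> v \<in># k. real (count k v) * c k * d (?m - k))"
      by (rule sum.reindex_bij_witness[where i = "\<lambda>k. k - {#v#}" and j = "add_mset v"])
        (auto simp: insert_subset_eq_iff subset_eq_diff_conv)
    \<comment> \<open>Here and below, enlarging the index set to all sub-multisets of
      \<open>?m\<close> adds only terms whose exponent factor is 0.\<close>
    also have "\<dots> = (\<Sum>k | k \<subseteq># ?m. real (count k v) * c k * d (?m - k))"
      by (rule sum.mono_neutral_left) (auto simp: not_in_iff)
    finally have 1: "(\<Sum>k | k \<subseteq># m. real (Suc (count k v)) * c (add_mset v k) * d (m - k)) = \<dots>" .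
    have "(\<Sum>k | k \<subseteq># m. c k * (real (Suc (count (m - k) v)) * d (add_mset v (m - k)))) =
        (\<Sum>k | k \<subseteq># m. real (count (?m - k) v) * c k * d (?m - k))"
      by (rule sum.cong) (auto simp: multiset_diff_simps)
    also have "\<dots> = (\<Sum>k | k \<subseteq># ?m. real (count (?m - k) v) * c k * d (?m - k))"
    proof (rule sum.mono_neutral_left)
      show "\<forall>k\<in>{k. k \<subseteq># ?m} - {k. k \<subseteq># m}. real (count (?m - k) v) * c k * d (?m - k) = 0"
      proof
        fix k
        assume k: "k \<in> {k. k \<subseteq># ?m} - {k. k \<subseteq># m}"
        then obtain w where "count m w < count k w"
          by (auto simp: subseteq_mset_def not_le)
        moreover have "count k u \<le> count ?m u" for u
          using k by (auto simp: subseteq_mset_def)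
        ultimately have "w = v" "count k v = Suc (count m v)"
          by (metis count_add_mset leD not_less_eq_eq le_antisym Suc_leI)+
        then show "real (count (?m - k) v) * c k * d (?m - k) = 0"
          by simp
      qed
    qed (auto intro: subset_mset.order_trans)
    finally have 2: "(\<Sum>k | k \<subseteq># m. c k * (real (Suc (count (m - k) v)) * d (add_mset v (m - k)))) = \<dots>" .
    have "real (Suc (count m v)) = real (count k v) + real (count (?m - k) v)" if "k \<subseteq># ?m" for k
      using that by (auto simp: subseteq_mset_def dest: spec[of _ v])
    then show ?thesis
      unfolding 1 2 sum_distrib_left sum.distrib[symmetric]
      by (intro sum.cong) (auto simp: algebra_simps)
  qed
  have "ediff v (gmult F G) q x = (\<Sum>T\<in>Pow S. osign T (S - T) * (real (Suc (count m v)) *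
      (\<Sum>k | k \<subseteq># add_mset v m. F (T, k) x * G (S - T, add_mset v m - k) x)))"
    by (simp add: q ediff_def gmult_double_sum sum_distrib_left mult_ac)
  also have "\<dots> = (\<Sum>T\<in>Pow S. osign T (S - T) *
      ((\<Sum>k | k \<subseteq># m. real (Suc (count k v)) * F (T, add_mset v k) x * G (S - T, m - k) x) +
       (\<Sum>k | k \<subseteq># m. F (T, k) x * (real (Suc (count (m - k) v)) * G (S - T, add_mset v (m - k)) x))))"
    by (rule sum.cong[OF refl], rule arg_cong[where f = "(*) _"], rule *)
  also have "\<dots> = (gmult (ediff v F) G + gmult F (ediff v G)) q x"
    by (simp add: q ediff_def gmult_double_sum sum.distrib distrib_left)
  finally show "ediff v (gmult F G) q x = \<dots>" .
qed

lemma sum_Pow_insert: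
  assumes "finite S" "v \<notin> S"
  shows "sum h (Pow (insert v S)) = sum h (Pow S) + (\<Sum>T\<in>Pow S. h (insert v T))"
proof -
  have "sum h (Pow (insert v S)) = sum h (Pow S) + sum h (insert v ` Pow S)"
    unfolding Pow_insert using assms by (intro sum.union_disjoint) auto
  also have "sum h (insert v ` Pow S) = (\<Sum>T\<in>Pow S. h (insert v T))"
    using assms by (subst sum.reindex) (auto simp: inj_on_def)
  finally show ?thesis .
qed

lemma osign_insert:
  assumes "finite A" "finite B" "v \<notin> A"
  shows "osign (insert v A) B = osign {v} B * osign A B" "osign B (insert v A) = osign B {v} * osign B A"
  using osign_Un_left[of "{v}" A B] osign_Un_right[of "{v}" A B] assms by auto

lemma osign_swap_singleton: "finite A \<Longrightarrow> v \<notin> A \<Longrightarrow> osign A {v} = (-1) ^ card A * osign {v} A"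
  using osign_swap[of A "{v}"] by simp

text \<open>Of the two sums over subsets of \<open>insert v S\<close> given by \<open>v \<notin> T\<close> and \<open>v \<in> T\<close>, one is
  the derivative of the left factor, the other that of the right one.\<close>

lemma odiff_sum_leibniz:
  fixes c :: "ovar set \<Rightarrow> ovar set \<Rightarrow> real"
  assumes S: "finite S" and v: "v \<notin> S"
  shows "osign {v} S * (\<Sum>T\<in>Pow (insert v S). osign T (insert v S - T) * c T (insert v S - T)) =
    (\<Sum>T\<in>Pow S. osign T (S - T) * (osign {v} T * c (insert v T) (S - T)))
    + (\<Sum>T\<in>Pow S. osign T (S - T) * ((-1) ^ card T * (osign {v} (S - T) * c T (insert v (S - T)))))"
proof -
  have 1: "osign {v} S * (osign T (insert v S - T) * c T (insert v S - T)) =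
      osign T (S - T) * ((-1) ^ card T * (osign {v} (S - T) * c T (insert v (S - T))))"
    "osign {v} S * (osign (insert v T) (insert v S - insert v T) * c (insert v T) (insert v S - insert v T)) =
      osign T (S - T) * (osign {v} T * c (insert v T) (S - T))"
    if T: "T \<in> Pow S" for T
  proof -
    have fin [simp]: "finite T" "finite (S - T)" "v \<notin> T" "v \<notin> S - T"
      using T S v by (auto intro: finite_subset)
    note ins = osign_insert[of T _ v, OF fin(1) _ fin(3)] osign_insert[of "S - T" _ v, OF fin(2) _ fin(4)]
    have e: "insert v S - T = insert v (S - T)" "insert v S - insert v T = S - T"
      using T v by auto
    have vS: "osign {v} S = osign {v} T * osign {v} (S - T)"
      using osign_Un_right[of T "S - T" "{v}"] fin T by (simp add: Un_absorb1)
    show "osign {v} S * (osign T (insert v S - T) * c T (insert v S - T)) =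
        osign T (S - T) * ((-1) ^ card T * (osign {v} (S - T) * c T (insert v (S - T))))"
      by (simp add: e vS ins osign_swap_singleton mult_ac)
    show "osign {v} S * (osign (insert v T) (insert v S - insert v T) * c (insert v T) (insert v S - insert v T)) =
        osign T (S - T) * (osign {v} T * c (insert v T) (S - T))"
      unfolding e vS by (simp add: ins mult_ac)
  qed
  show ?thesis
    unfolding sum_Pow_insert[OF S v] distrib_left sum_distrib_left
    by (subst add.commute, rule arg_cong2[where f = "(+)"]; rule sum.cong[OF refl], rule 1)
qed

text \<open>For \<open>v \<in> S\<close> the two contributions cancel each other.\<close>

lemma odiff_sum_cancel:
  fixes c :: "ovar set \<Rightarrow> ovar set \<Rightarrow> real"
  assumes S: "finite S" and v: "v \<notin> S"
  shows "(\<Sum>T\<in>Pow (insert v S). osign T (insert v S - T) *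
      (if v \<in> T then 0 else osign {v} T * c (insert v T) (insert v S - T)))
    + (\<Sum>T\<in>Pow (insert v S). osign T (insert v S - T) * ((-1) ^ card T *
      (if v \<in> insert v S - T then 0 else osign {v} (insert v S - T) * c T (insert v (insert v S - T))))) = 0"
proof -
  have 1: "osign T (insert v S - T) * (osign {v} T * c (insert v T) (insert v S - T))
      + osign (insert v T) (S - T) * ((-1) ^ card (insert v T) * (osign {v} (S - T) * c (insert v T) (insert v (S - T)))) = 0"
    if T: "T \<in> Pow S" for T
  proof -
    have fin [simp]: "finite T" "finite (S - T)" "v \<notin> T" "v \<notin> S - T"
      using T S v by (auto intro: finite_subset)
    note ins = osign_insert[of T _ v, OF fin(1) _ fin(3)] osign_insert[of "S - T" _ v, OF fin(2) _ fin(4)]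
    have e: "insert v S - T = insert v (S - T)"
      using T v by auto
    show ?thesis
      by (simp add: e ins osign_swap_singleton mult_ac)
  qed
  have e: "v \<notin> T" "insert v S - insert v T = S - T" "v \<in> insert v S - T" "v \<notin> S - T" if "T \<in> Pow S" for T
    using that v by auto
  show ?thesis
    unfolding sum_Pow_insert[OF S v] sum.distrib[symmetric]
    by (rule sum.neutral, rule ballI) (simp only: e if_True if_False insertI1 mult_zero_right add_0_left add_0_right 1)
qed

lemma odiff_mult: "odiff v (gmult F G) = gmult (odiff v F) G + gmult (gparity F) (odiff v G)"
proof (intro ext)
  fix q :: gmono and x
  obtain S m where q: "q = (S, m)"
    by (cases q)
  define c where "c T U = (\<Sum>k | k \<subseteq># m. F (T, k) x * G (U, m - k) x)" for T U
  have R1: "gmult (odiff v F) G q x =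
      (\<Sum>T\<in>Pow S. osign T (S - T) * (if v \<in> T then 0 else osign {v} T * c (insert v T) (S - T)))"
    unfolding q gmult_double_sum by (rule sum.cong) (auto simp: odiff_osign c_def sum_distrib_left mult.assoc)
  have R2: "gmult (gparity F) (odiff v G) q x =
      (\<Sum>T\<in>Pow S. osign T (S - T) * ((-1) ^ card T * (if v \<in> S - T then 0 else osign {v} (S - T) * c T (insert v (S - T)))))"
    unfolding q gmult_double_sum
    by (rule sum.cong) (auto simp: odiff_osign gparity_def c_def sum_distrib_left mult.assoc mult.left_commute)
  have R: "(gmult (odiff v F) G + gmult (gparity F) (odiff v G)) q x =
      (\<Sum>T\<in>Pow S. osign T (S - T) * (if v \<in> T then 0 else osign {v} T * c (insert v T) (S - T)))
    + (\<Sum>T\<in>Pow S. osign T (S - T) * ((-1) ^ card T * (if v \<in> S - T then 0 else osign {v} (S - T) * c T (insert v (S - T)))))"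
    by (simp only: plus_fun_apply R1 R2)
  show "odiff v (gmult F G) q x = (gmult (odiff v F) G + gmult (gparity F) (odiff v G)) q x"
  proof (cases "finite S")
    case False
    then show ?thesis
      by (simp add: q odiff_osign gmult_infinite)
  next
    case True
    show ?thesis
    proof (cases "v \<in> S")
      case True
      then obtain S' where S': "S = insert v S'" "v \<notin> S'"
        by (meson mk_disjoint_insert)
      then have "finite S'"
        using \<open>finite S\<close> by simp
      then show ?thesis
        unfolding R unfolding q odiff_osign S'(1) using odiff_sum_cancel[of S' v c] S'(2) by simp
    next
      case False
      have "odiff v (gmult F G) q x = osign {v} S * (\<Sum>T\<in>Pow (insert v S). osign T (insert v S - T) * c T (insert v S - T))"
        using False by (simp add: q odiff_osign gmult_double_sum c_def)
      also have "\<dots> = (\<Sum>T\<in>Pow S. osign T (S - T) * (osign {v} T * c (insert v T) (S - T)))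
    + (\<Sum>T\<in>Pow S. osign T (S - T) * ((-1) ^ card T * (osign {v} (S - T) * c T (insert v (S - T)))))"
        using True False by (rule odiff_sum_leibniz)
      finally show ?thesis
        unfolding R using False by (auto intro!: arg_cong2[where f = "(+)"] sum.cong)
    qed
  qed
qed

lemma osign_singleton_insert:
  assumes "u \<notin> S"
  shows "osign {v} (insert u S) = osign {v} {u} * osign {v} S"
proof -
  \<comment> \<open>Only finitely many variables precede \<open>v\<close>, also when
    \<open>S\<close> is infinite.\<close>
  have "finite {s \<in> S. opos s < opos v}"
    by (rule finite_imageD[of opos], rule finite_subset[of _ "{..<opos v}"]) (auto simp: inj_on_def inj_opos)
  moreover have "{s \<in> insert u S. opos s < opos v} =
      (if opos u < opos v then insert u {s \<in> S. opos s < opos v} else {s \<in> S. opos s < opos v})"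
    by auto
  moreover have "{s \<in> {u}. opos s < opos v} = (if opos u < opos v then {u} else {})"
    by auto
  ultimately show ?thesis
    using assms by (simp add: osign_singleton)
qed

lemma odiff_odiff: "odiff u (odiff v F) = - odiff v (odiff u F)"
proof (intro ext)
  fix q :: gmono and x
  obtain S m where q: "q = (S, m)"
    by (cases q)
  show "odiff u (odiff v F) q x = (- odiff v (odiff u F)) q x"
  proof (cases "u \<in> S \<or> v \<in> S \<or> u = v")
    case True
    then show ?thesis
      by (auto simp: q odiff_osign)
  next
    case False
    have "osign {u} {v} = - osign {v} {u}"
      by (subst osign_swap) (use False in auto)
    then show ?thesis
      using False by (auto simp: q odiff_osign osign_singleton_insert[of _ S] insert_commute)
  qed
qed

lemma gparity_gparity [simp]: "gparity (gparity F) = F"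
  by (auto simp: gparity_def fun_eq_iff power_mult_distrib[symmetric] mult.assoc[symmetric])

lemma linear_gparity: "linear gparity"
  by (auto simp: gparity_def fun_eq_iff algebra_simps intro!: linearI)

lemma linear_odiff: "linear (odiff v)"
  by (auto simp: odiff_def fun_eq_iff algebra_simps intro!: linearI)

lemma linear_ediff: "linear (ediff v)"
  by (auto simp: ediff_def fun_eq_iff algebra_simps intro!: linearI)

text \<open>The assumption excludes infinite \<open>S\<close>: there \<open>card S\<close> and
  \<open>card (insert v S)\<close> are both 0, and the sign change between them would be
  lost.\<close>

lemma gparity_odiff:
  assumes "\<And>S m. infinite S \<Longrightarrow> F (S, m) = 0"
  shows "gparity (odiff v F) = - odiff v (gparity F)"
proof (intro ext)
  fix q :: gmono and x
  obtain S m where q: "q = (S, m)"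
    by (cases q)
  show "gparity (odiff v F) q x = (- odiff v (gparity F)) q x"
    by (cases "finite S") (auto simp: q odiff_def gparity_def assms)
qed

text \<open>In each conjugate pair of coordinates exactly one is odd, so the pairs are indexed by
  the odd member \<open>v\<close>; this is the derivative along the even one. The signs are those in
  front of the three sums of \<open>poisson_in\<close>.\<close>

definition even_deriv :: "(nat \<Rightarrow> ('m \<Rightarrow> real) \<Rightarrow> 'm \<Rightarrow> real) \<Rightarrow> ovar \<Rightarrow> 'm gfun \<Rightarrow> 'm gfun" where
  "even_deriv X v F = (case v of P_dn i \<Rightarrow> (\<lambda>q. X i (F q)) | Xi_up j \<Rightarrow> - ediff (Xi_dn j) F
     | Th_dn k \<Rightarrow> - ediff (Th_up k) F)"

text \<open>\<open>R\<close> is a ring of functions on the base, \<open>X i\<close> plays the role of \<open>\<partial>/\<partial>x\<^sup>i\<close>.\<close>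

locale base_ring =
  fixes R :: "('m \<Rightarrow> real) set" and X :: "nat \<Rightarrow> ('m \<Rightarrow> real) \<Rightarrow> 'm \<Rightarrow> real" and I :: "ovar set"
  assumes R_subspace: "subspace R"
    and R_mult: "f \<in> R \<Longrightarrow> g \<in> R \<Longrightarrow> (\<lambda>x. f x * g x) \<in> R"
    and X_R: "f \<in> R \<Longrightarrow> X i f \<in> R"
    and X_add: "f \<in> R \<Longrightarrow> g \<in> R \<Longrightarrow> X i (f + g) = X i f + X i g"
    and X_scaleR: "f \<in> R \<Longrightarrow> X i (c *\<^sub>R f) = c *\<^sub>R X i f"
    and X_mult: "f \<in> R \<Longrightarrow> g \<in> R \<Longrightarrow> X i (\<lambda>x. f x * g x) = (\<lambda>x. X i f x * g x + f x * X i g x)"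
    and X_X: "f \<in> R \<Longrightarrow> X i (X j f) = X j (X i f)"
begin

text \<open>Monomials with infinitely many odd variables have to be excluded, as parities by
  \<open>card\<close> and sums over \<open>Pow S\<close> degenerate on them.\<close>

definition carrier :: "'m gfun set" where
  "carrier = {F. (\<forall>q. F q \<in> R) \<and> (\<forall>S m. infinite S \<longrightarrow> F (S, m) = 0)}"

lemma X_0 [simp]: "X i 0 = 0"
  using X_scaleR[of 0 i 0] subspace_0[OF R_subspace] by simp

lemma X_sum: "(\<And>a. a \<in> A \<Longrightarrow> h a \<in> R) \<Longrightarrow> X i (sum h A) = (\<Sum>a\<in>A. X i (h a))"
  by (induction A rule: infinite_finite_induct)
    (simp_all add: X_add subspace_sum[OF R_subspace])

lemma R_sum: "(\<And>a. a \<in> A \<Longrightarrow> h a \<in> R) \<Longrightarrow> sum h A \<in> R"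
  by (rule subspace_sum[OF R_subspace])

lemma gmult_eq_sum: "gmult F G (S, m) = (\<Sum>(T, k)\<in>Pow S \<times> {k. k \<subseteq># m}.
    osign T (S - T) *\<^sub>R (\<lambda>x. F (T, k) x * G (S - T, m - k) x))"
  by (auto simp: gmult_def fun_eq_iff sum_fun_apply split_def mult.assoc)

lemma gmult_carrier: "F \<in> carrier \<Longrightarrow> G \<in> carrier \<Longrightarrow> gmult F G \<in> carrier"
  using gmult_infinite
  by (auto simp: carrier_def gmult_eq_sum fun_eq_iff intro!: R_sum subspace_scale[OF R_subspace] R_mult)

lemma subspace_carrier: "subspace carrier"
  using subspace_0[OF R_subspace] subspace_add[OF R_subspace] subspace_scale[OF R_subspace]
  by (auto simp: subspace_def carrier_def)

lemma gparity_carrier: "F \<in> carrier \<Longrightarrow> gparity F \<in> carrier"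
proof -
  have *: "(\<lambda>x. c * f x) = c *\<^sub>R f" for c and f :: "'m \<Rightarrow> real"
    by auto
  show "F \<in> carrier \<Longrightarrow> gparity F \<in> carrier"
    by (auto simp: carrier_def gparity_def * intro!: subspace_scale[OF R_subspace])
qed

lemma odiff_eq_scaleR: "odiff v F (S, m) = (if v \<in> S then 0 else osign {v} S *\<^sub>R F (insert v S, m))"
  by (auto simp: odiff_osign fun_eq_iff)

lemma ediff_eq_scaleR: "ediff v F (S, m) = real (Suc (count m v)) *\<^sub>R F (S, add_mset v m)"
  by (auto simp: ediff_def fun_eq_iff)

lemma gparity_eq_scaleR: "gparity F (S, m) = (-1) ^ card S *\<^sub>R F (S, m)"
  by (auto simp: gparity_def fun_eq_iff)

lemma odiff_carrier: "F \<in> carrier \<Longrightarrow> odiff v F \<in> carrier"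
  by (auto simp: carrier_def odiff_eq_scaleR intro!: subspace_scale[OF R_subspace] subspace_0[OF R_subspace])

lemma ediff_carrier: "F \<in> carrier \<Longrightarrow> ediff v F \<in> carrier"
  by (auto simp: carrier_def ediff_eq_scaleR intro!: subspace_scale[OF R_subspace])

lemma even_deriv_carrier: "F \<in> carrier \<Longrightarrow> even_deriv X v F \<in> carrier"
  using ediff_carrier subspace_neg[OF subspace_carrier]
  by (cases v) (auto simp: even_deriv_def, auto simp: carrier_def X_R)

lemma X_gmult:
  assumes "F \<in> carrier" "G \<in> carrier"
  shows "(\<lambda>q. X i (gmult F G q)) = gmult (\<lambda>q. X i (F q)) G + gmult F (\<lambda>q. X i (G q))"
proof
  fix q :: gmono
  obtain S m where q: "q = (S, m)"
    by (cases q)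
  have R: "F p \<in> R" "G p \<in> R" for p
    using assms by (cases p; auto simp: carrier_def)+
  have "X i (gmult F G q) = (\<Sum>(T, k)\<in>Pow S \<times> {k. k \<subseteq># m}.
      osign T (S - T) *\<^sub>R X i (\<lambda>x. F (T, k) x * G (S - T, m - k) x))"
    unfolding q gmult_eq_sum
    by (subst X_sum) (auto intro!: sum.cong X_scaleR subspace_scale[OF R_subspace] R_mult R)
  also have "\<dots> = (gmult (\<lambda>q. X i (F q)) G + gmult F (\<lambda>q. X i (G q))) q"
    by (simp add: fun_eq_iff q gmult_eq_sum X_mult R sum_fun_apply split_def sum.distrib[symmetric] distrib_left)
  finally show "X i (gmult F G q) = \<dots>" .
qed

lemma ediff_ediff: "ediff u (ediff v F) = ediff v (ediff u F)"
  by (cases "u = v") (auto simp: ediff_def fun_eq_iff add_mset_commute)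

lemma ediff_odiff: "ediff u (odiff v F) = odiff v (ediff u F)"
  by (auto simp: ediff_def odiff_def fun_eq_iff)

lemma gparity_ediff: "gparity (ediff v F) = ediff v (gparity F)"
  by (auto simp: ediff_def gparity_def fun_eq_iff)

lemma X_ops:
  assumes F: "F \<in> carrier"
  shows "(\<lambda>q. X i (odiff v F q)) = odiff v (\<lambda>q. X i (F q))"
    and "(\<lambda>q. X i (ediff w F q)) = ediff w (\<lambda>q. X i (F q))"
    and "(\<lambda>q. X i (gparity F q)) = gparity (\<lambda>q. X i (F q))"
    and "(\<lambda>q. X i ((- F) q)) = - (\<lambda>q. X i (F q))"
proof -
  have R: "F p \<in> R" for p
    using F by (cases p) (auto simp: carrier_def)
  have "X i (- F p) = - X i (F p)" for p
    using X_scaleR[OF R, of i "-1" p] by simp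
  then show "(\<lambda>q. X i ((- F) q)) = - (\<lambda>q. X i (F q))"
    by (auto simp: fun_eq_iff)
qed (rule ext, rename_tac q, case_tac q, insert F,
    auto simp: odiff_eq_scaleR ediff_eq_scaleR gparity_eq_scaleR X_scaleR carrier_def)+

sublocale odd_poisson carrier gmult gparity "even_deriv X" odiff I
proof
  note linear_simps = linear_add linear_neg linear_scale
  fix F G K :: "'m gfun" and c :: real and a b :: ovar and f g :: real
  show "subspace carrier"
    by (rule subspace_carrier)
  show "gmult (F + G) K = gmult F K + gmult G K" "gmult K (F + G) = gmult K F + gmult K G"
    "gmult (c *\<^sub>R F) G = c *\<^sub>R gmult F G" "gmult F (c *\<^sub>R G) = c *\<^sub>R gmult F G"
    by (rule gmult_bilinear)+
  show "gmult (gmult F G) K = gmult F (gmult G K)"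
    by (rule gmult_assoc)
  show "gparity (gmult F G) = gmult (gparity F) (gparity G)"
    by (rule gparity_mult)
  show "odiff a (gmult F G) = gmult (odiff a F) G + gmult (gparity F) (odiff a G)"
    by (rule odiff_mult)
  show "odiff a (odiff b F) = - odiff b (odiff a F)"
    by (rule odiff_odiff)
  show "gparity (F + G) = gparity F + gparity G" "gparity (c *\<^sub>R F) = c *\<^sub>R gparity F"
    "odiff a (F + G) = odiff a F + odiff a G" "odiff a (c *\<^sub>R F) = c *\<^sub>R odiff a F"
    by (simp_all add: linear_simps linear_gparity linear_odiff)
  show "gparity (gparity F) = F"
    by simp
  show "gparity F = f *\<^sub>R F \<Longrightarrow> gparity G = g *\<^sub>R G \<Longrightarrow> f = 1 \<or> f = -1 \<Longrightarrow> g = 1 \<or> g = -1 \<Longrightarrow>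
      gmult F G = supersign f g *\<^sub>R gmult G F"
    by (rule gmult_supercommute)
  assume F: "F \<in> carrier"
  show "gparity F \<in> carrier" "even_deriv X a F \<in> carrier" "odiff a F \<in> carrier"
    using F by (auto intro: gparity_carrier even_deriv_carrier odiff_carrier)
  show "gparity (odiff a F) = - odiff a (gparity F)"
    using F by (intro gparity_odiff) (auto simp: carrier_def)
  show "even_deriv X a (c *\<^sub>R F) = c *\<^sub>R even_deriv X a F"
    using F by (cases a) (auto simp: even_deriv_def linear_simps linear_ediff carrier_def X_scaleR fun_eq_iff)
  show "even_deriv X a (odiff b F) = odiff b (even_deriv X a F)"
    by (cases a) (auto simp: even_deriv_def X_ops[OF F] ediff_odiff linear_neg linear_odiff)
  show "gparity (even_deriv X a F) = even_deriv X a (gparity F)"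
    by (cases a) (auto simp: even_deriv_def X_ops[OF F] gparity_ediff linear_neg linear_gparity)
  have XF: "(\<lambda>q. X i ((- ediff w F) q)) = - ediff w (\<lambda>q. X i (F q))" for i w
    unfolding X_ops(4)[OF ediff_carrier[OF F]] X_ops(2)[OF F] ..
  have "X i (X j (F q)) = X j (X i (F q))" for i j q
    using F by (cases q) (auto simp: carrier_def intro: X_X)
  then show "even_deriv X a (even_deriv X b F) = even_deriv X b (even_deriv X a F)"
    by (cases a; cases b) (simp_all only: even_deriv_def ovar.case XF linear_neg[OF linear_ediff] ediff_ediff)
  assume G: "G \<in> carrier"
  show "gmult F G \<in> carrier"
    using F G by (rule gmult_carrier)
  show "even_deriv X a (F + G) = even_deriv X a F + even_deriv X a G"
    using F G by (cases a) (auto simp: even_deriv_def linear_simps linear_ediff carrier_def X_add fun_eq_iff)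
  show "even_deriv X a (gmult F G) = gmult (even_deriv X a F) G + gmult F (even_deriv X a G)"
    using F G by (cases a)
      (simp_all add: even_deriv_def X_gmult ediff_mult gmult_bilinear(3)[of "-1", simplified]
        gmult_bilinear(4)[of _ "-1", simplified])
qed

end

section \<open>Smooth functions on \<open>\<real>\<^sup>n\<close>\<close>

abbreviation open_Rn :: "nat \<Rightarrow> (nat \<Rightarrow> real) set \<Rightarrow> bool" where
  "open_Rn n D \<equiv> openin (top_of_set (Rn n)) D"

text \<open>Only the first \<open>n\<close> coordinates vary on \<open>Rn n\<close>, so a basic
  neighbourhood of the product topology involves finitely many radii and their minimum is
  positive.\<close>

lemma open_Rn_box:
  assumes D: "open_Rn n D" and y: "y \<in> D"
  obtains d where "d > 0" "\<And>z. z \<in> Rn n \<Longrightarrow> (\<And>k. k < n \<Longrightarrow> \<bar>z k - y k\<bar> < d) \<Longrightarrow> z \<in> D"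
proof -
  obtain V where V: "open V" "D = Rn n \<inter> V"
    using D by (auto simp: openin_open)
  have "openin (product_topology (\<lambda>i. euclidean) UNIV) V"
    using V(1) by (simp add: open_fun_def)
  then obtain X where X: "y \<in> (\<Pi>\<^sub>E i\<in>UNIV. X i)" "\<And>i. open (X i)" "(\<Pi>\<^sub>E i\<in>UNIV. X i) \<subseteq> V"
    using product_topology_open_contains_basis[of "\<lambda>i. euclidean" UNIV V y] y V(2) by auto
  have "\<exists>e>0. \<forall>t. \<bar>t - y k\<bar> < e \<longrightarrow> t \<in> X k" for k
  proof -
    have "y k \<in> X k"
      using X(1) by auto
    then show ?thesis
      using X(2)[of k] unfolding open_dist dist_real_def by blast
  qed
  then obtain e where e: "\<And>k. e k > 0" "\<And>k t. \<bar>t - y k\<bar> < e k \<Longrightarrow> t \<in> X k"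
    by metis
  \<comment> \<open>The inserted 1 keeps the minimum defined and positive for
    \<open>n = 0\<close>.\<close>
  define d where "d = Min (insert 1 (e ` {..<n}))"
  show ?thesis
  proof
    show "d > 0"
      using e(1) by (auto simp: d_def)
    fix z assume z: "z \<in> Rn n" "\<And>k. k < n \<Longrightarrow> \<bar>z k - y k\<bar> < d"
    have "z k \<in> X k" for k
    proof (cases "k < n")
      case True
      then have "d \<le> e k"
        by (auto simp: d_def)
      then show ?thesis
        using z(2)[OF True] by (intro e(2)) simp
    next
      case False
      then have "z k = y k"
        using z(1) y V(2) by (auto simp: Rn_def)
      then show ?thesis
        using X(1) by auto
    qed
    then show "z \<in> D"
      using X(3) V(2) z(1) by auto
  qed
qed

lemma Rn_upd: "y \<in> Rn n \<Longrightarrow> i < n \<Longrightarrow> y(i := t) \<in> Rn n"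
  by (auto simp: Rn_def)

lemma open_Rn_subset: "open_Rn n D \<Longrightarrow> y \<in> D \<Longrightarrow> y \<in> Rn n"
  by (auto dest: openin_imp_subset)

lemma eventually_upd:
  assumes "open_Rn n D" "y \<in> D" "i < n"
  shows "\<forall>\<^sub>F t in nhds (y i). y(i := t) \<in> D"
proof -
  obtain d where d: "d > 0" "\<And>z. z \<in> Rn n \<Longrightarrow> (\<And>k. k < n \<Longrightarrow> \<bar>z k - y k\<bar> < d) \<Longrightarrow> z \<in> D"
    using open_Rn_box assms by blast
  have "\<forall>\<^sub>F t in nhds (y i). dist t (y i) < d"
    using d(1) eventually_nhds_metric by blast
  then show ?thesis
    by eventually_elim (use assms d open_Rn_subset[OF assms(1,2)] in \<open>auto intro!: d(2) Rn_upd simp: dist_real_def\<close>)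
qed

text \<open>\<open>partial\<close> has a value even where no derivative exists; this relational form
  carries existence along with the value.\<close>

definition has_partial :: "nat \<Rightarrow> ((nat \<Rightarrow> real) \<Rightarrow> real) \<Rightarrow> real \<Rightarrow> (nat \<Rightarrow> real) \<Rightarrow> bool" where
  "has_partial i g g' y \<longleftrightarrow> ((\<lambda>t. g (y(i := t))) has_real_derivative g') (at (y i))"

lemma has_partial_partial: "has_partial i g g' y \<Longrightarrow> partial i g y = g'"
  by (auto simp: has_partial_def partial_def DERIV_imp_deriv)

lemma has_partial_cong:
  assumes "open_Rn n D" "y \<in> D" "i < n" and "\<And>z. z \<in> D \<Longrightarrow> g z = h z"
  shows "has_partial i g g' y \<longleftrightarrow> has_partial i h g' y"
  unfolding has_partial_def
  by (rule DERIV_cong_ev[OF refl _ refl]) (use eventually_upd[OF assms(1-3)] assms(4) in \<open>auto elim: eventually_mono\<close>)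

lemma partial_cong:
  assumes "open_Rn n D" "y \<in> D" "i < n" and "\<And>z. z \<in> D \<Longrightarrow> g z = h z"
  shows "partial i g y = partial i h y"
  unfolding partial_def
  by (rule deriv_cong_ev[OF _ refl]) (use eventually_upd[OF assms(1-3)] assms(4) in \<open>auto elim: eventually_mono\<close>)

lemma fold_partial_cong:
  assumes "open_Rn n D" "set js \<subseteq> {..<n}" "\<And>z. z \<in> D \<Longrightarrow> g z = h z" "y \<in> D"
  shows "fold partial js g y = fold partial js h y"
  using assms(2-)
proof (induction js arbitrary: g h y)
  case (Cons i js)
  have "fold partial js (partial i g) y = fold partial js (partial i h) y"
    using Cons.prems by (intro Cons.IH partial_cong[OF assms(1)]) auto
  then show ?case
    by simp
qed simp

lemma cinf_on_continuous: "cinf_on n D g \<Longrightarrow> continuous_on D g"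
  by (auto simp: cinf_on_def dest: spec[of _ "[]"])

lemma cinf_on_has_partial:
  assumes g: "cinf_on n D g" and i: "i < n" and y: "y \<in> D"
  shows "has_partial i g (partial i g y) y"
proof -
  from g have "set [] \<subseteq> {..<n} \<longrightarrow> continuous_on D (fold partial [] g) \<and>
      (\<forall>i<n. \<forall>y\<in>D. (\<lambda>t. fold partial [] g (y(i := t))) differentiable at (y i))"
    unfolding cinf_on_def by (rule spec)
  then have "(\<lambda>t. g (y(i := t))) differentiable at (y i)"
    using i y by simp
  then show ?thesis
    unfolding has_partial_def partial_def by (simp only: DERIV_deriv_iff_real_differentiable)
qed

lemma cinf_on_partial: "cinf_on n D g \<Longrightarrow> i < n \<Longrightarrow> cinf_on n D (partial i g)"
proof -
  assume *: "cinf_on n D g" "i < n"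
  have "set (i # js) \<subseteq> {..<n}" if "set js \<subseteq> {..<n}" for js
    using that *(2) by simp
  then show ?thesis
    using *(1) unfolding cinf_on_def by (metis fold_simps(2))
qed

text \<open>Smoothness as a greatest fixed point: a class of continuous functions that contains, up
  to equality on \<open>D\<close>, the partial derivatives of its members consists of smooth
  functions. The induction on lists of indices is done here once for all closure properties.\<close>

lemma cinf_on_coinduct:
  assumes D: "open_Rn n D" and "P g"
    and step: "\<And>g. P g \<Longrightarrow> continuous_on D g \<and> (\<forall>i<n. \<exists>h. P h \<and> (\<forall>y\<in>D. has_partial i g (h y) y))"
  shows "cinf_on n D g"
proof -
  have *: "\<exists>h. P h \<and> (\<forall>y\<in>D. fold partial js g y = h y)" if "set js \<subseteq> {..<n}" "P g" for js g
    using that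
  proof (induction js arbitrary: g)
    case (Cons i js)
    then obtain h where h: "P h" "\<forall>y\<in>D. has_partial i g (h y) y"
      using step[of g] by auto
    then obtain h' where "P h'" "\<forall>y\<in>D. fold partial js h y = h' y"
      using Cons.IH[OF _ h(1)] Cons.prems(1) by auto
    moreover have "fold partial js (partial i g) y = fold partial js h y" if "y \<in> D" for y
      using Cons.prems that h(2) by (intro fold_partial_cong[OF D]) (auto simp: has_partial_partial)
    ultimately show ?case
      by auto
  qed auto
  show ?thesis
    unfolding cinf_on_def
  proof (intro allI impI)
    fix js assume js: "set js \<subseteq> {..<n}"
    then obtain h where h: "P h" "\<And>y. y \<in> D \<Longrightarrow> fold partial js g y = h y"
      using * \<open>P g\<close> by blast
    have "continuous_on D (fold partial js g)"
      using step[OF h(1)] h(2) by (metis continuous_on_cong)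
    moreover have "(\<lambda>t. fold partial js g (y(i := t))) differentiable at (y i)" if iy: "i < n" "y \<in> D" for i y
    proof -
      obtain h' where "has_partial i h (h' y) y"
        using step[OF h(1)] iy by blast
      then have "has_partial i (fold partial js g) (h' y) y"
        using has_partial_cong[OF D iy(2,1), of "fold partial js g" h] h(2) by simp
      then show ?thesis
        unfolding has_partial_def real_differentiable_def by blast
    qed
    ultimately show "continuous_on D (fold partial js g) \<and>
        (\<forall>i<n. \<forall>y\<in>D. (\<lambda>t. fold partial js g (y(i := t))) differentiable at (y i))"
      by blast
  qed
qed

lemma open_Rn_continuous_box:
  assumes D: "open_Rn n D" and y: "y \<in> D" and g: "continuous_on D g" and e: "e > 0"
  obtains d where "d > 0"
    "\<And>z. z \<in> Rn n \<Longrightarrow> (\<And>k. k < n \<Longrightarrow> \<bar>z k - y k\<bar> < d) \<Longrightarrow> z \<in> D \<and> \<bar>g z - g y\<bar> < (e::real)"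
proof -
  have "openin (top_of_set D) (D \<inter> g -` ball (g y) e)"
    using g by (intro continuous_openin_preimage_gen) auto
  then have "open_Rn n (D \<inter> g -` ball (g y) e)"
    using D openin_trans by blast
  moreover have "y \<in> D \<inter> g -` ball (g y) e"
    using y e by auto
  ultimately obtain d where "d > 0"
    "\<And>z. z \<in> Rn n \<Longrightarrow> (\<And>k. k < n \<Longrightarrow> \<bar>z k - y k\<bar> < d) \<Longrightarrow> z \<in> D \<inter> g -` ball (g y) e"
    using open_Rn_box by blast
  then show ?thesis
    by (intro that[of d]) (auto simp: dist_real_def abs_minus_commute)
qed

lemma mvt_between:
  fixes f :: "real \<Rightarrow> real"
  assumes "\<And>u. min a b \<le> u \<Longrightarrow> u \<le> max a b \<Longrightarrow> (f has_real_derivative f' u) (at u)"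
  obtains u where "min a b \<le> u" "u \<le> max a b" "f b - f a = f' u * (b - a)"
proof (cases a b rule: linorder_cases)
  case less
  then obtain z where "a < z" "z < b" "f b - f a = (b - a) * f' z"
    using MVT2[of a b f f'] assms by auto
  then show ?thesis
    by (intro that[of z]) auto
next
  case equal
  then show ?thesis
    by (intro that[of a]) auto
next
  case greater
  then obtain z where "b < z" "z < a" "f a - f b = (a - b) * f' z"
    using MVT2[of b a f f'] assms by auto
  then show ?thesis
    by (intro that[of z]) (auto simp: algebra_simps)
qed

text \<open>The increment of \<open>G\<close> along the curve is split into increments in one coordinate each, to
  which the mean value theorem applies.\<close>

lemma chain_rule_Rn:
  assumes D: "open_Rn n D" and y: "c t0 \<in> D" and Rn: "\<And>t. c t \<in> Rn n"
    and G: "\<And>k z. k < n \<Longrightarrow> z \<in> D \<Longrightarrow> has_partial k G (G' k z) z"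
    and G': "\<And>k. k < n \<Longrightarrow> continuous_on D (G' k)"
    and c: "\<And>k. k < n \<Longrightarrow> ((\<lambda>t. c t k) has_real_derivative d k) (at t0)"
  shows "((\<lambda>t. G (c t)) has_real_derivative (\<Sum>k<n. G' k (c t0) * d k)) (at t0)"
proof -
  let ?y = "c t0"
  define z where "z k t = (\<lambda>j. if j < k then c t j else ?y j)" for k t
  have z_Rn: "z k t \<in> Rn n" for k t
    using Rn by (auto simp: z_def Rn_def)
  have z_Suc: "z (Suc k) t = (z k t)(k := c t k)" and z_same: "(z k t)(k := ?y k) = z k t" for k t
    by (auto simp: z_def fun_eq_iff less_Suc_eq)
  have z_end: "z n t = c t" "z 0 t = ?y" for t
    using Rn by (auto simp: z_def fun_eq_iff Rn_def)
  have near: "\<forall>\<^sub>F t in at t0. \<forall>k<n. \<bar>c t k - ?y k\<bar> < e" if "e > 0" for e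
  proof -
    have "\<forall>\<^sub>F t in at t0. \<bar>c t k - ?y k\<bar> < e" if "k < n" for k
      using DERIV_isCont[OF c[OF that]] \<open>e > 0\<close> by (auto simp: isCont_def tendsto_iff dist_real_def)
    then show ?thesis
      using eventually_ball_finite[of "{..<n}" "\<lambda>t k. \<bar>c t k - ?y k\<bar> < e" "at t0"]
      by (auto elim: eventually_mono)
  qed
  have piece: "((\<lambda>t. G (z (Suc k) t) - G (z k t)) has_real_derivative G' k ?y * d k) (at t0)" if k: "k < n" for k
  proof -
    \<comment> \<open>A difference quotient whose value at coinciding coordinates is set to the
      expected limit. Thus \<open>q\<close> times the increment of the coordinate is always the
      increment of \<open>G\<close>, even where the coordinate has not moved.\<close>
    define q where "q t = (if c t k = ?y k then G' k ?y else (G (z (Suc k) t) - G (z k t)) / (c t k - ?y k))" for t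
    have "\<forall>\<^sub>F t in at t0. \<bar>q t - G' k ?y\<bar> < e" if e: "e > 0" for e
    proof -
      obtain r where r: "r > 0" "\<And>w. w \<in> Rn n \<Longrightarrow> (\<And>j. j < n \<Longrightarrow> \<bar>w j - ?y j\<bar> < r) \<Longrightarrow>
          w \<in> D \<and> \<bar>G' k w - G' k ?y\<bar> < e"
        using open_Rn_continuous_box[OF D y G'[OF k] e] by metis
      show ?thesis
        using near[OF r(1)]
      proof eventually_elim
        fix t assume t: "\<forall>j<n. \<bar>c t j - ?y j\<bar> < r"
        have box: "(z k t)(k := u) \<in> D \<and> \<bar>G' k ((z k t)(k := u)) - G' k ?y\<bar> < e"
          if "min (?y k) (c t k) \<le> u" "u \<le> max (?y k) (c t k)" for u
        proof (rule r(2))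
          show "(z k t)(k := u) \<in> Rn n"
            using z_Rn k by (rule Rn_upd)
          show "\<bar>((z k t)(k := u)) j - ?y j\<bar> < r" if "j < n" for j
            using t k r(1) that \<open>min (?y k) (c t k) \<le> u\<close> \<open>u \<le> max (?y k) (c t k)\<close>
            by (auto simp: z_def dest!: spec[of _ j])
        qed
        have "((\<lambda>u. G ((z k t)(k := u))) has_real_derivative G' k ((z k t)(k := u))) (at u)"
          if "min (?y k) (c t k) \<le> u" "u \<le> max (?y k) (c t k)" for u
          using G[OF k, of "(z k t)(k := u)"] box[OF that] by (simp add: has_partial_def)
        then obtain u where "min (?y k) (c t k) \<le> u" "u \<le> max (?y k) (c t k)"
          "G (z (Suc k) t) - G (z k t) = G' k ((z k t)(k := u)) * (c t k - ?y k)"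
          by (rule mvt_between[of "?y k" "c t k" "\<lambda>u. G ((z k t)(k := u))"]) (auto simp: z_Suc z_same)
        then show "\<bar>q t - G' k ?y\<bar> < e"
          using box that by (auto simp: q_def)
      qed
    qed
    then have "(q \<longlongrightarrow> G' k ?y) (at t0)"
      by (auto simp: tendsto_iff dist_real_def)
    moreover have "((\<lambda>t. (c t k - ?y k) / (t - t0)) \<longlongrightarrow> d k) (at t0)"
      using c[OF k] by (simp add: has_field_derivative_iff)
    ultimately have "((\<lambda>t. q t * ((c t k - ?y k) / (t - t0))) \<longlongrightarrow> G' k ?y * d k) (at t0)"
      by (rule tendsto_mult)
    moreover have "q t * ((c t k - ?y k) / (t - t0)) = (G (z (Suc k) t) - G (z k t) - (G (z (Suc k) t0) - G (z k t0))) / (t - t0)" for t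
    proof -
      have "z (Suc k) t0 = z k t0"
        by (auto simp: z_def)
      moreover have "z (Suc k) t = z k t" if "c t k = ?y k"
        using that z_Suc z_same by metis
      ultimately show ?thesis
        by (auto simp: q_def)
    qed
    ultimately show ?thesis
      by (simp only: has_field_derivative_iff)
  qed
  have "G ?y + (\<Sum>k<n. G (z (Suc k) t) - G (z k t)) = G (c t)" for t
    using sum_lessThan_telescope[of "\<lambda>k. G (z k t)" n] by (simp add: z_end)
  moreover have "((\<lambda>t. \<Sum>k<n. G (z (Suc k) t) - G (z k t)) has_real_derivative (\<Sum>k<n. G' k ?y * d k)) (at t0)"
    by (rule DERIV_sum) (simp add: piece)
  ultimately show ?thesis
    using DERIV_add[OF DERIV_const[of "G ?y"], of "\<lambda>t. \<Sum>k<n. G (z (Suc k) t) - G (z k t)"]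
    by (simp only: add_0_left)
qed

text \<open>Differentiating a composition produces sums and products of compositions, so closure
  under a single operation cannot be proved in isolation; this class is closed under all of them and
  under partial derivatives. In \<open>comp1\<close> the outer function is given with the whole
  sequence of its derivatives, so that differentiation only shifts the index.\<close>

inductive smooth_closure :: "nat \<Rightarrow> (nat \<Rightarrow> real) set \<Rightarrow> ((nat \<Rightarrow> real) \<Rightarrow> real) \<Rightarrow> bool" for n D where
  base: "cinf_on n D a \<Longrightarrow> smooth_closure n D a"
| const: "smooth_closure n D (\<lambda>y. c)"
| add: "smooth_closure n D a \<Longrightarrow> smooth_closure n D b \<Longrightarrow> smooth_closure n D (\<lambda>y. a y + b y)"
| mult: "smooth_closure n D a \<Longrightarrow> smooth_closure n D b \<Longrightarrow> smooth_closure n D (\<lambda>y. a y * b y)"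
| comp1: "smooth_closure n D a \<Longrightarrow> (\<And>k t. t \<in> U \<Longrightarrow> (\<phi> k has_real_derivative \<phi> (Suc k) t) (at t)) \<Longrightarrow>
    (\<And>y. y \<in> D \<Longrightarrow> a y \<in> U) \<Longrightarrow> smooth_closure n D (\<lambda>y. \<phi> (k::nat) (a y))"
| comp: "(\<And>k. k < n' \<Longrightarrow> smooth_closure n D (\<lambda>y. \<tau> y k)) \<Longrightarrow> open_Rn n' D' \<Longrightarrow> cinf_on n' D' G \<Longrightarrow>
    (\<And>y. y \<in> D \<Longrightarrow> \<tau> y \<in> D') \<Longrightarrow> (\<And>y. \<tau> y \<in> Rn n') \<Longrightarrow> smooth_closure n D (\<lambda>y. G (\<tau> y))"

lemma smooth_closure_sum:
  "finite A \<Longrightarrow> (\<And>k. k \<in> A \<Longrightarrow> smooth_closure n D (h k)) \<Longrightarrow> smooth_closure n D (\<lambda>y. \<Sum>k\<in>A. h k y)"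
  by (induction A rule: finite_induct) (auto intro: smooth_closure.const smooth_closure.add)

lemma smooth_closure_step:
  assumes D: "open_Rn n D" and "smooth_closure n D g"
  shows "continuous_on D g \<and> (\<forall>i<n. \<exists>h. smooth_closure n D h \<and> (\<forall>y\<in>D. has_partial i g (h y) y))"
  using assms(2)
proof induction
  case (base a)
  then show ?case
    by (blast intro: cinf_on_continuous cinf_on_has_partial cinf_on_partial smooth_closure.base)
next
  case (const c)
  then show ?case
    by (auto simp: has_partial_def intro: smooth_closure.const[of _ _ 0])
next
  case (add a b)
  show ?case
  proof (intro conjI allI impI)
    show "continuous_on D (\<lambda>y. a y + b y)"
      using add.IH by (auto intro: continuous_on_add)
    fix i assume "i < n"
    then obtain a' b' where "smooth_closure n D a'" "\<forall>y\<in>D. has_partial i a (a' y) y"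
      "smooth_closure n D b'" "\<forall>y\<in>D. has_partial i b (b' y) y"
      using add.IH by blast
    then show "\<exists>h. smooth_closure n D h \<and> (\<forall>y\<in>D. has_partial i (\<lambda>y. a y + b y) (h y) y)"
      by (intro exI[of _ "\<lambda>y. a' y + b' y"]) (auto simp: has_partial_def intro: smooth_closure.add DERIV_add)
  qed
next
  case (mult a b)
  show ?case
  proof (intro conjI allI impI)
    show "continuous_on D (\<lambda>y. a y * b y)"
      using mult.IH by (auto intro: continuous_on_mult)
    fix i assume "i < n"
    then obtain a' b' where a': "smooth_closure n D a'" "\<And>y. y \<in> D \<Longrightarrow> has_partial i a (a' y) y"
      and b': "smooth_closure n D b'" "\<And>y. y \<in> D \<Longrightarrow> has_partial i b (b' y) y"
      using mult.IH by blast
    have "has_partial i (\<lambda>y. a y * b y) (a' y * b y + b' y * a y) y" if "y \<in> D" for y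
      using DERIV_mult[OF a'(2)[OF that, unfolded has_partial_def] b'(2)[OF that, unfolded has_partial_def]]
      by (simp add: has_partial_def)
    then show "\<exists>h. smooth_closure n D h \<and> (\<forall>y\<in>D. has_partial i (\<lambda>y. a y * b y) (h y) y)"
      using mult.hyps a'(1) b'(1)
      by (intro exI[of _ "\<lambda>y. a' y * b y + b' y * a y"]) (auto intro!: smooth_closure.add smooth_closure.mult)
  qed
next
  case (comp1 a U \<phi> k)
  show ?case
  proof (intro conjI allI impI)
    have "continuous_on U (\<phi> k)"
      using comp1.hyps(2) by (meson DERIV_isCont continuous_at_imp_continuous_on)
    then show "continuous_on D (\<lambda>y. \<phi> k (a y))"
      using comp1 by (auto intro: continuous_on_compose2[of U])
    fix i assume "i < n"
    then obtain a' where a': "smooth_closure n D a'" "\<And>y. y \<in> D \<Longrightarrow> has_partial i a (a' y) y"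
      using comp1.IH by blast
    have "has_partial i (\<lambda>y. \<phi> k (a y)) (\<phi> (Suc k) (a y) * a' y) y" if "y \<in> D" for y
      unfolding has_partial_def
      by (rule DERIV_chain2[of "\<phi> k"]) (use a'(2)[OF that] comp1.hyps(2)[OF comp1.hyps(3)[OF that]] in \<open>auto simp: has_partial_def\<close>)
    moreover have "smooth_closure n D (\<lambda>y. \<phi> (Suc k) (a y) * a' y)"
      by (intro smooth_closure.mult a'(1) smooth_closure.comp1[of n D a U \<phi>, OF comp1.hyps])
    ultimately show "\<exists>h. smooth_closure n D h \<and> (\<forall>y\<in>D. has_partial i (\<lambda>y. \<phi> k (a y)) (h y) y)"
      by blast
  qed
next
  case (comp n' \<tau> D' G)
  show ?case
  proof (intro conjI allI impI)
    have "continuous_on D (\<lambda>y. \<tau> y k)" for k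
    proof (cases "k < n'")
      case False
      then have "\<tau> y k = 0" for y
        using comp.hyps(5) by (auto simp: Rn_def)
      then show ?thesis
        by simp
    qed (use comp.IH in auto)
    then have "continuous_on D \<tau>"
      by (intro continuous_on_coordinatewise_then_product) auto
    then show "continuous_on D (\<lambda>y. G (\<tau> y))"
      using comp.hyps(4) by (intro continuous_on_compose2[OF cinf_on_continuous[OF comp.hyps(3)]]) auto
    fix i assume i: "i < n"
    \<comment> \<open>The chain rule needs derivatives of all components of \<open>\<tau>\<close>
      simultaneously, as one family.\<close>
    define \<tau>' where "\<tau>' k = (SOME h. smooth_closure n D h \<and> (\<forall>y\<in>D. has_partial i (\<lambda>y. \<tau> y k) (h y) y))" for k
    have "smooth_closure n D (\<tau>' k) \<and> (\<forall>y\<in>D. has_partial i (\<lambda>y. \<tau> y k) (\<tau>' k y) y)" if "k < n'" for k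
      unfolding \<tau>'_def by (rule someI_ex[OF conjunct2[OF comp.IH[OF that], rule_format, OF i]])
    then have \<tau>': "\<And>k. k < n' \<Longrightarrow> smooth_closure n D (\<tau>' k)"
      "\<And>k y. k < n' \<Longrightarrow> y \<in> D \<Longrightarrow> has_partial i (\<lambda>y. \<tau> y k) (\<tau>' k y) y"
      by auto
    have "has_partial i (\<lambda>y. G (\<tau> y)) (\<Sum>k<n'. partial k G (\<tau> y) * \<tau>' k y) y" if "y \<in> D" for y
    proof -
      have "((\<lambda>t. G (\<tau> (y(i := t)))) has_real_derivative
          (\<Sum>k<n'. partial k G (\<tau> (y(i := y i))) * \<tau>' k y)) (at (y i))"
      proof (rule chain_rule_Rn[where D = D' and G' = "\<lambda>k. partial k G"])
        show "open_Rn n' D'" "\<tau> (y(i := y i)) \<in> D'" "\<tau> (y(i := t)) \<in> Rn n'" for t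
          using comp.hyps that by auto
        show "has_partial k G (partial k G z) z" if "k < n'" "z \<in> D'" for k z
          using comp.hyps(3) that by (rule cinf_on_has_partial)
        show "continuous_on D' (partial k G)" if "k < n'" for k
          using comp.hyps(3) that by (intro cinf_on_continuous cinf_on_partial)
        show "((\<lambda>t. \<tau> (y(i := t)) k) has_real_derivative \<tau>' k y) (at (y i))" if "k < n'" for k
          using \<tau>'(2)[OF that \<open>y \<in> D\<close>] unfolding has_partial_def .
      qed
      then show ?thesis
        by (simp add: has_partial_def)
    qed
    moreover have "smooth_closure n D (\<lambda>y. \<Sum>k<n'. partial k G (\<tau> y) * \<tau>' k y)"
    proof (intro smooth_closure_sum smooth_closure.mult)
      fix k assume "k \<in> {..<n'}"
      then show "smooth_closure n D (\<lambda>y. partial k G (\<tau> y))" "smooth_closure n D (\<tau>' k)"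
        using comp.hyps \<tau>'(1) by (auto intro: smooth_closure.comp[of n' n D \<tau> D' "partial k G"] cinf_on_partial)
    qed simp
    ultimately show "\<exists>h. smooth_closure n D h \<and> (\<forall>y\<in>D. has_partial i (\<lambda>y. G (\<tau> y)) (h y) y)"
      by blast
  qed
qed

lemma smooth_closure_cinf_on: "open_Rn n D \<Longrightarrow> smooth_closure n D g \<Longrightarrow> cinf_on n D g"
  by (rule cinf_on_coinduct[where P = "smooth_closure n D"]) (auto dest: smooth_closure_step)

text \<open>The mixed second difference of \<open>g\<close> is \<open>h\<^sup>2\<close> times the mixed derivative, in either order,
  at some point of the box.\<close>

lemma second_difference:
  assumes D: "open_Rn n D" and g: "cinf_on n D g" and i: "i < n" "j < n" "i \<noteq> j" and y: "y \<in> Rn n" and h: "h > 0"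
    and box: "\<And>s t. 0 \<le> s \<Longrightarrow> s \<le> h \<Longrightarrow> 0 \<le> t \<Longrightarrow> t \<le> h \<Longrightarrow> y(i := y i + s, j := y j + t) \<in> D"
  obtains s t where "0 \<le> s" "s \<le> h" "0 \<le> t" "t \<le> h"
    "g (y(i := y i + h, j := y j + h)) - g (y(i := y i + h)) - g (y(j := y j + h)) + g y =
      h * h * partial j (partial i g) (y(i := y i + s, j := y j + t))"
proof -
  define f where "f u = g (y(i := u, j := y j + h)) - g (y(i := u))" for u
  have up: "y(i := u, j := v) \<in> D" if "y i \<le> u" "u \<le> y i + h" "y j \<le> v" "v \<le> y j + h" for u v
    using box[of "u - y i" "v - y j"] that by simp
  have up0: "y(i := u) \<in> D" if "y i \<le> u" "u \<le> y i + h" for u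
  proof -
    have "y(i := u, j := y j) = y(i := u)"
      using i(3) by auto
    then show ?thesis
      using up[of u "y j"] that h by simp
  qed
  have "(f has_real_derivative (partial i g (y(i := u, j := y j + h)) - partial i g (y(i := u)))) (at u)"
    if "y i \<le> u" "u \<le> y i + h" for u
    unfolding f_def
    using cinf_on_has_partial[OF g i(1) up[OF that, of "y j + h"]] cinf_on_has_partial[OF g i(1) up0[OF that]] h i(3)
    by (intro DERIV_diff) (simp_all add: has_partial_def fun_upd_twist[of i j])
  then have "\<exists>u>y i. u < y i + h \<and> f (y i + h) - f (y i) =
      (y i + h - y i) * (partial i g (y(i := u, j := y j + h)) - partial i g (y(i := u)))"
    using h by (intro MVT2) auto
  then obtain u where u: "y i < u" "u < y i + h"
    "f (y i + h) - f (y i) = h * (partial i g (y(i := u, j := y j + h)) - partial i g (y(i := u)))"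
    by auto
  have D2: "((\<lambda>v. partial i g (y(i := u, j := v))) has_real_derivative partial j (partial i g) (y(i := u, j := v))) (at v)"
    if "y j \<le> v" "v \<le> y j + h" for v
    using cinf_on_has_partial[OF cinf_on_partial[OF g i(1)] i(2) up[of u v]] u that by (simp add: has_partial_def)
  have "\<exists>v>y j. v < y j + h \<and> partial i g (y(i := u, j := y j + h)) - partial i g (y(i := u, j := y j)) =
      (y j + h - y j) * partial j (partial i g) (y(i := u, j := v))"
    by (rule MVT2[where f = "\<lambda>v. partial i g (y(i := u, j := v))"], use h in simp, rule D2)
  then obtain v where v: "y j < v" "v < y j + h"
    "partial i g (y(i := u, j := y j + h)) - partial i g (y(i := u, j := y j)) = h * partial j (partial i g) (y(i := u, j := v))"
    by auto
  have "y(i := u, j := y j) = y(i := u)"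
    using i(3) by auto
  then have "f (y i + h) - f (y i) = h * h * partial j (partial i g) (y(i := y i + (u - y i), j := y j + (v - y j)))"
    using u(3) v(3) by simp
  then show ?thesis
    using u v by (intro that[of "u - y i" "v - y j"]) (auto simp: f_def)
qed

text \<open>If the mixed derivatives differed at \<open>y\<close>, then by continuity on a small box
  each would stay within half the gap \<open>e\<close> of its value at \<open>y\<close>. But the
  same second difference equals a multiple of either derivative at some point of the box, so they
  take a common value there.\<close>

lemma partial_commute:
  assumes D: "open_Rn n D" and g: "cinf_on n D g" and ij: "i < n" "j < n" and y: "y \<in> D"
  shows "partial i (partial j g) y = partial j (partial i g) y"
proof (rule ccontr)
  assume ne: "partial i (partial j g) y \<noteq> partial j (partial i g) y"
  then have "i \<noteq> j"
    by auto
  define e where "e = \<bar>partial i (partial j g) y - partial j (partial i g) y\<bar> / 2"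
  have e: "e > 0"
    using ne by (simp add: e_def)
  obtain d where d: "d > 0" "\<And>z. z \<in> Rn n \<Longrightarrow> (\<And>k. k < n \<Longrightarrow> \<bar>z k - y k\<bar> < d) \<Longrightarrow>
      z \<in> D \<and> \<bar>partial i (partial j g) z - partial i (partial j g) y\<bar> < e"
    using open_Rn_continuous_box[OF D y _ e] cinf_on_continuous cinf_on_partial g ij by metis
  obtain d' where d': "d' > 0" "\<And>z. z \<in> Rn n \<Longrightarrow> (\<And>k. k < n \<Longrightarrow> \<bar>z k - y k\<bar> < d') \<Longrightarrow>
      z \<in> D \<and> \<bar>partial j (partial i g) z - partial j (partial i g) y\<bar> < e"
    using open_Rn_continuous_box[OF D y _ e] cinf_on_continuous cinf_on_partial g ij by metis
  define h where "h = min d d' / 2"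
  have h: "h > 0" "h < d" "h < d'"
    using d(1) d'(1) by (auto simp: h_def)
  have yR: "y \<in> Rn n"
    using D y by (rule open_Rn_subset)
  have near: "y(i := y i + s, j := y j + t) \<in> Rn n" "\<And>k. \<bar>(y(i := y i + s, j := y j + t)) k - y k\<bar> < r"
    if "0 \<le> s" "s \<le> h" "0 \<le> t" "t \<le> h" "h < r" for s t r
    using that ij yR \<open>i \<noteq> j\<close> h by (auto intro!: Rn_upd)
  obtain s t where st: "0 \<le> s" "s \<le> h" "0 \<le> t" "t \<le> h"
    "g (y(i := y i + h, j := y j + h)) - g (y(i := y i + h)) - g (y(j := y j + h)) + g y =
      h * h * partial j (partial i g) (y(i := y i + s, j := y j + t))"
    using second_difference[OF D g ij \<open>i \<noteq> j\<close> yR h(1)] d(2) near h by metis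
  have twist: "y(j := a, i := b) = y(i := b, j := a)" for a b
    using \<open>i \<noteq> j\<close> by (auto simp: fun_upd_twist)
  obtain s' t' where st': "0 \<le> s'" "s' \<le> h" "0 \<le> t'" "t' \<le> h"
    "g (y(i := y i + h, j := y j + h)) - g (y(j := y j + h)) - g (y(i := y i + h)) + g y =
      h * h * partial i (partial j g) (y(i := y i + t', j := y j + s'))"
    using second_difference[OF D g ij(2,1) \<open>i \<noteq> j\<close>[symmetric] yR h(1)] d(2) near h unfolding twist by metis
  have "partial j (partial i g) (y(i := y i + s, j := y j + t)) = partial i (partial j g) (y(i := y i + t', j := y j + s'))"
    using st(5) st'(5) h(1) by (simp add: algebra_simps)
  moreover have "\<bar>partial j (partial i g) (y(i := y i + s, j := y j + t)) - partial j (partial i g) y\<bar> < e"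
    using d'(2) near st h by blast
  moreover have "\<bar>partial i (partial j g) (y(i := y i + t', j := y j + s')) - partial i (partial j g) y\<bar> < e"
    using d(2) near st' h by blast
  ultimately have "\<bar>partial i (partial j g) y - partial j (partial i g) y\<bar> < e + e"
    by linarith
  then show False
    by (simp add: e_def)
qed

section \<open>Smooth functions on manifolds\<close>

text \<open>With \<open>u = 1 / t\<close>, the \<open>k\<close>-th derivative of
  \<open>exp (- (1 / t))\<close> is a polynomial in \<open>u\<close> times \<open>exp (- u)\<close>.
  The recursion is the product rule, the factor \<open>u\<^sup>2\<close> coming from the derivative
  of \<open>u\<close>, which is \<open>- u\<^sup>2\<close>.\<close>

fun flat_poly :: "nat \<Rightarrow> real poly" where
  "flat_poly 0 = 1"
| "flat_poly (Suc k) = [:0, 0, 1:] * (flat_poly k - pderiv (flat_poly k))"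

definition flat_deriv :: "nat \<Rightarrow> real \<Rightarrow> real" where
  "flat_deriv k t = (if t > 0 then poly (flat_poly k) (1 / t) * exp (- (1 / t)) else 0)"

lemma tendsto_poly_exp: "((\<lambda>u. poly p u * exp (- u)) \<longlongrightarrow> 0) (at_top :: real filter)"
proof -
  have "((\<lambda>u. u ^ i * exp (- u)) \<longlongrightarrow> 0) (at_top :: real filter)" for i
    using tendsto_power_div_exp_0[of i] by (simp add: exp_minus field_simps)
  then have "((\<lambda>u. \<Sum>i\<le>degree p. coeff p i * (u ^ i * exp (- u))) \<longlongrightarrow> (\<Sum>i\<le>degree p. coeff p i * 0)) (at_top :: real filter)"
    by (intro tendsto_sum tendsto_mult tendsto_const)
  then show ?thesis
    by (simp add: poly_altdef sum_distrib_right mult.assoc)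
qed

lemma flat_deriv_DERIV: "(flat_deriv k has_real_derivative flat_deriv (Suc k) t) (at t)"
proof (cases t "0 :: real" rule: linorder_cases)
  case less
  have "((\<lambda>_. 0) has_real_derivative 0) (at t)"
    by simp
  moreover have "\<forall>\<^sub>F s in nhds t. s < 0"
    using eventually_nhds_in_open[of "{..<0}" t] less by simp
  then have "\<forall>\<^sub>F s in nhds t. flat_deriv k s = 0"
    by eventually_elim (simp add: flat_deriv_def)
  ultimately show ?thesis
    using less DERIV_cong_ev[of t t "flat_deriv k" "\<lambda>_. 0" 0 0] by (simp add: flat_deriv_def)
next
  case greater
  have "((\<lambda>s. poly (flat_poly k) (1 / s) * exp (- (1 / s))) has_real_derivative
      poly (flat_poly (Suc k)) (1 / t) * exp (- (1 / t))) (at t)"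
    using greater
    by (auto intro!: derivative_eq_intros DERIV_chain2[OF poly_DERIV]
        simp: field_simps power2_eq_square)
  moreover have "\<forall>\<^sub>F s in nhds t. s > 0"
    using eventually_nhds_in_open[of "{0<..}" t] greater by simp
  then have "\<forall>\<^sub>F s in nhds t. flat_deriv k s = poly (flat_poly k) (1 / s) * exp (- (1 / s))"
    by eventually_elim (simp add: flat_deriv_def)
  ultimately show ?thesis
    using greater by (subst DERIV_cong_ev[OF refl _ refl]) (auto simp: flat_deriv_def)
next
  case equal
  \<comment> \<open>The difference quotient at 0 divides by \<open>s\<close>, which in the variable
    \<open>u = 1 / s\<close> is multiplication by \<open>u\<close>; hence the additional factor
    \<open>[:0, 1:]\<close>.\<close>
  have "((\<lambda>u. poly ([:0, 1:] * flat_poly k) u * exp (- u)) \<longlongrightarrow> 0) (at_top :: real filter)"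
    by (rule tendsto_poly_exp)
  moreover have "filterlim (\<lambda>s::real. 1 / s) at_top (at_right 0)"
    using filterlim_inverse_at_top_right by (simp add: inverse_eq_divide)
  ultimately have "((\<lambda>s. poly ([:0, 1:] * flat_poly k) (1 / s) * exp (- (1 / s))) \<longlongrightarrow> 0) (at_right 0)"
    by (rule filterlim_compose)
  then have R: "((\<lambda>s. flat_deriv k s / s) \<longlongrightarrow> 0) (at_right 0)"
    by (rule Lim_transform_eventually)
      (auto simp: flat_deriv_def eventually_at_filter)
  have "((\<lambda>s. flat_deriv k s / s) \<longlongrightarrow> 0) (at_left 0)"
    by (rule Lim_transform_eventually[OF tendsto_const]) (auto simp: flat_deriv_def eventually_at_filter)
  then have "((\<lambda>s. flat_deriv k s / s) \<longlongrightarrow> 0) (at 0)"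
    using R by (simp add: filterlim_at_split)
  then show ?thesis
    using equal by (simp add: has_field_derivative_iff flat_deriv_def)
qed

lemma flat_pos: "flat_deriv 0 t \<ge> 0" "flat_deriv 0 t > 0 \<longleftrightarrow> t > 0" "flat_deriv 0 t = 0 \<longleftrightarrow> t \<le> 0"
  by (auto simp: flat_deriv_def)

text \<open>The successive derivatives of \<open>1 / t\<close>, as a sequence because
  \<open>smooth_on_comp1\<close> asks for all of them.\<close>

definition recip_deriv :: "nat \<Rightarrow> real \<Rightarrow> real" where
  "recip_deriv k t = (-1) ^ k * fact k / t ^ Suc k"

lemma recip_deriv_DERIV:
  assumes t: "t \<noteq> 0"
  shows "(recip_deriv k has_real_derivative recip_deriv (Suc k) t) (at t)"
proof -
  have "((\<lambda>t. t ^ Suc k) has_real_derivative real (Suc k) * t ^ k) (at t)"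
    using DERIV_pow[of "Suc k" t] by simp
  then have "((\<lambda>t. (-1) ^ k * fact k / t ^ Suc k) has_real_derivative
      (0 * t ^ Suc k - (-1) ^ k * fact k * (real (Suc k) * t ^ k)) / (t ^ Suc k * t ^ Suc k)) (at t)"
    using t by (intro DERIV_divide DERIV_const) auto
  moreover have "(0 * t ^ Suc k - (-1) ^ k * fact k * (real (Suc k) * t ^ k)) / (t ^ Suc k * t ^ Suc k) = recip_deriv (Suc k) t"
    using t by (simp add: recip_deriv_def divide_simps)
  ultimately show ?thesis
    unfolding recip_deriv_def[abs_def] by simp
qed

lemma cinf_on_cong:
  assumes "open_Rn n D" "\<And>y. y \<in> D \<Longrightarrow> g y = h y" "cinf_on n D g"
  shows "cinf_on n D h"
proof (rule cinf_on_coinduct[OF assms(1), where P = "\<lambda>h. \<exists>g. cinf_on n D g \<and> (\<forall>y\<in>D. g y = h y)"])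
  show "\<exists>g. cinf_on n D g \<and> (\<forall>y\<in>D. g y = h y)"
    using assms by blast
  fix h assume "\<exists>g. cinf_on n D g \<and> (\<forall>y\<in>D. g y = h y)"
  then obtain g where g: "cinf_on n D g" "\<And>y. y \<in> D \<Longrightarrow> g y = h y"
    by blast
  have "continuous_on D h"
    using cinf_on_continuous[OF g(1)] g(2) continuous_on_cong[of D D g h] by simp
  moreover have "has_partial i h (partial i g y) y" if "i < n" "y \<in> D" for i y
    using cinf_on_has_partial[OF g(1) that] has_partial_cong[OF assms(1) that(2,1), of g h] g(2) by simp
  ultimately show "continuous_on D h \<and>
      (\<forall>i<n. \<exists>h'. (\<exists>g. cinf_on n D g \<and> (\<forall>y\<in>D. g y = h' y)) \<and> (\<forall>y\<in>D. has_partial i h (h' y) y))"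
    using cinf_on_partial[OF g(1)] by blast
qed

lemma cinf_on_local:
  assumes D: "open_Rn n D"
    and loc: "\<And>y. y \<in> D \<Longrightarrow> \<exists>D'. open_Rn n D' \<and> y \<in> D' \<and> D' \<subseteq> D \<and> cinf_on n D' g"
  shows "cinf_on n D g"
proof (rule cinf_on_coinduct[OF D, where
      P = "\<lambda>g. \<forall>y\<in>D. \<exists>D'. open_Rn n D' \<and> y \<in> D' \<and> D' \<subseteq> D \<and> cinf_on n D' g"])
  show "\<forall>y\<in>D. \<exists>D'. open_Rn n D' \<and> y \<in> D' \<and> D' \<subseteq> D \<and> cinf_on n D' g"
    using loc by blast
  fix g assume g: "\<forall>y\<in>D. \<exists>D'. open_Rn n D' \<and> y \<in> D' \<and> D' \<subseteq> D \<and> cinf_on n D' g"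
  have "continuous (at y within D) g" if y: "y \<in> D" for y
  proof -
    obtain D' where D': "open_Rn n D'" "y \<in> D'" "D' \<subseteq> D" "cinf_on n D' g"
      using g y by blast
    obtain V where V: "open V" "D' = Rn n \<inter> V"
      using D'(1) by (auto simp: openin_open)
    have "continuous (at y within D') g"
      using cinf_on_continuous[OF D'(4)] D'(2) by (simp add: continuous_on_eq_continuous_within)
    moreover have "at y within D' = at y within D"
      by (rule at_within_nhd[of y V]) (use V D' open_Rn_subset[OF D] in auto)
    ultimately show ?thesis
      by simp
  qed
  then have "continuous_on D g"
    by (simp add: continuous_on_eq_continuous_within)
  moreover have "\<exists>h. (\<forall>y\<in>D. \<exists>D'. open_Rn n D' \<and> y \<in> D' \<and> D' \<subseteq> D \<and> cinf_on n D' h) \<and> (\<forall>y\<in>D. has_partial i g (h y) y)"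
    if "i < n" for i
  proof (intro exI[of _ "partial i g"] conjI ballI)
    fix y assume "y \<in> D"
    then obtain D' where D': "open_Rn n D'" "y \<in> D'" "D' \<subseteq> D" "cinf_on n D' g"
      using g by blast
    then show "has_partial i g (partial i g y) y"
      using cinf_on_has_partial[OF D'(4) that D'(2)] by simp
    show "\<exists>D'. open_Rn n D' \<and> y \<in> D' \<and> D' \<subseteq> D \<and> cinf_on n D' (partial i g)"
      using D' cinf_on_partial[OF D'(4) that] by blast
  qed
  ultimately show "continuous_on D g \<and> (\<forall>i<n. \<exists>h.
      (\<forall>y\<in>D. \<exists>D'. open_Rn n D' \<and> y \<in> D' \<and> D' \<subseteq> D \<and> cinf_on n D' h) \<and> (\<forall>y\<in>D. has_partial i g (h y) y))"
    by blast
qed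

lemma cinf_on_subset:
  assumes "cinf_on n D g" "D' \<subseteq> D"
  shows "cinf_on n D' g"
  using assms by (auto simp: cinf_on_def intro: continuous_on_subset)

context smooth_manifold
begin

abbreviation "n \<equiv> mdim M"

lemma chart_open_image:
  assumes c: "(U, \<phi>) \<in> atlas M" and W: "open W"
  shows "open_Rn n (\<phi> ` (U \<inter> W))"
proof -
  have "openin (top_of_set U) (U \<inter> W)"
    using W by (simp add: openin_open_Int)
  then have "openin (top_of_set (\<phi> ` U)) (\<phi> ` (U \<inter> W))"
    using homeomorphism_imp_open_map[OF chart_homeomorphism[OF c]] by simp
  then show ?thesis
    using chart_open[OF c] openin_trans by blast
qed

lemma chart_inverse:
  assumes "(U, \<phi>) \<in> atlas M" "x \<in> U"
  shows "inv_into U \<phi> (\<phi> x) = x"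
  using chart_homeomorphism[OF assms(1)] assms(2) by (auto simp: homeomorphism_def)

lemma chart_at:
  obtains U \<phi> where "(U, \<phi>) \<in> atlas M" "x \<in> U"
proof -
  have "x \<in> (\<Union>(U, \<phi>)\<in>atlas M. U)"
    by (simp add: atlas_cover)
  then show ?thesis
    using that by auto
qed

lemma smooth_onD: "smooth_on M W f \<Longrightarrow> (U, \<phi>) \<in> atlas M \<Longrightarrow> cinf_on n (\<phi> ` (U \<inter> W)) (\<lambda>y. f (inv_into U \<phi> y))"
  by (auto simp: smooth_on_def)

lemma smooth_on_closure:
  assumes W: "open W"
    and "\<And>U \<phi>. (U, \<phi>) \<in> atlas M \<Longrightarrow> smooth_closure n (\<phi> ` (U \<inter> W)) (\<lambda>y. f (inv_into U \<phi> y))"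
  shows "smooth_on M W f"
  using assms chart_open_image[OF _ W] smooth_closure_cinf_on by (auto simp: smooth_on_def)

lemma smooth_on_base: "smooth_on M W f \<Longrightarrow> (U, \<phi>) \<in> atlas M \<Longrightarrow> smooth_closure n (\<phi> ` (U \<inter> W)) (\<lambda>y. f (inv_into U \<phi> y))"
  by (intro smooth_closure.base smooth_onD)

lemma smooth_on_const [simp]: "open W \<Longrightarrow> smooth_on M W (\<lambda>x. c)"
  by (rule smooth_on_closure) (auto intro: smooth_closure.const)

lemma smooth_on_add: "open W \<Longrightarrow> smooth_on M W f \<Longrightarrow> smooth_on M W g \<Longrightarrow> smooth_on M W (\<lambda>x. f x + g x)"
  by (rule smooth_on_closure) (auto intro: smooth_closure.add smooth_on_base)

lemma smooth_on_mult: "open W \<Longrightarrow> smooth_on M W f \<Longrightarrow> smooth_on M W g \<Longrightarrow> smooth_on M W (\<lambda>x. f x * g x)"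
  by (rule smooth_on_closure) (auto intro: smooth_closure.mult smooth_on_base)

lemma smooth_on_comp1:
  assumes "open W" "smooth_on M W f" "\<And>k t. t \<in> T \<Longrightarrow> (\<psi> k has_real_derivative \<psi> (Suc k) t) (at t)"
    and "\<And>x. x \<in> W \<Longrightarrow> f x \<in> T"
  shows "smooth_on M W (\<lambda>x. \<psi> (k::nat) (f x))"
proof (rule smooth_on_closure)
  fix U \<phi> assume c: "(U, \<phi>) \<in> atlas M"
  show "smooth_closure n (\<phi> ` (U \<inter> W)) (\<lambda>y. \<psi> k (f (inv_into U \<phi> y)))"
    by (rule smooth_closure.comp1[of _ _ _ T \<psi>, OF smooth_on_base[OF assms(2) c] assms(3)])
      (use assms(4) chart_inverse[OF c] in auto)
qed fact

lemma smooth_on_cong: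
  assumes "open W" "\<And>x. x \<in> W \<Longrightarrow> f x = g x" "smooth_on M W f"
  shows "smooth_on M W g"
  unfolding smooth_on_def
proof (clarify)
  fix U \<phi> assume c: "(U, \<phi>) \<in> atlas M"
  show "cinf_on n (\<phi> ` (U \<inter> W)) (\<lambda>y. g (inv_into U \<phi> y))"
    by (rule cinf_on_cong[OF chart_open_image[OF c assms(1)] _ smooth_onD[OF assms(3) c]])
      (use assms(2) chart_inverse[OF c] in auto)
qed

lemma smooth_on_subset: "smooth_on M W f \<Longrightarrow> W' \<subseteq> W \<Longrightarrow> smooth_on M W' f"
  unfolding smooth_on_def by (auto intro: cinf_on_subset)

lemma smooth_on_local:
  assumes W: "open W" and loc: "\<And>x. x \<in> W \<Longrightarrow> \<exists>V. open V \<and> x \<in> V \<and> smooth_on M V f"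
  shows "smooth_on M W f"
  unfolding smooth_on_def
proof (clarify)
  fix U \<phi> assume c: "(U, \<phi>) \<in> atlas M"
  show "cinf_on n (\<phi> ` (U \<inter> W)) (\<lambda>y. f (inv_into U \<phi> y))"
  proof (rule cinf_on_local[OF chart_open_image[OF c W]])
    fix y assume "y \<in> \<phi> ` (U \<inter> W)"
    then obtain x where x: "y = \<phi> x" "x \<in> U" "x \<in> W"
      by auto
    then obtain V where V: "open V" "x \<in> V" "smooth_on M V f"
      using loc by blast
    have "smooth_on M (V \<inter> W) f"
      using V(3) by (rule smooth_on_subset) auto
    then have "cinf_on n (\<phi> ` (U \<inter> (V \<inter> W))) (\<lambda>y. f (inv_into U \<phi> y))"
      using c by (rule smooth_onD)
    moreover have "open_Rn n (\<phi> ` (U \<inter> (V \<inter> W)))"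
      using c V(1) W by (intro chart_open_image) auto
    ultimately show "\<exists>D'. open_Rn n D' \<and> y \<in> D' \<and> D' \<subseteq> \<phi> ` (U \<inter> W) \<and> cinf_on n D' (\<lambda>y. f (inv_into U \<phi> y))"
      using x V(2) by (intro exI[of _ "\<phi> ` (U \<inter> (V \<inter> W))"]) auto
  qed
qed

lemma smooth_on_continuous:
  assumes W: "open W" and f: "smooth_on M W f"
  shows "continuous_on W f"
proof -
  have "isCont f x" if x: "x \<in> W" for x
  proof -
    obtain U \<phi> where c: "(U, \<phi>) \<in> atlas M" and xU: "x \<in> U"
      by (rule chart_at)
    have "continuous_on (U \<inter> W) \<phi>"
      using chart_homeomorphism[OF c] by (auto simp: homeomorphism_def intro: continuous_on_subset)
    then have "continuous_on (U \<inter> W) (\<lambda>x. f (inv_into U \<phi> (\<phi> x)))"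
      by (rule continuous_on_compose2[OF cinf_on_continuous[OF smooth_onD[OF f c]]]) auto
    then have "continuous_on (U \<inter> W) f"
      using chart_inverse[OF c] by (subst continuous_on_cong[OF refl]) auto
    then show ?thesis
      using chart_open[OF c] W x xU continuous_on_eq_continuous_at[of "U \<inter> W" f] by auto
  qed
  then show ?thesis
    by (simp add: continuous_at_imp_continuous_on)
qed

lemma smooth_on_uminus: "open W \<Longrightarrow> smooth_on M W f \<Longrightarrow> smooth_on M W (\<lambda>x. - f x)"
  using smooth_on_mult[of W "\<lambda>x. -1" f] by simp

lemma smooth_on_diff: "open W \<Longrightarrow> smooth_on M W f \<Longrightarrow> smooth_on M W g \<Longrightarrow> smooth_on M W (\<lambda>x. f x - g x)"
  using smooth_on_add[of W f "\<lambda>x. - g x"] smooth_on_uminus[of W g] by simp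

lemma smooth_on_sum: "open W \<Longrightarrow> (\<And>a. a \<in> A \<Longrightarrow> smooth_on M W (f a)) \<Longrightarrow> smooth_on M W (\<lambda>x. \<Sum>a\<in>A. f a x)"
  by (induction A rule: infinite_finite_induct) (simp_all add: smooth_on_add)

lemma smooth_on_prod: "open W \<Longrightarrow> (\<And>a. a \<in> A \<Longrightarrow> smooth_on M W (f a)) \<Longrightarrow> smooth_on M W (\<lambda>x. \<Prod>a\<in>A. f a x)"
  by (induction A rule: infinite_finite_induct) (simp_all add: smooth_on_mult)

lemma smooth_on_divide:
  assumes "open W" "smooth_on M W f" "smooth_on M W g" "\<And>x. x \<in> W \<Longrightarrow> g x \<noteq> 0"
  shows "smooth_on M W (\<lambda>x. f x / g x)"
proof -
  have "smooth_on M W (\<lambda>x. recip_deriv 0 (g x))"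
    by (rule smooth_on_comp1[where T = "- {0}"]) (use assms recip_deriv_DERIV in auto)
  from smooth_on_mult[OF assms(1,2) this] show ?thesis
    by (simp add: recip_deriv_def)
qed

lemma smooth_on_coordinate:
  assumes c: "(U, \<phi>) \<in> atlas M" and i: "i < n"
  shows "smooth_on M U (\<lambda>x. \<phi> x i)"
  using transition_smooth[OF _ c i] by (auto simp: smooth_on_def)

lemma chart_Rn: "(U, \<phi>) \<in> atlas M \<Longrightarrow> x \<in> U \<Longrightarrow> \<phi> x \<in> Rn n"
  using chart_open by (meson image_eqI open_Rn_subset)

definition chart_diff :: "'m set \<Rightarrow> ('m \<Rightarrow> nat \<Rightarrow> real) \<Rightarrow> nat \<Rightarrow> ('m \<Rightarrow> real) \<Rightarrow> 'm \<Rightarrow> real" where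
  "chart_diff U \<phi> i f x = partial i (\<lambda>y. f (inv_into U \<phi> y)) (\<phi> x)"

lemma smooth_on_chart_diff:
  assumes c: "(U, \<phi>) \<in> atlas M" and W: "open W" "W \<subseteq> U" and f: "smooth_on M W f" and i: "i < n"
  shows "smooth_on M W (chart_diff U \<phi> i f)"
proof (rule smooth_on_closure[OF W(1)])
  fix U' \<phi>' assume c': "(U', \<phi>') \<in> atlas M"
  \<comment> \<open>The change of coordinates, extended by 0 outside its domain:
    \<open>smooth_closure.comp\<close> wants a map with values in \<open>Rn n\<close>
    everywhere.\<close>
  let ?\<tau> = "\<lambda>y. if y \<in> \<phi>' ` (U' \<inter> W) then \<phi> (inv_into U' \<phi>' y) else (\<lambda>_. 0)"
  have "smooth_closure n (\<phi>' ` (U' \<inter> W)) (\<lambda>y. partial i (\<lambda>y. f (inv_into U \<phi> y)) (?\<tau> y))"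
  proof (rule smooth_closure.comp[where n' = n and \<tau> = ?\<tau> and D' = "\<phi> ` (U \<inter> W)" and
        G = "partial i (\<lambda>y. f (inv_into U \<phi> y))"])
    show "smooth_closure n (\<phi>' ` (U' \<inter> W)) (\<lambda>y. ?\<tau> y k)" if "k < n" for k
    proof (rule smooth_closure.base, rule cinf_on_cong[OF chart_open_image[OF c' W(1)],
          where g = "\<lambda>y. \<phi> (inv_into U' \<phi>' y) k"])
      show "cinf_on n (\<phi>' ` (U' \<inter> W)) (\<lambda>y. \<phi> (inv_into U' \<phi>' y) k)"
        by (rule smooth_onD[OF smooth_on_subset[OF smooth_on_coordinate[OF c that] W(2)] c'])
    qed auto
    show "open_Rn n (\<phi> ` (U \<inter> W))"
      using c W(1) by (rule chart_open_image)
    show "cinf_on n (\<phi> ` (U \<inter> W)) (partial i (\<lambda>y. f (inv_into U \<phi> y)))"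
      using smooth_onD[OF f c] i by (rule cinf_on_partial)
    show "?\<tau> y \<in> \<phi> ` (U \<inter> W)" if "y \<in> \<phi>' ` (U' \<inter> W)" for y
      using that W(2) chart_inverse[OF c'] by auto
    show "?\<tau> y \<in> Rn n" for y
      using chart_Rn[OF c] W(2) chart_inverse[OF c'] by (auto simp: Rn_def)
  qed
  then have "cinf_on n (\<phi>' ` (U' \<inter> W)) (\<lambda>y. partial i (\<lambda>y. f (inv_into U \<phi> y)) (?\<tau> y))"
    by (rule smooth_closure_cinf_on[OF chart_open_image[OF c' W(1)]])
  then show "smooth_closure n (\<phi>' ` (U' \<inter> W)) (\<lambda>y. chart_diff U \<phi> i f (inv_into U' \<phi>' y))"
    by (intro smooth_closure.base, elim cinf_on_cong[OF chart_open_image[OF c' W(1)], rotated])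
      (auto simp: chart_diff_def)
qed

lemma chart_diff_cong:
  assumes c: "(U, \<phi>) \<in> atlas M" and W: "open W" "x \<in> W" "x \<in> U" and eq: "\<And>z. z \<in> W \<Longrightarrow> f z = g z" and i: "i < n"
  shows "chart_diff U \<phi> i f x = chart_diff U \<phi> i g x"
  unfolding chart_diff_def
  by (rule partial_cong[OF chart_open_image[OF c W(1)] _ i]) (use W eq chart_inverse[OF c] in auto)

lemma
  assumes c: "(U, \<phi>) \<in> atlas M" and W: "open W" "W \<subseteq> U" and f: "smooth_on M W f" and g: "smooth_on M W g"
    and i: "i < n" and x: "x \<in> W"
  shows chart_diff_add: "chart_diff U \<phi> i (\<lambda>x. f x + g x) x = chart_diff U \<phi> i f x + chart_diff U \<phi> i g x"
    and chart_diff_mult: "chart_diff U \<phi> i (\<lambda>x. f x * g x) x = chart_diff U \<phi> i f x * g x + f x * chart_diff U \<phi> i g x"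
    and chart_diff_commute: "j < n \<Longrightarrow> chart_diff U \<phi> i (chart_diff U \<phi> j f) x = chart_diff U \<phi> j (chart_diff U \<phi> i f) x"
proof -
  let ?D = "\<phi> ` (U \<inter> W)"
  have D: "open_Rn n ?D" "\<phi> x \<in> ?D"
    using chart_open_image[OF c W(1)] W(2) x by auto
  have f': "has_partial i (\<lambda>y. f (inv_into U \<phi> y)) (chart_diff U \<phi> i f x) (\<phi> x)"
    and g': "has_partial i (\<lambda>y. g (inv_into U \<phi> y)) (chart_diff U \<phi> i g x) (\<phi> x)"
    unfolding chart_diff_def using smooth_onD[OF f c] smooth_onD[OF g c] D(2) i by (auto intro: cinf_on_has_partial)
  have inv: "inv_into U \<phi> (\<phi> x) = x"
    using chart_inverse[OF c] x W(2) by auto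
  show "chart_diff U \<phi> i (\<lambda>x. f x + g x) x = chart_diff U \<phi> i f x + chart_diff U \<phi> i g x"
    unfolding chart_diff_def[of _ _ _ "\<lambda>x. f x + g x"]
    by (rule has_partial_partial) (use DERIV_add[OF f'[unfolded has_partial_def] g'[unfolded has_partial_def]] in \<open>simp add: has_partial_def\<close>)
  show "chart_diff U \<phi> i (\<lambda>x. f x * g x) x = chart_diff U \<phi> i f x * g x + f x * chart_diff U \<phi> i g x"
    unfolding chart_diff_def[of _ _ _ "\<lambda>x. f x * g x"]
    by (rule has_partial_partial)
      (use DERIV_mult[OF f'[unfolded has_partial_def] g'[unfolded has_partial_def]] in \<open>simp add: has_partial_def inv algebra_simps\<close>)
  assume j: "j < n"
  have eq: "partial k (\<lambda>y. chart_diff U \<phi> l f (inv_into U \<phi> y)) (\<phi> x) = partial k (partial l (\<lambda>y. f (inv_into U \<phi> y))) (\<phi> x)"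
    if "k < n" for k l
    using chart_inverse[OF c] by (intro partial_cong[OF D that]) (auto simp: chart_diff_def)
  show "chart_diff U \<phi> i (chart_diff U \<phi> j f) x = chart_diff U \<phi> j (chart_diff U \<phi> i f) x"
    unfolding chart_diff_def[of _ _ _ "chart_diff _ _ _ _"] eq[OF i] eq[OF j]
    by (rule partial_commute[OF D(1) smooth_onD[OF f c] i j D(2)])
qed

text \<open>The quotient \<open>a / (a + b)\<close> of flat functions of the scaled squared distance
  \<open>g\<close> is 1 for \<open>g \<le> 1\<close> and 0 for \<open>g \<ge> 2\<close>. Its support
  lies in the image \<open>K\<close> of a compact box in the chart, and compact sets are closed
  because the manifold is Hausdorff; so extension by 0 is smooth on an open cover.\<close>

lemma bump_function:
  assumes W: "open W" and x0: "x0 \<in> W"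
  obtains \<psi> V K where "smooth_on M UNIV \<psi>" "open V" "x0 \<in> V" "V \<subseteq> W" "\<And>x. x \<in> V \<Longrightarrow> \<psi> x = 1"
    "closed K" "K \<subseteq> W" "\<And>x. x \<notin> K \<Longrightarrow> \<psi> x = 0"
proof -
  obtain U \<phi> where c: "(U, \<phi>) \<in> atlas M" and xU: "x0 \<in> U"
    by (rule chart_at)
  have U: "open U"
    using chart_open[OF c] by simp
  obtain d where d: "d > 0" "\<And>z. z \<in> Rn n \<Longrightarrow> (\<And>k. k < n \<Longrightarrow> \<bar>z k - \<phi> x0 k\<bar> < d) \<Longrightarrow> z \<in> \<phi> ` (U \<inter> W)"
    using open_Rn_box[OF chart_open_image[OF c W], of "\<phi> x0"] xU x0 by auto
  \<comment> \<open>Chosen such that \<open>g x \<le> 2\<close> bounds the squared distance by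
    \<open>(d / 2)\<^sup>2\<close>, hence each coordinate difference by
    \<open>d / 2\<close>.\<close>
  define e where "e = (d / 2)\<^sup>2 / 2"
  have e: "e > 0"
    using d(1) by (simp add: e_def)
  define g where "g x = (\<Sum>i<n. (\<phi> x i - \<phi> x0 i) * (\<phi> x i - \<phi> x0 i)) / e" for x
  have g: "smooth_on M U g"
    unfolding g_def using U e smooth_on_coordinate[OF c]
    by (intro smooth_on_divide smooth_on_sum smooth_on_mult smooth_on_diff) auto
  define B where "B = (\<Pi>\<^sub>E i\<in>UNIV. if i < n then {\<phi> x0 i - d / 2 .. \<phi> x0 i + d / 2} else {0})"
  have B: "compact B"
  proof -
    have "compactin (product_topology (\<lambda>i. euclidean) UNIV) B"
      unfolding B_def compactin_PiE by auto
    then show ?thesis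
      by (simp add: euclidean_product_topology)
  qed
  have B_sub: "B \<subseteq> \<phi> ` (U \<inter> W)"
  proof
    fix z assume "z \<in> B"
    then have z: "z i \<in> (if i < n then {\<phi> x0 i - d / 2 .. \<phi> x0 i + d / 2} else {0})" for i
      by (auto simp: B_def PiE_iff)
    show "z \<in> \<phi> ` (U \<inter> W)"
    proof (rule d(2))
      show "z \<in> Rn n"
      proof -
        have "z i = 0" if "n \<le> i" for i
          using z[of i] that by simp
        then show ?thesis
          by (simp add: Rn_def)
      qed
      show "\<bar>z k - \<phi> x0 k\<bar> < d" if "k < n" for k
        using z[of k] that d(1) by (auto simp: abs_if)
    qed
  qed
  define K where "K = inv_into U \<phi> ` B"
  have K: "closed K" "K \<subseteq> U \<inter> W"
  proof -
    have "continuous_on B (inv_into U \<phi>)"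
      using chart_homeomorphism[OF c] B_sub by (auto simp: homeomorphism_def intro: continuous_on_subset)
    then show "closed K"
      unfolding K_def using B by (intro compact_imp_closed compact_continuous_image)
    show "K \<subseteq> U \<inter> W"
      unfolding K_def using B_sub chart_inverse[OF c] by fastforce
  qed
  have g2: "x \<in> K" if x: "x \<in> U" "g x \<le> 2" for x
  proof -
    have bd: "\<bar>\<phi> x i - \<phi> x0 i\<bar> \<le> d / 2" if i: "i < n" for i
    proof -
      have "(\<phi> x i - \<phi> x0 i) * (\<phi> x i - \<phi> x0 i) \<le> (\<Sum>i<n. (\<phi> x i - \<phi> x0 i) * (\<phi> x i - \<phi> x0 i))"
        by (rule member_le_sum) (use i in auto)
      also have "\<dots> \<le> (d / 2)\<^sup>2"
        using x(2) e by (simp add: g_def e_def field_simps)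
      finally have "(\<phi> x i - \<phi> x0 i)\<^sup>2 \<le> (d / 2)\<^sup>2"
        by (simp only: power2_eq_square)
      then show ?thesis
        using d(1) abs_le_square_iff[of "\<phi> x i - \<phi> x0 i" "d / 2"] by simp
    qed
    have "\<phi> x i \<in> (if i < n then {\<phi> x0 i - d / 2 .. \<phi> x0 i + d / 2} else {0})" for i
    proof (cases "i < n")
      case True
      then show ?thesis
        using bd[OF True, unfolded abs_le_iff] True by auto
    next
      case False
      then show ?thesis
        using chart_Rn[OF c x(1)] by (simp add: Rn_def)
    qed
    then have "\<phi> x \<in> B"
      by (simp add: B_def PiE_iff)
    then show ?thesis
      unfolding K_def using chart_inverse[OF c x(1)] by (intro image_eqI[where x = "\<phi> x"]) simp_all
  qed
  \<comment> \<open>At least one of \<open>g x < 2\<close> and \<open>g x > 1\<close> holds, so the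
    two functions never vanish together.\<close>
  define a b where "a x = flat_deriv 0 (2 - g x)" and "b x = flat_deriv 0 (g x - 1)" for x
  have "smooth_on M U (\<lambda>x. 2 - g x)" "smooth_on M U (\<lambda>x. g x - 1)"
    using U g by (simp_all add: smooth_on_diff)
  then have ab: "smooth_on M U a" "smooth_on M U b"
    unfolding a_def b_def using U flat_deriv_DERIV
    by (auto intro: smooth_on_comp1[of U _ UNIV flat_deriv 0])
  have pos: "a x + b x > 0" for x
    using flat_pos[of "2 - g x"] flat_pos[of "g x - 1"]
    by (cases "g x < 2") (auto simp: a_def b_def add_pos_nonneg add_nonneg_pos)
  define \<psi> where "\<psi> x = (if x \<in> U then a x / (a x + b x) else 0)" for x
  have \<psi>0: "\<psi> x = 0" if "x \<notin> K" for x
    using g2[of x] that flat_pos(3)[of "2 - g x"] by (auto simp: \<psi>_def a_def)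
  have "smooth_on M U \<psi>"
  proof (rule smooth_on_cong[OF U])
    show "smooth_on M U (\<lambda>x. a x / (a x + b x))"
      using U ab pos by (intro smooth_on_divide smooth_on_add) (auto simp: less_imp_neq[symmetric] dest: less_imp_neq)
  qed (simp add: \<psi>_def)
  moreover have "smooth_on M (- K) \<psi>"
    by (rule smooth_on_cong[OF _ _ smooth_on_const[of _ 0]]) (use K(1) \<psi>0 in auto)
  ultimately have "smooth_on M UNIV \<psi>"
    using K U by (intro smooth_on_local) (auto intro: exI[of _ U] exI[of _ "- K"])
  moreover define V where "V = {x \<in> U. g x < 1} \<inter> W"
  have "open V"
  proof -
    have "open (U \<inter> g -` {..<1})"
      using smooth_on_continuous[OF U g] U by (rule continuous_open_preimage) simp
    moreover have "U \<inter> g -` {..<1} = {x \<in> U. g x < 1}"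
      by auto
    ultimately have "open {x \<in> U. g x < 1}"
      by simp
    then show ?thesis
      using W by (auto simp: V_def)
  qed
  moreover have "x0 \<in> V"
    using x0 xU by (simp add: V_def g_def)
  moreover have "\<psi> x = 1" if "x \<in> V" for x
    using that flat_pos(2)[of "2 - g x"] flat_pos(3)[of "g x - 1"] by (auto simp: V_def \<psi>_def a_def b_def)
  ultimately show ?thesis
    using that[of \<psi> V K] K \<psi>0 by (auto simp: V_def)
qed

lemma cutoff_function:
  assumes U: "open U" and \<psi>: "smooth_on M UNIV \<psi>" "closed K" "K \<subseteq> U" "\<And>x. x \<notin> K \<Longrightarrow> \<psi> x = 0" and h: "smooth_on M U h"
  shows "smooth_on M UNIV (\<lambda>x. if x \<in> U then \<psi> x * h x else 0)"
proof (rule smooth_on_local[OF open_UNIV])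
  fix x
  have "smooth_on M U (\<lambda>x. if x \<in> U then \<psi> x * h x else 0)"
    by (rule smooth_on_cong[OF U _ smooth_on_mult[OF U smooth_on_subset[OF \<psi>(1)] h]]) auto
  moreover have "smooth_on M (- K) (\<lambda>x. if x \<in> U then \<psi> x * h x else 0)"
    by (rule smooth_on_cong[OF _ _ smooth_on_const[of _ 0]]) (use \<psi>(2,4) in auto)
  ultimately show "\<exists>V. open V \<and> x \<in> V \<and> smooth_on M V (\<lambda>x. if x \<in> U then \<psi> x * h x else 0)"
    using U \<psi>(2,3) by (cases "x \<in> K") (auto intro: exI[of _ U] exI[of _ "- K"])
qed

end

section \<open>Sections of vector bundles\<close>

lemma lin_onD:
  assumes "lin_on U W f"
  shows "u \<in> U \<Longrightarrow> f u \<in> W" "u \<in> U \<Longrightarrow> v \<in> U \<Longrightarrow> f (u + v) = f u + f v" "u \<in> U \<Longrightarrow> f (c *\<^sub>R u) = c *\<^sub>R f u"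
  using assms by (auto simp: lin_on_def)

lemma lin_on_zero: "lin_on U W f \<Longrightarrow> subspace U \<Longrightarrow> f 0 = 0"
  using lin_onD(3)[of U W f 0 0] subspace_0[of U] by simp

lemma lin_on_sum:
  assumes "lin_on U W f" "subspace U" "\<And>a. a \<in> A \<Longrightarrow> g a \<in> U"
  shows "f (sum g A) = (\<Sum>a\<in>A. f (g a))"
  using assms(3)
  by (induction A rule: infinite_finite_induct)
    (simp_all add: lin_on_zero[OF assms(1,2)] lin_onD(2)[OF assms(1)] subspace_sum[OF assms(2)])

context
  fixes E :: "('m, 'v::real_vector) vbundle" and es :: "('m \<Rightarrow> 'v) list" and x :: 'm
  assumes basis: "basis_at E es x"
begin

lemma basis_at_distinct: "j < length es \<Longrightarrow> k < length es \<Longrightarrow> (es ! j) x = (es ! k) x \<longleftrightarrow> j = k"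
proof -
  have "distinct (map (\<lambda>e. e x) es)"
    using basis by (simp add: basis_at_def Let_def)
  then show "j < length es \<Longrightarrow> k < length es \<Longrightarrow> ?thesis"
    using nth_eq_iff_index_eq[of "map (\<lambda>e. e x) es" j k] by simp
qed

lemma basis_at_independent: "independent ((\<lambda>e. e x) ` set es)" and basis_at_span: "span ((\<lambda>e. e x) ` set es) = fib E x"
  using basis by (simp_all add: basis_at_def Let_def)

lemma subspace_fib: "subspace (fib E x)"
  using basis_at_span subspace_span by metis

lemma frame_in_fib: "j < length es \<Longrightarrow> (es ! j) x \<in> fib E x"
  using basis_at_span span_base[of "(es ! j) x" "(\<lambda>e. e x) ` set es"] by simp

lemma image_eq_nth: "(\<lambda>e. e x) ` set es = (\<lambda>j. (es ! j) x) ` {..<length es}"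
  by (force simp: in_set_conv_nth)

lemma frame_expansion: "v \<in> fib E x \<Longrightarrow> (\<Sum>j<length es. frame_coeff es j x v *\<^sub>R (es ! j) x) = v"
proof -
  let ?B = "(\<lambda>e. e x) ` set es"
  assume "v \<in> fib E x"
  then have "(\<Sum>b\<in>?B. representation ?B v b *\<^sub>R b) = v"
    using basis_at_independent basis_at_span by (intro sum_representation_eq) auto
  also have "(\<Sum>b\<in>?B. representation ?B v b *\<^sub>R b) = (\<Sum>j<length es. representation ?B v ((es ! j) x) *\<^sub>R (es ! j) x)"
    unfolding image_eq_nth by (subst sum.reindex) (auto simp: inj_on_def basis_at_distinct)
  finally show ?thesis
    by (simp add: frame_coeff_def)
qed

lemma frame_coeff_add: "u \<in> fib E x \<Longrightarrow> v \<in> fib E x \<Longrightarrow> frame_coeff es j x (u + v) = frame_coeff es j x u + frame_coeff es j x v"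
  using basis_at_independent basis_at_span by (simp add: frame_coeff_def representation_add)

lemma frame_coeff_scaleR: "v \<in> fib E x \<Longrightarrow> frame_coeff es j x (c *\<^sub>R v) = c * frame_coeff es j x v"
  using basis_at_independent basis_at_span by (simp add: frame_coeff_def representation_scale)

lemma lin_on_frame_coeff: "lin_on (fib E x) UNIV (frame_coeff es j x)"
  by (simp add: lin_on_def frame_coeff_add frame_coeff_scaleR)

lemma frame_coeff_frame: "j < length es \<Longrightarrow> k < length es \<Longrightarrow> frame_coeff es j x ((es ! k) x) = (if j = k then 1 else 0)"
  using basis_at_independent by (simp add: frame_coeff_def representation_basis basis_at_distinct)

lemma frame_combination_in_fib: "(\<Sum>j<length es. c j *\<^sub>R (es ! j) x) \<in> fib E x"
  using frame_in_fib by (intro subspace_sum[OF subspace_fib] subspace_scale[OF subspace_fib]) auto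

lemma frame_coeff_combination: "k < length es \<Longrightarrow> frame_coeff es k x (\<Sum>j<length es. c j *\<^sub>R (es ! j) x) = c k"
proof -
  assume k: "k < length es"
  have "frame_coeff es k x (\<Sum>j<length es. c j *\<^sub>R (es ! j) x) = (\<Sum>j<length es. frame_coeff es k x (c j *\<^sub>R (es ! j) x))"
    using frame_in_fib by (intro lin_on_sum[OF lin_on_frame_coeff subspace_fib] subspace_scale[OF subspace_fib]) auto
  also have "\<dots> = (\<Sum>j<length es. if k = j then c j else 0)"
    using frame_in_fib k by (intro sum.cong) (auto simp: frame_coeff_scaleR frame_coeff_frame)
  finally show ?thesis
    using k by simp
qed

lemma frame_dim: "length es = dim (fib E x)"
proof -
  have "card ((\<lambda>e. e x) ` set es) = length es"
    using basis distinct_card[of "map (\<lambda>e. e x) es"] by (simp add: basis_at_def Let_def)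
  moreover have "card ((\<lambda>e. e x) ` set es) = dim (fib E x)"
    unfolding basis_at_span[symmetric] dim_span by (rule dim_eq_card_independent[OF basis_at_independent, symmetric])
  ultimately show ?thesis
    by simp
qed

lemma fib_dual: "fib (dual_bundle E) x = {\<alpha>. lin_on (fib E x) UNIV \<alpha> \<and> (\<forall>v. v \<notin> fib E x \<longrightarrow> \<alpha> v = 0)}"
  by (simp add: dual_bundle_def)

lemma dual_elt_fib: "dual_elt E es j x \<in> fib (dual_bundle E) x"
  using subspace_fib by (auto simp: fib_dual lin_on_def dual_elt_def frame_coeff_add frame_coeff_scaleR subspace_add subspace_scale)

lemma dual_expansion:
  assumes "\<alpha> \<in> fib (dual_bundle E) x"
  shows "\<alpha> = (\<Sum>j<length es. \<alpha> ((es ! j) x) *\<^sub>R dual_elt E es j x)"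
proof
  fix v
  show "\<alpha> v = (\<Sum>j<length es. \<alpha> ((es ! j) x) *\<^sub>R dual_elt E es j x) v"
  proof (cases "v \<in> fib E x")
    case True
    have "\<alpha> v = \<alpha> (\<Sum>j<length es. frame_coeff es j x v *\<^sub>R (es ! j) x)"
      using True by (simp add: frame_expansion)
    also have "\<dots> = (\<Sum>j<length es. \<alpha> (frame_coeff es j x v *\<^sub>R (es ! j) x))"
      using assms frame_in_fib subspace_fib
      by (intro lin_on_sum[of _ UNIV, OF _ subspace_fib] subspace_scale) (auto simp: fib_dual)
    also have "\<dots> = (\<Sum>j<length es. \<alpha> ((es ! j) x) * dual_elt E es j x v)"
      using assms frame_in_fib True by (intro sum.cong) (auto simp: fib_dual lin_onD(3) dual_elt_def)
    finally show ?thesis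
      by (simp add: sum_fun_apply)
  next
    case False
    then show ?thesis
      using assms by (simp add: fib_dual sum_fun_apply dual_elt_def)
  qed
qed

lemma dual_eqI:
  assumes "\<alpha> \<in> fib (dual_bundle E) x" "\<beta> \<in> fib (dual_bundle E) x"
    and "\<And>j. j < length es \<Longrightarrow> \<alpha> ((es ! j) x) = \<beta> ((es ! j) x)"
  shows "\<alpha> = \<beta>"
  using dual_expansion[OF assms(1)] dual_expansion[OF assms(2)] assms(3) by simp

lemma dual_elt_frame: "j < length es \<Longrightarrow> k < length es \<Longrightarrow> dual_elt E es j x ((es ! k) x) = (if j = k then 1 else 0)"
  by (simp add: dual_elt_def frame_in_fib frame_coeff_frame)

lemma fib_eqI:
  assumes "u \<in> fib E x" "v \<in> fib E x" "\<And>\<alpha>. \<alpha> \<in> fib (dual_bundle E) x \<Longrightarrow> \<alpha> u = \<alpha> v"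
  shows "u = v"
proof -
  have "frame_coeff es j x u = frame_coeff es j x v" for j
    using assms(3)[OF dual_elt_fib[of j]] assms(1,2) by (simp add: dual_elt_def)
  then have "(\<Sum>j<length es. frame_coeff es j x u *\<^sub>R (es ! j) x) = (\<Sum>j<length es. frame_coeff es j x v *\<^sub>R (es ! j) x)"
    by (simp only:)
  then show ?thesis
    unfolding frame_expansion[OF assms(1)] frame_expansion[OF assms(2)] .
qed

lemma subspace_dual_fib: "subspace (fib (dual_bundle E) x)"
proof (rule subspaceI)
  show "0 \<in> fib (dual_bundle E) x"
    by (simp add: fib_dual lin_on_def)
  show "\<alpha> + \<beta> \<in> fib (dual_bundle E) x" if "\<alpha> \<in> fib (dual_bundle E) x" "\<beta> \<in> fib (dual_bundle E) x" for \<alpha> \<beta>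
    using that unfolding fib_dual lin_on_def by (simp add: algebra_simps)
  show "c *\<^sub>R \<alpha> \<in> fib (dual_bundle E) x" if "\<alpha> \<in> fib (dual_bundle E) x" for c \<alpha>
    using that unfolding fib_dual lin_on_def by (simp add: algebra_simps)
qed

lemma dual_basis_at: "basis_at (dual_bundle E) (map (dual_elt E es) [0..<length es]) x"
proof -
  let ?d = "\<lambda>j. dual_elt E es j x"
  have inj: "inj_on ?d {..<length es}"
  proof (rule inj_onI)
    fix j k assume jk: "j \<in> {..<length es}" "k \<in> {..<length es}" "?d j = ?d k"
    then have "?d k ((es ! j) x) = 1"
      using dual_elt_frame[of j j] by simp
    then show "j = k"
      using dual_elt_frame[of k j] jk by (auto split: if_splits)
  qed
  have "independent (?d ` {..<length es})"
  proof (rule independent_if_scalars_zero)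
    fix f v assume f: "(\<Sum>v\<in>?d ` {..<length es}. f v *\<^sub>R v) = 0" and v: "v \<in> ?d ` {..<length es}"
    then obtain k where k: "k < length es" "v = ?d k"
      by auto
    have "(\<Sum>v\<in>?d ` {..<length es}. f v *\<^sub>R v) ((es ! k) x) = (\<Sum>j<length es. f (?d j) * ?d j ((es ! k) x))"
      by (subst sum.reindex[OF inj]) (simp add: sum_fun_apply)
    also have "\<dots> = (\<Sum>j<length es. if j = k then f (?d j) else 0)"
      using k(1) by (intro sum.cong refl) (simp add: dual_elt_frame)
    finally have "(\<Sum>v\<in>?d ` {..<length es}. f v *\<^sub>R v) ((es ! k) x) = f (?d k)"
      using k(1) by simp
    then show "f v = 0"
      using f k by simp
  qed simp
  moreover have "span (?d ` {..<length es}) = fib (dual_bundle E) x"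
  proof
    show "span (?d ` {..<length es}) \<subseteq> fib (dual_bundle E) x"
      using dual_elt_fib by (intro span_minimal subspace_dual_fib) auto
    show "fib (dual_bundle E) x \<subseteq> span (?d ` {..<length es})"
    proof
      fix \<alpha> assume "\<alpha> \<in> fib (dual_bundle E) x"
      then have "\<alpha> = (\<Sum>j<length es. \<alpha> ((es ! j) x) *\<^sub>R ?d j)"
        by (rule dual_expansion)
      also have "\<dots> \<in> span (?d ` {..<length es})"
        by (intro span_sum span_scale span_base) auto
      finally show "\<alpha> \<in> span (?d ` {..<length es})" .
    qed
  qed
  moreover have "set (map ?d [0..<length es]) = ?d ` {..<length es}"
    by auto
  ultimately show ?thesis
    using inj by (simp add: basis_at_def Let_def o_def distinct_map atLeast0LessThan)
qed

end

lemma dual_frame_coeff: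
  assumes "basis_at E es x" "\<alpha> \<in> fib (dual_bundle E) x" "j < length es"
  shows "frame_coeff (map (dual_elt E es) [0..<length es]) j x \<alpha> = \<alpha> ((es ! j) x)"
proof -
  let ?d = "map (dual_elt E es) [0..<length es]"
  have "\<alpha> = (\<Sum>j<length ?d. \<alpha> ((es ! j) x) *\<^sub>R (?d ! j) x)"
    using dual_expansion[OF assms(1,2)] by simp
  then show ?thesis
    using frame_coeff_combination[OF dual_basis_at[OF assms(1)], of j "\<lambda>j. \<alpha> ((es ! j) x)"] assms(3) by simp
qed

lemma double_dual:
  assumes b: "basis_at E es x" and \<phi>: "lin_on (fib (dual_bundle E) x) UNIV \<phi>"
  defines "v \<equiv> \<Sum>j<length es. \<phi> (dual_elt E es j x) *\<^sub>R (es ! j) x"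
  shows "v \<in> fib E x" "\<And>\<alpha>. \<alpha> \<in> fib (dual_bundle E) x \<Longrightarrow> \<alpha> v = \<phi> \<alpha>"
proof -
  show v: "v \<in> fib E x"
    unfolding v_def by (rule frame_combination_in_fib[OF b])
  fix \<alpha> assume \<alpha>: "\<alpha> \<in> fib (dual_bundle E) x"
  have "\<alpha> v = (\<Sum>j<length es. \<alpha> (\<phi> (dual_elt E es j x) *\<^sub>R (es ! j) x))"
    unfolding v_def using \<alpha> subspace_fib[OF b] frame_in_fib[OF b]
    by (intro lin_on_sum[where W = UNIV and U = "fib E x"] subspace_scale) (auto simp: fib_dual[OF b])
  also have "\<dots> = (\<Sum>j<length es. \<alpha> ((es ! j) x) * \<phi> (dual_elt E es j x))"
    using \<alpha> frame_in_fib[OF b] by (intro sum.cong) (auto simp: fib_dual[OF b] lin_onD(3))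
  also have "\<dots> = (\<Sum>j<length es. \<phi> (\<alpha> ((es ! j) x) *\<^sub>R dual_elt E es j x))"
    using lin_onD(3)[OF \<phi> dual_elt_fib[OF b]] by simp
  also have "\<dots> = \<phi> (\<Sum>j<length es. \<alpha> ((es ! j) x) *\<^sub>R dual_elt E es j x)"
    using dual_elt_fib[OF b] subspace_dual_fib[OF b]
    by (intro lin_on_sum[OF \<phi>, symmetric] subspace_scale) auto
  also have "\<dots> = \<phi> \<alpha>"
    using dual_expansion[OF b \<alpha>] by simp
  finally show "\<alpha> v = \<phi> \<alpha>" .
qed

text \<open>The common form of \<open>H_sharp\<close>, \<open>H_nat\<close> and
  \<open>K_flat\<close>: identification of a finite-dimensional fibre with its bidual.\<close>

definition riesz :: "('m, 'v::real_vector) vbundle \<Rightarrow> 'm \<Rightarrow> (('v \<Rightarrow> real) \<Rightarrow> real) \<Rightarrow> 'v" where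
  "riesz E x \<phi> = (THE v. v \<in> fib E x \<and> (\<forall>\<alpha>\<in>fib (dual_bundle E) x. \<alpha> v = \<phi> \<alpha>))"

lemma riesz:
  assumes b: "basis_at E es x" and \<phi>: "lin_on (fib (dual_bundle E) x) UNIV \<phi>"
  shows "riesz E x \<phi> \<in> fib E x" "\<And>\<alpha>. \<alpha> \<in> fib (dual_bundle E) x \<Longrightarrow> \<alpha> (riesz E x \<phi>) = \<phi> \<alpha>"
proof -
  have "\<exists>!v. v \<in> fib E x \<and> (\<forall>\<alpha>\<in>fib (dual_bundle E) x. \<alpha> v = \<phi> \<alpha>)"
    using double_dual[OF b \<phi>] fib_eqI[OF b] by (intro ex1I) auto
  then have "riesz E x \<phi> \<in> fib E x \<and> (\<forall>\<alpha>\<in>fib (dual_bundle E) x. \<alpha> (riesz E x \<phi>) = \<phi> \<alpha>)"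
    unfolding riesz_def by (rule theI')
  then show "riesz E x \<phi> \<in> fib E x" "\<And>\<alpha>. \<alpha> \<in> fib (dual_bundle E) x \<Longrightarrow> \<alpha> (riesz E x \<phi>) = \<phi> \<alpha>"
    by auto
qed

lemma smul_zero: "smul (\<lambda>_. 0) s = 0"
  by (auto simp: smul_def)

lemma lin_on_cong: "subspace U \<Longrightarrow> lin_on U W f \<Longrightarrow> (\<And>u. u \<in> U \<Longrightarrow> f u = g u) \<Longrightarrow> lin_on U W g"
  unfolding lin_on_def by (metis subspace_add subspace_scale)

lemma lin_on_neg: "subspace W \<Longrightarrow> lin_on U W f \<Longrightarrow> lin_on U W (\<lambda>u. - f u)"
  unfolding lin_on_def by (simp add: subspace_neg)

lemma skew2_on_neg: "subspace W \<Longrightarrow> skew2_on U W f \<Longrightarrow> skew2_on U W (\<lambda>u v. - f u v)"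
  unfolding skew2_on_def bilin_on_def
proof (intro conjI ballI)
  assume W: "subspace W" and f: "((\<forall>v\<in>U. lin_on U W (\<lambda>u. f u v)) \<and> (\<forall>u\<in>U. lin_on U W (f u))) \<and> (\<forall>u\<in>U. \<forall>v\<in>U. f u v = - f v u)"
  show "lin_on U W (\<lambda>u. - f u v)" "lin_on U W (\<lambda>u. - f v u)" if "v \<in> U" for v
    using f that by (auto intro: lin_on_neg[OF W])
  show "- f u v = - (- f v u)" if "u \<in> U" "v \<in> U" for u v
    using f that by (metis minus_minus)
qed

context smooth_manifold
begin

section \<open>Linear equations with smooth coefficients\<close>

lemma smooth_on_det:
  assumes W: "open W" and a: "\<And>i j. i < r \<Longrightarrow> j < r \<Longrightarrow> smooth_on M W (a i j)"
  shows "smooth_on M W (\<lambda>x. Determinant.det (mat r r (\<lambda>(i, j). a i j x)))"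
proof -
  have "Determinant.det (mat r r (\<lambda>(i, j). a i j x)) =
      (\<Sum>p | p permutes {0..<r}. signof p * (\<Prod>i = 0..<r. a i (p i) x))" for x
    by (subst det_def'[of _ r]) (auto intro!: sum.cong prod.cong arg_cong2[where f = "(*)"])
  then show ?thesis
    using W by (auto intro!: smooth_on_sum smooth_on_mult smooth_on_prod a)
qed

lemma mat_delete_mat: "mat_delete (mat r r (\<lambda>(i, j). a i j)) k l = mat (r - 1) (r - 1) (\<lambda>(i, j). a (insert_index k i) (insert_index l j))"
  by (rule eq_matI) (auto simp: mat_delete_def insert_index_def)

lemma smooth_on_cofactor:
  assumes W: "open W" and a: "\<And>i j. i < r \<Longrightarrow> j < r \<Longrightarrow> smooth_on M W (a i j)" and kl: "k < r" "l < r"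
  shows "smooth_on M W (\<lambda>x. cofactor (mat r r (\<lambda>(i, j). a i j x)) k l)"
  unfolding cofactor_def mat_delete_mat
  using W kl by (intro smooth_on_mult smooth_on_const smooth_on_det a) (auto simp: insert_index_def)

text \<open>The left inverse \<open>b\<close> shows that the determinant has no zeros. Then the
  solution is the adjugate applied to \<open>s\<close>, divided by the determinant, and cofactors
  are polynomial in the smooth entries.\<close>

lemma smooth_on_matrix_solution:
  fixes r k :: nat and a b :: "nat \<Rightarrow> nat \<Rightarrow> 'm \<Rightarrow> real"
  assumes W: "open W" and a: "\<And>i j. i < r \<Longrightarrow> j < r \<Longrightarrow> smooth_on M W (a i j)"
    and s: "\<And>i. i < r \<Longrightarrow> smooth_on M W (s i)"
    and inv: "\<And>x i j. x \<in> W \<Longrightarrow> i < r \<Longrightarrow> j < r \<Longrightarrow> (\<Sum>l<r. b i l x * a l j x) = (if i = j then 1 else (0::real))"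
    and eq: "\<And>x i. x \<in> W \<Longrightarrow> i < r \<Longrightarrow> (\<Sum>j<r. a i j x * c j x) = s i x"
    and k: "k < r"
  shows "smooth_on M W (c k)"
proof -
  define A where "A x = mat r r (\<lambda>(i, j). a i j x)" for x
  have A: "A x \<in> carrier_mat r r" for x
    by (simp add: A_def)
  have det: "Determinant.det (A x) \<noteq> 0" if x: "x \<in> W" for x
  proof -
    define B where "B = mat r r (\<lambda>(i, j). b i j x)"
    have "B * A x = 1\<^sub>m r"
      using inv[OF x] by (intro eq_matI) (auto simp: A_def B_def scalar_prod_def atLeast0LessThan)
    then have "Determinant.det B * Determinant.det (A x) = 1"
      using Determinant.det_mult[of B r "A x"] A by (simp add: B_def)
    then show ?thesis
      by auto
  qed
  have c: "c k x = (\<Sum>i<r. cofactor (A x) i k * s i x) / Determinant.det (A x)" if x: "x \<in> W" for x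
  proof -
    have adj: "(\<Sum>i<r. cofactor (A x) i k * a i j x) = (if k = j then Determinant.det (A x) else 0)" if j: "j < r" for j
    proof -
      have "(adj_mat (A x) * A x) $$ (k, j) = (Determinant.det (A x) \<cdot>\<^sub>m 1\<^sub>m r) $$ (k, j)"
        using adj_mat(3)[OF A] by simp
      moreover have "(adj_mat (A x) * A x) $$ (k, j) = (\<Sum>i<r. cofactor (A x) i k * a i j x)"
        using k j by (simp add: adj_mat_def scalar_prod_def atLeast0LessThan) (simp add: A_def scalar_prod_def atLeast0LessThan)
      ultimately show ?thesis
        using k j by auto
    qed
    have "(\<Sum>i<r. cofactor (A x) i k * s i x) = (\<Sum>i<r. \<Sum>j<r. cofactor (A x) i k * a i j x * c j x)"
      by (intro sum.cong refl) (simp add: eq[OF x, symmetric] sum_distrib_left mult.assoc)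
    also have "\<dots> = (\<Sum>j<r. (\<Sum>i<r. cofactor (A x) i k * a i j x) * c j x)"
      by (subst sum.swap) (simp add: sum_distrib_right)
    also have "\<dots> = (\<Sum>j<r. if k = j then Determinant.det (A x) * c j x else 0)"
      by (intro sum.cong refl) (simp add: adj)
    also have "\<dots> = Determinant.det (A x) * c k x"
      using k by simp
    finally show ?thesis
      using det[OF x] by simp
  qed
  have "smooth_on M W (\<lambda>x. (\<Sum>i<r. cofactor (A x) i k * s i x) / Determinant.det (A x))"
    unfolding A_def using W a s k det
    by (intro smooth_on_divide smooth_on_sum smooth_on_mult smooth_on_cofactor smooth_on_det) (auto simp: A_def)
  then show ?thesis
    by (rule smooth_on_cong[OF W, rotated]) (simp add: c)
qed

section \<open>Local frames and global sections\<close>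

lemma vector_bundleD:
  assumes "vector_bundle M E" "(U, es) \<in> frames E"
  shows "open U" "local_frame M E U es" "\<And>x. x \<in> U \<Longrightarrow> basis_at E es x"
    "\<And>j. j < length es \<Longrightarrow> smooth_section_on M E U (es ! j)"
  using assms by (auto simp: vector_bundle_def local_frame_def)

lemma frame_at:
  assumes "vector_bundle M E"
  obtains U es where "(U, es) \<in> frames E" "x \<in> U"
proof -
  have "x \<in> (\<Union>(U, es)\<in>frames E. U)"
    using assms by (simp add: vector_bundle_def)
  then show ?thesis
    using that by auto
qed

lemma smooth_sectionD:
  assumes "smooth_section_on M E W s"
  shows "x \<in> W \<Longrightarrow> s x \<in> fib E x"
    "(U, es) \<in> frames E \<Longrightarrow> j < length es \<Longrightarrow> smooth_on M (U \<inter> W) (\<lambda>x. frame_coeff es j x (s x))"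
  using assms by (auto simp: smooth_section_on_def)

lemma smooth_section_on_subset:
  "smooth_section_on M E W s \<Longrightarrow> W' \<subseteq> W \<Longrightarrow> smooth_section_on M E W' s"
  unfolding smooth_section_on_def by (fast intro: smooth_on_subset[OF _ Int_mono[OF subset_refl]])

lemma local_frameD:
  assumes "local_frame M E W fr"
  shows "j < length fr \<Longrightarrow> smooth_section_on M E W (fr ! j)" "x \<in> W \<Longrightarrow> basis_at E fr x"
  using assms by (auto simp: local_frame_def)

text \<open>The coefficients with respect to an arbitrary local frame are obtained from those with respect
  to a frame of the bundle by Cramer's rule.\<close>

lemma smooth_frame_coeff:
  assumes E: "vector_bundle M E" and W: "open W" and fr: "local_frame M E W fr"
    and s: "smooth_section_on M E W s" and k: "k < length fr"
  shows "smooth_on M W (\<lambda>x. frame_coeff fr k x (s x))"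
proof (rule smooth_on_local[OF W])
  fix x0 assume x0: "x0 \<in> W"
  obtain U es where es: "(U, es) \<in> frames E" and xU: "x0 \<in> U"
    by (rule frame_at[OF E])
  note U = vector_bundleD[OF E es]
  have len: "length es = length fr"
    using frame_dim[OF U(3)[OF xU]] frame_dim[OF local_frameD(2)[OF fr x0]] by simp
  have UW: "open (U \<inter> W)"
    using U(1) W by auto
  have "smooth_on M (U \<inter> W) (\<lambda>x. frame_coeff fr k x (s x))"
  proof (rule smooth_on_matrix_solution[OF UW, where c = "\<lambda>k x. frame_coeff fr k x (s x)" and r = "length fr" and
      a = "\<lambda>i j x. frame_coeff es i x ((fr ! j) x)" and s = "\<lambda>i x. frame_coeff es i x (s x)" and
      b = "\<lambda>i j x. frame_coeff fr i x ((es ! j) x)"])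
    show "smooth_on M (U \<inter> W) (\<lambda>x. frame_coeff es i x ((fr ! j) x))" if "i < length fr" "j < length fr" for i j
      using smooth_sectionD(2)[OF local_frameD(1)[OF fr] es] that len by simp
    show "smooth_on M (U \<inter> W) (\<lambda>x. frame_coeff es i x (s x))" if "i < length fr" for i
      using smooth_sectionD(2)[OF s es] that len by simp
    fix x assume x: "x \<in> U \<inter> W"
    have bes: "basis_at E es x" and bfr: "basis_at E fr x"
      using x U(3) local_frameD(2)[OF fr] by auto
    show "(\<Sum>l<length fr. frame_coeff fr i x ((es ! l) x) * frame_coeff es l x ((fr ! j) x)) = (if i = j then 1 else 0)"
      if ij: "i < length fr" "j < length fr" for i j
    proof -
      have "(if i = j then 1 else 0) = frame_coeff fr i x (\<Sum>l<length es. frame_coeff es l x ((fr ! j) x) *\<^sub>R (es ! l) x)"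
        using ij frame_expansion[OF bes frame_in_fib[OF bfr]] frame_coeff_frame[OF bfr] by simp
      also have "\<dots> = (\<Sum>l<length es. frame_coeff fr i x (frame_coeff es l x ((fr ! j) x) *\<^sub>R (es ! l) x))"
        using frame_in_fib[OF bes] subspace_fib[OF bes]
        by (intro lin_on_sum[OF lin_on_frame_coeff[OF bfr]] subspace_scale) auto
      finally show ?thesis
        using frame_in_fib[OF bes] len by (simp add: frame_coeff_scaleR[OF bfr] mult.commute)
    qed
    show "(\<Sum>j<length fr. frame_coeff es i x ((fr ! j) x) * frame_coeff fr j x (s x)) = frame_coeff es i x (s x)" for i
    proof -
      have "s x \<in> fib E x"
        using smooth_sectionD(1)[OF s] x by auto
      then have "frame_coeff es i x (s x) = frame_coeff es i x (\<Sum>j<length fr. frame_coeff fr j x (s x) *\<^sub>R (fr ! j) x)"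
        by (simp add: frame_expansion[OF bfr])
      also have "\<dots> = (\<Sum>j<length fr. frame_coeff es i x (frame_coeff fr j x (s x) *\<^sub>R (fr ! j) x))"
        using frame_in_fib[OF bfr] subspace_fib[OF bfr]
        by (intro lin_on_sum[OF lin_on_frame_coeff[OF bes]] subspace_scale) auto
      finally show ?thesis
        using frame_in_fib[OF bfr] by (simp add: frame_coeff_scaleR[OF bes] mult.commute)
    qed
  qed (rule k)
  then show "\<exists>V. open V \<and> x0 \<in> V \<and> smooth_on M V (\<lambda>x. frame_coeff fr k x (s x))"
    using UW xU x0 by blast
qed

lemma subspace_fibre: "vector_bundle M E \<Longrightarrow> subspace (fib E x)"
  using frame_at[of E x] vector_bundleD(3) subspace_fib by metis

lemma smooth_section_combination:
  assumes E: "vector_bundle M E" and W: "open W"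
    and s: "\<And>j. j \<in> J \<Longrightarrow> smooth_section_on M E W (s j)" and c: "\<And>j. j \<in> J \<Longrightarrow> smooth_on M W (c j)"
  shows "smooth_section_on M E W (\<lambda>x. \<Sum>j\<in>J. c j x *\<^sub>R s j x)"
  unfolding smooth_section_on_def
proof (intro conjI ballI, goal_cases)
  case (1 x)
  then show ?case
    using smooth_sectionD(1)[OF s] subspace_fibre[OF E]
    by (intro subspace_sum subspace_scale) auto
next
  case (2 p)
  obtain U es where p: "p = (U, es)"
    by (cases p)
  note es = 2[unfolded p] and U = vector_bundleD[OF E 2[unfolded p]]
  have UW: "open (U \<inter> W)"
    using U(1) W by auto
  have "smooth_on M (U \<inter> W) (\<lambda>x. frame_coeff es i x (\<Sum>j\<in>J. c j x *\<^sub>R s j x))" if i: "i < length es" for i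
  proof (rule smooth_on_cong[OF UW])
    show "smooth_on M (U \<inter> W) (\<lambda>x. \<Sum>j\<in>J. c j x * frame_coeff es i x (s j x))"
      using UW smooth_sectionD(2)[OF s es i] c
      by (intro smooth_on_sum smooth_on_mult) (auto intro: smooth_on_subset)
    show "(\<Sum>j\<in>J. c j x * frame_coeff es i x (s j x)) = frame_coeff es i x (\<Sum>j\<in>J. c j x *\<^sub>R s j x)"
      if x: "x \<in> U \<inter> W" for x
    proof -
      have b: "basis_at E es x"
        using x U(3) by auto
      have "frame_coeff es i x (\<Sum>j\<in>J. c j x *\<^sub>R s j x) = (\<Sum>j\<in>J. frame_coeff es i x (c j x *\<^sub>R s j x))"
        using x smooth_sectionD(1)[OF s] subspace_fibre[OF E]
        by (intro lin_on_sum[OF lin_on_frame_coeff[OF b] subspace_fib[OF b]] subspace_scale) auto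
      also have "\<dots> = (\<Sum>j\<in>J. c j x * frame_coeff es i x (s j x))"
        using x smooth_sectionD(1)[OF s] by (intro sum.cong refl frame_coeff_scaleR[OF b]) auto
      finally show ?thesis
        by simp
    qed
  qed
  then show ?case
    by (simp add: p)
qed

lemma smooth_section_cong:
  assumes E: "vector_bundle M E" and W: "open W" and eq: "\<And>x. x \<in> W \<Longrightarrow> s x = t x" and s: "smooth_section_on M E W s"
  shows "smooth_section_on M E W t"
  unfolding smooth_section_on_def
proof (intro conjI ballI, goal_cases)
  case (1 x)
  then show ?case
    using smooth_sectionD(1)[OF s] eq by metis
next
  case (2 p)
  obtain U es where p: "p = (U, es)"
    by (cases p)
  have "open (U \<inter> W)"
    using vector_bundleD(1)[OF E 2[unfolded p]] W by auto
  then show ?case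
    using smooth_sectionD(2)[OF s 2[unfolded p]] eq
    by (auto simp: p intro: smooth_on_cong[of _ "\<lambda>x. frame_coeff es _ x (s x)"])
qed

lemma smooth_section_local:
  assumes E: "vector_bundle M E" and W: "open W"
    and loc: "\<And>x. x \<in> W \<Longrightarrow> \<exists>V. open V \<and> x \<in> V \<and> smooth_section_on M E V s"
  shows "smooth_section_on M E W s"
  unfolding smooth_section_on_def
proof (intro conjI ballI, goal_cases)
  case (1 x)
  then show ?case
    using loc smooth_sectionD(1) by metis
next
  case (2 p)
  obtain U es where p: "p = (U, es)"
    by (cases p)
  note es = 2[unfolded p]
  have "smooth_on M (U \<inter> W) (\<lambda>x. frame_coeff es j x (s x))" if j: "j < length es" for j
  proof (rule smooth_on_local)
    show "open (U \<inter> W)"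
      using vector_bundleD(1)[OF E es] W by auto
    fix x assume "x \<in> U \<inter> W"
    then obtain V where "open V" "x \<in> V" "smooth_section_on M E V s" "x \<in> U"
      using loc by blast
    then show "\<exists>V. open V \<and> x \<in> V \<and> smooth_on M V (\<lambda>x. frame_coeff es j x (s x))"
      using smooth_sectionD(2)[OF _ es j] vector_bundleD(1)[OF E es] by (intro exI[of _ "U \<inter> V"]) auto
  qed
  then show ?case
    by (simp add: p)
qed

lemma sections_iff: "s \<in> sections M E \<longleftrightarrow> smooth_section_on M E UNIV s"
  by (simp add: sections_def)

lemma cutoff_section:
  assumes E: "vector_bundle M E" and U: "open U" and s: "smooth_section_on M E U s"
    and \<psi>: "smooth_on M UNIV \<psi>" "closed K" "K \<subseteq> U" "\<And>x. x \<notin> K \<Longrightarrow> \<psi> x = 0"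
  shows "(\<lambda>x. if x \<in> U then \<psi> x *\<^sub>R s x else 0) \<in> sections M E" (is "?S \<in> _")
proof -
  have "smooth_section_on M E U (\<lambda>x. \<Sum>j\<in>{()}. \<psi> x *\<^sub>R s x)"
    using s \<psi>(1) by (intro smooth_section_combination[OF E U]) (auto intro: smooth_on_subset)
  then have 1: "smooth_section_on M E U ?S"
    by (rule smooth_section_cong[OF E U, rotated]) simp
  have "smooth_section_on M E (- K) (\<lambda>x. \<Sum>j\<in>{}. 0 *\<^sub>R s x)"
    using \<psi>(2) by (intro smooth_section_combination[OF E]) auto
  then have 2: "smooth_section_on M E (- K) ?S"
    by (rule smooth_section_cong[OF E, rotated 2]) (use \<psi>(2,4) in auto)
  show ?thesis
    unfolding sections_iff
  proof (rule smooth_section_local[OF E open_UNIV])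
    fix x show "\<exists>V. open V \<and> x \<in> V \<and> smooth_section_on M E V ?S"
      using 1 2 U \<psi>(2,3) by (cases "x \<in> K") (auto intro: exI[of _ U] exI[of _ "- K"])
  qed
qed

text \<open>Multiply by a bump function that is 1 near \<open>x0\<close>. Every germ of a section is
  therefore a germ of a global one, and smoothness conditions stated for global sections can be
  tested on local frames.\<close>

lemma section_extension:
  assumes E: "vector_bundle M E" and W: "open W" and s: "smooth_section_on M E W s" and x0: "x0 \<in> W"
  obtains S V where "S \<in> sections M E" "open V" "x0 \<in> V" "V \<subseteq> W" "\<And>x. x \<in> V \<Longrightarrow> S x = s x"
proof -
  obtain \<psi> V K where \<psi>: "smooth_on M UNIV \<psi>" "open V" "x0 \<in> V" "V \<subseteq> W" "\<And>x. x \<in> V \<Longrightarrow> \<psi> x = 1"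
    "closed K" "K \<subseteq> W" "\<And>x. x \<notin> K \<Longrightarrow> \<psi> x = 0"
    using bump_function[OF W x0] by metis
  show ?thesis
    using \<psi>(2-5) by (intro that[OF cutoff_section[OF E W s \<psi>(1,6,7,8)]]) auto
qed

lemma section_through:
  assumes E: "vector_bundle M E" and v: "v \<in> fib E x"
  obtains S where "S \<in> sections M E" "S x = v"
proof -
  obtain U es where es: "(U, es) \<in> frames E" and x: "x \<in> U"
    by (rule frame_at[OF E])
  note U = vector_bundleD[OF E es]
  have "smooth_section_on M E U (\<lambda>y. \<Sum>j<length es. frame_coeff es j x v *\<^sub>R (es ! j) y)"
    using U by (intro smooth_section_combination[OF E]) auto
  then show ?thesis
  proof (rule section_extension[OF E U(1) _ x])
    fix S V assume "S \<in> sections M E" "x \<in> V"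
      "\<And>y. y \<in> V \<Longrightarrow> S y = (\<Sum>j<length es. frame_coeff es j x v *\<^sub>R (es ! j) y)"
    then show thesis
      using frame_expansion[OF U(3)[OF x] v] by (intro that[of S]) auto
  qed
qed

lemma section_in_fib: "s \<in> sections M E \<Longrightarrow> s x \<in> fib E x"
  by (simp add: sections_def smooth_section_on_def)

lemma section_sum:
  assumes "vector_bundle M E" "\<And>j. j \<in> J \<Longrightarrow> s j \<in> sections M E" "\<And>j. j \<in> J \<Longrightarrow> smooth_on M UNIV (c j)"
  shows "(\<lambda>x. \<Sum>j\<in>J. c j x *\<^sub>R s j x) \<in> sections M E"
  unfolding sections_iff using assms
  by (intro smooth_section_combination[OF assms(1) open_UNIV]) (auto simp: sections_iff)

lemma Cinf_iff: "f \<in> Cinf M \<longleftrightarrow> smooth_on M UNIV f"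
  by (simp add: Cinf_def)

lemma section_smul: "vector_bundle M E \<Longrightarrow> s \<in> sections M E \<Longrightarrow> f \<in> Cinf M \<Longrightarrow> smul f s \<in> sections M E"
  using section_sum[of E "{()}" "\<lambda>_. s" "\<lambda>_. f"] by (simp add: smul_def Cinf_iff)

lemma subspace_sections:
  assumes E: "vector_bundle M E"
  shows "subspace (sections M E)"
proof (rule subspaceI)
  show "0 \<in> sections M E"
    using section_sum[OF E, of "{}"] by (simp add: zero_fun_def)
  fix s t c assume s: "s \<in> sections M E"
  show "c *\<^sub>R s \<in> sections M E"
    using section_sum[OF E, of "{()}" "\<lambda>_. s" "\<lambda>_ _. c"] s by (simp add: scaleR_fun_def)
  assume "t \<in> sections M E"
  then show "s + t \<in> sections M E"
    using section_sum[OF E, of "{True, False}" "\<lambda>b. if b then s else t" "\<lambda>_ _. 1"] s by (simp add: plus_fun_def)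
qed

lemma dual_frames: "frames (dual_bundle E) = (\<lambda>(U, es). (U, map (dual_elt E es) [0..<length es])) ` frames E"
  by (simp add: dual_bundle_def)

lemma smooth_dual_section_iff:
  assumes E: "vector_bundle M E" and W: "open W"
  shows "smooth_section_on M (dual_bundle E) W \<alpha> \<longleftrightarrow> (\<forall>x\<in>W. \<alpha> x \<in> fib (dual_bundle E) x) \<and>
    (\<forall>(U, es)\<in>frames E. \<forall>j<length es. smooth_on M (U \<inter> W) (\<lambda>x. \<alpha> x ((es ! j) x)))"
proof -
  have "smooth_on M (U \<inter> W) (\<lambda>x. frame_coeff (map (dual_elt E es) [0..<length es]) j x (\<alpha> x)) \<longleftrightarrow>
      smooth_on M (U \<inter> W) (\<lambda>x. \<alpha> x ((es ! j) x))"
    if \<alpha>: "\<forall>x\<in>W. \<alpha> x \<in> fib (dual_bundle E) x" and es: "(U, es) \<in> frames E" and j: "j < length es" for U es j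
  proof -
    have eq: "frame_coeff (map (dual_elt E es) [0..<length es]) j x (\<alpha> x) = \<alpha> x ((es ! j) x)" if "x \<in> U \<inter> W" for x
      using that \<alpha> j vector_bundleD(3)[OF E es] by (intro dual_frame_coeff) auto
    have "open (U \<inter> W)"
      using vector_bundleD(1)[OF E es] W by auto
    then show ?thesis
      using eq smooth_on_cong[of "U \<inter> W" "\<lambda>x. frame_coeff (map (dual_elt E es) [0..<length es]) j x (\<alpha> x)" "\<lambda>x. \<alpha> x ((es ! j) x)"]
        smooth_on_cong[of "U \<inter> W" "\<lambda>x. \<alpha> x ((es ! j) x)" "\<lambda>x. frame_coeff (map (dual_elt E es) [0..<length es]) j x (\<alpha> x)"]
      by auto
  qed
  then show ?thesis
    unfolding smooth_section_on_def dual_frames by fastforce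
qed

lemma dual_elt_smooth:
  assumes E: "vector_bundle M E" and W: "open W" and fr: "local_frame M E W fr" and j: "j < length fr"
  shows "smooth_section_on M (dual_bundle E) W (dual_elt E fr j)"
  unfolding smooth_dual_section_iff[OF E W]
proof (intro conjI ballI, goal_cases)
  case (1 x)
  then show ?case
    using local_frameD(2)[OF fr] by (intro dual_elt_fib) auto
next
  case (2 p)
  obtain U es where p: "p = (U, es)"
    by (cases p)
  note es = 2[unfolded p] and U = vector_bundleD[OF E 2[unfolded p]]
  have UW: "open (U \<inter> W)"
    using U(1) W by auto
  have "smooth_on M (U \<inter> W) (\<lambda>x. dual_elt E fr j x ((es ! k) x))" if k: "k < length es" for k
  proof (rule smooth_on_cong[OF UW])
    have "local_frame M E (U \<inter> W) fr"
      using fr by (auto simp: local_frame_def intro: smooth_section_on_subset)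
    then show "smooth_on M (U \<inter> W) (\<lambda>x. frame_coeff fr j x ((es ! k) x))"
      using U(4)[OF k] j by (intro smooth_frame_coeff[OF E UW]) (auto intro: smooth_section_on_subset)
    show "frame_coeff fr j x ((es ! k) x) = dual_elt E fr j x ((es ! k) x)" if "x \<in> U \<inter> W" for x
      using that frame_in_fib[OF U(3) k] by (simp add: dual_elt_def)
  qed
  then show ?case
    by (simp add: p)
qed

lemma vector_bundle_dual:
  assumes E: "vector_bundle M E"
  shows "vector_bundle M (dual_bundle E)"
proof -
  have "open U \<and> local_frame M (dual_bundle E) U (map (dual_elt E es) [0..<length es])" if es: "(U, es) \<in> frames E" for U es
    using vector_bundleD[OF E es] dual_elt_smooth[OF E, of U es]
    by (auto simp: local_frame_def[of _ "dual_bundle E"] intro: dual_basis_at)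
  moreover have "(\<Union>(U, es)\<in>frames (dual_bundle E). U) = UNIV"
    using E unfolding vector_bundle_def dual_frames by auto
  ultimately show ?thesis
    unfolding vector_bundle_def dual_frames by auto
qed

lemma smooth_pairing:
  assumes E: "vector_bundle M E" and W: "open W" and s: "smooth_section_on M E W s"
    and \<alpha>: "smooth_section_on M (dual_bundle E) W \<alpha>"
  shows "smooth_on M W (\<lambda>x. \<alpha> x (s x))"
proof (rule smooth_on_local[OF W])
  fix x0 assume x0: "x0 \<in> W"
  obtain U es where es: "(U, es) \<in> frames E" and xU: "x0 \<in> U"
    by (rule frame_at[OF E])
  note U = vector_bundleD[OF E es]
  have UW: "open (U \<inter> W)"
    using U(1) W by auto
  have "smooth_on M (U \<inter> W) (\<lambda>x. \<alpha> x (s x))"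
  proof (rule smooth_on_cong[OF UW])
    have "\<And>j. j < length es \<Longrightarrow> smooth_on M (U \<inter> W) (\<lambda>x. \<alpha> x ((es ! j) x))"
      using \<alpha> es unfolding smooth_dual_section_iff[OF E W] by auto
    then show "smooth_on M (U \<inter> W) (\<lambda>x. \<Sum>j<length es. frame_coeff es j x (s x) * \<alpha> x ((es ! j) x))"
      using UW smooth_sectionD(2)[OF s es] by (intro smooth_on_sum smooth_on_mult) auto
    show "(\<Sum>j<length es. frame_coeff es j x (s x) * \<alpha> x ((es ! j) x)) = \<alpha> x (s x)" if x: "x \<in> U \<inter> W" for x
    proof -
      have b: "basis_at E es x"
        using U(3) x by auto
      have lin: "lin_on (fib E x) UNIV (\<alpha> x)"
        using smooth_sectionD(1)[OF \<alpha>] x by (auto simp: dual_bundle_def)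
      have "\<alpha> x (s x) = \<alpha> x (\<Sum>j<length es. frame_coeff es j x (s x) *\<^sub>R (es ! j) x)"
        using frame_expansion[OF b] smooth_sectionD(1)[OF s] x by simp
      also have "\<dots> = (\<Sum>j<length es. \<alpha> x (frame_coeff es j x (s x) *\<^sub>R (es ! j) x))"
        using frame_in_fib[OF b] subspace_fib[OF b] by (intro lin_on_sum[OF lin] subspace_scale) auto
      finally show ?thesis
        using frame_in_fib[OF b] by (simp add: lin_onD(3)[OF lin])
    qed
  qed
  then show "\<exists>V. open V \<and> x0 \<in> V \<and> smooth_on M V (\<lambda>x. \<alpha> x (s x))"
    using UW xU x0 by blast
qed

lemma pairing_Cinf:
  "vector_bundle M E \<Longrightarrow> s \<in> sections M E \<Longrightarrow> \<alpha> \<in> sections M (dual_bundle E) \<Longrightarrow> pairing s \<alpha> \<in> Cinf M"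
  using smooth_pairing[of E UNIV s \<alpha>] by (simp add: sections_iff Cinf_iff pairing_def)

lemma dual_section_eqI:
  assumes E: "vector_bundle M E" and "\<alpha> \<in> sections M (dual_bundle E)" "\<beta> \<in> sections M (dual_bundle E)"
    and eq: "\<And>s. s \<in> sections M E \<Longrightarrow> pairing s \<alpha> = pairing s \<beta>"
  shows "\<alpha> = \<beta>"
proof
  fix x
  obtain U es where es: "(U, es) \<in> frames E" and x: "x \<in> U"
    by (rule frame_at[OF E])
  note b = vector_bundleD(3)[OF E es x]
  show "\<alpha> x = \<beta> x"
  proof (rule dual_eqI[OF b])
    show "\<alpha> x ((es ! j) x) = \<beta> x ((es ! j) x)" if j: "j < length es" for j
      using section_through[OF E frame_in_fib[OF b j]] eq unfolding pairing_def fun_eq_iff by metis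
  qed (use assms(2,3) section_in_fib in auto)
qed

section \<open>Tensorial maps and sections of the dual bundle\<close>

definition tensorial :: "('m, 'v::real_vector) vbundle \<Rightarrow> (('m \<Rightarrow> 'v) \<Rightarrow> 'm \<Rightarrow> real) \<Rightarrow> bool" where
  "tensorial E \<Phi> \<longleftrightarrow> (\<forall>s\<in>sections M E. \<Phi> s \<in> Cinf M) \<and>
    (\<forall>s\<in>sections M E. \<forall>t\<in>sections M E. \<Phi> (s + t) = \<Phi> s + \<Phi> t) \<and>
    (\<forall>s\<in>sections M E. \<forall>f\<in>Cinf M. \<Phi> (smul f s) = (\<lambda>x. f x * \<Phi> s x))"

text \<open>For a cut-off function \<open>\<psi>\<close> with \<open>\<psi> x\<^sub>0 = 1\<close>, the section \<open>\<psi>\<^sup>2 s\<close> is a combination of global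
  sections whose coefficients vanish at \<open>x\<^sub>0\<close>.\<close>

lemma tensorial_zero:
  assumes E: "vector_bundle M E" and \<Phi>: "tensorial E \<Phi>" and s: "s \<in> sections M E" and s0: "s x0 = 0"
  shows "\<Phi> s x0 = 0"
proof -
  obtain U es where es: "(U, es) \<in> frames E" and x0: "x0 \<in> U"
    by (rule frame_at[OF E])
  note U = vector_bundleD[OF E es]
  obtain \<psi> V K where \<psi>: "smooth_on M UNIV \<psi>" "open V" "x0 \<in> V" "V \<subseteq> U" "\<And>x. x \<in> V \<Longrightarrow> \<psi> x = 1"
    "closed K" "K \<subseteq> U" "\<And>x. x \<notin> K \<Longrightarrow> \<psi> x = 0"
    using bump_function[OF U(1) x0] by metis
  define S where "S j x = (if x \<in> U then \<psi> x *\<^sub>R (es ! j) x else 0)" for j x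
  have S: "S j \<in> sections M E" if "j < length es" for j
    unfolding S_def by (rule cutoff_section[OF E U(1) U(4)[OF that] \<psi>(1,6,7,8)])
  define h where "h j x = (if x \<in> U then \<psi> x * frame_coeff es j x (s x) else 0)" for j x
  have h: "h j \<in> Cinf M" if "j < length es" for j
    unfolding h_def Cinf_iff
    by (rule cutoff_function[OF U(1) \<psi>(1,6,7,8) smooth_sectionD(2)[OF s[unfolded sections_iff] es that, unfolded Int_UNIV_right]])
  have sum_in: "(\<Sum>j\<in>J. smul (h j) (S j)) \<in> sections M E" if "J \<subseteq> {..<length es}" for J
    using that S h by (intro subspace_sum[OF subspace_sections[OF E]] section_smul[OF E]) auto
  have "finite J \<Longrightarrow> J \<subseteq> {..<length es} \<Longrightarrow> \<Phi> (\<Sum>j\<in>J. smul (h j) (S j)) = (\<lambda>x. \<Sum>j\<in>J. h j x * \<Phi> (S j) x)" for J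
  proof (induction J rule: finite_induct)
    case empty
    have "\<Phi> (smul (\<lambda>_. 0) 0) = (\<lambda>x. 0)"
      using \<Phi> subspace_0[OF subspace_sections[OF E]] by (auto simp: tensorial_def Cinf_iff)
    then show ?case
      by (simp only: smul_zero sum.empty)
  next
    case (insert k J)
    have "\<Phi> (smul (h k) (S k) + (\<Sum>j\<in>J. smul (h j) (S j))) = \<Phi> (smul (h k) (S k)) + \<Phi> (\<Sum>j\<in>J. smul (h j) (S j))"
      using \<Phi> insert.prems sum_in[of J] section_smul[OF E S h] by (auto simp: tensorial_def)
    also have "\<Phi> (smul (h k) (S k)) = (\<lambda>x. h k x * \<Phi> (S k) x)"
      using insert.prems \<Phi> S h by (simp add: tensorial_def)
    also have "\<Phi> (\<Sum>j\<in>J. smul (h j) (S j)) = (\<lambda>x. \<Sum>j\<in>J. h j x * \<Phi> (S j) x)"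
      using insert by simp
    finally show ?case
      using insert.hyps by (simp add: plus_fun_def)
  qed
  then have "\<Phi> (\<Sum>j<length es. smul (h j) (S j)) = (\<lambda>x. \<Sum>j<length es. h j x * \<Phi> (S j) x)"
    by simp
  moreover have "(\<Sum>j<length es. smul (h j) (S j)) = smul (\<lambda>x. \<psi> x * \<psi> x) s"
  proof
    fix x
    show "(\<Sum>j<length es. smul (h j) (S j)) x = smul (\<lambda>x. \<psi> x * \<psi> x) s x"
    proof (cases "\<psi> x * \<psi> x = 0")
      case True
      then have "\<psi> x = 0"
        by simp
      then show ?thesis
        by (simp add: sum_fun_apply smul_def h_def cong: if_cong)
    next
      case False
      then have "x \<in> U"
        using \<psi>(7,8) by auto
      have "(\<Sum>j<length es. smul (h j) (S j)) x = (\<psi> x * \<psi> x) *\<^sub>R (\<Sum>j<length es. frame_coeff es j x (s x) *\<^sub>R (es ! j) x)"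
        using \<open>x \<in> U\<close> by (simp add: sum_fun_apply smul_def h_def S_def scaleR_sum_right mult_ac)
      then show ?thesis
        using frame_expansion[OF U(3)[OF \<open>x \<in> U\<close>] section_in_fib[OF s]] by (simp add: smul_def)
    qed
  qed
  moreover have "\<Phi> (smul (\<lambda>x. \<psi> x * \<psi> x) s) = (\<lambda>x. \<psi> x * \<psi> x * \<Phi> s x)"
    using \<Phi> s smooth_on_mult[OF open_UNIV \<psi>(1) \<psi>(1)] by (auto simp: tensorial_def Cinf_iff)
  ultimately have "\<psi> x0 * \<psi> x0 * \<Phi> s x0 = (\<Sum>j<length es. h j x0 * \<Phi> (S j) x0)"
    by metis
  moreover have "h j x0 = 0" for j
    using s0 lin_on_zero[OF lin_on_frame_coeff[OF U(3)[OF x0]] subspace_fib[OF U(3)[OF x0]]] by (simp add: h_def)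
  ultimately show ?thesis
    using \<psi>(3,5) by simp
qed

text \<open>By \<open>tensorial_zero\<close>, applied to a difference, the value of
  \<open>\<Phi> s\<close> at \<open>x\<close> depends only on \<open>s x\<close>; so
  \<open>\<Phi>\<close> descends to a linear form on each fibre, computed with any global section
  through the given vector. Its smoothness is checked on frames that are extended to global sections
  near a point. Uniqueness then justifies the definite description in
  \<open>dual_section\<close>.\<close>

lemma dual_section:
  assumes E: "vector_bundle M E" and \<Phi>: "tensorial E \<Phi>"
  shows "dual_section M E \<Phi> \<in> sections M (dual_bundle E)"
    and "s \<in> sections M E \<Longrightarrow> pairing s (dual_section M E \<Phi>) = \<Phi> s"
proof -
  have diff: "\<Phi> s x = \<Phi> t x" if st: "s \<in> sections M E" "t \<in> sections M E" "s x = t x" for s t x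
  proof -
    have d: "smul (\<lambda>_. -1) t \<in> sections M E" "s + smul (\<lambda>_. -1) t \<in> sections M E"
      using st section_smul[OF E st(2), of "\<lambda>_. -1"] subspace_add[OF subspace_sections[OF E]] by (auto simp: Cinf_iff)
    have "\<Phi> (s + smul (\<lambda>_. -1) t) x = 0"
      using st d by (intro tensorial_zero[OF E \<Phi>]) (auto simp: smul_def)
    moreover have "\<Phi> (s + smul (\<lambda>_. -1) t) = \<Phi> s + \<Phi> (smul (\<lambda>_. -1) t)"
      using \<Phi> st d by (auto simp: tensorial_def)
    moreover have "\<Phi> (smul (\<lambda>_. -1) t) = (\<lambda>x. -1 * \<Phi> t x)"
      using \<Phi> st by (auto simp: tensorial_def Cinf_iff)
    ultimately show ?thesis
      by simp
  qed
  define \<beta> where "\<beta> x v = (if v \<in> fib E x then \<Phi> (SOME S. S \<in> sections M E \<and> S x = v) x else 0)" for x v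
  have \<beta>: "\<beta> x (s x) = \<Phi> s x" if s: "s \<in> sections M E" for s x
  proof -
    have "(SOME S. S \<in> sections M E \<and> S x = s x) \<in> sections M E \<and> (SOME S. S \<in> sections M E \<and> S x = s x) x = s x"
      by (rule someI[of _ s]) (use s in simp)
    then show ?thesis
      using diff[OF _ s] section_in_fib[OF s] by (simp add: \<beta>_def)
  qed
  have \<beta>_fib: "\<beta> x \<in> fib (dual_bundle E) x" for x
  proof -
    have "\<beta> x (u + v) = \<beta> x u + \<beta> x v" "\<beta> x (c *\<^sub>R u) = c * \<beta> x u" if uv: "u \<in> fib E x" "v \<in> fib E x" for u v c
    proof -
      obtain S T where ST: "S \<in> sections M E" "S x = u" "T \<in> sections M E" "T x = v"
        using section_through[OF E] uv by metis
      have "\<beta> x ((S + T) x) = \<Phi> (S + T) x"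
        by (intro \<beta> subspace_add[OF subspace_sections[OF E]] ST)
      moreover have "\<beta> x (smul (\<lambda>_. c) S x) = \<Phi> (smul (\<lambda>_. c) S) x"
        by (intro \<beta> section_smul[OF E]) (simp_all add: ST Cinf_iff)
      ultimately show "\<beta> x (u + v) = \<beta> x u + \<beta> x v" "\<beta> x (c *\<^sub>R u) = c * \<beta> x u"
        using \<Phi> ST \<beta>[OF ST(1)] \<beta>[OF ST(3)] by (auto simp: tensorial_def smul_def Cinf_iff)
    qed
    then show ?thesis
      by (auto simp: dual_bundle_def lin_on_def \<beta>_def)
  qed
  have \<beta>_sec: "\<beta> \<in> sections M (dual_bundle E)"
    unfolding sections_iff smooth_dual_section_iff[OF E open_UNIV]
  proof (intro conjI ballI, rule \<beta>_fib, goal_cases)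
    case (1 p)
    obtain U es where p: "p = (U, es)"
      by (cases p)
    note U = vector_bundleD[OF E 1[unfolded p]]
    have "smooth_on M U (\<lambda>x. \<beta> x ((es ! j) x))" if j: "j < length es" for j
    proof (rule smooth_on_local[OF U(1)])
      fix x0 assume "x0 \<in> U"
      then obtain S V where S: "S \<in> sections M E" "open V" "x0 \<in> V" "V \<subseteq> U" "\<And>x. x \<in> V \<Longrightarrow> S x = (es ! j) x"
        using section_extension[OF E U(1) U(4)[OF j]] by metis
      have "smooth_on M V (\<Phi> S)"
        using \<Phi> S(1) by (auto simp: tensorial_def Cinf_iff intro: smooth_on_subset)
      then have "smooth_on M V (\<lambda>x. \<beta> x ((es ! j) x))"
        by (rule smooth_on_cong[OF S(2), rotated]) (metis \<beta>[OF S(1)] S(5))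
      then show "\<exists>V. open V \<and> x0 \<in> V \<and> smooth_on M V (\<lambda>x. \<beta> x ((es ! j) x))"
        using S by blast
    qed
    then show ?case
      by (simp add: p)
  qed
  have "\<exists>!\<beta>. \<beta> \<in> sections M (dual_bundle E) \<and> (\<forall>s\<in>sections M E. pairing s \<beta> = \<Phi> s)"
  proof (rule ex1I[of _ \<beta>])
    show "\<beta> \<in> sections M (dual_bundle E) \<and> (\<forall>s\<in>sections M E. pairing s \<beta> = \<Phi> s)"
      using \<beta>_sec \<beta> by (auto simp: pairing_def)
    then show "\<gamma> = \<beta>" if "\<gamma> \<in> sections M (dual_bundle E) \<and> (\<forall>s\<in>sections M E. pairing s \<gamma> = \<Phi> s)" for \<gamma>
      using that by (intro dual_section_eqI[OF E]) auto
  qed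
  then have "dual_section M E \<Phi> \<in> sections M (dual_bundle E) \<and> (\<forall>s\<in>sections M E. pairing s (dual_section M E \<Phi>) = \<Phi> s)"
    unfolding dual_section_def by (rule theI')
  then show "dual_section M E \<Phi> \<in> sections M (dual_bundle E)"
    "s \<in> sections M E \<Longrightarrow> pairing s (dual_section M E \<Phi>) = \<Phi> s"
    by auto
qed

text \<open>The frame coefficients are the values of \<open>\<phi>\<close> on the dual frame, which
  near each point agrees with global sections of the dual bundle.\<close>

lemma riesz_section:
  assumes E: "vector_bundle M E" and \<phi>: "\<And>x. lin_on (fib (dual_bundle E) x) UNIV (\<phi> x)"
    and sm: "\<And>\<alpha>. \<alpha> \<in> sections M (dual_bundle E) \<Longrightarrow> (\<lambda>x. \<phi> x (\<alpha> x)) \<in> Cinf M"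
  shows "(\<lambda>x. riesz E x (\<phi> x)) \<in> sections M E"
  unfolding sections_iff smooth_section_on_def
proof (intro conjI ballI, goal_cases)
  case (1 x)
  obtain U es where "(U, es) \<in> frames E" "x \<in> U"
    by (rule frame_at[OF E])
  then show ?case
    by (intro riesz(1)[OF vector_bundleD(3)[OF E] \<phi>])
next
  case (2 p)
  obtain U es where p: "p = (U, es)"
    by (cases p)
  note U = vector_bundleD[OF E 2[unfolded p]]
  have "smooth_on M U (\<lambda>x. frame_coeff es j x (riesz E x (\<phi> x)))" if j: "j < length es" for j
  proof (rule smooth_on_local[OF U(1)])
    fix x0 assume x0: "x0 \<in> U"
    have "smooth_section_on M (dual_bundle E) U (dual_elt E es j)"
      by (rule dual_elt_smooth[OF E U(1,2) j])
    then obtain S V where S: "S \<in> sections M (dual_bundle E)" "open V" "x0 \<in> V" "V \<subseteq> U"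
      "\<And>x. x \<in> V \<Longrightarrow> S x = dual_elt E es j x"
      using section_extension[OF vector_bundle_dual[OF E] U(1) _ x0] by metis
    have "smooth_on M V (\<lambda>x. \<phi> x (S x))"
      using sm[OF S(1)] by (auto simp: Cinf_iff intro: smooth_on_subset)
    moreover have "\<phi> x (S x) = frame_coeff es j x (riesz E x (\<phi> x))" if "x \<in> V" for x
    proof -
      have b: "basis_at E es x"
        using that S(4) U(3) by auto
      show ?thesis
        using riesz[OF b \<phi>] dual_elt_fib[OF b, of j] S(5)[OF that] by (simp add: dual_elt_def)
    qed
    ultimately have "smooth_on M V (\<lambda>x. frame_coeff es j x (riesz E x (\<phi> x)))"
      by (rule smooth_on_cong[OF S(2), rotated])
    then show "\<exists>V. open V \<and> x0 \<in> V \<and> smooth_on M V (\<lambda>x. frame_coeff es j x (riesz E x (\<phi> x)))"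
      using S by blast
  qed
  then show ?case
    by (simp add: p)
qed

lemma riesz_bundle:
  assumes E: "vector_bundle M E" and \<phi>: "lin_on (fib (dual_bundle E) x) UNIV \<phi>"
  shows "riesz E x \<phi> \<in> fib E x" "\<alpha> \<in> fib (dual_bundle E) x \<Longrightarrow> \<alpha> (riesz E x \<phi>) = \<phi> \<alpha>"
proof -
  obtain U es where "(U, es) \<in> frames E" "x \<in> U"
    by (rule frame_at[OF E])
  note R = riesz[OF vector_bundleD(3)[OF E this] \<phi>]
  show "riesz E x \<phi> \<in> fib E x" "\<alpha> \<in> fib (dual_bundle E) x \<Longrightarrow> \<alpha> (riesz E x \<phi>) = \<phi> \<alpha>"
    using R by blast+
qed

lemma bundle_fib_eqI:
  assumes E: "vector_bundle M E" and uv: "u \<in> fib E x" "v \<in> fib E x"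
    and eq: "\<And>\<alpha>. \<alpha> \<in> fib (dual_bundle E) x \<Longrightarrow> \<alpha> u = \<alpha> v"
  shows "u = v"
proof -
  obtain U es where "(U, es) \<in> frames E" "x \<in> U"
    by (rule frame_at[OF E])
  from fib_eqI[OF vector_bundleD(3)[OF E this] uv eq] show ?thesis .
qed

lemma riesz_linear:
  assumes E: "vector_bundle M E" and U: "subspace U" and \<phi>: "\<And>u. u \<in> U \<Longrightarrow> lin_on (fib (dual_bundle E) x) UNIV (\<phi> u)"
    and l: "\<And>\<alpha>. \<alpha> \<in> fib (dual_bundle E) x \<Longrightarrow> lin_on U UNIV (\<lambda>u. \<phi> u \<alpha>)"
  shows "lin_on U (fib E x) (\<lambda>u. riesz E x (\<phi> u))"
  unfolding lin_on_def
proof (intro conjI ballI allI)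
  note R = riesz_bundle[OF E \<phi>]
  have dl: "lin_on (fib E x) UNIV \<alpha>" if "\<alpha> \<in> fib (dual_bundle E) x" for \<alpha>
    using that by (simp add: dual_bundle_def)
  fix u v r assume u: "u \<in> U"
  show "riesz E x (\<phi> u) \<in> fib E x"
    by (rule R(1)[OF u])
  show "riesz E x (\<phi> (u + v)) = riesz E x (\<phi> u) + riesz E x (\<phi> v)" if v: "v \<in> U"
    using R(2)[OF u] R(2)[OF v] R(2)[OF subspace_add[OF U u v]] lin_onD(2)[OF l u v] lin_onD(2)[OF dl R(1)[OF u] R(1)[OF v]]
    by (intro bundle_fib_eqI[OF E R(1)[OF subspace_add[OF U u v]] subspace_add[OF subspace_fibre[OF E] R(1)[OF u] R(1)[OF v]]])
      simp
  show "riesz E x (\<phi> (r *\<^sub>R u)) = r *\<^sub>R riesz E x (\<phi> u)"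
  proof (rule bundle_fib_eqI[OF E R(1)[OF subspace_scale[OF U u]] subspace_scale[OF subspace_fibre[OF E] R(1)[OF u]]])
    show "\<alpha> (riesz E x (\<phi> (r *\<^sub>R u))) = \<alpha> (r *\<^sub>R riesz E x (\<phi> u))" if a: "\<alpha> \<in> fib (dual_bundle E) x" for \<alpha>
      using R(2)[OF u a] R(2)[OF subspace_scale[OF U u] a] lin_onD(3)[OF l[OF a] u, of r] lin_onD(3)[OF dl[OF a] R(1)[OF u], of r]
      by simp
  qed
qed

lemma bundle_map_sections:
  assumes F: "bundle_map M E E' F"
  shows "lin_on (sections M E) (sections M E') (\<lambda>s x. F x (s x))"
  unfolding lin_on_def
proof (intro conjI ballI allI)
  have l: "lin_on (fib E x) (fib E' x) (F x)" for x
    using F by (simp add: bundle_map_def)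
  fix s t r assume s: "s \<in> sections M E"
  show "(\<lambda>x. F x (s x)) \<in> sections M E'"
    using F s by (simp add: bundle_map_def)
  show "(\<lambda>x. F x ((r *\<^sub>R s) x)) = r *\<^sub>R (\<lambda>x. F x (s x))"
    using lin_onD(3)[OF l section_in_fib[OF s]] by (simp add: fun_eq_iff)
  show "(\<lambda>x. F x ((s + t) x)) = (\<lambda>x. F x (s x)) + (\<lambda>x. F x (t x))" if "t \<in> sections M E"
    using lin_onD(2)[OF l section_in_fib[OF s] section_in_fib[OF that]] by (simp add: fun_eq_iff)
qed

lemma bundle_map_wedge2_sections:
  assumes F: "bundle_map_wedge2 M E E' F"
  shows "skew2_on (sections M E) (sections M E') (\<lambda>s t x. F x (s x) (t x))"
  unfolding skew2_on_def bilin_on_def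
proof (intro conjI ballI)
  have f: "(\<forall>v\<in>fib E x. lin_on (fib E x) (fib E' x) (\<lambda>u. F x u v)) \<and> (\<forall>u\<in>fib E x. lin_on (fib E x) (fib E' x) (F x u))"
    "\<forall>u\<in>fib E x. \<forall>v\<in>fib E x. F x u v = - F x v u" for x
    using F unfolding bundle_map_wedge2_def skew2_on_def bilin_on_def by blast+
  fix t assume t: "t \<in> sections M E"
  have "bundle_map M E E' (\<lambda>x v. F x v (t x))" "bundle_map M E E' (\<lambda>x. F x (t x))"
    using F t f(1) section_in_fib[OF t] by (simp_all add: bundle_map_def bundle_map_wedge2_def)
  from this[THEN bundle_map_sections]
  show "lin_on (sections M E) (sections M E') (\<lambda>s x. F x (s x) (t x))" "lin_on (sections M E) (sections M E') (\<lambda>s x. F x (t x) (s x))" .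
  show "(\<lambda>x. F x (t x) (s x)) = - (\<lambda>x. F x (s x) (t x))" if "s \<in> sections M E" for s
  proof
    show "F x (t x) (s x) = (- (\<lambda>x. F x (s x) (t x))) x" for x
      unfolding uminus_apply using f(2)[of x] section_in_fib[OF t] section_in_fib[OF that] by blast
  qed
qed

end

section \<open>The big bracket in a Darboux chart\<close>

context odd_poisson
begin

text \<open>The minus sign is the parity shift: functions of odd degree are even for a bracket of
  odd degree.\<close>

definition "Even = {F \<in> C. P F = - F}"

definition "Odd = {F \<in> C. P F = F}"

sublocale lie_superalgebra C Even Odd pb
proof
  have s: "supersign (- 1) (- 1) = - 1" "supersign 1 (- 1) = 1" "supersign (- 1) 1 = 1" "supersign 1 1 = 1"
    by (simp_all add: supersign_def)
  have E: "P F = (-1) *\<^sub>R F" "F \<in> C" if "F \<in> Even" for F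
    using that by (simp_all add: Even_def)
  have O: "P F = 1 *\<^sub>R F" "F \<in> C" if "F \<in> Odd" for F
    using that by (simp_all add: Odd_def)
  have Pz: "P 0 = 0"
    by simp
  show "subspace Even" "subspace Odd"
    using subspace_0[OF subspace_C] subspace_add[OF subspace_C] subspace_scale[OF subspace_C]
    by (auto simp: subspace_def Even_def Odd_def)
  show "Even \<subseteq> C" "Odd \<subseteq> C"
    by (auto simp: Even_def Odd_def)
  fix a b c r
  show "a \<in> C \<Longrightarrow> b \<in> C \<Longrightarrow> pb a b \<in> C"
    by simp
  show "a \<in> Even \<Longrightarrow> b \<in> Even \<Longrightarrow> pb a b \<in> Even" "a \<in> Even \<Longrightarrow> b \<in> Odd \<Longrightarrow> pb a b \<in> Odd"
    "a \<in> Odd \<Longrightarrow> b \<in> Odd \<Longrightarrow> pb a b \<in> Even"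
    by (auto simp: Even_def Odd_def P_pb)
  show "pb (a + b) c = pb a c + pb b c" if "a \<in> C" "b \<in> C" "c \<in> C"
    using that by (simp add: pb_add_left)
  show "pb a (b + c) = pb a b + pb a c" if "a \<in> C" "b \<in> C" "c \<in> C"
    using that by (simp add: pb_add_right)
  show "pb (r *\<^sub>R a) b = r *\<^sub>R pb a b" "pb a (r *\<^sub>R b) = r *\<^sub>R pb a b" if "a \<in> C" "b \<in> C"
    using that by (simp_all add: pb_scaleR_left pb_scaleR_right)
  show "pb a b = pb b a" if "a \<in> Odd" "b \<in> Odd"
    using pb_swap[OF O(2) O(2) O(1) O(1)] that by (simp add: s)
  show "pb a b = - pb b a" if "a \<in> Even" "b \<in> Even \<union> Odd"
    using pb_swap[OF E(2) E(2) E(1) E(1), of a b] pb_swap[OF E(2) O(2) E(1) O(1), of a b] that by (auto simp: s)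
  show "pb a (pb b c) = pb (pb a b) c - pb b (pb a c)" if "a \<in> Odd" "b \<in> Odd" "c \<in> C"
    using pb_jacobi[OF O(2) O(2) _ O(1) O(1), of a b c] that by (simp add: s)
  show "pb a (pb b c) = pb (pb a b) c + pb b (pb a c)" if "a \<in> Even" "b \<in> Even \<union> Odd" "c \<in> C"
    using pb_jacobi[OF E(2) E(2) _ E(1) E(1), of a b c] pb_jacobi[OF E(2) O(2) _ E(1) O(1), of a b c] that
    by (auto simp: s)
qed (rule subspace_C)

end

text \<open>Functions on a chart are extended by \<open>0\<close>, so that equality in the chart becomes equality.\<close>

definition restrict_gfun :: "'m set \<Rightarrow> 'm gfun \<Rightarrow> 'm gfun" where
  "restrict_gfun D F = (\<lambda>q x. if x \<in> D then F q x else 0)"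

text \<open>Apart from the derivative along the base, all operations on graded functions are
  pointwise in \<open>x\<close>; therefore restriction to the chart domain passes through
  them.\<close>

lemma gmult_pointwise:
  assumes "\<And>q. F q x = F' q x" "\<And>q. G q x = G' q x"
  shows "gmult F G q x = gmult F' G' q x"
  using assms by (cases q) (simp add: gmult_def)

lemma odiff_pointwise: "(\<And>q. F q x = F' q x) \<Longrightarrow> odiff v F q x = odiff v F' q x"
  by (cases q) (simp add: odiff_def)

lemma ediff_pointwise: "(\<And>q. F q x = F' q x) \<Longrightarrow> ediff v F q x = ediff v F' q x"
  by (cases q) (simp add: ediff_def)

lemma gparity_pointwise: "(\<And>q. F q x = F' q x) \<Longrightarrow> gparity F q x = gparity F' q x"
  by (cases q) (simp add: gparity_def)

lemma fun_nonzeroD: "f \<noteq> 0 \<Longrightarrow> \<exists>x. f x \<noteq> (0::real)"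
  by (auto simp: fun_eq_iff)

locale chart_algebra = smooth_manifold M
  for M :: "'m::{t2_space, second_countable_topology} smfd" +
  fixes A :: "('m, 'a::real_vector, 'b::real_vector) sl2" and c :: "('m, 'a, 'b) dchart"
  assumes bun1: "vector_bundle M (bun1 A)" and bun2: "vector_bundle M (bun2 A)"
    and chart: "darboux_chart M A c"
begin

abbreviation "dm \<equiv> cdom c"
abbreviation "r1 \<equiv> length (fr1 c)"
abbreviation "r2 \<equiv> length (fr2 c)"

lemma chartD:
  "(cbase c, ccoord c) \<in> atlas M" "open dm" "dm \<subseteq> cbase c"
  "local_frame M (bun1 A) dm (fr1 c)" "local_frame M (bun2 A) dm (fr2 c)"
  using chart by (auto simp: darboux_chart_def)

definition base :: "('m \<Rightarrow> real) set" where
  "base = {f. smooth_on M dm f \<and> (\<forall>x. x \<notin> dm \<longrightarrow> f x = 0)}"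

text \<open>The rules of \<open>base_ring\<close> range over all natural indices, so indices that
  are not coordinates get the zero derivation.\<close>

definition base_diff :: "nat \<Rightarrow> ('m \<Rightarrow> real) \<Rightarrow> 'm \<Rightarrow> real" where
  "base_diff i f = (\<lambda>x. if x \<in> dm \<and> i < n then chart_diff (cbase c) (ccoord c) i f x else 0)"

definition index_set :: "ovar set" where
  "index_set = P_dn ` {..<n} \<union> Xi_up ` {..<r1} \<union> Th_dn ` {..<r2}"

lemma chart_diff_const: "chart_diff U \<phi> i (\<lambda>x. k) x = 0"
  by (simp add: chart_diff_def partial_def)

sublocale B: base_ring base base_diff index_set
proof
  show "subspace base"
    using chartD(2) by (auto simp: subspace_def base_def zero_fun_def plus_fun_def scaleR_fun_def
        intro: smooth_on_add smooth_on_mult)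
  fix f g :: "'m \<Rightarrow> real" and i j k
  assume f: "f \<in> base"
  show "base_diff i f \<in> base"
  proof (cases "i < n")
    case True
    have "smooth_on M dm (chart_diff (cbase c) (ccoord c) i f)"
      using chartD f True by (intro smooth_on_chart_diff) (auto simp: base_def)
    then have "smooth_on M dm (base_diff i f)"
      by (rule smooth_on_cong[OF chartD(2), rotated]) (simp add: base_diff_def True)
    then show ?thesis
      by (auto simp: base_def base_diff_def)
  next
    case False
    then show ?thesis
      using chartD(2) by (simp add: base_diff_def base_def)
  qed
  have "chart_diff (cbase c) (ccoord c) i (\<lambda>x. k * f x) x = k * chart_diff (cbase c) (ccoord c) i f x"
    if "x \<in> dm" "i < n" for x
    using chart_diff_mult[OF chartD(1-3) smooth_on_const[OF chartD(2), of k] _ that(2,1)] f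
    by (simp add: chart_diff_const base_def)
  then show "base_diff i (k *\<^sub>R f) = k *\<^sub>R base_diff i f"
    by (auto simp: base_diff_def scaleR_fun_def)
  have "chart_diff (cbase c) (ccoord c) i (base_diff j f) x = chart_diff (cbase c) (ccoord c) i (chart_diff (cbase c) (ccoord c) j f) x"
    if "x \<in> dm" "i < n" "j < n" for x i j
    using chartD that by (intro chart_diff_cong[OF chartD(1,2)]) (auto simp: base_diff_def)
  moreover have "chart_diff (cbase c) (ccoord c) i (base_diff j f) x = 0"
    if "x \<in> dm" "i < n" "\<not> j < n" for x i j
    using that by (simp add: base_diff_def chart_diff_const)
  ultimately show "base_diff i (base_diff j f) = base_diff j (base_diff i f)"
    using chart_diff_commute[OF chartD(1-3) _ _ , of f f i _ j] f
    by (auto simp: base_diff_def[of i "base_diff j f"] base_diff_def[of j "base_diff i f"] base_def fun_eq_iff)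
  assume g: "g \<in> base"
  show "(\<lambda>x. f x * g x) \<in> base"
    using f g chartD(2) by (auto simp: base_def intro: smooth_on_mult)
  show "base_diff i (f + g) = base_diff i f + base_diff i g"
    using chart_diff_add[OF chartD(1-3), of f g i] f g
    by (auto simp: base_diff_def base_def fun_eq_iff plus_fun_def)
  show "base_diff i (\<lambda>x. f x * g x) = (\<lambda>x. base_diff i f x * g x + f x * base_diff i g x)"
    using chart_diff_mult[OF chartD(1-3), of f g i] f g
    by (auto simp: base_diff_def base_def fun_eq_iff)
qed

abbreviation "C \<equiv> B.carrier"
abbreviation "br \<equiv> B.pb"
abbreviation "rs \<equiv> restrict_gfun dm"

lemma carrier_base: "F \<in> C \<Longrightarrow> F q \<in> base"
  by (cases q) (simp add: B.carrier_def)

lemma carrier_vanish: "F \<in> C \<Longrightarrow> x \<notin> dm \<Longrightarrow> F q x = 0"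
  using carrier_base[of F q] by (simp add: base_def)

lemma carrier_eqI:
  "F \<in> C \<Longrightarrow> G \<in> C \<Longrightarrow> (\<And>q x. x \<in> dm \<Longrightarrow> F q x = G q x) \<Longrightarrow> F = G"
  by (intro ext) (metis carrier_vanish)

lemma sum_index:
  "(\<Sum>a\<in>index_set. h a) = (\<Sum>i<n. h (P_dn i)) + (\<Sum>j<r1. h (Xi_up j)) + (\<Sum>k<r2. h (Th_dn k))"
  for h :: "ovar \<Rightarrow> 'm gfun"
  unfolding index_set_def
  by (subst sum.union_disjoint, auto)+ (auto simp: sum.reindex inj_on_def)

lemma br_eq: "br F G q x =
    (\<Sum>i<n. gmult (\<lambda>q. base_diff i (F q)) (odiff (P_dn i) G) q x + gmult (odiff (P_dn i) (gparity F)) (\<lambda>q. base_diff i (G q)) q x)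
    - (\<Sum>j<r1. gmult (ediff (Xi_dn j) F) (odiff (Xi_up j) G) q x + gmult (odiff (Xi_up j) (gparity F)) (ediff (Xi_dn j) G) q x)
    - (\<Sum>k<r2. gmult (odiff (Th_dn k) (gparity F)) (ediff (Th_up k) G) q x + gmult (ediff (Th_up k) F) (odiff (Th_dn k) G) q x)"
  unfolding B.pb_def sum_index
  by (simp add: even_deriv_def sum_fun_apply sum_negf[symmetric] add.commute
      sum_subtractf[symmetric])

lemma poisson_in_br:
  assumes "x \<in> dm"
  shows "poisson_in M c F G q x = br (rs F) (rs G) q x"
proof -
  have F: "F q x = rs F q x" and G: "G q x = rs G q x" for q
    using assms by (simp_all add: restrict_gfun_def)
  have X: "xdiff c i F q x = base_diff i (rs F q) x" if "i < n" for i q F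
    using chart_diff_cong[OF chartD(1,2) assms, of "F q" "rs F q" i] assms chartD(3) that
    by (auto simp: xdiff_def base_diff_def chart_diff_def restrict_gfun_def)
  show ?thesis
    unfolding br_eq poisson_in_def
    by (simp add: sum_fun_apply)
      (intro arg_cong2[where f = "(-)"] arg_cong2[where f = "(+)"] sum.cong refl
        gmult_pointwise odiff_pointwise ediff_pointwise gparity_pointwise F G X; simp)
qed

lemma rs_poisson:
  assumes "rs F \<in> C" "rs G \<in> C"
  shows "rs (poisson_in M c F G) = br (rs F) (rs G)"
proof (intro ext)
  fix q x
  show "rs (poisson_in M c F G) q x = br (rs F) (rs G) q x"
    using poisson_in_br[of x F G q] carrier_vanish[of "br (rs F) (rs G)" x q] assms
    by (cases "x \<in> dm") (simp_all add: restrict_gfun_def[of _ "poisson_in M c F G"])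
qed

text \<open>Integers, since the bracket lowers each component of the tridegree by one.\<close>

definition deg :: "gmono \<Rightarrow> int \<times> int \<times> int" where
  "deg q = (int (fst (tridegree q)), int (fst (snd (tridegree q))), int (snd (snd (tridegree q))))"

definition T :: "int \<Rightarrow> int \<Rightarrow> int \<Rightarrow> 'm gfun set" where
  "T i j k = {F \<in> C. \<forall>q. F q \<noteq> 0 \<longrightarrow> mono_in M c q \<and> deg q = (i, j, k)}"

section \<open>Homogeneity of the operations with respect to the tridegree\<close>

definition otriple :: "ovar \<Rightarrow> int \<times> int \<times> int" where
  "otriple v = (case v of P_dn i \<Rightarrow> (1, 1, 1) | Xi_up j \<Rightarrow> (0, 1, 0) | Th_dn k \<Rightarrow> (0, 0, 1))"

definition etriple :: "evar \<Rightarrow> int \<times> int \<times> int" where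
  "etriple v = (case v of Th_up k \<Rightarrow> (1, 1, 0) | Xi_dn j \<Rightarrow> (1, 0, 1))"

lemma deg_eq: "deg (S, m) = (\<Sum>v\<in>S. otriple v) + (\<Sum>v\<in>#m. etriple v)"
proof -
  have o: "otriple v = (int (fst (otri v)), int (fst (snd (otri v))), int (snd (snd (otri v))))" for v
    by (cases v) (simp_all add: otriple_def)
  have e: "etriple v = (int (fst (etri v)), int (fst (snd (etri v))), int (snd (snd (etri v))))" for v
    by (cases v) (simp_all add: etriple_def)
  have "(\<Sum>v\<in>S. otriple v) = (int (fst (\<Sum>v\<in>S. otri v)), int (fst (snd (\<Sum>v\<in>S. otri v))), int (snd (snd (\<Sum>v\<in>S. otri v))))"
    by (induction S rule: infinite_finite_induct) (simp_all add: o zero_prod_def plus_prod_def)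
  moreover have "(\<Sum>v\<in>#m. etriple v) = (int (fst (\<Sum>v\<in>#m. etri v)), int (fst (snd (\<Sum>v\<in>#m. etri v))), int (snd (snd (\<Sum>v\<in>#m. etri v))))"
    by (induction m) (simp_all add: e zero_prod_def plus_prod_def)
  ultimately show ?thesis
    by (simp add: deg_def tridegree_def plus_prod_def)
qed

lemma deg_insert: "finite S \<Longrightarrow> v \<notin> S \<Longrightarrow> deg (insert v S, m) = otriple v + deg (S, m)"
  by (simp add: deg_eq add.assoc)

lemma deg_add_mset: "deg (S, add_mset v m) = etriple v + deg (S, m)"
  by (simp add: deg_eq add_ac)

lemma deg_split: "finite S \<Longrightarrow> S1 \<subseteq> S \<Longrightarrow> k \<subseteq># m \<Longrightarrow> deg (S, m) = deg (S1, k) + deg (S - S1, m - k)"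
proof -
  assume *: "finite S" "S1 \<subseteq> S" "k \<subseteq># m"
  have "(\<Sum>v\<in>S. otriple v) = (\<Sum>v\<in>S1. otriple v) + (\<Sum>v\<in>S - S1. otriple v)"
    using * by (metis add.commute sum.subset_diff)
  moreover have "(\<Sum>v\<in>#m. etriple v) = (\<Sum>v\<in>#k. etriple v) + (\<Sum>v\<in>#m - k. etriple v)"
    using * by (metis image_mset_union subset_mset.add_diff_inverse sum_mset.union)
  ultimately show ?thesis
    by (simp add: deg_eq add_ac)
qed

text \<open>All claims are additive over the variables of the monomial and hold for each coordinate:
  its first component is at most the sum of the other two, and its total degree is odd exactly for
  the odd variables.\<close>

lemma deg_bounds:
  assumes "deg (S, m) = (i, j, k)"
  shows "0 \<le> i" "0 \<le> j" "0 \<le> k" "i \<le> j + k" "finite S \<Longrightarrow> even (i + j + k) = even (card S)"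
proof -
  have 1: "fst (\<Sum>v\<in>S. otriple v) \<le> fst (snd (\<Sum>v\<in>S. otriple v)) + snd (snd (\<Sum>v\<in>S. otriple v))"
    by (induction S rule: infinite_finite_induct) (auto simp: otriple_def split: ovar.splits)
  have 2: "fst (\<Sum>v\<in>#m. etriple v) \<le> fst (snd (\<Sum>v\<in>#m. etriple v)) + snd (snd (\<Sum>v\<in>#m. etriple v))"
    by (induction m) (auto simp: etriple_def split: evar.splits)
  have ijk: "i = fst (deg (S, m))" "j = fst (snd (deg (S, m)))" "k = snd (snd (deg (S, m)))"
    by (simp_all add: assms)
  show "0 \<le> i" "0 \<le> j" "0 \<le> k"
    unfolding ijk by (simp_all add: deg_def)
  show "i \<le> j + k"
    unfolding ijk using 1 2 by (simp add: deg_eq)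
  have 3: "finite S \<Longrightarrow> even (fst (\<Sum>v\<in>S. otriple v) + fst (snd (\<Sum>v\<in>S. otriple v)) + snd (snd (\<Sum>v\<in>S. otriple v))) = even (card S)"
    by (induction S rule: finite_induct) (auto simp: otriple_def split: ovar.splits)
  have 4: "even (fst (\<Sum>v\<in>#m. etriple v) + fst (snd (\<Sum>v\<in>#m. etriple v)) + snd (snd (\<Sum>v\<in>#m. etriple v)))"
    by (induction m) (auto simp: etriple_def split: evar.splits)
  show "finite S \<Longrightarrow> even (i + j + k) = even (card S)"
    unfolding ijk using 3 4 by (simp add: deg_eq) presburger
qed

lemma T_carrier: "F \<in> T i j k \<Longrightarrow> F \<in> C"
  by (simp add: T_def)

lemma TD: "F \<in> T i j k \<Longrightarrow> F q \<noteq> 0 \<Longrightarrow> mono_in M c q \<and> deg q = (i, j, k)"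
  unfolding T_def by blast

lemma carrier_finite: "F \<in> C \<Longrightarrow> F (S, m) \<noteq> 0 \<Longrightarrow> finite S"
  by (auto simp: B.carrier_def)

lemma T_parity: 
  assumes "F \<in> T i j k"
  shows "gparity F = (if even (i + j + k) then F else - F)"
proof (intro ext)
  fix q :: gmono and x
  obtain S m where q: "q = (S, m)"
    by (cases q)
  show "gparity F q x = (if even (i + j + k) then F else - F) q x"
  proof (cases "F q x = 0")
    case False
    then have "F q \<noteq> 0"
      by auto
    then show ?thesis
      using assms deg_bounds(5)[of S m i j k] carrier_finite[OF T_carrier[OF assms], of S m]
      by (auto simp: q T_def gparity_def)
  qed (simp add: q gparity_def)
qed

lemma mono_in_insert: "mono_in M c (insert v S, m) \<Longrightarrow> mono_in M c (S, m)"
  and mono_in_add_mset: "mono_in M c (S, add_mset w m) \<Longrightarrow> mono_in M c (S, m)"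
  and mono_in_split: "mono_in M c (S1, k) \<Longrightarrow> mono_in M c (S - S1, m - k) \<Longrightarrow> S1 \<subseteq> S \<Longrightarrow> k \<subseteq># m \<Longrightarrow> mono_in M c (S, m)"
proof -
  show "mono_in M c (insert v S, m) \<Longrightarrow> mono_in M c (S, m)" "mono_in M c (S, add_mset w m) \<Longrightarrow> mono_in M c (S, m)"
    by (auto simp: mono_in_def)
  assume *: "mono_in M c (S1, k)" "mono_in M c (S - S1, m - k)" "S1 \<subseteq> S" "k \<subseteq># m"
  have "S = S1 \<union> (S - S1)" "set_mset m = set_mset k \<union> set_mset (m - k)"
    using *(3,4) by (auto simp: set_mset_union[symmetric] subset_mset.add_diff_inverse simp del: set_mset_union)
  then show "mono_in M c (S, m)"
    using *(1,2) unfolding mono_in_def prod.case by blast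
qed

lemma gmult_nonzero:
  assumes F: "F \<in> C" and nz: "gmult F G (S, m) \<noteq> 0"
  obtains S1 k where "S1 \<subseteq> S" "k \<subseteq># m" "F (S1, k) \<noteq> 0" "G (S - S1, m - k) \<noteq> 0" "finite S"
proof -
  have "\<exists>x. gmult F G (S, m) x \<noteq> 0"
    by (rule fun_nonzeroD[OF nz])
  then obtain x where x: "gmult F G (S, m) x \<noteq> 0" ..
  have fin: "finite S"
    using gmult_infinite[of S F G m x] x by metis
  from x obtain p where "p \<in> Pow S \<times> {k. k \<subseteq># m}"
    "(case p of (S1, k) \<Rightarrow> osign S1 (S - S1) * F (S1, k) x * G (S - S1, m - k) x) \<noteq> 0"
    unfolding gmult_def prod.case by (meson sum.not_neutral_contains_not_neutral)
  then show ?thesis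
    using that fin by (cases p) (auto simp: fun_eq_iff)
qed

lemma T_gmult:
  assumes F: "F \<in> C" "\<And>q. F q \<noteq> 0 \<Longrightarrow> mono_in M c q \<and> deg q = d"
    and G: "G \<in> C" "\<And>q. G q \<noteq> 0 \<Longrightarrow> mono_in M c q \<and> deg q = e"
    and nz: "gmult F G q \<noteq> 0"
  shows "mono_in M c q \<and> deg q = d + e"
proof -
  obtain S m where q: "q = (S, m)"
    by (cases q)
  obtain S1 k where *: "S1 \<subseteq> S" "k \<subseteq># m" "F (S1, k) \<noteq> 0" "G (S - S1, m - k) \<noteq> 0" "finite S"
    using gmult_nonzero[OF F(1) nz[unfolded q]] by metis
  show ?thesis
    using F(2)[OF *(3)] G(2)[OF *(4)] deg_split[OF *(5,1,2)] mono_in_split[OF _ _ *(1,2)] by (simp add: q)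
qed

lemma odiff_homogeneous:
  assumes "F \<in> C" "\<And>q. F q \<noteq> 0 \<Longrightarrow> mono_in M c q \<and> deg q = d" "odiff v F q \<noteq> 0"
  shows "mono_in M c q \<and> deg q = d - otriple v"
proof -
  obtain S m where q: "q = (S, m)"
    by (cases q)
  have "v \<notin> S" "F (insert v S, m) \<noteq> 0"
    using assms(3) by (auto simp: q odiff_def fun_eq_iff split: if_splits)
  moreover from this have "finite S"
    using carrier_finite[OF assms(1), of "insert v S" m] by simp
  moreover have "deg (S, m) = deg (insert v S, m) - otriple v"
    using calculation by (simp add: deg_insert)
  ultimately show ?thesis
    using assms(2)[of "(insert v S, m)"] mono_in_insert by (auto simp: q)
qed

lemma ediff_homogeneous:
  assumes "\<And>q. F q \<noteq> 0 \<Longrightarrow> mono_in M c q \<and> deg q = d" "ediff v F q \<noteq> 0"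
  shows "mono_in M c q \<and> deg q = d - etriple v"
proof -
  obtain S m where q: "q = (S, m)"
    by (cases q)
  have "F (S, add_mset v m) \<noteq> 0"
    using assms(2) by (auto simp: q ediff_def fun_eq_iff)
  moreover have "deg (S, m) = deg (S, add_mset v m) - etriple v"
    by (simp add: deg_add_mset)
  ultimately show ?thesis
    using assms(1)[of "(S, add_mset v m)"] mono_in_add_mset by (auto simp: q)
qed

lemma gparity_zero: "gparity F q \<noteq> 0 \<Longrightarrow> F q \<noteq> 0"
  by (cases q) (auto simp: gparity_def fun_eq_iff)

text \<open>The tridegrees of conjugate coordinates add up to (1, 1, 1). Differentiating once by
  each member of a pair thus lowers every component by one, which is the degree of the
  bracket.\<close>

lemma even_deriv_homogeneous:
  assumes "\<And>q. F q \<noteq> 0 \<Longrightarrow> mono_in M c q \<and> deg q = d" "even_deriv base_diff v F q \<noteq> 0"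
  shows "mono_in M c q \<and> deg q = d - ((1, 1, 1) - otriple v)"
proof (cases v)
  case (P_dn i)
  have "F q \<noteq> 0"
    using assms(2) B.X_0 by (auto simp: P_dn even_deriv_def)
  then show ?thesis
    using assms(1) by (simp add: P_dn otriple_def zero_prod_def[symmetric])
next
  case (Xi_up j)
  then show ?thesis
    using ediff_homogeneous[where F = F and v = "Xi_dn j", OF assms(1)] assms(2) by (simp add: even_deriv_def otriple_def etriple_def)
next
  case (Th_dn k)
  then show ?thesis
    using ediff_homogeneous[where F = F and v = "Th_up k", OF assms(1)] assms(2) by (simp add: even_deriv_def otriple_def etriple_def)
qed

lemma T_br_closed:
  assumes F: "F \<in> T i j k" and G: "G \<in> T i' j' k'"
  shows "br F G \<in> T (i + i' - 1) (j + j' - 1) (k + k' - 1)"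
proof -
  have FC: "F \<in> C" "G \<in> C"
    using F G by (auto dest: T_carrier)
  have d: "(i, j, k) - ((1, 1, 1) - otriple a) + ((i', j', k') - otriple a) = (i + i' - 1, j + j' - 1, k + k' - 1)"
    "(i, j, k) - otriple a + ((i', j', k') - ((1, 1, 1) - otriple a)) = (i + i' - 1, j + j' - 1, k + k' - 1)" for a
    by (cases a; simp add: otriple_def)+
  have hF: "F q \<noteq> 0 \<Longrightarrow> mono_in M c q \<and> deg q = (i, j, k)" and hG: "G q \<noteq> 0 \<Longrightarrow> mono_in M c q \<and> deg q = (i', j', k')" for q
    using TD[OF F] TD[OF G] by blast+
  have hPF: "gparity F q \<noteq> 0 \<Longrightarrow> mono_in M c q \<and> deg q = (i, j, k)" for q
    using hF gparity_zero by blast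
  have "mono_in M c q \<and> deg q = (i + i' - 1, j + j' - 1, k + k' - 1)" if nz: "br F G q \<noteq> 0" for q
  proof -
    have "br F G q = (\<Sum>a\<in>index_set. gmult (even_deriv base_diff a F) (odiff a G) q + gmult (odiff a (gparity F)) (even_deriv base_diff a G) q)"
      by (simp add: B.pb_def sum_fun_apply)
    then obtain a where a: "gmult (even_deriv base_diff a F) (odiff a G) q \<noteq> 0 \<or> gmult (odiff a (gparity F)) (even_deriv base_diff a G) q \<noteq> 0"
      using nz by (metis (no_types, lifting) add.right_neutral sum.neutral)
    then show ?thesis
    proof
      assume nz: "gmult (even_deriv base_diff a F) (odiff a G) q \<noteq> 0"
      have "mono_in M c q \<and> deg q = (i, j, k) - ((1, 1, 1) - otriple a) + ((i', j', k') - otriple a)"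
        by (rule T_gmult[OF B.even_deriv_carrier[OF FC(1)] even_deriv_homogeneous[OF hF]
              B.odiff_carrier[OF FC(2)] odiff_homogeneous[OF FC(2) hG] nz])
      then show ?thesis
        by (simp only: d)
    next
      assume nz: "gmult (odiff a (gparity F)) (even_deriv base_diff a G) q \<noteq> 0"
      have "mono_in M c q \<and> deg q = (i, j, k) - otriple a + ((i', j', k') - ((1, 1, 1) - otriple a))"
        by (rule T_gmult[OF B.odiff_carrier[OF B.gparity_carrier[OF FC(1)]]
              odiff_homogeneous[OF B.gparity_carrier[OF FC(1)] hPF]
              B.even_deriv_carrier[OF FC(2)] even_deriv_homogeneous[OF hG] nz])
      then show ?thesis
        by (simp only: d)
    qed
  qed
  then show ?thesis
    using FC by (simp add: T_def del: split_paired_All)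
qed

lemma T_empty_degree:
  assumes "F \<in> T i j k" "i < 0 \<or> j < 0 \<or> k < 0 \<or> j + k < i"
  shows "F = 0"
proof
  fix q :: gmono
  obtain S m where q: "q = (S, m)"
    by (cases q)
  have "F q = 0"
  proof (rule ccontr)
    assume "F q \<noteq> 0"
    then have "deg (S, m) = (i, j, k)"
      using TD[OF assms(1)] q by simp
    then show False
      using assms(2) deg_bounds(1-4)[of S m i j k] by auto
  qed
  then show "F q = 0 q"
    by simp
qed

sublocale T: trigraded_lie C B.Even B.Odd br T
proof
  show "F \<in> B.Even" if "F \<in> T a b d" "odd (a + b + d)" for F a b d
    using T_carrier[OF that(1)] trans[OF T_parity[OF that(1)] if_not_P[OF that(2)]] unfolding B.Even_def by blast
  show "F \<in> B.Odd" if "F \<in> T a b d" "even (a + b + d)" for F a b d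
    using T_carrier[OF that(1)] trans[OF T_parity[OF that(1)] if_P[OF that(2)]] unfolding B.Odd_def by blast
  show "subspace (T a b d)" for a b d
  proof (rule subspaceI)
    show "0 \<in> T a b d"
      using B.subspace_carrier by (simp add: T_def subspace_0)
    show "F + G \<in> T a b d" if FG: "F \<in> T a b d" "G \<in> T a b d" for F G
    proof -
      have "F q \<noteq> 0 \<or> G q \<noteq> 0" if "(F + G) q \<noteq> 0" for q
        using that by auto
      then show ?thesis
        using FG TD[OF FG(1)] TD[OF FG(2)] subspace_add[OF B.subspace_carrier, of F G]
        unfolding T_def mem_Collect_eq by metis
    qed
    show "r *\<^sub>R F \<in> T a b d" if F: "F \<in> T a b d" for F r
    proof -
      have "F q \<noteq> 0" if "(r *\<^sub>R F) q \<noteq> 0" for q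
        using that by auto
      then show ?thesis
        using TD[OF F] subspace_scale[OF B.subspace_carrier T_carrier[OF F], of r]
        unfolding T_def mem_Collect_eq by metis
    qed
  qed
  show "br F G \<in> T (a + a' - 1) (b + b' - 1) (d + d' - 1)"
    if "F \<in> T a b d" "G \<in> T a' b' d'" for F G a b d a' b' d'
    using that by (rule T_br_closed)
  show "F = 0" if "F \<in> T a b d" "a < 0 \<or> b < 0 \<or> d < 0 \<or> b + d < a" for F a b d
    using that by (rule T_empty_degree)
qed

end

section \<open>Sections as functions\<close>

lemma odiff_gterm:
  "odiff v (gterm {w} {#} g) = (if v = w then gterm {} {#} g else 0)"
  "odiff v (gterm {} m g) = 0"
  by (auto simp: fun_eq_iff odiff_def gterm_def)

lemma ediff_gterm:
  "ediff v (gterm S {#w#} g) = (if v = w then gterm S {#} g else 0)"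
  "ediff v (gterm S {#} g) = 0"
  by (auto simp: fun_eq_iff ediff_def gterm_def)

lemma odiff_sum: "odiff v (sum h J) = (\<Sum>a\<in>J. odiff v (h a))"
  by (rule linear_sum[OF linear_odiff])

lemma ediff_sum: "ediff v (sum h J) = (\<Sum>a\<in>J. ediff v (h a))"
  by (rule linear_sum[OF linear_ediff])

lemma gterm_apply: "gterm S m f (S', m') x = (if S' = S \<and> m' = m then f x else 0)"
  by (simp add: gterm_def)

lemma gmult_gterm_right:
  assumes "\<And>S m. infinite S \<Longrightarrow> F (S, m) x = 0"
  shows "gmult F (gterm {} {#} g) q x = F q x * g x"
proof -
  obtain S m where q: "q = (S, m)"
    by (cases q)
  show ?thesis
  proof (cases "finite S")
    case True
    have "gmult F (gterm {} {#} g) (S, m) x = (\<Sum>p\<in>Pow S \<times> {k. k \<subseteq># m}. if p = (S, m) then F (S, m) x * g x else 0)"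
      unfolding gmult_def prod.case by (rule sum.cong) (auto simp: gterm_def Diff_eq_empty_iff_mset split: if_splits dest: subset_mset.antisym)
    also have "\<dots> = F (S, m) x * g x"
      using True by (subst sum.delta) auto
    finally show ?thesis
      by (simp add: q)
  next
    case False
    then show ?thesis
      using assms by (simp add: q gmult_infinite)
  qed
qed

lemma gmult_zero [simp]: "gmult 0 F = 0" "gmult F 0 = 0"
  using gmult_bilinear(1)[of 0 0 F] gmult_bilinear(2)[of F 0 0] by simp_all

context chart_algebra
begin

definition cut :: "('m \<Rightarrow> real) \<Rightarrow> 'm \<Rightarrow> real" where
  "cut f = (\<lambda>x. if x \<in> dm then f x else 0)"

lemma cut_base: "smooth_on M dm f \<Longrightarrow> cut f \<in> base"
  using smooth_on_cong[OF chartD(2), of f "cut f"] by (auto simp: base_def cut_def)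

lemma rs_gterm: "rs (gterm S m f) = gterm S m (cut f)"
  by (auto simp: restrict_gfun_def gterm_def cut_def fun_eq_iff)

lemma rs_sum: "rs (sum h J) = (\<Sum>a\<in>J. rs (h a))"
  by (auto simp: restrict_gfun_def fun_eq_iff sum_fun_apply)

lemma rs_linear: "rs (F + G) = rs F + rs G" "rs (F - G) = rs F - rs G" "rs (- F) = - rs F"
  "rs (r *\<^sub>R F) = r *\<^sub>R rs F" "rs 0 = 0"
  by (auto simp: restrict_gfun_def fun_eq_iff)

lemma gterm_T:
  assumes "smooth_on M dm f" "mono_in M c (S, m)" "deg (S, m) = (i, j, k)"
  shows "gterm S m (cut f) \<in> T i j k"
proof -
  have "finite S"
    using assms(2) finite_subset unfolding mono_in_def by fastforce
  then show ?thesis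
    using assms cut_base[OF assms(1)] subspace_0[OF B.R_subspace]
    by (auto simp: T_def B.carrier_def gterm_def)
qed

lemma subspace_T: "subspace (T i j k)"
  by (rule T.T_subspace)

definition "s1 X = rs (sec1 X c)"
definition "s2 Y = rs (sec2 Y c)"
definition "c1 \<alpha> = rs (cosec1 \<alpha> c)"
definition "c2 \<beta> = rs (cosec2 \<beta> c)"
definition "f0 f = rs (fun0 f c)"
definition "Hc H = rs (sym12_fun A H c)"
definition "Kc K = rs (wedge3_fun A K c)"

lemma
  shows s1_eq: "s1 X = (\<Sum>j<r1. gterm {} {#Xi_dn j#} (cut (\<lambda>x. frame_coeff (fr1 c) j x (X x))))"
    and s2_eq: "s2 Y = (\<Sum>k<r2. gterm {Th_dn k} {#} (cut (\<lambda>x. frame_coeff (fr2 c) k x (Y x))))"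
    and c1_eq: "c1 \<alpha> = (\<Sum>j<r1. gterm {Xi_up j} {#} (cut (\<lambda>x. \<alpha> x ((fr1 c ! j) x))))"
    and c2_eq: "c2 \<beta> = (\<Sum>k<r2. gterm {} {#Th_up k#} (cut (\<lambda>x. \<beta> x ((fr2 c ! k) x))))"
    and f0_eq: "f0 f = gterm {} {#} (cut f)"
  by (simp_all add: s1_def sec1_def s2_def sec2_def c1_def cosec1_def c2_def cosec2_def f0_def fun0_def
      rs_sum rs_gterm pairing_def)

abbreviation "loc1 \<equiv> smooth_section_on M (bun1 A) dm"
abbreviation "loc2 \<equiv> smooth_section_on M (bun2 A) dm"
abbreviation "loc1' \<equiv> smooth_section_on M (dual_bundle (bun1 A)) dm"
abbreviation "loc2' \<equiv> smooth_section_on M (dual_bundle (bun2 A)) dm"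

lemma loc_frame: "j < r1 \<Longrightarrow> loc1 (fr1 c ! j)" "k < r2 \<Longrightarrow> loc2 (fr2 c ! k)"
  using local_frameD(1)[OF chartD(4)] local_frameD(1)[OF chartD(5)] by blast+

lemma basis: "x \<in> dm \<Longrightarrow> basis_at (bun1 A) (fr1 c) x" "x \<in> dm \<Longrightarrow> basis_at (bun2 A) (fr2 c) x"
  using local_frameD(2)[OF chartD(4)] local_frameD(2)[OF chartD(5)] by blast+

lemma loc_sections: "X \<in> sections M E \<Longrightarrow> smooth_section_on M E dm X"
  unfolding sections_iff by (erule smooth_section_on_subset) simp

lemmas mono_deg_simps = mono_in_def deg_eq otriple_def etriple_def zero_prod_def

lemma s1_T [simp]: "loc1 X \<Longrightarrow> s1 X \<in> T 1 0 1"
  unfolding s1_eq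
  by (intro subspace_sum[OF subspace_T] gterm_T smooth_frame_coeff[OF bun1 chartD(2,4)])
    (auto simp: mono_deg_simps)

lemma s2_T [simp]: "loc2 X \<Longrightarrow> s2 X \<in> T 0 0 1"
  unfolding s2_eq
  by (intro subspace_sum[OF subspace_T] gterm_T smooth_frame_coeff[OF bun2 chartD(2,5)])
    (auto simp: mono_deg_simps)

lemma c1_T [simp]: "loc1' X \<Longrightarrow> c1 X \<in> T 0 1 0"
  unfolding c1_eq
  by (intro subspace_sum[OF subspace_T] gterm_T smooth_pairing[OF bun1 chartD(2)] loc_frame)
    (auto simp: mono_deg_simps)

lemma c2_T [simp]: "loc2' X \<Longrightarrow> c2 X \<in> T 1 1 0"
  unfolding c2_eq
  by (intro subspace_sum[OF subspace_T] gterm_T smooth_pairing[OF bun2 chartD(2)] loc_frame)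
    (auto simp: mono_deg_simps)

lemma f0_T [simp]: "smooth_on M dm f \<Longrightarrow> f0 f \<in> T 0 0 0"
  unfolding f0_eq by (intro gterm_T) (auto simp: mono_deg_simps)

lemma carrier_finite': "F \<in> C \<Longrightarrow> infinite S \<Longrightarrow> F (S, m) = 0"
  by (auto simp: B.carrier_def)

text \<open>A function on the base has only base derivatives, so its bracket sees only the momenta
  in \<open>F\<close>.\<close>

lemma br_f0:
  assumes F: "F \<in> C"
  shows "br F (f0 f) q x = (\<Sum>i<n. odiff (P_dn i) (gparity F) q x * base_diff i (cut f) x)"
proof -
  have 1: "(\<lambda>q. base_diff i (f0 f q)) = gterm {} {#} (base_diff i (cut f))" for i
    by (auto simp: f0_eq gterm_def fun_eq_iff)
  have 2: "odiff v (f0 f) = 0" "ediff w (f0 f) = 0" for v w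
    by (simp_all add: f0_eq odiff_gterm ediff_gterm)
  have 3: "gmult (odiff v (gparity F)) (gterm {} {#} g) q x = odiff v (gparity F) q x * g x" for v g
    by (rule gmult_gterm_right) (simp add: carrier_finite'[OF B.odiff_carrier[OF B.gparity_carrier[OF F]]])
  show ?thesis
    unfolding br_eq 1 2 3 by simp
qed

text \<open>Without momenta in \<open>F\<close>, the base derivatives of the frame coefficients do
  not contribute and the bracket is a contraction, that is, a derivative along the conjugate
  coordinates. The other kinds of sections behave in the same way.\<close>

lemma br_s2:
  assumes F: "F \<in> C" and P: "\<And>i. odiff (P_dn i) (gparity F) = 0"
  shows "br F (s2 X) q x = - (\<Sum>k<r2. ediff (Th_up k) F q x * cut (\<lambda>x. frame_coeff (fr2 c) k x (X x)) x)"
proof -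
  have 1: "odiff (P_dn i) (s2 X) = 0" "odiff (Xi_up j) (s2 X) = 0" "ediff v (s2 X) = 0" for i j v
    by (simp_all add: s2_eq odiff_sum ediff_sum odiff_gterm ediff_gterm)
  have 2: "odiff (Th_dn k) (s2 X) = gterm {} {#} (cut (\<lambda>x. frame_coeff (fr2 c) k x (X x)))" if "k < r2" for k
    using that by (simp add: s2_eq odiff_sum odiff_gterm if_distrib[of "\<lambda>f. f _"] cong: if_cong)
  have 3: "gmult (ediff v F) (gterm {} {#} g) q x = ediff v F q x * g x" for v g
    by (rule gmult_gterm_right) (simp add: carrier_finite'[OF B.ediff_carrier[OF F]])
  show ?thesis
    unfolding br_eq by (simp add: 1 2 3 P)
qed

lemma br_s1:
  assumes F: "F \<in> C" and P: "\<And>i. odiff (P_dn i) (gparity F) = 0"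
  shows "br F (s1 X) q x = - (\<Sum>j<r1. odiff (Xi_up j) (gparity F) q x * cut (\<lambda>x. frame_coeff (fr1 c) j x (X x)) x)"
proof -
  have 1: "odiff v (s1 X) = 0" "ediff (Th_up k) (s1 X) = 0" for k v
    by (simp_all add: s1_eq odiff_sum ediff_sum odiff_gterm ediff_gterm)
  have 2: "ediff (Xi_dn j) (s1 X) = gterm {} {#} (cut (\<lambda>x. frame_coeff (fr1 c) j x (X x)))" if "j < r1" for j
    using that by (simp add: s1_eq ediff_sum ediff_gterm if_distrib[of "\<lambda>f. f _"] cong: if_cong)
  have 3: "gmult (odiff v (gparity F)) (gterm {} {#} g) q x = odiff v (gparity F) q x * g x" for v g
    by (rule gmult_gterm_right) (simp add: carrier_finite'[OF B.odiff_carrier[OF B.gparity_carrier[OF F]]])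
  show ?thesis
    unfolding br_eq by (simp add: 1 2 3 P)
qed

lemma br_c1:
  assumes F: "F \<in> C" and P: "\<And>i. odiff (P_dn i) (gparity F) = 0"
  shows "br F (c1 \<alpha>) q x = - (\<Sum>j<r1. ediff (Xi_dn j) F q x * cut (\<lambda>x. \<alpha> x ((fr1 c ! j) x)) x)"
proof -
  have 1: "odiff (P_dn i) (c1 \<alpha>) = 0" "odiff (Th_dn k) (c1 \<alpha>) = 0" "ediff v (c1 \<alpha>) = 0" for i k v
    by (simp_all add: c1_eq odiff_sum ediff_sum odiff_gterm ediff_gterm)
  have 2: "odiff (Xi_up k) (c1 \<alpha>) = gterm {} {#} (cut (\<lambda>x. \<alpha> x ((fr1 c ! k) x)))" if "k < r1" for k
    using that by (simp add: c1_eq odiff_sum odiff_gterm if_distrib[of "\<lambda>f. f _"] cong: if_cong)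
  have 3: "gmult (ediff v F) (gterm {} {#} g) q x = ediff v F q x * g x" for v g
    by (rule gmult_gterm_right) (simp add: carrier_finite'[OF B.ediff_carrier[OF F]])
  show ?thesis
    unfolding br_eq by (simp add: 1 2 3 P)
qed

lemma br_c2:
  assumes F: "F \<in> C" and P: "\<And>i. odiff (P_dn i) (gparity F) = 0"
  shows "br F (c2 \<beta>) q x = - (\<Sum>k<r2. odiff (Th_dn k) (gparity F) q x * cut (\<lambda>x. \<beta> x ((fr2 c ! k) x)) x)"
proof -
  have 1: "odiff v (c2 \<beta>) = 0" "ediff (Xi_dn k) (c2 \<beta>) = 0" for k v
    by (simp_all add: c2_eq odiff_sum ediff_sum odiff_gterm ediff_gterm)
  have 2: "ediff (Th_up j) (c2 \<beta>) = gterm {} {#} (cut (\<lambda>x. \<beta> x ((fr2 c ! j) x)))" if "j < r2" for j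
    using that by (simp add: c2_eq ediff_sum ediff_gterm if_distrib[of "\<lambda>f. f _"] cong: if_cong)
  have 3: "gmult (odiff v (gparity F)) (gterm {} {#} g) q x = odiff v (gparity F) q x * g x" for v g
    by (rule gmult_gterm_right) (simp add: carrier_finite'[OF B.odiff_carrier[OF B.gparity_carrier[OF F]]])
  show ?thesis
    unfolding br_eq by (simp add: 1 2 3 P)
qed

text \<open>If a linear form is positive on the tridegree of \<open>F\<close>, then every monomial of \<open>F\<close> contains a
  variable on whose tridegree it is positive.\<close>

lemma T_detect:
  fixes a b d :: int
  assumes F: "F \<in> T i j k" and pos: "a * i + b * j + d * k > 0"
    and o: "\<And>v. (case otriple v of (i, j, k) \<Rightarrow> a * i + b * j + d * k) > 0 \<Longrightarrow> odiff v F = 0"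
    and e: "\<And>w. (case etriple w of (i, j, k) \<Rightarrow> a * i + b * j + d * k) > 0 \<Longrightarrow> ediff w F = 0"
  shows "F = 0"
proof
  fix q :: gmono
  obtain S m where q: "q = (S, m)"
    by (cases q)
  define w where "w = (\<lambda>(i, j, k). a * i + b * j + d * k :: int)"
  have w: "w (s + t) = w s + w t" "w 0 = 0" for s t
    by (cases s; cases t; simp add: w_def algebra_simps zero_prod_def)+
  have "F (S, m) = 0"
  proof (rule ccontr)
    assume nz: "F (S, m) \<noteq> 0"
    then have fin: "finite S" and dg: "deg (S, m) = (i, j, k)"
      using carrier_finite[OF T_carrier[OF F]] TD[OF F] by auto
    have 1: "w (otriple v) \<le> 0" if v: "v \<in> S" for v
    proof (rule ccontr)
      assume "\<not> w (otriple v) \<le> 0"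
      then have "odiff v F = 0"
        using o[of v] by (simp add: w_def)
      then have z: "odiff v F (S - {v}, m) x = 0" for x
        by simp
      have "F (S, m) x = 0" for x
        using z[of x] v by (simp add: odiff_def insert_absorb)
      then show False
        using nz by (simp add: fun_eq_iff)
    qed
    have 2: "w (etriple v) \<le> 0" if v: "v \<in># m" for v
    proof (rule ccontr)
      assume "\<not> w (etriple v) \<le> 0"
      then have "ediff v F = 0"
        using e[of v] by (simp add: w_def)
      then have z: "ediff v F (S, m - {#v#}) x = 0" for x
        by simp
      have "F (S, m) x = 0" for x
        using z[of x] v by (simp add: ediff_def count_eq_zero_iff del: of_nat_Suc)
      then show False
        using nz by (simp add: fun_eq_iff)
    qed
    have "w (\<Sum>v\<in>S. otriple v) \<le> 0"
      using fin 1 by (induction S rule: finite_induct) (auto simp: w intro: add_nonpos_nonpos)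
    moreover have "w (\<Sum>v\<in>#m. etriple v) \<le> 0"
      using 2 by (induction m) (auto simp: w intro: add_nonpos_nonpos)
    ultimately have "w (i, j, k) \<le> 0"
      using dg by (simp add: deg_eq flip: dg add: w)
    then show False
      using pos by (simp add: w_def)
  qed
  then show "F q = 0 q"
    by (simp add: q)
qed

end

section \<open>Detection by brackets\<close>

lemma odiff_scaled: "odiff v (\<lambda>q x. \<Sum>a\<in>J. G a q x * g a x) = (\<lambda>q x. \<Sum>a\<in>J. odiff v (G a) q x * g a x)"
  by (auto simp: odiff_def fun_eq_iff sum_distrib_left mult.assoc)

text \<open>For comparing coefficients of \<open>wedge3_fun\<close>, which lists only increasing
  triples of indices. Entries with a repeated index are their own negatives; the others are sorted
  by transpositions.\<close>

lemma alternating3_eqI: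
  fixes t u :: "nat \<Rightarrow> nat \<Rightarrow> nat \<Rightarrow> real"
  assumes t: "\<And>k l m. k < r \<Longrightarrow> l < r \<Longrightarrow> m < r \<Longrightarrow> t k l m = - t l k m \<and> t k l m = - t k m l"
    and u: "\<And>k l m. k < r \<Longrightarrow> l < r \<Longrightarrow> m < r \<Longrightarrow> u k l m = - u l k m \<and> u k l m = - u k m l"
    and eq: "\<And>k l m. k < l \<Longrightarrow> l < m \<Longrightarrow> m < r \<Longrightarrow> t k l m = u k l m"
    and r: "k < r" "l < r" "m < r"
  shows "t k l m = u k l m"
proof -
  have z: "s i i j = 0 \<and> s j i i = 0 \<and> s i j i = 0"
    if s: "\<And>k l m. k < r \<Longrightarrow> l < r \<Longrightarrow> m < r \<Longrightarrow> s k l m = - s l k m \<and> s k l m = - s k m l"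
      and ij: "i < r" "j < r" for s :: "nat \<Rightarrow> nat \<Rightarrow> nat \<Rightarrow> real" and i j
  proof -
    have "s i i j = - s i i j" "s j i i = - s j i i" "s i j i = - s j i i"
      using s[of i i j] s[of j i i] s[of i j i] ij by blast+
    then show ?thesis
      by linarith
  qed
  note z = z[of t, OF t] z[of u, OF u]
  consider "k = l \<or> l = m \<or> k = m" | "k < l \<and> l < m" | "k < m \<and> m < l" | "l < k \<and> k < m" | "l < m \<and> m < k"
    | "m < k \<and> k < l" | "m < l \<and> l < k"
    by linarith
  then show ?thesis
  proof cases
    case 1
    then show ?thesis
      using z(1)[of k l] z(1)[of k m] z(1)[of l k] z(1)[of m k] z(2)[of k l] z(2)[of k m] z(2)[of l k] z(2)[of m k] r
      by auto
  next
    case 2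
    then show ?thesis
      using eq r by simp
  next
    case 3
    then show ?thesis
      using eq[of k m l] t[of k l m] u[of k l m] r by simp
  next
    case 4
    then show ?thesis
      using eq[of l k m] t[of k l m] u[of k l m] r by simp
  next
    case 5
    then show ?thesis
      using eq[of l m k] t[of k l m] t[of l k m] u[of k l m] u[of l k m] r by simp
  next
    case 6
    then show ?thesis
      using eq[of m k l] t[of k l m] t[of k m l] u[of k l m] u[of k m l] r by simp
  next
    case 7
    then show ?thesis
      using eq[of m l k] t[of k l m] t[of l k m] t[of l m k] u[of k l m] u[of l k m] u[of l m k] r by simp
  qed
qed

lemma sorted_triple_eq:
  fixes j k l :: nat
  assumes "j < k" "k < l" "j' < k'" "k' < l'"
  shows "{j, k, l} = {j', k', l'} \<longleftrightarrow> j = j' \<and> k = k' \<and> l = l'"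
proof
  assume eq: "{j, k, l} = {j', k', l'}"
  have "sorted_list_of_set {j, k, l} = [j, k, l]" if "j < k" "k < l" for j k l :: nat
    using sorted_list_of_set.idem_if_sorted_distinct[of "[j, k, l]"] that by simp
  from this[OF assms(1,2)] this[OF assms(3,4)] eq show "j = j' \<and> k = k' \<and> l = l'"
    by (metis list.inject)
qed auto

context smooth_manifold
begin

text \<open>A cut-off coordinate. Bracketing with it singles out one momentum at a given point,
  although only global functions are available for testing.\<close>

lemma coordinate_function:
  assumes c: "(U, \<phi>) \<in> atlas M" and x: "x \<in> U" and i: "i < n"
  obtains f where "f \<in> Cinf M" "\<And>l. l < n \<Longrightarrow> chart_diff U \<phi> l f x = (if l = i then 1 else 0)"
proof -
  have U: "open U"
    using chart_open[OF c] by simp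
  obtain \<psi> V K where \<psi>: "smooth_on M UNIV \<psi>" "open V" "x \<in> V" "V \<subseteq> U" "\<And>x. x \<in> V \<Longrightarrow> \<psi> x = 1"
    "closed K" "K \<subseteq> U" "\<And>x. x \<notin> K \<Longrightarrow> \<psi> x = 0"
    using bump_function[OF U x] by metis
  define f where "f y = (if y \<in> U then \<psi> y * \<phi> y i else 0)" for y
  have "f \<in> Cinf M"
    unfolding f_def Cinf_iff by (rule cutoff_function[OF U \<psi>(1,6,7,8) smooth_on_coordinate[OF c i]])
  moreover have "chart_diff U \<phi> l f x = (if l = i then 1 else 0)" if l: "l < n" for l
  proof -
    have "chart_diff U \<phi> l f x = chart_diff U \<phi> l (\<lambda>y. \<phi> y i) x"
      using \<psi>(2-5) x l by (intro chart_diff_cong[OF c]) (auto simp: f_def)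
    also have "\<dots> = partial l (\<lambda>y. y i) (\<phi> x)"
      unfolding chart_diff_def
    proof (rule partial_cong[OF chart_open_image[OF c U] _ l])
      show "\<phi> x \<in> \<phi> ` (U \<inter> U)"
        using x by simp
      show "\<phi> (inv_into U \<phi> y) i = y i" if "y \<in> \<phi> ` (U \<inter> U)" for y
        using that chart_inverse[OF c] by auto
    qed
    also have "\<dots> = (if l = i then 1 else 0)"
      by (simp add: partial_def)
    finally show ?thesis .
  qed
  ultimately show ?thesis
    using that by blast
qed

end

context chart_algebra
begin

lemma odiff_T:
  assumes F: "F \<in> T i j k" and v: "otriple v = (a, b, d)"
  shows "odiff v F \<in> T (i - a) (j - b) (k - d)"
  using odiff_homogeneous[OF T_carrier[OF F] TD[OF F], of v] B.odiff_carrier[OF T_carrier[OF F]]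
  unfolding T_def by (simp add: v del: split_paired_All)

text \<open>A momentum carries tridegree (1, 1, 1); the condition says that what remains after
  removing one would have a tridegree without monomials.\<close>

lemma no_P:
  assumes F: "F \<in> T i j k" and d: "i < 1 \<or> j < 1 \<or> k < 1 \<or> j + k \<le> i"
  shows "odiff (P_dn l) F = 0"
  using d by (intro T.T_zero[OF odiff_T[OF F]]) (auto simp: otriple_def)

lemma odiff_gparity_zero:
  assumes F: "F \<in> T i j k"
  shows "odiff v (gparity F) = 0 \<longleftrightarrow> odiff v F = 0"
  by (simp add: T_parity[OF F] linear_neg[OF linear_odiff])

lemma no_P':
  "F \<in> T i j k \<Longrightarrow> i < 1 \<or> j < 1 \<or> k < 1 \<or> j + k \<le> i \<Longrightarrow> odiff (P_dn l) (gparity F) = 0"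
  by (simp add: odiff_gparity_zero no_P)

lemma odiff_outside:
  assumes F: "F \<in> T i j k" and v: "v \<notin> index_set"
  shows "odiff v F = 0"
proof
  fix q :: gmono
  show "odiff v F q = 0 q"
  proof (cases q)
    case (Pair S m)
    have "\<not> mono_in M c (insert v S, m)"
      using v by (auto simp: mono_in_def index_set_def)
    then have "F (insert v S, m) = 0"
      using TD[OF F] by blast
    then show ?thesis
      by (auto simp: Pair odiff_def fun_eq_iff)
  qed
qed

lemma ediff_outside:
  assumes F: "F \<in> T i j k" and v: "v \<notin> Th_up ` {..<r2} \<union> Xi_dn ` {..<r1}"
  shows "ediff v F = 0"
proof
  fix q :: gmono
  show "ediff v F q = 0 q"
  proof (cases q)
    case (Pair S m)
    have "\<not> mono_in M c (S, add_mset v m)"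
      using v by (auto simp: mono_in_def)
    then have "F (S, add_mset v m) = 0"
      using TD[OF F] by blast
    then show ?thesis
      by (auto simp: Pair ediff_def fun_eq_iff)
  qed
qed

lemma zero_funI: "F \<in> C \<Longrightarrow> (\<And>q x. x \<in> dm \<Longrightarrow> F q x = 0) \<Longrightarrow> F = 0"
  using carrier_eqI[of F 0] by simp

text \<open>At a point \<open>x\<close>, bracket with a global section that passes through the
  \<open>v\<close>-th frame vector; the contraction formula then reduces to the derivative in
  question at \<open>x\<close>.\<close>

lemma detect_s1:
  assumes F: "F \<in> T i j k" and P: "\<And>l. odiff (P_dn l) F = 0"
    and z: "\<And>X. X \<in> sections M (bun1 A) \<Longrightarrow> br F (s1 X) = 0"
  shows "odiff (Xi_up v) F = 0"
proof (cases "v < r1")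
  case True
  have "odiff (Xi_up v) (gparity F) q x = 0" if x: "x \<in> dm" for q x
  proof -
    obtain X where X: "X \<in> sections M (bun1 A)" "X x = (fr1 c ! v) x"
      using section_through[OF bun1 frame_in_fib[OF basis(1)[OF x] True]] by metis
    have "br F (s1 X) q x = - (\<Sum>j<r1. odiff (Xi_up j) (gparity F) q x * (if j = v then 1 else 0))"
      using P x True by (simp add: br_s1[OF T_carrier[OF F]] odiff_gparity_zero[OF F] cut_def X frame_coeff_frame[OF basis(1)[OF x]])
    then show ?thesis
      using z[OF X(1)] True by (simp add: if_distrib[of "(*) _"] cong: if_cong)
  qed
  then have "odiff (Xi_up v) (gparity F) = 0"
    by (intro zero_funI B.odiff_carrier B.gparity_carrier T_carrier[OF F])
  then show ?thesis
    by (simp add: odiff_gparity_zero[OF F])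
qed (auto intro!: odiff_outside[OF F] simp: index_set_def)

lemma detect_c2:
  assumes F: "F \<in> T i j k" and P: "\<And>l. odiff (P_dn l) F = 0"
    and z: "\<And>\<beta>. \<beta> \<in> sections M (dual_bundle (bun2 A)) \<Longrightarrow> br F (c2 \<beta>) = 0"
  shows "odiff (Th_dn v) F = 0"
proof (cases "v < r2")
  case True
  have "odiff (Th_dn v) (gparity F) q x = 0" if x: "x \<in> dm" for q x
  proof -
    obtain X where X: "X \<in> sections M (dual_bundle (bun2 A))" "X x = dual_elt (bun2 A) (fr2 c) v x"
      using section_through[OF vector_bundle_dual[OF bun2] dual_elt_fib[OF basis(2)[OF x]]] by metis
    have "br F (c2 X) q x = - (\<Sum>j<r2. odiff (Th_dn j) (gparity F) q x * (if v = j then 1 else 0))"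
      using P x True by (simp add: br_c2[OF T_carrier[OF F]] odiff_gparity_zero[OF F] cut_def X dual_elt_frame[OF basis(2)[OF x]])
    then show ?thesis
      using z[OF X(1)] True by (simp add: if_distrib[of "(*) _"] cong: if_cong)
  qed
  then have "odiff (Th_dn v) (gparity F) = 0"
    by (intro zero_funI B.odiff_carrier B.gparity_carrier T_carrier[OF F])
  then show ?thesis
    by (simp add: odiff_gparity_zero[OF F])
qed (auto intro!: odiff_outside[OF F] simp: index_set_def)

lemma detect_s2:
  assumes F: "F \<in> T i j k" and P: "\<And>l. odiff (P_dn l) F = 0"
    and z: "\<And>X. X \<in> sections M (bun2 A) \<Longrightarrow> br F (s2 X) = 0"
  shows "ediff (Th_up v) F = 0"
proof (cases "v < r2")
  case True
  have "ediff (Th_up v) F q x = 0" if x: "x \<in> dm" for q x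
  proof -
    obtain X where X: "X \<in> sections M (bun2 A)" "X x = (fr2 c ! v) x"
      using section_through[OF bun2 frame_in_fib[OF basis(2)[OF x] True]] by metis
    have "br F (s2 X) q x = - (\<Sum>j<r2. ediff (Th_up j) F q x * (if j = v then 1 else 0))"
      using P x True by (simp add: br_s2[OF T_carrier[OF F]] odiff_gparity_zero[OF F] cut_def X frame_coeff_frame[OF basis(2)[OF x]])
    then show ?thesis
      using z[OF X(1)] True by (simp add: if_distrib[of "(*) _"] cong: if_cong)
  qed
  then show ?thesis
    by (intro zero_funI B.ediff_carrier T_carrier[OF F])
qed (auto intro!: ediff_outside[OF F])

lemma detect_c1:
  assumes F: "F \<in> T i j k" and P: "\<And>l. odiff (P_dn l) F = 0"
    and z: "\<And>\<beta>. \<beta> \<in> sections M (dual_bundle (bun1 A)) \<Longrightarrow> br F (c1 \<beta>) = 0"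
  shows "ediff (Xi_dn v) F = 0"
proof (cases "v < r1")
  case True
  have "ediff (Xi_dn v) F q x = 0" if x: "x \<in> dm" for q x
  proof -
    obtain X where X: "X \<in> sections M (dual_bundle (bun1 A))" "X x = dual_elt (bun1 A) (fr1 c) v x"
      using section_through[OF vector_bundle_dual[OF bun1] dual_elt_fib[OF basis(1)[OF x]]] by metis
    have "br F (c1 X) q x = - (\<Sum>j<r1. ediff (Xi_dn j) F q x * (if v = j then 1 else 0))"
      using P x True by (simp add: br_c1[OF T_carrier[OF F]] odiff_gparity_zero[OF F] cut_def X dual_elt_frame[OF basis(1)[OF x]])
    then show ?thesis
      using z[OF X(1)] True by (simp add: if_distrib[of "(*) _"] cong: if_cong)
  qed
  then show ?thesis
    by (intro zero_funI B.ediff_carrier T_carrier[OF F])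
qed (auto intro!: ediff_outside[OF F])

lemma detect_f0:
  assumes F: "F \<in> T i j k"
    and z: "\<And>f. f \<in> Cinf M \<Longrightarrow> br F (f0 f) = 0"
  shows "odiff (P_dn v) F = 0"
proof (cases "v < n")
  case True
  have "odiff (P_dn v) (gparity F) q x = 0" if x: "x \<in> dm" for q x
  proof -
    obtain f where f: "f \<in> Cinf M" "\<And>l. l < n \<Longrightarrow> chart_diff (cbase c) (ccoord c) l f x = (if l = v then 1 else 0)"
      using coordinate_function[OF chartD(1) _ True, of x] chartD(3) x by auto
    have "base_diff l (cut f) x = (if l = v then 1 else 0)" if "l < n" for l
      using f(2)[OF that] chart_diff_cong[OF chartD(1,2) x, of f "cut f" l] that x chartD(3)
      by (auto simp: base_diff_def cut_def)
    then have "br F (f0 f) q x = (\<Sum>j<n. odiff (P_dn j) (gparity F) q x * (if j = v then 1 else 0))"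
      by (simp add: br_f0[OF T_carrier[OF F]])
    then show ?thesis
      using z[OF f(1)] True by (simp add: if_distrib[of "(*) _"] cong: if_cong)
  qed
  then have "odiff (P_dn v) (gparity F) = 0"
    by (intro zero_funI B.odiff_carrier B.gparity_carrier T_carrier[OF F])
  then show ?thesis
    by (simp add: odiff_gparity_zero[OF F])
qed (auto intro!: odiff_outside[OF F] simp: index_set_def)

text \<open>The weight \<open>j - i\<close> is 1 on \<open>Xi_up\<close>, -1 on \<open>Xi_dn\<close>
  and 0 on all other coordinates, so positive weight forces a factor \<open>Xi_up\<close>, and that
  is what sections of the degree -1 bundle detect. The next three lemmas use in the same way the
  weights that are positive only on \<open>Th_dn\<close>, \<open>Th_up\<close> and
  \<open>Xi_dn\<close>.\<close>

lemma T_zero_s1: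
  assumes F: "F \<in> T i j k" and ij: "i < j" "\<And>l. odiff (P_dn l) F = 0"
    and z: "\<And>X. X \<in> sections M (bun1 A) \<Longrightarrow> br F (s1 X) = 0"
  shows "F = 0"
  using ij detect_s1[OF F ij(2) z] by (intro T_detect[OF F, of "-1" 1 0])
    (auto simp: otriple_def etriple_def split: ovar.splits evar.splits)

lemma T_zero_c2:
  assumes F: "F \<in> T i j k" and ij: "i < k" "\<And>l. odiff (P_dn l) F = 0"
    and z: "\<And>X. X \<in> sections M (dual_bundle (bun2 A)) \<Longrightarrow> br F (c2 X) = 0"
  shows "F = 0"
  using ij detect_c2[OF F ij(2) z] by (intro T_detect[OF F, of "-1" 0 1])
    (auto simp: otriple_def etriple_def split: ovar.splits evar.splits)

lemma T_zero_s2: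
  assumes F: "F \<in> T i j k" and ij: "k < i" "\<And>l. odiff (P_dn l) F = 0"
    and z: "\<And>X. X \<in> sections M (bun2 A) \<Longrightarrow> br F (s2 X) = 0"
  shows "F = 0"
  using ij detect_s2[OF F ij(2) z] by (intro T_detect[OF F, of 1 0 "-1"])
    (auto simp: otriple_def etriple_def split: ovar.splits evar.splits)

lemma T_zero_c1:
  assumes F: "F \<in> T i j k" and ij: "j < i" "\<And>l. odiff (P_dn l) F = 0"
    and z: "\<And>X. X \<in> sections M (dual_bundle (bun1 A)) \<Longrightarrow> br F (c1 X) = 0"
  shows "F = 0"
  using ij detect_c1[OF F ij(2) z] by (intro T_detect[OF F, of 1 "-1" 0])
    (auto simp: otriple_def etriple_def split: ovar.splits evar.splits)

text \<open>The weight \<open>j\<close> is positive exactly on the momenta, \<open>Xi_up\<close> and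
  \<open>Th_up\<close>, and these are detected by the three kinds of test functions. For the dual
  version below the weight is \<open>k\<close>.\<close>

lemma T_zero_111:
  assumes F: "F \<in> T 1 1 1" and z0: "\<And>f. f \<in> Cinf M \<Longrightarrow> br F (f0 f) = 0"
    and z1: "\<And>X. X \<in> sections M (bun1 A) \<Longrightarrow> br F (s1 X) = 0"
    and z2: "\<And>X. X \<in> sections M (bun2 A) \<Longrightarrow> br F (s2 X) = 0"
  shows "F = 0"
proof -
  note P = detect_f0[OF F z0]
  show ?thesis
    using P detect_s1[OF F P z1] detect_s2[OF F P z2] by (intro T_detect[OF F, of 0 1 0])
      (auto simp: otriple_def etriple_def split: ovar.splits evar.splits)
qed

lemma T_zero_111':
  assumes F: "F \<in> T 1 1 1" and z0: "\<And>f. f \<in> Cinf M \<Longrightarrow> br F (f0 f) = 0"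
    and z1: "\<And>X. X \<in> sections M (dual_bundle (bun1 A)) \<Longrightarrow> br F (c1 X) = 0"
    and z2: "\<And>X. X \<in> sections M (dual_bundle (bun2 A)) \<Longrightarrow> br F (c2 X) = 0"
  shows "F = 0"
proof -
  note P = detect_f0[OF F z0]
  show ?thesis
    using P detect_c1[OF F P z1] detect_c2[OF F P z2] by (intro T_detect[OF F, of 0 0 1])
      (auto simp: otriple_def etriple_def split: ovar.splits evar.splits)
qed

end

section \<open>Pairings and contractions as brackets\<close>

context chart_algebra
begin

lemma pairing_expansion:
  assumes b: "basis_at E es x" and v: "v \<in> fib E x" and \<alpha>: "\<alpha> \<in> fib (dual_bundle E) x"
  shows "(\<Sum>j<length es. frame_coeff es j x v * \<alpha> ((es ! j) x)) = \<alpha> v"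
proof -
  have l: "lin_on (fib E x) UNIV \<alpha>"
    using \<alpha> by (simp add: fib_dual[OF b])
  have "\<alpha> v = \<alpha> (\<Sum>j<length es. frame_coeff es j x v *\<^sub>R (es ! j) x)"
    using frame_expansion[OF b v] by simp
  also have "\<dots> = (\<Sum>j<length es. \<alpha> (frame_coeff es j x v *\<^sub>R (es ! j) x))"
    using frame_in_fib[OF b] subspace_fib[OF b] by (intro lin_on_sum[OF l]) (auto intro: subspace_scale)
  also have "\<dots> = (\<Sum>j<length es. frame_coeff es j x v * \<alpha> ((es ! j) x))"
    using lin_onD(3)[OF l] frame_in_fib[OF b] by simp
  finally show ?thesis ..
qed

text \<open>The sign, opposite to that of \<open>pair_2\<close>, comes from
  \<open>{\<xi>\<^sub>j, \<xi>\<^sup>j} = -1\<close> as against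
  \<open>{\<theta>\<^sub>k, \<theta>\<^sup>k} = 1\<close>.\<close>

lemma pair_1:
  assumes X: "loc1 X" and \<alpha>: "loc1' \<alpha>"
  shows "br (s1 X) (c1 \<alpha>) = - f0 (pairing X \<alpha>)"
proof (rule carrier_eqI)
  show "br (s1 X) (c1 \<alpha>) \<in> C" "- f0 (pairing X \<alpha>) \<in> C"
    using T_carrier[OF s1_T[OF X]] T_carrier[OF c1_T[OF \<alpha>]] T_carrier[OF f0_T[OF smooth_pairing[OF bun1 chartD(2) X \<alpha>]]]
    by (simp_all add: pairing_def)
  fix q :: gmono and x assume x: "x \<in> dm"
  have P: "odiff (P_dn i) (gparity (s1 X)) = 0" for i
    by (rule no_P'[OF s1_T[OF X]]) simp
  have e: "ediff (Xi_dn j) (s1 X) = gterm {} {#} (cut (\<lambda>x. frame_coeff (fr1 c) j x (X x)))" if "j < r1" for j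
    using that by (simp add: s1_eq ediff_sum ediff_gterm if_distrib[of "\<lambda>f. f _"] cong: if_cong)
  have "br (s1 X) (c1 \<alpha>) q x = - (\<Sum>j<r1. (if q = ({}, {#}) then frame_coeff (fr1 c) j x (X x) * \<alpha> x ((fr1 c ! j) x) else 0))"
    using x by (simp add: br_c1[OF T_carrier[OF s1_T[OF X]] P]) (intro sum.cong refl, simp add: e cut_def gterm_def)
  also have "\<dots> = (if q = ({}, {#}) then - \<alpha> x (X x) else 0)"
    using pairing_expansion[OF basis(1)[OF x], of "X x" "\<alpha> x"] X \<alpha> x by (auto simp: smooth_section_on_def)
  also have "\<dots> = (- f0 (pairing X \<alpha>)) q x"
    using x by (simp add: f0_eq gterm_def cut_def pairing_def)
  finally show "br (s1 X) (c1 \<alpha>) q x = (- f0 (pairing X \<alpha>)) q x" .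
qed

lemma pair_2:
  assumes X: "loc2 X" and \<alpha>: "loc2' \<alpha>"
  shows "br (s2 X) (c2 \<alpha>) = f0 (pairing X \<alpha>)"
proof (rule carrier_eqI)
  show "br (s2 X) (c2 \<alpha>) \<in> C" "f0 (pairing X \<alpha>) \<in> C"
    using T_carrier[OF s2_T[OF X]] T_carrier[OF c2_T[OF \<alpha>]] T_carrier[OF f0_T[OF smooth_pairing[OF bun2 chartD(2) X \<alpha>]]]
    by (simp_all add: pairing_def)
  fix q :: gmono and x assume x: "x \<in> dm"
  have P: "odiff (P_dn i) (gparity (s2 X)) = 0" for i
    by (rule no_P'[OF s2_T[OF X]]) simp
  have p: "gparity (s2 X) = - s2 X"
    using T_parity[OF s2_T[OF X]] by simp
  have e: "odiff (Th_dn k) (s2 X) = gterm {} {#} (cut (\<lambda>x. frame_coeff (fr2 c) k x (X x)))" if "k < r2" for k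
    using that by (simp add: s2_eq odiff_sum odiff_gterm if_distrib[of "\<lambda>f. f _"] cong: if_cong)
  have "br (s2 X) (c2 \<alpha>) q x = (\<Sum>j<r2. (if q = ({}, {#}) then frame_coeff (fr2 c) j x (X x) * \<alpha> x ((fr2 c ! j) x) else 0))"
    using x by (simp add: br_c2[OF T_carrier[OF s2_T[OF X]] P] p linear_neg[OF linear_odiff] sum_negf)
      (intro sum.cong refl, simp add: e cut_def gterm_def)
  also have "\<dots> = (if q = ({}, {#}) then \<alpha> x (X x) else 0)"
    using pairing_expansion[OF basis(2)[OF x], of "X x" "\<alpha> x"] X \<alpha> x by (auto simp: smooth_section_on_def)
  also have "\<dots> = f0 (pairing X \<alpha>) q x"
    using x by (simp add: f0_eq gterm_def cut_def pairing_def)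
  finally show "br (s2 X) (c2 \<alpha>) q x = f0 (pairing X \<alpha>) q x" .
qed

text \<open>Smoothness of \<open>H\<close> and \<open>K\<close> is required only on global sections,
  whereas the frames of a chart are local; near each point they agree with global sections. For
  \<open>H\<close> the third argument is a dummy.\<close>

lemma smooth_form3:
  assumes E: "vector_bundle M E" "vector_bundle M E'" "vector_bundle M E''"
    and \<alpha>: "smooth_section_on M E dm \<alpha>" "smooth_section_on M E' dm \<beta>" "smooth_section_on M E'' dm \<delta>"
    and h: "\<And>\<alpha> \<beta> \<delta>. \<alpha> \<in> sections M E \<Longrightarrow> \<beta> \<in> sections M E' \<Longrightarrow> \<delta> \<in> sections M E'' \<Longrightarrow>
      (\<lambda>x. h x (\<alpha> x) (\<beta> x) (\<delta> x)) \<in> Cinf M"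
  shows "smooth_on M dm (\<lambda>x. h x (\<alpha> x) (\<beta> x) (\<delta> x))"
proof (rule smooth_on_local[OF chartD(2)])
  fix x assume x: "x \<in> dm"
  obtain S W where S: "S \<in> sections M E" "open W" "x \<in> W" "W \<subseteq> dm" "\<And>x. x \<in> W \<Longrightarrow> S x = \<alpha> x"
    using section_extension[OF E(1) chartD(2) \<alpha>(1) x] by metis
  obtain S' W' where S': "S' \<in> sections M E'" "open W'" "x \<in> W'" "W' \<subseteq> dm" "\<And>x. x \<in> W' \<Longrightarrow> S' x = \<beta> x"
    using section_extension[OF E(2) chartD(2) \<alpha>(2) x] by metis
  obtain S'' W'' where S'': "S'' \<in> sections M E''" "open W''" "x \<in> W''" "W'' \<subseteq> dm" "\<And>x. x \<in> W'' \<Longrightarrow> S'' x = \<delta> x"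
    using section_extension[OF E(3) chartD(2) \<alpha>(3) x] by metis
  have "smooth_on M (W \<inter> W' \<inter> W'') (\<lambda>x. h x (S x) (S' x) (S'' x))"
    using h[OF S(1) S'(1) S''(1)] by (auto simp: Cinf_iff intro: smooth_on_subset)
  then have "smooth_on M (W \<inter> W' \<inter> W'') (\<lambda>x. h x (\<alpha> x) (\<beta> x) (\<delta> x))"
    by (rule smooth_on_cong[OF open_Int[OF open_Int[OF S(2) S'(2)] S''(2)], rotated]) (simp add: S S' S'')
  then show "\<exists>V. open V \<and> x \<in> V \<and> smooth_on M V (\<lambda>x. h x (\<alpha> x) (\<beta> x) (\<delta> x))"
    using S S' S'' by (intro exI[of _ "W \<inter> W' \<inter> W''"]) auto
qed

lemma Hc_eq: "Hc H = (\<Sum>j<r1. \<Sum>k<r2. gterm {Th_dn k} {#Xi_dn j#}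
    (cut (\<lambda>x. H x (dual_elt (bun1 A) (fr1 c) j x) (dual_elt (bun2 A) (fr2 c) k x))))"
  by (simp add: Hc_def sym12_fun_def rs_sum rs_gterm)

lemma Hc_T:
  assumes H: "H \<in> sym12_sections M A"
  shows "Hc H \<in> T 1 0 2"
  unfolding Hc_eq
proof (intro subspace_sum[OF subspace_T] gterm_T)
  fix j k assume "j \<in> {..<r1}" "k \<in> {..<r2}"
  then show "smooth_on M dm (\<lambda>x. H x (dual_elt (bun1 A) (fr1 c) j x) (dual_elt (bun2 A) (fr2 c) k x))"
    using H dual_elt_smooth[OF bun1 chartD(2,4), of j] dual_elt_smooth[OF bun2 chartD(2,5), of k]
    by (intro smooth_form3[of _ _ _ _ _ "dual_elt (bun2 A) (fr2 c) k" "\<lambda>x a b _. H x a b", OF vector_bundle_dual[OF bun1] vector_bundle_dual[OF bun2] vector_bundle_dual[OF bun2]])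
      (auto simp: sym12_sections_def)
qed (auto simp: mono_deg_simps)

lemma gterm_mult_apply: "gterm S m f q x * g x = gterm S m (\<lambda>x. f x * g x) q x"
  by (auto simp: gterm_def)

lemma gterm_sum_apply: "(\<Sum>a\<in>J. gterm S m (f a) q x) = gterm S m (\<lambda>x. \<Sum>a\<in>J. f a x) q x"
  by (auto simp: gterm_def)

lemma gterm_cong: "f x = g x \<Longrightarrow> gterm S m f q x = gterm S m g q x"
  by (auto simp: gterm_def)

lemma form_expand2:
  assumes b: "basis_at E es x" and l: "lin_on (fib (dual_bundle E) x) UNIV (h :: _ \<Rightarrow> real)" and \<beta>: "\<beta> \<in> fib (dual_bundle E) x"
  shows "(\<Sum>k<length es. h (dual_elt E es k x) * \<beta> ((es ! k) x)) = h \<beta>"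
proof -
  have "h \<beta> = h (\<Sum>k<length es. \<beta> ((es ! k) x) *\<^sub>R dual_elt E es k x)"
    using dual_expansion[OF b \<beta>] by simp
  also have "\<dots> = (\<Sum>k<length es. h (\<beta> ((es ! k) x) *\<^sub>R dual_elt E es k x))"
    using dual_elt_fib[OF b] subspace_dual_fib[OF b] by (intro lin_on_sum[OF l]) (auto intro: subspace_scale)
  also have "\<dots> = (\<Sum>k<length es. h (dual_elt E es k x) * \<beta> ((es ! k) x))"
    using lin_onD(3)[OF l] dual_elt_fib[OF b] by (simp add: mult.commute)
  finally show ?thesis ..
qed

lemma Hc_c2:
  assumes H: "H \<in> sym12_sections M A" and \<beta>: "loc2' \<beta>"
  shows "br (Hc H) (c2 \<beta>) = s1 (\<lambda>x. H_sharp A H x (\<beta> x))"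
proof (intro ext)
  fix q :: gmono and x
  note HT = Hc_T[OF H]
  have P: "odiff (P_dn i) (gparity (Hc H)) = 0" for i
    by (rule no_P'[OF HT]) simp
  have p: "gparity (Hc H) = - Hc H"
    using T_parity[OF HT] by simp
  have e: "odiff (Th_dn k) (gterm {Th_dn k'} {#Xi_dn j#} f) = (if k = k' then gterm {} {#Xi_dn j#} f else 0)" for k k' j and f :: "'m \<Rightarrow> real"
    by (auto simp: odiff_def gterm_def fun_eq_iff)
  have D: "odiff (Th_dn k) (Hc H) = (\<Sum>j<r1. gterm {} {#Xi_dn j#}
      (cut (\<lambda>x. H x (dual_elt (bun1 A) (fr1 c) j x) (dual_elt (bun2 A) (fr2 c) k x))))" if "k < r2" for k
    using that by (simp add: Hc_eq odiff_sum e if_distrib[of "\<lambda>f. f _"] cong: if_cong)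
  have "br (Hc H) (c2 \<beta>) q x = (\<Sum>k<r2. \<Sum>j<r1. gterm {} {#Xi_dn j#} (\<lambda>x. cut (\<lambda>x. H x (dual_elt (bun1 A) (fr1 c) j x)
      (dual_elt (bun2 A) (fr2 c) k x)) x * cut (\<lambda>x. \<beta> x ((fr2 c ! k) x)) x) q x)"
    by (simp add: br_c2[OF T_carrier[OF HT] P] p linear_neg[OF linear_odiff] sum_negf D sum_fun_apply sum_distrib_right gterm_mult_apply)
  also have "\<dots> = (\<Sum>j<r1. gterm {} {#Xi_dn j#} (\<lambda>x. \<Sum>k<r2. cut (\<lambda>x. H x (dual_elt (bun1 A) (fr1 c) j x)
      (dual_elt (bun2 A) (fr2 c) k x)) x * cut (\<lambda>x. \<beta> x ((fr2 c ! k) x)) x) q x)"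
    by (subst sum.swap) (simp add: gterm_sum_apply)
  also have "\<dots> = (\<Sum>j<r1. gterm {} {#Xi_dn j#} (cut (\<lambda>x. frame_coeff (fr1 c) j x (H_sharp A H x (\<beta> x)))) q x)"
  proof (intro sum.cong refl gterm_cong)
    fix j assume "j \<in> {..<r1}"
    show "(\<Sum>k<r2. cut (\<lambda>x. H x (dual_elt (bun1 A) (fr1 c) j x) (dual_elt (bun2 A) (fr2 c) k x)) x
        * cut (\<lambda>x. \<beta> x ((fr2 c ! k) x)) x) = cut (\<lambda>x. frame_coeff (fr1 c) j x (H_sharp A H x (\<beta> x))) x"
    proof (cases "x \<in> dm")
      case True
      have bx: "\<beta> x \<in> fib (dual_bundle (bun2 A)) x"
        using \<beta> True by (simp add: smooth_section_on_def)
      have bl: "bilin_on (fib (dual_bundle (bun1 A)) x) (fib (dual_bundle (bun2 A)) x) UNIV (H x)"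
        using H by (simp add: sym12_sections_def)
      have r: "H_sharp A H x (\<beta> x) = riesz (bun1 A) x (\<lambda>\<alpha>. H x \<alpha> (\<beta> x))"
        by (simp add: H_sharp_def riesz_def)
      have l1: "lin_on (fib (dual_bundle (bun1 A)) x) UNIV (\<lambda>\<alpha>. H x \<alpha> (\<beta> x))"
        using bl bx by (simp add: bilin_on_def)
      have d: "dual_elt (bun1 A) (fr1 c) j x \<in> fib (dual_bundle (bun1 A)) x"
        by (rule dual_elt_fib[OF basis(1)[OF True]])
      have l2: "lin_on (fib (dual_bundle (bun2 A)) x) UNIV (H x (dual_elt (bun1 A) (fr1 c) j x))"
        using bl d by (simp add: bilin_on_def)
      have "frame_coeff (fr1 c) j x (H_sharp A H x (\<beta> x)) = dual_elt (bun1 A) (fr1 c) j x (H_sharp A H x (\<beta> x))"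
        using riesz(1)[OF basis(1)[OF True] l1] by (simp add: dual_elt_def r)
      also have "\<dots> = H x (dual_elt (bun1 A) (fr1 c) j x) (\<beta> x)"
        using riesz(2)[OF basis(1)[OF True] l1 d] by (simp add: r)
      finally show ?thesis
        using True form_expand2[OF basis(2)[OF True] l2 bx] by (simp add: cut_def)
    qed (simp add: cut_def)
  qed
  finally show "br (Hc H) (c2 \<beta>) q x = s1 (\<lambda>x. H_sharp A H x (\<beta> x)) q x"
    by (simp add: s1_eq sum_fun_apply)
qed

end

lemma sum_triangle_delta:
  fixes v :: "'a::comm_monoid_add"
  assumes "j < k" "k < l" "l < (r::nat)"
  shows "(\<Sum>l'<r. \<Sum>k'<l'. \<Sum>j'<k'. if j' = j \<and> k' = k \<and> l' = l then f j' k' l' else 0) = (f j k l :: 'a)"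
proof -
  have "(\<Sum>j'<k'. if j' = j \<and> k' = k \<and> l' = l then f j' k' l' else 0) =
      (if k' = k then if l' = l then f j k l else 0 else 0)" for k' l'
    using assms by (cases "k' = k \<and> l' = l") (auto intro: sum.neutral)
  then have "(\<Sum>k'<l'. \<Sum>j'<k'. if j' = j \<and> k' = k \<and> l' = l then f j' k' l' else 0) =
      (\<Sum>k'<l'. if k' = k then if l' = l then f j k l else 0 else 0)" for l'
    by simp
  also have "\<dots> l' = (if l' = l then f j k l else 0)" for l'
    using assms by simp
  finally show ?thesis
    using assms by simp
qed

context chart_algebra
begin

section \<open>Contractions of the trivector\<close>

abbreviation "Kd K j k l x \<equiv>
  K x (dual_elt (bun2 A) (fr2 c) j x) (dual_elt (bun2 A) (fr2 c) k x) (dual_elt (bun2 A) (fr2 c) l x)"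

lemma Kc_eq: "Kc K = (\<Sum>l<r2. \<Sum>k<l. \<Sum>j<k. gterm {Th_dn j, Th_dn k, Th_dn l} {#} (cut (Kd K j k l)))"
  by (simp add: Kc_def wedge3_fun_def rs_sum rs_gterm)

lemma Kc_T:
  assumes K: "K \<in> wedge3_sections M A"
  shows "Kc K \<in> T 0 0 3"
  unfolding Kc_eq
proof (intro subspace_sum[OF subspace_T] gterm_T)
  fix j k l assume *: "l \<in> {..<r2}" "k \<in> {..<l}" "j \<in> {..<k}"
  then show "smooth_on M dm (Kd K j k l)"
    using K dual_elt_smooth[OF bun2 chartD(2,5)]
    by (intro smooth_form3[OF vector_bundle_dual[OF bun2] vector_bundle_dual[OF bun2] vector_bundle_dual[OF bun2]]) (auto simp: wedge3_sections_def)
  show "mono_in M c ({Th_dn j, Th_dn k, Th_dn l}, {#})" "deg ({Th_dn j, Th_dn k, Th_dn l}, {#}) = (0, 0, 3)"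
    using * by (auto simp: mono_deg_simps)
qed

lemma T_000:
  assumes F: "F \<in> T 0 0 0"
  shows "F = gterm {} {#} (F ({}, {#}))"
proof
  fix q :: gmono
  show "F q = gterm {} {#} (F ({}, {#})) q"
  proof (cases q)
    case (Pair S m)
    have "S = {} \<and> m = {#}" if nz: "F (S, m) \<noteq> 0"
    proof -
      have fin: "finite S" and d: "deg (S, m) = (0, 0, 0)"
        using carrier_finite[OF T_carrier[OF F] nz] TD[OF F nz] by auto
      have "tridegree (S, m) = (0, 0, 0)"
        using d by (simp add: deg_def prod_eq_iff)
      then have 1: "(\<Sum>v\<in>S. otri v) = (0, 0, 0)" "(\<Sum>v\<in>#m. etri v) = (0, 0, 0)"
        by (cases "\<Sum>v\<in>S. otri v"; cases "\<Sum>v\<in>#m. etri v"; auto simp: tridegree_def)+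
      have "S = {}"
      proof (rule ccontr)
        assume "S \<noteq> {}"
        then obtain v where v: "v \<in> S"
          by blast
        then have "(\<Sum>v\<in>S. otri v) = otri v + (\<Sum>v\<in>S - {v}. otri v)"
          using fin by (simp add: sum.remove)
        then show False
          using 1(1) by (cases v; cases "\<Sum>v\<in>S - {v}. otri v"; auto)
      qed
      moreover have "m = {#}"
      proof (rule ccontr)
        assume "m \<noteq> {#}"
        then obtain v m' where m: "m = add_mset v m'"
          by (metis multiset_cases)
        show False
          using 1(2) by (cases v; cases "\<Sum>v\<in>#m'. etri v"; auto simp: m)
      qed
      ultimately show ?thesis ..
    qed
    then show ?thesis
      by (auto simp: Pair gterm_def)
  qed
qed

text \<open>Odd derivatives anticommute, so the left side is alternating in \<open>k\<close>,
  \<open>l\<close>, \<open>m\<close> just like \<open>K\<close>. For increasing indices exactly one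
  monomial of \<open>wedge3_fun\<close> contributes.\<close>

lemma Kc_triple:
  assumes K: "K \<in> wedge3_sections M A" and r: "k < r2" "l < r2" "m < r2"
  shows "odiff (Th_dn m) (odiff (Th_dn l) (odiff (Th_dn k) (Kc K))) = gterm {} {#} (cut (Kd K k l m))"
proof -
  define t where "t k l m = odiff (Th_dn m) (odiff (Th_dn l) (odiff (Th_dn k) (Kc K)))" for k l m
  have tT: "t k l m \<in> T 0 0 0" for k l m
    using odiff_T[OF odiff_T[OF odiff_T[OF Kc_T[OF K]]], of "Th_dn k" 0 0 1 "Th_dn l" 0 0 1 "Th_dn m" 0 0 1]
    by (simp add: t_def otriple_def)
  have "t k l m ({}, {#}) x = cut (Kd K k l m) x" for x
  proof (cases "x \<in> dm")
    case True
    have sk: "skew3_on (fib (dual_bundle (bun2 A)) x) UNIV (K x)"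
      using K by (simp add: wedge3_sections_def)
    have alt: "K x a b d = - K x b a d \<and> K x a b d = - K x a d b"
      if "a \<in> fib (dual_bundle (bun2 A)) x" "b \<in> fib (dual_bundle (bun2 A)) x" "d \<in> fib (dual_bundle (bun2 A)) x" for a b d
      using sk that unfolding skew3_on_def by blast
    show ?thesis
    proof (rule alternating3_eqI[of r2 "\<lambda>k l m. t k l m ({}, {#}) x" "\<lambda>k l m. cut (Kd K k l m) x"])
      fix k l m
      show "t k l m ({}, {#}) x = - t l k m ({}, {#}) x \<and> t k l m ({}, {#}) x = - t k m l ({}, {#}) x"
        using odiff_odiff[of "Th_dn l" "Th_dn k" "Kc K"] odiff_odiff[of "Th_dn m" "Th_dn l" "odiff (Th_dn k) (Kc K)"]
        by (simp add: t_def linear_neg[OF linear_odiff])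
      show "cut (Kd K k l m) x = - cut (Kd K l k m) x \<and> cut (Kd K k l m) x = - cut (Kd K k m l) x"
        unfolding cut_def by (simp only: True if_True) (rule alt; rule dual_elt_fib[OF basis(2)[OF True]])
      assume kl: "k < l" and lm: "l < m" and mr: "m < r2"
      \<comment> \<open>With derivatives taken in increasing order, no remaining variable precedes
        the one being removed, so all signs are 1.\<close>
      have *: "{s. (s = Th_dn l \<or> s = Th_dn m) \<and> opos s < opos (Th_dn k)} = {}"
        "{s. s = Th_dn m \<and> opos s < opos (Th_dn l)} = {}"
        using kl lm by auto
      have "t k l m ({}, {#}) x = Kc K ({Th_dn k, Th_dn l, Th_dn m}, {#}) x"
        using kl lm by (simp add: t_def odiff_def * del: opos.simps)
      also have "\<dots> = (\<Sum>l'<r2. \<Sum>k'<l'. \<Sum>j'<k'. if j' = k \<and> k' = l \<and> l' = m then cut (Kd K j' k' l') x else 0)"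
        unfolding Kc_eq sum_fun_apply
      proof (intro sum.cong refl)
        fix j' k' l' assume "l' \<in> {..<r2}" "k' \<in> {..<l'}" "j' \<in> {..<k'}"
        then have "{Th_dn k, Th_dn l, Th_dn m} = {Th_dn j', Th_dn k', Th_dn l'} \<longleftrightarrow> j' = k \<and> k' = l \<and> l' = m"
          using sorted_triple_eq[of k l m j' k' l'] kl lm inj_image_eq_iff[of Th_dn "{k, l, m}" "{j', k', l'}"]
          by (auto simp: inj_def)
        then show "gterm {Th_dn j', Th_dn k', Th_dn l'} {#} (cut (Kd K j' k' l')) ({Th_dn k, Th_dn l, Th_dn m}, {#}) x
          = (if j' = k \<and> k' = l \<and> l' = m then cut (Kd K j' k' l') x else 0)"
          unfolding gterm_apply by simp
      qed
      also have "\<dots> = cut (Kd K k l m) x"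
        using kl lm mr by (rule sum_triangle_delta)
      finally show "t k l m ({}, {#}) x = cut (Kd K k l m) x" .
    qed (fact r)+
  next
    case False
    then show ?thesis
      using carrier_vanish[OF T_carrier[OF tT]] by (simp add: cut_def)
  qed
  then have "t k l m ({}, {#}) = cut (Kd K k l m)"
    by blast
  then show ?thesis
    using T_000[OF tT, of k l m] by (simp add: t_def)
qed

text \<open>Each contraction brings a minus sign and a parity sign; as the parities of the three
  stages alternate between odd, even and odd, the signs are plus, minus and plus.\<close>

lemma Kc_c2:
  assumes K: "K \<in> wedge3_sections M A" and \<alpha>: "loc2' \<alpha>" and \<beta>: "loc2' \<beta>" and \<delta>: "loc2' \<delta>"
  shows "br (br (br (Kc K) (c2 \<alpha>)) (c2 \<beta>)) (c2 \<delta>) = - f0 (\<lambda>x. K x (\<alpha> x) (\<beta> x) (\<delta> x))"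
proof (intro ext)
  fix q :: gmono and x
  note KT = Kc_T[OF K]
  let ?a = "\<lambda>\<alpha> k. cut (\<lambda>x. \<alpha> x ((fr2 c ! k) x))"
  let ?F = "br (Kc K) (c2 \<alpha>)" and ?G = "br (br (Kc K) (c2 \<alpha>)) (c2 \<beta>)"
  have FT: "?F \<in> T 0 0 2" and GT: "?G \<in> T 0 0 1"
    using T_br_closed[OF KT c2_T[OF \<alpha>]] T_br_closed[OF T_br_closed[OF KT c2_T[OF \<alpha>]] c2_T[OF \<beta>]] by simp_all
  have P: "odiff (P_dn i) (gparity F) = 0" if "F \<in> T 0 0 k" for i F k
    by (rule no_P'[OF that]) simp
  have p: "gparity (Kc K) = - Kc K" "gparity ?F = ?F" "gparity ?G = - ?G"
    using T_parity[OF KT] T_parity[OF FT] T_parity[OF GT] by simp_all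
  note neg = linear_neg[OF linear_odiff] sum_negf
  have F: "?F = (\<lambda>q x. \<Sum>k<r2. odiff (Th_dn k) (Kc K) q x * ?a \<alpha> k x)"
    by (intro ext) (simp add: br_c2[OF T_carrier[OF KT] P[OF KT]] p neg)
  have G: "?G = - (\<lambda>q x. \<Sum>l<r2. odiff (Th_dn l) ?F q x * ?a \<beta> l x)"
    by (intro ext) (simp add: br_c2[OF T_carrier[OF FT] P[OF FT]] p)
  have "odiff (Th_dn l) ?F = (\<lambda>q x. \<Sum>k<r2. odiff (Th_dn l) (odiff (Th_dn k) (Kc K)) q x * ?a \<alpha> k x)" for l
    by (subst F) (rule odiff_scaled)
  then have oF: "odiff (Th_dn m) (odiff (Th_dn l) ?F) = (\<lambda>q x. \<Sum>k<r2. odiff (Th_dn m) (odiff (Th_dn l) (odiff (Th_dn k) (Kc K))) q x * ?a \<alpha> k x)" for l m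
    by (simp only: odiff_scaled)
  have oG: "odiff (Th_dn m) ?G = - (\<lambda>q x. \<Sum>l<r2. (\<Sum>k<r2. odiff (Th_dn m) (odiff (Th_dn l) (odiff (Th_dn k) (Kc K))) q x
      * ?a \<alpha> k x) * ?a \<beta> l x)" for m
    unfolding G linear_neg[OF linear_odiff] odiff_scaled oF ..
  have "br ?G (c2 \<delta>) q x = (\<Sum>m<r2. odiff (Th_dn m) ?G q x * ?a \<delta> m x)"
    by (simp add: br_c2[OF T_carrier[OF GT] P[OF GT]] p neg)
  also have "\<dots> = - (\<Sum>m<r2. (\<Sum>l<r2. (\<Sum>k<r2. odiff (Th_dn m) (odiff (Th_dn l) (odiff (Th_dn k) (Kc K))) q x
      * ?a \<alpha> k x) * ?a \<beta> l x) * ?a \<delta> m x)"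
    by (simp add: oG sum_negf)
  also have "\<dots> = - (\<Sum>m<r2. (\<Sum>l<r2. (\<Sum>k<r2. gterm {} {#} (cut (Kd K k l m)) q x * ?a \<alpha> k x) * ?a \<beta> l x) * ?a \<delta> m x)"
    by (simp add: Kc_triple[OF K])
  also have "\<dots> = - gterm {} {#} (\<lambda>x. \<Sum>m<r2. (\<Sum>l<r2. (\<Sum>k<r2. cut (Kd K k l m) x * ?a \<alpha> k x) * ?a \<beta> l x) * ?a \<delta> m x) q x"
    by (simp only: gterm_mult_apply gterm_sum_apply)
  also have "\<dots> = - gterm {} {#} (cut (\<lambda>x. K x (\<alpha> x) (\<beta> x) (\<delta> x))) q x"
  proof (intro arg_cong[where f = uminus] gterm_cong)
    show "(\<Sum>m<r2. (\<Sum>l<r2. (\<Sum>k<r2. cut (Kd K k l m) x * ?a \<alpha> k x) * ?a \<beta> l x) * ?a \<delta> m x)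
        = cut (\<lambda>x. K x (\<alpha> x) (\<beta> x) (\<delta> x)) x"
    proof (cases "x \<in> dm")
      case True
      note b = basis(2)[OF True] and de = dual_elt_fib[OF basis(2)[OF True]]
      have sk: "skew3_on (fib (dual_bundle (bun2 A)) x) UNIV (K x)"
        using K by (simp add: wedge3_sections_def)
      have ax: "\<alpha> x \<in> fib (dual_bundle (bun2 A)) x" "\<beta> x \<in> fib (dual_bundle (bun2 A)) x" "\<delta> x \<in> fib (dual_bundle (bun2 A)) x"
        using \<alpha> \<beta> \<delta> True by (auto simp: smooth_section_on_def)
      have l: "lin_on (fib (dual_bundle (bun2 A)) x) UNIV (\<lambda>w. K x w u v)" "lin_on (fib (dual_bundle (bun2 A)) x) UNIV (\<lambda>w. K x u w v)"
        "lin_on (fib (dual_bundle (bun2 A)) x) UNIV (\<lambda>w. K x u v w)"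
        if "u \<in> fib (dual_bundle (bun2 A)) x" "v \<in> fib (dual_bundle (bun2 A)) x" for u v
        using sk that unfolding skew3_on_def by blast+
      show ?thesis
        using True form_expand2[OF b l(1)[OF de de] ax(1)] form_expand2[OF b l(2)[OF ax(1) de] ax(2)] form_expand2[OF b l(3)[OF ax(1,2)] ax(3)]
        by (simp add: cut_def)
    qed (simp add: cut_def)
  qed
  finally show "br ?G (c2 \<delta>) q x = (- f0 (\<lambda>x. K x (\<alpha> x) (\<beta> x) (\<delta> x))) q x"
    by (simp add: f0_eq)
qed

lemma T_eq_c2:
  assumes "F \<in> T 0 0 1" "G \<in> T 0 0 1" "\<And>\<delta>. \<delta> \<in> sections M (dual_bundle (bun2 A)) \<Longrightarrow> br F (c2 \<delta>) = br G (c2 \<delta>)"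
  shows "F = G"
proof -
  have "F - G \<in> T 0 0 1"
    using assms(1,2) subspace_diff[OF subspace_T] by blast
  then have "F - G = 0"
  proof (rule T_zero_c2)
    show "odiff (P_dn l) (F - G) = 0" for l
      by (rule no_P[OF subspace_diff[OF subspace_T assms(1,2)]]) simp
    show "br (F - G) (c2 \<delta>) = 0" if "\<delta> \<in> sections M (dual_bundle (bun2 A))" for \<delta>
      using assms(3)[OF that] T_carrier[OF assms(1)] T_carrier[OF assms(2)] by (simp add: B.pb_diff_left)
  qed simp
  then show ?thesis
    by simp
qed

lemma K_flat_section:
  assumes K: "K \<in> wedge3_sections M A" and \<alpha>: "\<alpha> \<in> sections M (dual_bundle (bun2 A))" and \<beta>: "\<beta> \<in> sections M (dual_bundle (bun2 A))"
  shows "(\<lambda>x. K_flat A K x (\<alpha> x) (\<beta> x)) \<in> sections M (bun2 A)"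
    and "v \<in> fib (dual_bundle (bun2 A)) x \<Longrightarrow> v (K_flat A K x (\<alpha> x) (\<beta> x)) = K x (\<alpha> x) (\<beta> x) v"
proof -
  have r: "K_flat A K x (\<alpha> x) (\<beta> x) = riesz (bun2 A) x (K x (\<alpha> x) (\<beta> x))" for x
    by (simp add: K_flat_def riesz_def)
  have l: "lin_on (fib (dual_bundle (bun2 A)) x) UNIV (K x (\<alpha> x) (\<beta> x))" for x
    using K section_in_fib[OF \<alpha>] section_in_fib[OF \<beta>] unfolding wedge3_sections_def skew3_on_def by blast
  show "(\<lambda>x. K_flat A K x (\<alpha> x) (\<beta> x)) \<in> sections M (bun2 A)"
    unfolding r using K \<alpha> \<beta> by (intro riesz_section[OF bun2 l]) (auto simp: wedge3_sections_def)
  show "v \<in> fib (dual_bundle (bun2 A)) x \<Longrightarrow> v (K_flat A K x (\<alpha> x) (\<beta> x)) = K x (\<alpha> x) (\<beta> x) v"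
    unfolding r by (rule riesz_bundle(2)[OF bun2 l])
qed

lemma Kc_flat:
  assumes K: "K \<in> wedge3_sections M A" and \<alpha>: "\<alpha> \<in> sections M (dual_bundle (bun2 A))" and \<beta>: "\<beta> \<in> sections M (dual_bundle (bun2 A))"
  shows "br (br (Kc K) (c2 \<alpha>)) (c2 \<beta>) = - s2 (\<lambda>x. K_flat A K x (\<alpha> x) (\<beta> x))"
proof (rule T_eq_c2)
  note loc = loc_sections[OF \<alpha>] loc_sections[OF \<beta>] loc_sections[OF K_flat_section(1)[OF K \<alpha> \<beta>]]
  show "br (br (Kc K) (c2 \<alpha>)) (c2 \<beta>) \<in> T 0 0 1"
    using T_br_closed[OF T_br_closed[OF Kc_T[OF K] c2_T] c2_T, OF loc(1,2)] by simp
  show "- s2 (\<lambda>x. K_flat A K x (\<alpha> x) (\<beta> x)) \<in> T 0 0 1"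
    using subspace_neg[OF subspace_T s2_T[OF loc(3)]] .
  fix \<delta> assume \<delta>: "\<delta> \<in> sections M (dual_bundle (bun2 A))"
  have "pairing (\<lambda>x. K_flat A K x (\<alpha> x) (\<beta> x)) \<delta> = (\<lambda>x. K x (\<alpha> x) (\<beta> x) (\<delta> x))"
    using K_flat_section(2)[OF K \<alpha> \<beta>] section_in_fib[OF \<delta>] by (simp add: pairing_def)
  then show "br (br (br (Kc K) (c2 \<alpha>)) (c2 \<beta>)) (c2 \<delta>) = br (- s2 (\<lambda>x. K_flat A K x (\<alpha> x) (\<beta> x))) (c2 \<delta>)"
    using Kc_c2[OF K loc(1,2) loc_sections[OF \<delta>]] pair_2[OF loc(3) loc_sections[OF \<delta>]] T_carrier[OF s2_T[OF loc(3)]]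
    by simp
qed

end

context smooth_manifold
begin

lemma H_sharp_section:
  assumes E: "vector_bundle M (bun1 A)" and H: "H \<in> sym12_sections M A"
  shows "\<beta> \<in> sections M (dual_bundle (bun2 A)) \<Longrightarrow> (\<lambda>x. H_sharp A H x (\<beta> x)) \<in> sections M (bun1 A)"
    and "b \<in> fib (dual_bundle (bun2 A)) x \<Longrightarrow> H_sharp A H x b \<in> fib (bun1 A) x"
    and "b \<in> fib (dual_bundle (bun2 A)) x \<Longrightarrow> v \<in> fib (dual_bundle (bun1 A)) x \<Longrightarrow> v (H_sharp A H x b) = H x v b"
proof -
  have r: "H_sharp A H x b = riesz (bun1 A) x (\<lambda>\<alpha>. H x \<alpha> b)" for x b
    by (simp add: H_sharp_def riesz_def)
  have l: "lin_on (fib (dual_bundle (bun1 A)) x) UNIV (\<lambda>\<alpha>. H x \<alpha> b)" if "b \<in> fib (dual_bundle (bun2 A)) x" for x b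
    using H that unfolding sym12_sections_def bilin_on_def by blast
  show "(\<lambda>x. H_sharp A H x (\<beta> x)) \<in> sections M (bun1 A)" if \<beta>: "\<beta> \<in> sections M (dual_bundle (bun2 A))"
    unfolding r using H \<beta> by (intro riesz_section[OF E l[OF section_in_fib[OF \<beta>]]]) (auto simp: sym12_sections_def)
  show "b \<in> fib (dual_bundle (bun2 A)) x \<Longrightarrow> H_sharp A H x b \<in> fib (bun1 A) x"
    "b \<in> fib (dual_bundle (bun2 A)) x \<Longrightarrow> v \<in> fib (dual_bundle (bun1 A)) x \<Longrightarrow> v (H_sharp A H x b) = H x v b"
    unfolding r by (rule riesz_bundle[OF E l]; assumption)+
qed

lemma H_nat_section:
  assumes E: "vector_bundle M (bun2 A)" and H: "H \<in> sym12_sections M A"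
  shows "\<beta> \<in> sections M (dual_bundle (bun1 A)) \<Longrightarrow> (\<lambda>x. H_nat A H x (\<beta> x)) \<in> sections M (bun2 A)"
    and "b \<in> fib (dual_bundle (bun1 A)) x \<Longrightarrow> H_nat A H x b \<in> fib (bun2 A) x"
    and "b \<in> fib (dual_bundle (bun1 A)) x \<Longrightarrow> v \<in> fib (dual_bundle (bun2 A)) x \<Longrightarrow> v (H_nat A H x b) = H x b v"
proof -
  have r: "H_nat A H x b = riesz (bun2 A) x (\<lambda>\<alpha>. H x b \<alpha>)" for x b
    by (simp add: H_nat_def riesz_def)
  have l: "lin_on (fib (dual_bundle (bun2 A)) x) UNIV (\<lambda>\<alpha>. H x b \<alpha>)" if "b \<in> fib (dual_bundle (bun1 A)) x" for x b
    using H that unfolding sym12_sections_def bilin_on_def by blast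
  show "(\<lambda>x. H_nat A H x (\<beta> x)) \<in> sections M (bun2 A)" if \<beta>: "\<beta> \<in> sections M (dual_bundle (bun1 A))"
    unfolding r using H \<beta> by (intro riesz_section[OF E l[OF section_in_fib[OF \<beta>]]]) (auto simp: sym12_sections_def)
  show "b \<in> fib (dual_bundle (bun1 A)) x \<Longrightarrow> H_nat A H x b \<in> fib (bun2 A) x"
    "b \<in> fib (dual_bundle (bun1 A)) x \<Longrightarrow> v \<in> fib (dual_bundle (bun2 A)) x \<Longrightarrow> v (H_nat A H x b) = H x b v"
    unfolding r by (rule riesz_bundle[OF E l]; assumption)+
qed

end

lemma restrict_gfun_eq_iff: "restrict_gfun D F = restrict_gfun D G \<longleftrightarrow> (\<forall>q. \<forall>x\<in>D. F q x = G q x)"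
  unfolding restrict_gfun_def fun_eq_iff by metis

lemma beq_iff: "beq M A F G \<longleftrightarrow> (\<forall>c. darboux_chart M A c \<longrightarrow> restrict_gfun (cdom c) (F c) = restrict_gfun (cdom c) (G c))"
  by (simp add: beq_def restrict_gfun_eq_iff)

context chart_algebra
begin

lemma T_eq_s2:
  assumes F: "F \<in> T 1 1 0" and G: "G \<in> T 1 1 0"
    and eq: "\<And>Y. Y \<in> sections M (bun2 A) \<Longrightarrow> br (s2 Y) F = br (s2 Y) G"
  shows "F = G"
proof -
  note FG = subspace_diff[OF subspace_T F G]
  have "F - G = 0"
  proof (rule T_zero_s2[OF FG])
    show "odiff (P_dn l) (F - G) = 0" for l
      by (rule no_P[OF FG]) simp
    fix Y assume Y: "Y \<in> sections M (bun2 A)"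
    note YT = s2_T[OF loc_sections[OF Y]]
    have "br (F - G) (s2 Y) = - br (s2 Y) (F - G)"
      using T.T_Od[OF FG] T.T_Ev[OF YT] by (intro B.swap_e') auto
    then show "br (F - G) (s2 Y) = 0"
      using eq[OF Y] T_carrier[OF F] T_carrier[OF G] T_carrier[OF YT] by (simp add: B.pb_diff_right)
  qed simp
  then show ?thesis
    by simp
qed

lemma T_eq_s1:
  assumes F: "F \<in> T 0 1 0" and G: "G \<in> T 0 1 0"
    and eq: "\<And>Y. Y \<in> sections M (bun1 A) \<Longrightarrow> br (s1 Y) F = br (s1 Y) G"
  shows "F = G"
proof -
  note FG = subspace_diff[OF subspace_T F G]
  have "F - G = 0"
  proof (rule T_zero_s1[OF FG])
    show "odiff (P_dn l) (F - G) = 0" for l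
      by (rule no_P[OF FG]) simp
    fix Y assume Y: "Y \<in> sections M (bun1 A)"
    note YT = s1_T[OF loc_sections[OF Y]]
    have "br (s1 Y) (F - G) = - br (F - G) (s1 Y)"
      using T.T_Ev[OF FG] T.T_Od[OF YT] by (intro B.swap_e') auto
    then show "br (F - G) (s1 Y) = 0"
      using eq[OF Y] T_carrier[OF F] T_carrier[OF G] T_carrier[OF YT] by (simp add: B.pb_diff_right)
  qed simp
  then show ?thesis
    by simp
qed

lemma f0_linear: "f0 (\<lambda>x. f x + g x) = f0 f + f0 g" "f0 (\<lambda>x. f x - g x) = f0 f - f0 g" "f0 (\<lambda>x. - f x) = - f0 f"
    "f0 (f + g) = f0 f + f0 g" "f0 (f - g) = f0 f - f0 g" "f0 (- f) = - f0 f" "f0 (r *\<^sub>R f) = r *\<^sub>R f0 f"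
  by (auto simp: f0_eq gterm_def cut_def fun_eq_iff)

lemma c1_linear: "c1 (\<alpha> + \<beta>) = c1 \<alpha> + c1 \<beta>" "c1 (\<alpha> - \<beta>) = c1 \<alpha> - c1 \<beta>" "c1 (- \<alpha>) = - c1 \<alpha>" "c1 (r *\<^sub>R \<alpha>) = r *\<^sub>R c1 \<alpha>" "c1 0 = 0"
  by (auto simp: c1_eq gterm_def cut_def fun_eq_iff sum_fun_apply sum.distrib[symmetric] sum_subtractf[symmetric] sum_negf[symmetric] sum_distrib_left intro!: sum.cong sum.neutral)

lemma c2_linear: "c2 (\<alpha> + \<beta>) = c2 \<alpha> + c2 \<beta>" "c2 (\<alpha> - \<beta>) = c2 \<alpha> - c2 \<beta>" "c2 (- \<alpha>) = - c2 \<alpha>" "c2 (r *\<^sub>R \<alpha>) = r *\<^sub>R c2 \<alpha>" "c2 0 = 0"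
  by (auto simp: c2_eq gterm_def cut_def fun_eq_iff sum_fun_apply sum.distrib[symmetric] sum_subtractf[symmetric] sum_negf[symmetric] sum_distrib_left intro!: sum.cong sum.neutral)

lemma smul_pointwise:
  "c1 (smul f \<alpha>) q x = f x * c1 \<alpha> q x" "c2 (smul f \<beta>) q x = f x * c2 \<beta> q x"
  by (auto simp: c1_eq c2_eq gterm_def cut_def smul_def sum_fun_apply sum_distrib_left intro!: sum.cong)

lemma gmult_f0_left:
  assumes F: "F \<in> C"
  shows "gmult (f0 g) F q x = g x * F q x"
proof (cases q)
  case (Pair S m)
  show ?thesis
  proof (cases "finite S")
    case True
    have "gmult (f0 g) F (S, m) x = (\<Sum>p\<in>Pow S \<times> {k. k \<subseteq># m}. if p = ({}, {#}) then cut g x * F (S, m) x else 0)"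
      unfolding gmult_def prod.case f0_eq by (rule sum.cong) (auto simp: gterm_def split: if_splits)
    also have "\<dots> = cut g x * F (S, m) x"
      using True by (subst sum.delta) auto
    finally show ?thesis
      using carrier_vanish[OF F] by (auto simp: Pair cut_def)
  next
    case False
    then show ?thesis
      using carrier_finite'[OF F] by (simp add: Pair gmult_infinite)
  qed
qed

lemma smul_gmult:
  "loc1' \<alpha> \<Longrightarrow> c1 (smul f \<alpha>) = gmult (f0 f) (c1 \<alpha>)" "loc2' \<beta> \<Longrightarrow> c2 (smul f \<beta>) = gmult (f0 f) (c2 \<beta>)"
  by (auto simp: fun_eq_iff smul_pointwise gmult_f0_left T_carrier[OF c1_T] T_carrier[OF c2_T])

lemma br_leibniz:
  assumes F: "F \<in> T i j k" and f: "smooth_on M dm f" and G: "G \<in> C"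
  shows "br F (gmult (f0 f) G) = gmult (br F (f0 f)) G + gmult (f0 f) (br F G)"
proof -
  note f0 = f0_T[OF f]
  have "gparity (f0 f) = 1 *\<^sub>R f0 f"
    using T_parity[OF f0] by simp
  moreover obtain s where "gparity F = s *\<^sub>R F" "s = 1 \<or> s = -1"
    using T_parity[OF F] by (metis scaleR_minus1_left scaleR_one)
  ultimately show ?thesis
    using B.pb_mul_right[OF T_carrier[OF F] T_carrier[OF f0] G, of s 1] by (auto simp: supersign_def)
qed

lemma c1_inj:
  assumes "loc1' \<alpha>" "loc1' \<beta>" "c1 \<alpha> = c1 \<beta>" "x \<in> dm"
  shows "\<alpha> x = \<beta> x"
proof (rule dual_eqI[OF basis(1)[OF assms(4)]])
  show "\<alpha> x \<in> fib (dual_bundle (bun1 A)) x" "\<beta> x \<in> fib (dual_bundle (bun1 A)) x"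
    using assms by (auto simp: smooth_section_on_def)
  fix j assume j: "j < r1"
  have "c1 \<gamma> ({Xi_up j}, {#}) x = \<gamma> x ((fr1 c ! j) x)" for \<gamma>
    using j assms(4) by (simp add: c1_eq sum_fun_apply gterm_def cut_def if_distrib[of "\<lambda>f. f _"] cong: if_cong)
  then show "\<alpha> x ((fr1 c ! j) x) = \<beta> x ((fr1 c ! j) x)"
    using assms(3) by metis
qed

lemma c2_inj:
  assumes "loc2' \<alpha>" "loc2' \<beta>" "c2 \<alpha> = c2 \<beta>" "x \<in> dm"
  shows "\<alpha> x = \<beta> x"
proof (rule dual_eqI[OF basis(2)[OF assms(4)]])
  show "\<alpha> x \<in> fib (dual_bundle (bun2 A)) x" "\<beta> x \<in> fib (dual_bundle (bun2 A)) x"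
    using assms by (auto simp: smooth_section_on_def)
  fix j assume j: "j < r2"
  have "c2 \<gamma> ({}, {#Th_up j#}) x = \<gamma> x ((fr2 c ! j) x)" for \<gamma>
    using j assms(4) by (simp add: c2_eq sum_fun_apply gterm_def cut_def if_distrib[of "\<lambda>f. f _"] cong: if_cong)
  then show "\<alpha> x ((fr2 c ! j) x) = \<beta> x ((fr2 c ! j) x)"
    using assms(3) by metis
qed

lemma s1_inj:
  assumes "loc1 X" "loc1 Y" "s1 X = s1 Y" "x \<in> dm"
  shows "X x = Y x"
proof -
  have "s1 Z ({}, {#Xi_dn j#}) x = frame_coeff (fr1 c) j x (Z x)" if "j < r1" for Z j
    using that assms(4) by (simp add: s1_eq sum_fun_apply gterm_def cut_def if_distrib[of "\<lambda>f. f _"] cong: if_cong)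
  then have "frame_coeff (fr1 c) j x (X x) = frame_coeff (fr1 c) j x (Y x)" if "j < r1" for j
    using assms(3) that by metis
  then have "(\<Sum>j<r1. frame_coeff (fr1 c) j x (X x) *\<^sub>R (fr1 c ! j) x) = (\<Sum>j<r1. frame_coeff (fr1 c) j x (Y x) *\<^sub>R (fr1 c ! j) x)"
    by simp
  then show ?thesis
    using assms frame_expansion[OF basis(1)[OF assms(4)]] by (simp add: smooth_section_on_def)
qed

lemma s2_inj:
  assumes "loc2 X" "loc2 Y" "s2 X = s2 Y" "x \<in> dm"
  shows "X x = Y x"
proof -
  have "s2 Z ({Th_dn j}, {#}) x = frame_coeff (fr2 c) j x (Z x)" if "j < r2" for Z j
    using that assms(4) by (simp add: s2_eq sum_fun_apply gterm_def cut_def if_distrib[of "\<lambda>f. f _"] cong: if_cong)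
  then have "frame_coeff (fr2 c) j x (X x) = frame_coeff (fr2 c) j x (Y x)" if "j < r2" for j
    using assms(3) that by metis
  then have "(\<Sum>j<r2. frame_coeff (fr2 c) j x (X x) *\<^sub>R (fr2 c ! j) x) = (\<Sum>j<r2. frame_coeff (fr2 c) j x (Y x) *\<^sub>R (fr2 c ! j) x)"
    by simp
  then show ?thesis
    using assms frame_expansion[OF basis(2)[OF assms(4)]] by (simp add: smooth_section_on_def)
qed

lemma s1_linear:
  assumes "loc1 X" "loc1 Y"
  shows "s1 (X + Y) = s1 X + s1 Y" "s1 (r *\<^sub>R X) = r *\<^sub>R s1 X" "s1 (- X) = - s1 X" "s1 (X - Y) = s1 X - s1 Y"
proof -
  have f: "X x \<in> fib (bun1 A) x" "Y x \<in> fib (bun1 A) x" if "x \<in> dm" for x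
    using assms that by (auto simp: smooth_section_on_def)
  have ad: "s1 (X + Z) = s1 X + s1 Z" if Z: "\<And>x. x \<in> dm \<Longrightarrow> Z x \<in> fib (bun1 A) x" for Z
    using f frame_coeff_add[OF basis(1)] Z
    by (auto simp: s1_eq gterm_def cut_def fun_eq_iff sum_fun_apply sum.distrib[symmetric] intro!: sum.cong)
  have sc: "s1 (r *\<^sub>R Z) = r *\<^sub>R s1 Z" if Z: "\<And>x. x \<in> dm \<Longrightarrow> Z x \<in> fib (bun1 A) x" for r Z
    using Z frame_coeff_scaleR[OF basis(1)]
    by (auto simp: s1_eq gterm_def cut_def fun_eq_iff sum_fun_apply sum_distrib_left intro!: sum.cong)
  show "s1 (X + Y) = s1 X + s1 Y" "s1 (r *\<^sub>R X) = r *\<^sub>R s1 X" "s1 (- X) = - s1 X"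
    using ad[of Y] sc[of X r] sc[of X "-1"] f by simp_all
  show "s1 (X - Y) = s1 X - s1 Y"
    using ad[of "- Y"] sc[of Y "-1"] f subspace_neg[OF subspace_fib[OF basis(1)]] by simp
qed

lemma s2_linear:
  assumes "loc2 X" "loc2 Y"
  shows "s2 (X + Y) = s2 X + s2 Y" "s2 (r *\<^sub>R X) = r *\<^sub>R s2 X" "s2 (- X) = - s2 X" "s2 (X - Y) = s2 X - s2 Y"
proof -
  have f: "X x \<in> fib (bun2 A) x" "Y x \<in> fib (bun2 A) x" if "x \<in> dm" for x
    using assms that by (auto simp: smooth_section_on_def)
  have ad: "s2 (X + Z) = s2 X + s2 Z" if Z: "\<And>x. x \<in> dm \<Longrightarrow> Z x \<in> fib (bun2 A) x" for Z
    using f frame_coeff_add[OF basis(2)] Z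
    by (auto simp: s2_eq gterm_def cut_def fun_eq_iff sum_fun_apply sum.distrib[symmetric] intro!: sum.cong)
  have sc: "s2 (r *\<^sub>R Z) = r *\<^sub>R s2 Z" if Z: "\<And>x. x \<in> dm \<Longrightarrow> Z x \<in> fib (bun2 A) x" for r Z
    using Z frame_coeff_scaleR[OF basis(2)]
    by (auto simp: s2_eq gterm_def cut_def fun_eq_iff sum_fun_apply sum_distrib_left intro!: sum.cong)
  show "s2 (X + Y) = s2 X + s2 Y" "s2 (r *\<^sub>R X) = r *\<^sub>R s2 X" "s2 (- X) = - s2 X"
    using ad[of Y] sc[of X r] sc[of X "-1"] f by simp_all
  show "s2 (X - Y) = s2 X - s2 Y"
    using ad[of "- Y"] sc[of Y "-1"] f subspace_neg[OF subspace_fib[OF basis(2)]] by simp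
qed

lemma tri_T:
  assumes F: "bfun_of_tridegrees M A Ts F"
  shows "rs (tri (i, j, k) F c) \<in> T (int i) (int j) (int k)"
proof -
  have q: "rs (tri (i, j, k) F c) q = (if tridegree q = (i, j, k) then cut (F c q) else 0)" for q
    by (auto simp: restrict_gfun_def tri_def cut_def fun_eq_iff)
  have nz: "mono_in M c q" if "cut (F c q) \<noteq> 0" for q
  proof -
    have "\<exists>x. cut (F c q) x \<noteq> 0"
      by (rule fun_nonzeroD[OF that])
    then obtain x where "cut (F c q) x \<noteq> 0" ..
    then have "x \<in> dm" "F c q x \<noteq> 0"
      by (auto simp: cut_def split: if_splits)
    then show ?thesis
      using F chart unfolding bfun_of_tridegrees_def by blast
  qed
  have b: "cut (F c q) \<in> base" for q
    using F chart unfolding bfun_of_tridegrees_def by (blast intro: cut_base)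
  have fin: "finite S" if "mono_in M c (S, m)" for S m
    using that finite_subset unfolding mono_in_def by fastforce
  have "rs (tri (i, j, k) F c) (S, m) = 0" if "infinite S" for S m
    using nz fin that by (auto simp: q)
  then have "rs (tri (i, j, k) F c) \<in> C"
    using b subspace_0[OF B.R_subspace] by (auto simp: B.carrier_def q)
  moreover have "mono_in M c p \<and> deg p = (int i, int j, int k)" if "rs (tri (i, j, k) F c) p \<noteq> 0" for p
    using that nz[of p] by (auto simp: q deg_def split: if_splits)
  ultimately show ?thesis
    unfolding T_def by blast
qed

lemma tri_sum:
  assumes F: "bfun_of_tridegrees M A {t1, t2, t3} F" and d: "t1 \<noteq> t2" "t1 \<noteq> t3" "t2 \<noteq> t3"
  shows "rs (F c) = rs (tri t1 F c) + rs (tri t2 F c) + rs (tri t3 F c)"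
proof (intro ext)
  fix q x
  have "x \<in> dm \<Longrightarrow> F c q x \<noteq> 0 \<Longrightarrow> tridegree q \<in> {t1, t2, t3}"
    using F chart unfolding bfun_of_tridegrees_def by blast
  then show "rs (F c) q x = (rs (tri t1 F c) + rs (tri t2 F c) + rs (tri t3 F c)) q x"
    using d by (cases "F c q x = 0") (auto simp: restrict_gfun_def tri_def)
qed

lemma T_independent:
  assumes T: "F \<in> T i j k" "G \<in> T i' j' k'" "L \<in> T i'' j'' k''"
    and d: "(i, j, k) \<noteq> (i', j', k')" "(i, j, k) \<noteq> (i'', j'', k'')" "(i', j', k') \<noteq> (i'', j'', k'')"
    and z: "F + G + L = 0"
  shows "F = 0 \<and> G = 0 \<and> L = 0"
proof -
  have "F q = 0 \<and> G q = 0 \<and> L q = 0" for q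
  proof -
    have "(F + G + L) q = 0"
      by (simp add: z)
    moreover have "F q = 0 \<or> G q = 0 \<and> L q = 0" "G q = 0 \<or> L q = 0"
      using TD[OF T(1), of q] TD[OF T(2), of q] TD[OF T(3), of q] d by metis+
    ultimately show ?thesis
      by auto
  qed
  then show ?thesis
    by (intro conjI; intro ext[of _ "0 :: 'm gfun"]) simp_all
qed

lemma bb:
  assumes "rs (F c) \<in> C" "rs (G c) \<in> C"
  shows "rs (big_bracket M F G c) = br (rs (F c)) (rs (G c))" "rs (big_bracket M F G c) \<in> C"
  using rs_poisson[OF assms] assms by (simp_all add: big_bracket_def)

lemma beqD: "beq M A F G \<Longrightarrow> rs (F c) = rs (G c)"
  using chart by (simp add: beq_iff)

end

section \<open>Structure functions in a chart\<close>

locale twisted_algebroid = split_lie2_algebroid M A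
  for M :: "'m::{t2_space, second_countable_topology} smfd" and A :: "('m, 'a::real_vector, 'b::real_vector) sl2" +
  fixes \<mu> :: "('m, 'a, 'b) bfun" and H :: "'m \<Rightarrow> ('a \<Rightarrow> real) \<Rightarrow> ('b \<Rightarrow> real) \<Rightarrow> real"
    and K :: "'m \<Rightarrow> ('b \<Rightarrow> real) \<Rightarrow> ('b \<Rightarrow> real) \<Rightarrow> ('b \<Rightarrow> real) \<Rightarrow> real"
  assumes \<mu>: "structure_function M A \<mu>"
    and H: "H \<in> sym12_sections M A"
    and K: "K \<in> wedge3_sections M A"
    and MC: "maurer_cartan M A \<mu> (sym12_fun A H + wedge3_fun A K)"

text \<open>Kept apart from the Maurer-Cartan data, so that it can be instantiated with a second
  structure function when uniqueness is proved.\<close>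

locale structured_chart = chart_algebra M A c
  for M :: "'m::{t2_space, second_countable_topology} smfd" and A :: "('m, 'a::real_vector, 'b::real_vector) sl2"
    and c :: "('m, 'a, 'b) dchart" +
  fixes \<mu> :: "('m, 'a, 'b) bfun"
  assumes \<mu>: "structure_function M A \<mu>"
begin

definition "m1 = rs (tri (2, 1, 1) \<mu> c)"
definition "m2 = rs (tri (1, 2, 1) \<mu> c)"
definition "m3 = rs (tri (0, 3, 1) \<mu> c)"

lemma \<mu>_tridegrees: "bfun_of_tridegrees M A {(2, 1, 1), (1, 2, 1), (0, 3, 1)} \<mu>"
  using \<mu> by (simp add: structure_function_def)

lemma m_T: "m1 \<in> T 2 1 1" "m2 \<in> T 1 2 1" "m3 \<in> T 0 3 1"
  using tri_T[OF \<mu>_tridegrees, of 2 1 1] tri_T[OF \<mu>_tridegrees, of 1 2 1] tri_T[OF \<mu>_tridegrees, of 0 3 1]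
  by (simp_all add: m1_def m2_def m3_def)

lemmas m_C [simp] = m_T[THEN T_carrier]

lemma rs_\<mu>: "rs (\<mu> c) = m1 + m2 + m3"
  using tri_sum[OF \<mu>_tridegrees] by (simp add: m1_def m2_def m3_def)

lemma m_Od [simp]: "m1 \<in> B.Odd" "m2 \<in> B.Odd" "m3 \<in> B.Odd"
  using T.T_Od[OF m_T(1)] T.T_Od[OF m_T(2)] T.T_Od[OF m_T(3)] by simp_all

lemma T_add: "F \<in> T i j k \<Longrightarrow> G \<in> T i j k \<Longrightarrow> F + G \<in> T i j k"
  and T_scale: "F \<in> T i j k \<Longrightarrow> r *\<^sub>R F \<in> T i j k"
  and T_neg: "F \<in> T i j k \<Longrightarrow> - F \<in> T i j k"
  and T_diff: "F \<in> T i j k \<Longrightarrow> G \<in> T i j k \<Longrightarrow> F - G \<in> T i j k"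
  using subspace_T subspace_add subspace_scale subspace_neg subspace_diff by blast+

text \<open>Odd elements commute under the bracket, so \<open>{\<mu>, \<mu>}\<close> collects into
  parts of the distinct tridegrees (2, 2, 1), (1, 3, 1) and (0, 4, 1), each of which must
  vanish.\<close>

lemma \<mu>_square: "br m1 m2 = 0" "br m2 m2 + 2 *\<^sub>R br m1 m3 = 0" "br m2 m3 = 0"
proof -
  have "beq M A (big_bracket M \<mu> \<mu>) 0"
    using \<mu> by (simp add: structure_function_def)
  then have "rs (big_bracket M \<mu> \<mu> c) = rs (0 c)"
    by (rule beqD)
  then have z: "br (m1 + m2 + m3) (m1 + m2 + m3) = 0"
    by (subst (asm) bb(1)) (simp_all add: rs_\<mu> rs_linear)
  have 1: "br m1 m1 = 0" "br m3 m3 = 0"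
    using T.T_zero[OF T_br_closed[OF m_T(1) m_T(1)]] T.T_zero[OF T_br_closed[OF m_T(3) m_T(3)]] by simp_all
  have 2: "br m2 m1 = br m1 m2" "br m3 m1 = br m1 m3" "br m3 m2 = br m2 m3"
    by (rule B.swap_oo; simp)+
  have "br (m1 + m2 + m3) (m1 + m2 + m3) = 2 *\<^sub>R br m1 m2 + (br m2 m2 + 2 *\<^sub>R br m1 m3) + 2 *\<^sub>R br m2 m3"
    by (simp add: B.br_linear 1 2 scaleR_2 algebra_simps)
  moreover have "2 *\<^sub>R br m1 m2 \<in> T 2 2 1" "br m2 m2 + 2 *\<^sub>R br m1 m3 \<in> T 1 3 1" "2 *\<^sub>R br m2 m3 \<in> T 0 4 1"
    using T_br_closed[OF m_T(1) m_T(2)] T_br_closed[OF m_T(2) m_T(2)] T_br_closed[OF m_T(1) m_T(3)] T_br_closed[OF m_T(2) m_T(3)]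
    by (simp_all add: T_scale T_add)
  ultimately have "2 *\<^sub>R br m1 m2 = 0 \<and> br m2 m2 + 2 *\<^sub>R br m1 m3 = 0 \<and> 2 *\<^sub>R br m2 m3 = 0"
    using z by (intro T_independent) auto
  then show "br m1 m2 = 0" "br m2 m2 + 2 *\<^sub>R br m1 m3 = 0" "br m2 m3 = 0"
    by simp_all
qed

lemma rs_s: "rs (sec1 X c) = s1 X" "rs (sec2 Y c) = s2 Y" "rs (cosec1 \<alpha> c) = c1 \<alpha>" "rs (cosec2 \<beta> c) = c2 \<beta>" "rs (fun0 f c) = f0 f"
  "rs (sym12_fun A H c) = Hc H" "rs (wedge3_fun A K c) = Kc K"
  "rs (tri (2, 1, 1) \<mu> c) = m1" "rs (tri (1, 2, 1) \<mu> c) = m2" "rs (tri (0, 3, 1) \<mu> c) = m3"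
  by (simp_all add: s1_def s2_def c1_def c2_def f0_def Hc_def Kc_def m1_def m2_def m3_def)

lemma sec_C:
  "X \<in> sections M (bun1 A) \<Longrightarrow> s1 X \<in> C" "Y \<in> sections M (bun2 A) \<Longrightarrow> s2 Y \<in> C"
  "\<alpha> \<in> sections M (dual_bundle (bun1 A)) \<Longrightarrow> c1 \<alpha> \<in> C" "\<beta> \<in> sections M (dual_bundle (bun2 A)) \<Longrightarrow> c2 \<beta> \<in> C"
  "f \<in> Cinf M \<Longrightarrow> f0 f \<in> C"
  using T_carrier[OF s1_T[OF loc_sections]] T_carrier[OF s2_T[OF loc_sections]]
    T_carrier[OF c1_T[OF loc_sections]] T_carrier[OF c2_T[OF loc_sections]] T_carrier[OF f0_T] smooth_on_subset[of UNIV f dm]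
  by (auto simp: Cinf_iff)

lemma structure_eqs:
  "Y \<in> sections M (bun2 A) \<Longrightarrow> s1 (bra1 A Y) = - br m1 (s2 Y)"
  "X \<in> sections M (bun1 A) \<Longrightarrow> X' \<in> sections M (bun1 A) \<Longrightarrow> s1 (bra2 A X X') = - br (br m2 (s1 X)) (s1 X')"
  "X \<in> sections M (bun1 A) \<Longrightarrow> Y \<in> sections M (bun2 A) \<Longrightarrow> s2 (bra2m A X Y) = - br (br m2 (s1 X)) (s2 Y)"
  "X \<in> sections M (bun1 A) \<Longrightarrow> X' \<in> sections M (bun1 A) \<Longrightarrow> X'' \<in> sections M (bun1 A) \<Longrightarrow>
    s2 (bra3 A X X' X'') = - br (br (br m3 (s1 X)) (s1 X')) (s1 X'')"
  "X \<in> sections M (bun1 A) \<Longrightarrow> f \<in> Cinf M \<Longrightarrow> f0 (rho A X f) = - br (br m2 (s1 X)) (f0 f)"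
proof -
  note S = \<mu>[unfolded structure_function_def]
  show "s1 (bra1 A Y) = - br m1 (s2 Y)" if "Y \<in> sections M (bun2 A)"
    using beqD[OF bspec[OF S[THEN conjunct2, THEN conjunct2, THEN conjunct1] that]] by (simp add: bb rs_s rs_linear sec_C that del: One_nat_def)
  show "s1 (bra2 A X X') = - br (br m2 (s1 X)) (s1 X')" if "X \<in> sections M (bun1 A)" "X' \<in> sections M (bun1 A)"
    using beqD[OF bspec[OF bspec[OF S[THEN conjunct2, THEN conjunct2, THEN conjunct2, THEN conjunct1] that(1)] that(2)]] by (simp add: bb rs_s rs_linear sec_C that del: One_nat_def)
  show "s2 (bra2m A X Y) = - br (br m2 (s1 X)) (s2 Y)" if "X \<in> sections M (bun1 A)" "Y \<in> sections M (bun2 A)"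
    using beqD[OF bspec[OF bspec[OF S[THEN conjunct2, THEN conjunct2, THEN conjunct2, THEN conjunct2, THEN conjunct1] that(1)] that(2)]] by (simp add: bb rs_s rs_linear sec_C that del: One_nat_def)
  show "s2 (bra3 A X X' X'') = - br (br (br m3 (s1 X)) (s1 X')) (s1 X'')" if "X \<in> sections M (bun1 A)" "X' \<in> sections M (bun1 A)" "X'' \<in> sections M (bun1 A)"
    using beqD[OF bspec[OF bspec[OF bspec[OF S[THEN conjunct2, THEN conjunct2, THEN conjunct2, THEN conjunct2, THEN conjunct2, THEN conjunct1] that(1)] that(2)] that(3)]] by (simp add: bb rs_s rs_linear sec_C that del: One_nat_def)
  show "f0 (rho A X f) = - br (br m2 (s1 X)) (f0 f)" if "X \<in> sections M (bun1 A)" "f \<in> Cinf M"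
    using beqD[OF bspec[OF bspec[OF S[THEN conjunct2, THEN conjunct2, THEN conjunct2, THEN conjunct2, THEN conjunct2, THEN conjunct2] that(1)] that(2)]] by (simp add: bb rs_s rs_linear sec_C that del: One_nat_def)
qed

text \<open>This is not an axiom. By symmetry \<open>{{m\<^sub>2, X}, Y} = {{m\<^sub>2, Y}, X}\<close>, and \<open>{m\<^sub>2, Y}\<close> contains no momenta.\<close>

lemma bra2m_tensorial:
  assumes X: "X \<in> sections M (bun1 A)" and Y: "Y \<in> sections M (bun2 A)" and x: "x \<in> dm"
    and fX: "smul f X \<in> sections M (bun1 A)" and l: "bra2m A X Y \<in> sections M (bun2 A)"
    and l': "bra2m A (smul f X) Y \<in> sections M (bun2 A)" and f: "f \<in> Cinf M"
  shows "bra2m A (smul f X) Y x = f x *\<^sub>R bra2m A X Y x"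
proof -
  note YT = s2_T[OF loc_sections[OF Y]]
  have GT: "br m2 (s2 Y) \<in> T 0 1 1"
    using T_br_closed[OF m_T(2) YT] by simp
  have P: "odiff (P_dn l) (gparity (br m2 (s2 Y))) = 0" for l
    by (rule no_P'[OF GT]) simp
  have *: "s2 (bra2m A Z Y) = - br (br m2 (s2 Y)) (s1 Z)" if Z: "Z \<in> sections M (bun1 A)" for Z
  proof -
    note ZT = s1_T[OF loc_sections[OF Z]]
    have "br (s1 Z) (s2 Y) = 0"
      using T.T_zero[OF T_br_closed[OF ZT YT]] by simp
    then have "br (br m2 (s1 Z)) (s2 Y) = br (br m2 (s2 Y)) (s1 Z)"
      using B.right_e'[of m2 "s1 Z" "s2 Y"] B.right_e[of m2 "s1 Z" "s2 Y"] T.T_Od[OF ZT] T.T_Ev[OF YT] by auto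
    then show ?thesis
      using structure_eqs(3)[OF Z Y] by simp
  qed
  have "s2 (bra2m A (smul f X) Y) q y = f y * s2 (bra2m A X Y) q y" if "y \<in> dm" for q y
    using that X unfolding *[OF X] *[OF fX]
    by (simp add: br_s1[OF T_carrier[OF GT] P] sum_distrib_left cut_def smul_def frame_coeff_scaleR[OF basis(1)]
        section_in_fib mult.left_commute)
  moreover have "s2 (smul f (bra2m A X Y)) q y = f y * s2 (bra2m A X Y) q y" if "y \<in> dm" for q y
    using that l by (auto simp: s2_eq sum_fun_apply gterm_def cut_def smul_def frame_coeff_scaleR[OF basis(2)]
        section_in_fib sum_distrib_left intro!: sum.cong)
  ultimately have "s2 (bra2m A (smul f X) Y) = s2 (smul f (bra2m A X Y))"
    using section_smul[OF bun2 l f] l' by (intro carrier_eqI sec_C) auto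
  then have "bra2m A (smul f X) Y x = smul f (bra2m A X Y) x"
    using section_smul[OF bun2 l f] l' x by (intro s2_inj loc_sections) auto
  then show ?thesis
    by (simp add: smul_def)
qed

end

locale twisted_chart = twisted_algebroid M A \<mu> H K + structured_chart M A c \<mu>
  for M :: "'m::{t2_space, second_countable_topology} smfd" and A :: "('m, 'a::real_vector, 'b::real_vector) sl2"
    and \<mu> H K and c :: "('m, 'a, 'b) dchart"
begin

abbreviation "h \<equiv> Hc H"
abbreviation "\<kappa> \<equiv> Kc K"

lemma hk_T: "h \<in> T 1 0 2" "\<kappa> \<in> T 0 0 3"
  by (rule Hc_T[OF H], rule Kc_T[OF K])

lemma hk_C [simp]: "h \<in> C" "\<kappa> \<in> C"
  using hk_T[THEN T_carrier] .

lemma hk_Ev [simp]: "h \<in> B.Even" "\<kappa> \<in> B.Even"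
  using T.T_Ev[OF hk_T(1)] T.T_Ev[OF hk_T(2)] by simp_all

lemma MC_chart: "br m1 h = 0" "br m1 \<kappa> + (1/2) *\<^sub>R br (br m2 h) h = 0"
    "br (br m2 h) \<kappa> + (1/6) *\<^sub>R br (br (br m3 h) h) h = 0"
proof -
  let ?P = "sym12_fun A H + wedge3_fun A K"
  have P: "rs (?P c) = h + \<kappa>"
    by (simp add: rs_linear rs_s)
  have r: "rs (symbr1 M \<mu> ?P c) = - br m1 (h + \<kappa>)" "rs (symbr2 M \<mu> ?P ?P c) = - br (br m2 (h + \<kappa>)) (h + \<kappa>)"
    "rs (symbr3 M \<mu> ?P ?P ?P c) = - br (br (br m3 (h + \<kappa>)) (h + \<kappa>)) (h + \<kappa>)"
    unfolding symbr1_def symbr2_def symbr3_def by (simp_all only: uminus_apply rs_linear bb P rs_s m_C hk_C B.C_simps B.pb_C)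
  have "rs ((symbr1 M \<mu> ?P + (1/2) *\<^sub>R symbr2 M \<mu> ?P ?P + (1/6) *\<^sub>R symbr3 M \<mu> ?P ?P ?P) c) = rs (0 c)"
    using MC unfolding maurer_cartan_def by (rule beqD)
  then have "- (br m1 (h + \<kappa>) + (1/2) *\<^sub>R br (br m2 (h + \<kappa>)) (h + \<kappa>) + (1/6) *\<^sub>R br (br (br m3 (h + \<kappa>)) (h + \<kappa>)) (h + \<kappa>)) = 0"
    by (simp only: plus_fun_apply scaleR_fun_apply rs_linear r) (simp add: rs_linear)
  then have z: "br m1 (h + \<kappa>) + (1/2) *\<^sub>R br (br m2 (h + \<kappa>)) (h + \<kappa>) + (1/6) *\<^sub>R br (br (br m3 (h + \<kappa>)) (h + \<kappa>)) (h + \<kappa>) = 0"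
    by (simp only: neg_equal_0_iff_equal)
  have T2: "br m1 h \<in> T 2 0 2" "br m1 \<kappa> \<in> T 1 0 3" "br m2 h \<in> T 1 1 2" "br m2 \<kappa> \<in> T 0 1 3"
    "br m3 h \<in> T 0 2 2" "br m3 \<kappa> \<in> T (-1) 2 3"
    using T_br_closed[OF m_T(1) hk_T(1)] T_br_closed[OF m_T(1) hk_T(2)] T_br_closed[OF m_T(2) hk_T(1)]
      T_br_closed[OF m_T(2) hk_T(2)] T_br_closed[OF m_T(3) hk_T(1)] T_br_closed[OF m_T(3) hk_T(2)] by simp_all
  have T3: "br (br m2 h) h \<in> T 1 0 3" "br (br m2 h) \<kappa> \<in> T 0 0 4" "br (br m3 h) h \<in> T 0 1 3"
    using T_br_closed[OF T2(3) hk_T(1)] T_br_closed[OF T2(3) hk_T(2)] T_br_closed[OF T2(5) hk_T(1)] by simp_all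
  have T4: "br (br (br m3 h) h) h \<in> T 0 0 4"
    using T_br_closed[OF T3(3) hk_T(1)] by simp
  have v: "br (br m2 \<kappa>) \<kappa> = 0" "br m3 \<kappa> = 0" "br (br m3 h) \<kappa> = 0" "br (br (br m3 h) h) \<kappa> = 0" "br h \<kappa> = 0"
    using T.T_zero[OF T_br_closed[OF T2(4) hk_T(2)]] T.T_zero[OF T2(6)] T.T_zero[OF T_br_closed[OF T2(5) hk_T(2)]]
      T.T_zero[OF T_br_closed[OF T3(3) hk_T(2)]] T.T_zero[OF T_br_closed[OF hk_T]] by simp_all
  have s: "br (br m2 \<kappa>) h = br (br m2 h) \<kappa>"
    using B.right_e[of m2 h \<kappa>] by (simp add: v)
  have "br m1 h + (br m1 \<kappa> + (1/2) *\<^sub>R br (br m2 h) h) + (br (br m2 h) \<kappa> + (1/6) *\<^sub>R br (br (br m3 h) h) h) = 0"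
  proof -
    \<comment> \<open>The two mixed terms coincide by \<open>s\<close>; their sum cancels the factor
      1/2, which is why the term with \<open>H\<close> and \<open>K\<close> enters the last
      component with coefficient 1.\<close>
    have 1: "br (br m2 (h + \<kappa>)) (h + \<kappa>) = br (br m2 h) h + 2 *\<^sub>R br (br m2 h) \<kappa>"
      by (simp add: B.br_linear v s scaleR_2)
    have 2: "br (br (br m3 (h + \<kappa>)) (h + \<kappa>)) (h + \<kappa>) = br (br (br m3 h) h) h"
      by (simp add: B.br_linear v)
    show ?thesis
      using z unfolding 1 2 by (simp add: B.br_linear scaleR_add_right algebra_simps)
  qed
  then have "br m1 h = 0 \<and> br m1 \<kappa> + (1/2) *\<^sub>R br (br m2 h) h = 0 \<and> br (br m2 h) \<kappa> + (1/6) *\<^sub>R br (br (br m3 h) h) h = 0"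
    using T2 T3 T4 by (intro T_independent) (auto intro: T_add T_scale)
  then show "br m1 h = 0" "br m1 \<kappa> + (1/2) *\<^sub>R br (br m2 h) h = 0"
    "br (br m2 h) \<kappa> + (1/6) *\<^sub>R br (br (br m3 h) h) h = 0"
    by simp_all
qed

sublocale D: maurer_cartan_datum C B.Even B.Odd br T m1 m2 m3 h \<kappa>
  by unfold_locales (rule m_T hk_T \<mu>_square MC_chart)+

end

section \<open>The induced brackets on the dual\<close>

context smooth_manifold
begin

lemma Cinf_simps:
  "f \<in> Cinf M \<Longrightarrow> g \<in> Cinf M \<Longrightarrow> (\<lambda>x. f x + g x) \<in> Cinf M" "f \<in> Cinf M \<Longrightarrow> g \<in> Cinf M \<Longrightarrow> f + g \<in> Cinf M"
  "f \<in> Cinf M \<Longrightarrow> g \<in> Cinf M \<Longrightarrow> (\<lambda>x. f x * g x) \<in> Cinf M" "f \<in> Cinf M \<Longrightarrow> - f \<in> Cinf M"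
  "f \<in> Cinf M \<Longrightarrow> g \<in> Cinf M \<Longrightarrow> f - g \<in> Cinf M"
  using smooth_on_uminus[of UNIV f] smooth_on_diff[of UNIV f g]
  by (auto simp: Cinf_iff plus_fun_def fun_Compl_def fun_diff_def smooth_on_add smooth_on_mult)

lemma pairing_linear:
  assumes "vector_bundle M E" "\<alpha> \<in> sections M (dual_bundle E)" "s \<in> sections M E"
  shows "t \<in> sections M E \<Longrightarrow> pairing (s + t) \<alpha> = pairing s \<alpha> + pairing t \<alpha>"
    and "pairing (smul f s) \<alpha> = (\<lambda>x. f x * pairing s \<alpha> x)"
    and "pairing (- s) \<alpha> = - pairing s \<alpha>"
proof -
  have l: "lin_on (fib E x) UNIV (\<alpha> x)" for x
    using section_in_fib[OF assms(2), of x] by (simp add: dual_bundle_def)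
  note s = section_in_fib[OF assms(3)]
  show "t \<in> sections M E \<Longrightarrow> pairing (s + t) \<alpha> = pairing s \<alpha> + pairing t \<alpha>"
    using lin_onD(2)[OF l s section_in_fib] by (auto simp: pairing_def fun_eq_iff)
  show "pairing (smul f s) \<alpha> = (\<lambda>x. f x * pairing s \<alpha> x)" "pairing (- s) \<alpha> = - pairing s \<alpha>"
  proof -
    have sc: "\<alpha> x (r *\<^sub>R s x) = r * \<alpha> x (s x)" for x r
      using lin_onD(3)[OF l s] by simp
    show "pairing (smul f s) \<alpha> = (\<lambda>x. f x * pairing s \<alpha> x)"
      by (simp add: pairing_def smul_def sc)
    show "pairing (- s) \<alpha> = - pairing s \<alpha>"
    proof
      show "pairing (- s) \<alpha> x = (- pairing s \<alpha>) x" for x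
        using sc[of x "-1"] by (simp add: pairing_def)
    qed
  qed
qed

lemma tensorial_uminus: "tensorial E \<Phi> \<Longrightarrow> tensorial E (\<lambda>s. - \<Phi> s)"
  by (auto simp: tensorial_def Cinf_simps fun_eq_iff)

end

context split_lie2_algebroid
begin

abbreviation "\<Gamma>1 \<equiv> sections M (bun1 A)"
abbreviation "\<Gamma>2 \<equiv> sections M (bun2 A)"
abbreviation "\<Gamma>1' \<equiv> sections M (dual_bundle (bun1 A))"
abbreviation "\<Gamma>2' \<equiv> sections M (dual_bundle (bun2 A))"

lemma darboux_chart_at: "\<exists>c. darboux_chart M A c \<and> x \<in> cdom c"
proof -
  obtain U \<phi> where U: "(U, \<phi>) \<in> atlas M" "x \<in> U"
    by (rule chart_at)
  obtain U1 e1 where e1: "(U1, e1) \<in> frames (bun1 A)" "x \<in> U1"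
    by (rule frame_at[OF bun1_bundle])
  obtain U2 e2 where e2: "(U2, e2) \<in> frames (bun2 A)" "x \<in> U2"
    by (rule frame_at[OF bun2_bundle])
  note F1 = vector_bundleD[OF bun1_bundle e1(1)] and F2 = vector_bundleD[OF bun2_bundle e2(1)]
  let ?W = "U \<inter> U1 \<inter> U2"
  have "local_frame M (bun1 A) ?W e1" "local_frame M (bun2 A) ?W e2"
    using F1(2) F2(2) by (auto simp: local_frame_def intro: smooth_section_on_subset)
  moreover have "open ?W"
    using chart_open[OF U(1)] F1(1) F2(1) by auto
  ultimately have "darboux_chart M A \<lparr>cdom = ?W, cbase = U, ccoord = \<phi>, fr1 = e1, fr2 = e2\<rparr>"
    using U by (auto simp: darboux_chart_def)
  then show ?thesis
    using U e1 e2 by (intro exI[of _ "\<lparr>cdom = ?W, cbase = U, ccoord = \<phi>, fr1 = e1, fr2 = e2\<rparr>"]) auto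
qed

interpretation L: lie2_algebra "section_lie2 M A"
  by (rule section_lie2_algebra)

lemma bra_lin:
  "lin_on \<Gamma>2 \<Gamma>1 (bra1 A)" "X \<in> \<Gamma>1 \<Longrightarrow> lin_on \<Gamma>1 \<Gamma>1 (bra2 A X)" "X \<in> \<Gamma>1 \<Longrightarrow> lin_on \<Gamma>2 \<Gamma>2 (bra2m A X)"
  "Y \<in> \<Gamma>2 \<Longrightarrow> lin_on \<Gamma>1 \<Gamma>2 (\<lambda>X. bra2m A X Y)" "X \<in> \<Gamma>1 \<Longrightarrow> X' \<in> \<Gamma>1 \<Longrightarrow> lin_on \<Gamma>1 \<Gamma>2 (bra3 A X X')"
  using L.ldiff_linear L.lbr2_skew L.lact_bilinear L.lbr3_skew
  unfolding bilin_on_def skew2_on_def skew3_on_def by (simp_all add: section_lie2_def)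

lemma bra_closed [simp]:
  "Y \<in> \<Gamma>2 \<Longrightarrow> bra1 A Y \<in> \<Gamma>1" "X \<in> \<Gamma>1 \<Longrightarrow> X' \<in> \<Gamma>1 \<Longrightarrow> bra2 A X X' \<in> \<Gamma>1" "X \<in> \<Gamma>1 \<Longrightarrow> Y \<in> \<Gamma>2 \<Longrightarrow> bra2m A X Y \<in> \<Gamma>2"
  "X \<in> \<Gamma>1 \<Longrightarrow> X' \<in> \<Gamma>1 \<Longrightarrow> X'' \<in> \<Gamma>1 \<Longrightarrow> bra3 A X X' X'' \<in> \<Gamma>2"
  by (rule lin_onD(1)[OF bra_lin(1)] lin_onD(1)[OF bra_lin(2)] lin_onD(1)[OF bra_lin(3)] lin_onD(1)[OF bra_lin(5)]; assumption)+

lemma bra_add: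
  "Y \<in> \<Gamma>2 \<Longrightarrow> Y' \<in> \<Gamma>2 \<Longrightarrow> bra1 A (Y + Y') = bra1 A Y + bra1 A Y'"
  "X \<in> \<Gamma>1 \<Longrightarrow> Z \<in> \<Gamma>1 \<Longrightarrow> Z' \<in> \<Gamma>1 \<Longrightarrow> bra2 A X (Z + Z') = bra2 A X Z + bra2 A X Z'"
  "X \<in> \<Gamma>1 \<Longrightarrow> Y \<in> \<Gamma>2 \<Longrightarrow> Y' \<in> \<Gamma>2 \<Longrightarrow> bra2m A X (Y + Y') = bra2m A X Y + bra2m A X Y'"
  "Z \<in> \<Gamma>1 \<Longrightarrow> Z' \<in> \<Gamma>1 \<Longrightarrow> Y \<in> \<Gamma>2 \<Longrightarrow> bra2m A (Z + Z') Y = bra2m A Z Y + bra2m A Z' Y"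
  "X \<in> \<Gamma>1 \<Longrightarrow> X' \<in> \<Gamma>1 \<Longrightarrow> Z \<in> \<Gamma>1 \<Longrightarrow> Z' \<in> \<Gamma>1 \<Longrightarrow> bra3 A X X' (Z + Z') = bra3 A X X' Z + bra3 A X X' Z'"
  by (rule lin_onD(2)[OF bra_lin(1)] lin_onD(2)[OF bra_lin(2)] lin_onD(2)[OF bra_lin(3)] lin_onD(2)[OF bra_lin(4)]
      lin_onD(2)[OF bra_lin(5)]; assumption)+

lemma rho_simps:
  assumes X: "X \<in> \<Gamma>1" and f: "f \<in> Cinf M" and g: "g \<in> Cinf M"
  shows "rho A X (f + g) = rho A X f + rho A X g"
    and "rho A X (\<lambda>x. f x * g x) = (\<lambda>x. rho A X f x * g x + f x * rho A X g x)"
    and "X' \<in> \<Gamma>1 \<Longrightarrow> rho A (X + X') f = rho A X f + rho A X' f"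
    and "rho A (smul u X) f = (\<lambda>x. u x * rho A X f x)"
proof -
  note D = anchor_tangent[OF section_in_fib[OF X], unfolded tangent_vectors_def mem_Collect_eq]
  have d: "anchor A x (X x) (f + g) = anchor A x (X x) f + anchor A x (X x) g"
    "anchor A x (X x) (f * g) = anchor A x (X x) f * g x + f x * anchor A x (X x) g" for x
    using D f g by blast+
  have l: "anchor A x (X x + v) f = anchor A x (X x) f + anchor A x v f" if "v \<in> fib (bun1 A) x" for x v
    using lin_onD(2)[OF anchor_linear[OF f] section_in_fib[OF X] that] .
  have l': "anchor A x (r *\<^sub>R X x) f = r * anchor A x (X x) f" for x r
    using lin_onD(3)[OF anchor_linear[OF f] section_in_fib[OF X]] by simp
  show "rho A X (f + g) = rho A X f + rho A X g"
    "rho A X (\<lambda>x. f x * g x) = (\<lambda>x. rho A X f x * g x + f x * rho A X g x)"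
    using d by (simp_all add: rho_def fun_eq_iff times_fun_def)
  show "rho A (X + X') f = rho A X f + rho A X' f" if "X' \<in> \<Gamma>1"
    using l[OF section_in_fib[OF that]] by (simp add: rho_def fun_eq_iff)
  show "rho A (smul u X) f = (\<lambda>x. u x * rho A X f x)"
    by (simp add: rho_def smul_def l')
qed

lemma smul_closed [simp]:
  "f \<in> Cinf M \<Longrightarrow> X \<in> \<Gamma>1 \<Longrightarrow> smul f X \<in> \<Gamma>1" "f \<in> Cinf M \<Longrightarrow> Y \<in> \<Gamma>2 \<Longrightarrow> smul f Y \<in> \<Gamma>2"
  "f \<in> Cinf M \<Longrightarrow> \<alpha> \<in> \<Gamma>1' \<Longrightarrow> smul f \<alpha> \<in> \<Gamma>1'" "f \<in> Cinf M \<Longrightarrow> \<beta> \<in> \<Gamma>2' \<Longrightarrow> smul f \<beta> \<in> \<Gamma>2'"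
  using section_smul bun1_bundle bun2_bundle vector_bundle_dual by blast+

lemma sections_closed [simp]:
  "X \<in> \<Gamma>1 \<Longrightarrow> X' \<in> \<Gamma>1 \<Longrightarrow> X + X' \<in> \<Gamma>1" "Y \<in> \<Gamma>2 \<Longrightarrow> Y' \<in> \<Gamma>2 \<Longrightarrow> Y + Y' \<in> \<Gamma>2"
  "\<alpha> \<in> \<Gamma>1' \<Longrightarrow> \<alpha>' \<in> \<Gamma>1' \<Longrightarrow> \<alpha> + \<alpha>' \<in> \<Gamma>1'" "\<beta> \<in> \<Gamma>2' \<Longrightarrow> \<beta>' \<in> \<Gamma>2' \<Longrightarrow> \<beta> + \<beta>' \<in> \<Gamma>2'"
  "\<alpha> \<in> \<Gamma>1' \<Longrightarrow> \<alpha>' \<in> \<Gamma>1' \<Longrightarrow> \<alpha> - \<alpha>' \<in> \<Gamma>1'" "\<beta> \<in> \<Gamma>2' \<Longrightarrow> \<beta>' \<in> \<Gamma>2' \<Longrightarrow> \<beta> - \<beta>' \<in> \<Gamma>2'"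
  "\<alpha> \<in> \<Gamma>1' \<Longrightarrow> r *\<^sub>R \<alpha> \<in> \<Gamma>1'" "\<beta> \<in> \<Gamma>2' \<Longrightarrow> r *\<^sub>R \<beta> \<in> \<Gamma>2'" "\<alpha> \<in> \<Gamma>1' \<Longrightarrow> - \<alpha> \<in> \<Gamma>1'" "\<beta> \<in> \<Gamma>2' \<Longrightarrow> - \<beta> \<in> \<Gamma>2'"
  "X \<in> \<Gamma>1 \<Longrightarrow> X' \<in> \<Gamma>1 \<Longrightarrow> X - X' \<in> \<Gamma>1" "Y \<in> \<Gamma>2 \<Longrightarrow> Y' \<in> \<Gamma>2 \<Longrightarrow> Y - Y' \<in> \<Gamma>2" "Y \<in> \<Gamma>2 \<Longrightarrow> - Y \<in> \<Gamma>2"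
  using subspace_sections bun1_bundle bun2_bundle vector_bundle_dual
  by (blast intro: subspace_add subspace_diff subspace_scale subspace_neg)+

lemma pairing_closed [simp]:
  "X \<in> \<Gamma>1 \<Longrightarrow> \<alpha> \<in> \<Gamma>1' \<Longrightarrow> pairing X \<alpha> \<in> Cinf M" "Y \<in> \<Gamma>2 \<Longrightarrow> \<beta> \<in> \<Gamma>2' \<Longrightarrow> pairing Y \<beta> \<in> Cinf M"
  using pairing_Cinf bun1_bundle bun2_bundle by blast+

lemmas anchor_smooth [simp]
lemmas pair1 = pairing_linear[OF bun1_bundle] and pair2 = pairing_linear[OF bun2_bundle]

lemma tensorial_bra1: "\<alpha> \<in> \<Gamma>1' \<Longrightarrow> tensorial (bun2 A) (\<lambda>Y. pairing (bra1 A Y) \<alpha>)"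
  by (simp add: tensorial_def bra_add bra1_Cinf pair1)

lemma tensorial_lieD1_1: "X \<in> \<Gamma>1 \<Longrightarrow> \<alpha> \<in> \<Gamma>1' \<Longrightarrow> tensorial (bun1 A) (\<lambda>Y. rho A X (pairing Y \<alpha>) - pairing (bra2 A X Y) \<alpha>)"
  by (simp add: tensorial_def bra_add leibniz1 pair1 rho_simps Cinf_simps) (simp add: fun_eq_iff algebra_simps)

lemma tensorial_lieD1_2: "X \<in> \<Gamma>1 \<Longrightarrow> \<beta> \<in> \<Gamma>2' \<Longrightarrow> tensorial (bun2 A) (\<lambda>Y. rho A X (pairing Y \<beta>) - pairing (bra2m A X Y) \<beta>)"
  by (simp add: tensorial_def bra_add leibniz2 pair2 rho_simps Cinf_simps) (simp add: fun_eq_iff algebra_simps)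

lemma tensorial_lieD3: "X \<in> \<Gamma>1 \<Longrightarrow> X' \<in> \<Gamma>1 \<Longrightarrow> \<beta> \<in> \<Gamma>2' \<Longrightarrow> tensorial (bun1 A) (\<lambda>Z. - pairing (bra3 A X X' Z) \<beta>)"
  by (rule tensorial_uminus) (simp add: tensorial_def bra_add bra3_Cinf pair2)

lemma tensorial_dfun: "f \<in> Cinf M \<Longrightarrow> tensorial (bun1 A) (\<lambda>X. rho A X f)"
  by (simp add: tensorial_def rho_simps)

end

context twisted_algebroid
begin

lemma twisted_chart: "darboux_chart M A c \<Longrightarrow> twisted_chart M A \<mu> H K c"
  by unfold_locales (rule bun1_bundle bun2_bundle \<mu> | assumption)+

text \<open>The chartwise result, glued over all charts. It makes the formula for
  \<open>lieD2\<close> tensorial, so that this Lie derivative exists as a section.\<close>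

lemma bra2m_Cinf:
  assumes X: "X \<in> \<Gamma>1" and Y: "Y \<in> \<Gamma>2" and f: "f \<in> Cinf M"
  shows "bra2m A (smul f X) Y = smul f (bra2m A X Y)"
proof
  fix x
  obtain c where c: "darboux_chart M A c" "x \<in> cdom c"
    using darboux_chart_at by blast
  interpret twisted_chart M A \<mu> H K c
    by (rule twisted_chart[OF c(1)])
  show "bra2m A (smul f X) Y x = smul f (bra2m A X Y) x"
    using bra2m_tensorial[OF X Y c(2) _ _ _ f] X Y f by (simp add: smul_def[of f "bra2m A X Y"])
qed

lemma tensorial_lieD2: "Y \<in> \<Gamma>2 \<Longrightarrow> \<beta> \<in> \<Gamma>2' \<Longrightarrow> tensorial (bun1 A) (\<lambda>X. - pairing (bra2m A X Y) \<beta>)"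
  by (rule tensorial_uminus) (simp add: tensorial_def bra_add bra2m_Cinf pair2)

definition "sharp \<beta> = (\<lambda>x. H_sharp A H x (\<beta> x))"
definition "natural \<alpha> = (\<lambda>x. H_nat A H x (\<alpha> x))"
definition "flat \<beta> \<beta>' = (\<lambda>x. K_flat A K x (\<beta> x) (\<beta>' x))"

abbreviation "DA \<equiv> dual_sl2 M A H K"

lemma sharp_closed [simp]: "\<beta> \<in> \<Gamma>2' \<Longrightarrow> sharp \<beta> \<in> \<Gamma>1" "\<alpha> \<in> \<Gamma>1' \<Longrightarrow> natural \<alpha> \<in> \<Gamma>2"
  unfolding sharp_def natural_def using H_sharp_section(1)[OF bun1_bundle H] H_nat_section(1)[OF bun2_bundle H] by blast+

lemma flat_closed [simp]: "\<beta> \<in> \<Gamma>2' \<Longrightarrow> \<beta>' \<in> \<Gamma>2' \<Longrightarrow> flat \<beta> \<beta>' \<in> \<Gamma>2"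
proof -
  assume *: "\<beta> \<in> \<Gamma>2'" "\<beta>' \<in> \<Gamma>2'"
  obtain c where c: "darboux_chart M A c"
    using darboux_chart_at by blast
  interpret twisted_chart M A \<mu> H K c
    by (rule twisted_chart[OF c])
  show "flat \<beta> \<beta>' \<in> \<Gamma>2"
    unfolding flat_def by (rule K_flat_section(1)[OF K *])
qed

lemma HK_Cinf [simp]:
  "\<alpha> \<in> \<Gamma>1' \<Longrightarrow> \<beta> \<in> \<Gamma>2' \<Longrightarrow> (\<lambda>x. H x (\<alpha> x) (\<beta> x)) \<in> Cinf M"
  "\<beta> \<in> \<Gamma>2' \<Longrightarrow> \<beta>' \<in> \<Gamma>2' \<Longrightarrow> \<beta>'' \<in> \<Gamma>2' \<Longrightarrow> (\<lambda>x. K x (\<beta> x) (\<beta>' x) (\<beta>'' x)) \<in> Cinf M"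
  using H K by (simp_all add: sym12_sections_def wedge3_sections_def)

lemma dual_simps:
  "bun1 DA = dual_bundle (bun2 A)" "bun2 DA = dual_bundle (bun1 A)"
  "bra1 DA \<alpha> = dual_section M (bun2 A) (\<lambda>Y. pairing (bra1 A Y) \<alpha>)"
  "bra2 DA \<beta> \<beta>' = lieD1_2 M A (sharp \<beta>) \<beta>' - lieD1_2 M A (sharp \<beta>') \<beta>"
  "bra2m DA \<beta> \<alpha> = lieD1_1 M A (sharp \<beta>) \<alpha> - lieD2 M A (natural \<alpha>) \<beta> - dfun M A (\<lambda>x. H x (\<alpha> x) (\<beta> x))"
  "bra3 DA \<beta> \<beta>' \<beta>'' = - lieD2 M A (flat \<beta> \<beta>') \<beta>'' - lieD2 M A (flat \<beta>'' \<beta>) \<beta>' - lieD2 M A (flat \<beta>' \<beta>'') \<beta>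
     - 2 *\<^sub>R dfun M A (\<lambda>x. K x (\<beta> x) (\<beta>' x) (\<beta>'' x))
     + lieD3 M A (sharp \<beta>) (sharp \<beta>') \<beta>'' + lieD3 M A (sharp \<beta>') (sharp \<beta>'') \<beta> + lieD3 M A (sharp \<beta>'') (sharp \<beta>) \<beta>'"
  "anchor DA x a = anchor A x (H_sharp A H x a)" "rho DA \<beta> f = rho A (sharp \<beta>) f"
  by (simp_all add: dual_sl2_def Let_def sharp_def natural_def flat_def rho_def)

lemmas dual1 = dual_section[OF bun1_bundle] and dual2 = dual_section[OF bun2_bundle]

lemma dual_closed [simp]:
  "\<alpha> \<in> \<Gamma>1' \<Longrightarrow> bra1 DA \<alpha> \<in> \<Gamma>2'" "\<beta> \<in> \<Gamma>2' \<Longrightarrow> \<beta>' \<in> \<Gamma>2' \<Longrightarrow> bra2 DA \<beta> \<beta>' \<in> \<Gamma>2'"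
  "\<beta> \<in> \<Gamma>2' \<Longrightarrow> \<alpha> \<in> \<Gamma>1' \<Longrightarrow> bra2m DA \<beta> \<alpha> \<in> \<Gamma>1'"
  "\<beta> \<in> \<Gamma>2' \<Longrightarrow> \<beta>' \<in> \<Gamma>2' \<Longrightarrow> \<beta>'' \<in> \<Gamma>2' \<Longrightarrow> bra3 DA \<beta> \<beta>' \<beta>'' \<in> \<Gamma>1'"
  unfolding dual_simps lieD1_1_def lieD1_2_def lieD2_def lieD3_def dfun_def
  by (simp_all add: dual1(1)[OF tensorial_lieD1_1] dual1(1)[OF tensorial_lieD2] dual1(1)[OF tensorial_lieD3]
      dual1(1)[OF tensorial_dfun] dual2(1)[OF tensorial_lieD1_2] dual2(1)[OF tensorial_bra1])

lemma pairing_right: "pairing s (\<alpha> + \<beta>) = pairing s \<alpha> + pairing s \<beta>" "pairing s (\<alpha> - \<beta>) = pairing s \<alpha> - pairing s \<beta>"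
  "pairing s (- \<alpha>) = - pairing s \<alpha>" "pairing s (r *\<^sub>R \<alpha>) = r *\<^sub>R pairing s \<alpha>" for \<alpha> \<beta> :: "'m \<Rightarrow> 'v \<Rightarrow> real"
  by (simp_all add: pairing_def fun_eq_iff)

lemma dual_pairing:
  "\<alpha> \<in> \<Gamma>1' \<Longrightarrow> Y \<in> \<Gamma>2 \<Longrightarrow> pairing Y (bra1 DA \<alpha>) = pairing (bra1 A Y) \<alpha>"
  "\<beta> \<in> \<Gamma>2' \<Longrightarrow> \<beta>' \<in> \<Gamma>2' \<Longrightarrow> Y \<in> \<Gamma>2 \<Longrightarrow> pairing Y (bra2 DA \<beta> \<beta>') =
    rho A (sharp \<beta>) (pairing Y \<beta>') - pairing (bra2m A (sharp \<beta>) Y) \<beta>' - (rho A (sharp \<beta>') (pairing Y \<beta>) - pairing (bra2m A (sharp \<beta>') Y) \<beta>)"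
  "\<beta> \<in> \<Gamma>2' \<Longrightarrow> \<alpha> \<in> \<Gamma>1' \<Longrightarrow> X \<in> \<Gamma>1 \<Longrightarrow> pairing X (bra2m DA \<beta> \<alpha>) =
    rho A (sharp \<beta>) (pairing X \<alpha>) - pairing (bra2 A (sharp \<beta>) X) \<alpha> + pairing (bra2m A X (natural \<alpha>)) \<beta> - rho A X (\<lambda>x. H x (\<alpha> x) (\<beta> x))"
  "\<beta> \<in> \<Gamma>2' \<Longrightarrow> \<beta>' \<in> \<Gamma>2' \<Longrightarrow> \<beta>'' \<in> \<Gamma>2' \<Longrightarrow> X \<in> \<Gamma>1 \<Longrightarrow> pairing X (bra3 DA \<beta> \<beta>' \<beta>'') =
    pairing (bra2m A X (flat \<beta> \<beta>')) \<beta>'' + pairing (bra2m A X (flat \<beta>'' \<beta>)) \<beta>' + pairing (bra2m A X (flat \<beta>' \<beta>'')) \<beta>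
    - 2 *\<^sub>R rho A X (\<lambda>x. K x (\<beta> x) (\<beta>' x) (\<beta>'' x))
    - pairing (bra3 A (sharp \<beta>) (sharp \<beta>') X) \<beta>'' - pairing (bra3 A (sharp \<beta>') (sharp \<beta>'') X) \<beta> - pairing (bra3 A (sharp \<beta>'') (sharp \<beta>) X) \<beta>'"
  unfolding dual_simps lieD1_1_def lieD1_2_def lieD2_def lieD3_def dfun_def
  by (simp_all add: pairing_right dual1(2)[OF tensorial_lieD1_1] dual1(2)[OF tensorial_lieD2] dual1(2)[OF tensorial_lieD3]
      dual1(2)[OF tensorial_dfun] dual2(2)[OF tensorial_lieD1_2] dual2(2)[OF tensorial_bra1])

end

context twisted_chart
begin

lemma sec_T [simp]:
  "X \<in> \<Gamma>1 \<Longrightarrow> s1 X \<in> T 1 0 1" "Y \<in> \<Gamma>2 \<Longrightarrow> s2 Y \<in> T 0 0 1" "\<alpha> \<in> \<Gamma>1' \<Longrightarrow> c1 \<alpha> \<in> T 0 1 0" "\<beta> \<in> \<Gamma>2' \<Longrightarrow> c2 \<beta> \<in> T 1 1 0"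
  "f \<in> Cinf M \<Longrightarrow> f0 f \<in> T 0 0 0"
  using smooth_on_subset[of UNIV f dm] by (simp_all add: loc_sections Cinf_iff)

lemmas sec_C' [simp] = sec_T[THEN T_carrier]

lemma structure_rules:
  "Y \<in> \<Gamma>2 \<Longrightarrow> br m1 (s2 Y) = - s1 (bra1 A Y)"
  "X \<in> \<Gamma>1 \<Longrightarrow> X' \<in> \<Gamma>1 \<Longrightarrow> br (br m2 (s1 X)) (s1 X') = - s1 (bra2 A X X')"
  "X \<in> \<Gamma>1 \<Longrightarrow> Y \<in> \<Gamma>2 \<Longrightarrow> br (br m2 (s1 X)) (s2 Y) = - s2 (bra2m A X Y)"
  "X \<in> \<Gamma>1 \<Longrightarrow> X' \<in> \<Gamma>1 \<Longrightarrow> X'' \<in> \<Gamma>1 \<Longrightarrow> br (br (br m3 (s1 X)) (s1 X')) (s1 X'') = - s2 (bra3 A X X' X'')"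
  "X \<in> \<Gamma>1 \<Longrightarrow> f \<in> Cinf M \<Longrightarrow> br (br m2 (s1 X)) (f0 f) = - f0 (rho A X f)"
  by (simp_all add: structure_eqs)

lemma pair_rules:
  "X \<in> \<Gamma>1 \<Longrightarrow> \<alpha> \<in> \<Gamma>1' \<Longrightarrow> br (s1 X) (c1 \<alpha>) = - f0 (pairing X \<alpha>)"
  "Y \<in> \<Gamma>2 \<Longrightarrow> \<beta> \<in> \<Gamma>2' \<Longrightarrow> br (s2 Y) (c2 \<beta>) = f0 (pairing Y \<beta>)"
  by (simp_all add: pair_1 pair_2 loc_sections)

lemma pairing_sharp: "\<beta> \<in> \<Gamma>2' \<Longrightarrow> \<alpha> \<in> \<Gamma>1' \<Longrightarrow> pairing (sharp \<beta>) \<alpha> = (\<lambda>x. H x (\<alpha> x) (\<beta> x))"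
  using H_sharp_section(3)[OF bun1_bundle H section_in_fib section_in_fib] by (simp add: pairing_def sharp_def)

lemma pairing_natural: "\<beta> \<in> \<Gamma>2' \<Longrightarrow> \<alpha> \<in> \<Gamma>1' \<Longrightarrow> pairing (natural \<alpha>) \<beta> = (\<lambda>x. H x (\<alpha> x) (\<beta> x))"
  using H_nat_section(3)[OF bun2_bundle H section_in_fib section_in_fib] by (simp add: pairing_def natural_def)

lemma pairing_flat: "\<beta> \<in> \<Gamma>2' \<Longrightarrow> \<beta>' \<in> \<Gamma>2' \<Longrightarrow> \<beta>'' \<in> \<Gamma>2' \<Longrightarrow>
    pairing (flat \<beta> \<beta>') \<beta>'' = (\<lambda>x. K x (\<beta> x) (\<beta>' x) (\<beta>'' x))"
  using K_flat_section(2)[OF K _ _ section_in_fib] by (simp add: pairing_def flat_def)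

text \<open>The second rule follows from the first: contracting \<open>H\<close> with both kinds of
  covectors gives the same function in either order, since the covectors have vanishing bracket, and
  elements of tridegree (0, 0, 1) are determined by such contractions.\<close>

lemma HK_rules:
  "\<beta> \<in> \<Gamma>2' \<Longrightarrow> br h (c2 \<beta>) = s1 (sharp \<beta>)"
  "\<alpha> \<in> \<Gamma>1' \<Longrightarrow> br h (c1 \<alpha>) = - s2 (natural \<alpha>)"
  "\<beta> \<in> \<Gamma>2' \<Longrightarrow> \<beta>' \<in> \<Gamma>2' \<Longrightarrow> br (br \<kappa> (c2 \<beta>)) (c2 \<beta>') = - s2 (flat \<beta> \<beta>')"
proof -
  show sh: "br h (c2 \<beta>) = s1 (sharp \<beta>)" if "\<beta> \<in> \<Gamma>2'" for \<beta>
    using Hc_c2[OF H loc_sections[OF that]] by (simp add: sharp_def)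
  show "br (br \<kappa> (c2 \<beta>)) (c2 \<beta>') = - s2 (flat \<beta> \<beta>')" if "\<beta> \<in> \<Gamma>2'" "\<beta>' \<in> \<Gamma>2'"
    using Kc_flat[OF K that] by (simp add: flat_def)
  assume \<alpha>: "\<alpha> \<in> \<Gamma>1'"
  show "br h (c1 \<alpha>) = - s2 (natural \<alpha>)"
  proof (rule T_eq_c2)
    show "br h (c1 \<alpha>) \<in> T 0 0 1" "- s2 (natural \<alpha>) \<in> T 0 0 1"
      using D.T_closed(2)[OF sec_T(3)[OF \<alpha>]] \<alpha> by (simp_all add: T_neg)
    fix \<beta> assume \<beta>: "\<beta> \<in> \<Gamma>2'"
    have "br (br h (c1 \<alpha>)) (c2 \<beta>) = br (br h (c2 \<beta>)) (c1 \<alpha>)"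
      using B.right_e'[of h "c2 \<beta>" "c1 \<alpha>"] D.van_ap[OF sec_T(4)[OF \<beta>] sec_T(3)[OF \<alpha>]]
        D.T_EvOd(1)[OF sec_T(4)[OF \<beta>]] D.T_EvOd(2)[OF sec_T(3)[OF \<alpha>]] by simp
    then show "br (br h (c1 \<alpha>)) (c2 \<beta>) = br (- s2 (natural \<alpha>)) (c2 \<beta>)"
      using \<alpha> \<beta> by (simp add: sh pair_rules pairing_sharp pairing_natural)
  qed
qed

section \<open>The operations on the dual as derived brackets\<close>

lemma dual_chart1:
  assumes \<alpha>: "\<alpha> \<in> \<Gamma>1'"
  shows "c2 (bra1 DA \<alpha>) = - br m1 (c1 \<alpha>)"
proof (rule T_eq_s2)
  show "c2 (bra1 DA \<alpha>) \<in> T 1 1 0" "- br m1 (c1 \<alpha>) \<in> T 1 1 0"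
    using T_br_closed[OF m_T(1) sec_T(3)[OF \<alpha>]] \<alpha> by (simp_all add: T_neg)
  fix Y assume Y: "Y \<in> \<Gamma>2"
  show "br (s2 Y) (c2 (bra1 DA \<alpha>)) = br (s2 Y) (- br m1 (c1 \<alpha>))"
    using D.dual_bra1[OF sec_T(3,2), OF \<alpha> Y] Y \<alpha> by (simp add: pair_rules dual_pairing structure_rules)
qed

lemma dual_chart2:
  assumes \<beta>: "\<beta> \<in> \<Gamma>2'" and \<beta>': "\<beta>' \<in> \<Gamma>2'"
  shows "c2 (bra2 DA \<beta> \<beta>') = - br (br D.g2 (c2 \<beta>)) (c2 \<beta>')"
proof (rule T_eq_s2)
  show "c2 (bra2 DA \<beta> \<beta>') \<in> T 1 1 0" "- br (br D.g2 (c2 \<beta>)) (c2 \<beta>') \<in> T 1 1 0"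
    using T_br_closed[OF T_br_closed[OF D.g2_T sec_T(4)[OF \<beta>]] sec_T(4)[OF \<beta>']] \<beta> \<beta>' by (simp_all add: T_neg)
  fix Y assume Y: "Y \<in> \<Gamma>2"
  note g2C = T_carrier[OF D.g2_T]
  show "br (s2 Y) (c2 (bra2 DA \<beta> \<beta>')) = br (s2 Y) (- br (br D.g2 (c2 \<beta>)) (c2 \<beta>'))"
    using D.dual_bra2[OF sec_T(4,4,2), OF \<beta> \<beta>' Y] Y \<beta> \<beta>' g2C
    by (simp add: pair_rules dual_pairing HK_rules structure_rules f0_linear)
qed

lemma dual_chart2m:
  assumes \<beta>: "\<beta> \<in> \<Gamma>2'" and \<alpha>: "\<alpha> \<in> \<Gamma>1'"
  shows "c1 (bra2m DA \<beta> \<alpha>) = - br (br D.g2 (c2 \<beta>)) (c1 \<alpha>)"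
proof (rule T_eq_s1)
  show "c1 (bra2m DA \<beta> \<alpha>) \<in> T 0 1 0" "- br (br D.g2 (c2 \<beta>)) (c1 \<alpha>) \<in> T 0 1 0"
    using T_br_closed[OF T_br_closed[OF D.g2_T sec_T(4)[OF \<beta>]] sec_T(3)[OF \<alpha>]] \<beta> \<alpha> by (simp_all add: T_neg)
  fix X assume X: "X \<in> \<Gamma>1"
  note g2C = T_carrier[OF D.g2_T]
  show "br (s1 X) (c1 (bra2m DA \<beta> \<alpha>)) = br (s1 X) (- br (br D.g2 (c2 \<beta>)) (c1 \<alpha>))"
    using D.dual_bra2m[OF sec_T(4,3,1), OF \<beta> \<alpha> X] X \<alpha> \<beta> g2C
    by (simp add: pair_rules dual_pairing HK_rules structure_rules pairing_sharp f0_linear)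
qed

lemma dual_chart3:
  assumes \<beta>: "\<beta> \<in> \<Gamma>2'" and \<beta>': "\<beta>' \<in> \<Gamma>2'" and \<beta>'': "\<beta>'' \<in> \<Gamma>2'"
  shows "c1 (bra3 DA \<beta> \<beta>' \<beta>'') = - br (br (br D.g3 (c2 \<beta>)) (c2 \<beta>')) (c2 \<beta>'')"
proof (rule T_eq_s1)
  show "c1 (bra3 DA \<beta> \<beta>' \<beta>'') \<in> T 0 1 0" "- br (br (br D.g3 (c2 \<beta>)) (c2 \<beta>')) (c2 \<beta>'') \<in> T 0 1 0"
    using T_br_closed[OF T_br_closed[OF T_br_closed[OF D.g3_T sec_T(4)[OF \<beta>]] sec_T(4)[OF \<beta>']] sec_T(4)[OF \<beta>'']] \<beta> \<beta>' \<beta>''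
    by (simp_all add: T_neg)
  fix X assume X: "X \<in> \<Gamma>1"
  note g3C = T_carrier[OF D.g3_T]
  show "br (s1 X) (c1 (bra3 DA \<beta> \<beta>' \<beta>'')) = br (s1 X) (- br (br (br D.g3 (c2 \<beta>)) (c2 \<beta>')) (c2 \<beta>''))"
    using D.dual_bra3[OF sec_T(4,4,4,1), OF \<beta> \<beta>' \<beta>'' X] X \<beta> \<beta>' \<beta>'' g3C
    by (simp add: pair_rules dual_pairing HK_rules structure_rules pairing_flat f0_linear)
qed

lemma dual_chart0:
  assumes \<beta>: "\<beta> \<in> \<Gamma>2'" and f: "f \<in> Cinf M"
  shows "f0 (rho DA \<beta> f) = - br (br D.g2 (c2 \<beta>)) (f0 f)"
  using D.dual_anchor[OF sec_T(4,5), OF \<beta> f] \<beta> f by (simp add: HK_rules structure_rules dual_simps)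

end

section \<open>The algebroid structure and the morphism\<close>

context twisted_algebroid
begin

lemma eq_in_charts:
  assumes "\<And>c x. twisted_chart M A \<mu> H K c \<Longrightarrow> x \<in> cdom c \<Longrightarrow> s x = t x"
  shows "s = t"
  using assms darboux_chart_at twisted_chart by (metis ext)

lemma eq1'I:
  assumes s: "s \<in> \<Gamma>1'" "t \<in> \<Gamma>1'"
    and eq: "\<And>c. twisted_chart M A \<mu> H K c \<Longrightarrow> restrict_gfun (cdom c) (cosec1 s c) = restrict_gfun (cdom c) (cosec1 t c)"
  shows "s = t"
proof (rule eq_in_charts)
  fix c x assume c: "twisted_chart M A \<mu> H K c" and x: "x \<in> cdom c"
  from c interpret twisted_chart M A \<mu> H K c .
  show "s x = t x"
    using eq[OF c] by (intro c1_inj[OF s[THEN loc_sections] _ x]) (simp add: rs_s)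
qed

lemma eq2'I:
  assumes s: "s \<in> \<Gamma>2'" "t \<in> \<Gamma>2'"
    and eq: "\<And>c. twisted_chart M A \<mu> H K c \<Longrightarrow> restrict_gfun (cdom c) (cosec2 s c) = restrict_gfun (cdom c) (cosec2 t c)"
  shows "s = t"
proof (rule eq_in_charts)
  fix c x assume c: "twisted_chart M A \<mu> H K c" and x: "x \<in> cdom c"
  from c interpret twisted_chart M A \<mu> H K c .
  show "s x = t x"
    using eq[OF c] by (intro c2_inj[OF s[THEN loc_sections] _ x]) (simp add: rs_s)
qed

lemma eq1I:
  assumes s: "s \<in> \<Gamma>1" "t \<in> \<Gamma>1"
    and eq: "\<And>c. twisted_chart M A \<mu> H K c \<Longrightarrow> restrict_gfun (cdom c) (sec1 s c) = restrict_gfun (cdom c) (sec1 t c)"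
  shows "s = t"
proof (rule eq_in_charts)
  fix c x assume c: "twisted_chart M A \<mu> H K c" and x: "x \<in> cdom c"
  from c interpret twisted_chart M A \<mu> H K c .
  show "s x = t x"
    using eq[OF c] by (intro s1_inj[OF s[THEN loc_sections] _ x]) (simp add: rs_s)
qed

lemma eq2I:
  assumes s: "s \<in> \<Gamma>2" "t \<in> \<Gamma>2"
    and eq: "\<And>c. twisted_chart M A \<mu> H K c \<Longrightarrow> restrict_gfun (cdom c) (sec2 s c) = restrict_gfun (cdom c) (sec2 t c)"
  shows "s = t"
proof (rule eq_in_charts)
  fix c x assume c: "twisted_chart M A \<mu> H K c" and x: "x \<in> cdom c"
  from c interpret twisted_chart M A \<mu> H K c .
  show "s x = t x"
    using eq[OF c] by (intro s2_inj[OF s[THEN loc_sections] _ x]) (simp add: rs_s)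
qed

end

context twisted_chart
begin

lemma D_C [simp]: "D.g2 \<in> C" "D.g3 \<in> C"
  using D.g2_T D.g3_T by (simp_all add: T_carrier)

lemma swap_c2:
  "F \<in> B.Hom \<Longrightarrow> \<beta> \<in> \<Gamma>2' \<Longrightarrow> \<beta>' \<in> \<Gamma>2' \<Longrightarrow> br (br F (c2 \<beta>)) (c2 \<beta>') = - br (br F (c2 \<beta>')) (c2 \<beta>)"
  by (intro D.aa_swap) simp_all

lemma sec_parity [simp]: "\<alpha> \<in> \<Gamma>1' \<Longrightarrow> c1 \<alpha> \<in> B.Even" "\<beta> \<in> \<Gamma>2' \<Longrightarrow> c2 \<beta> \<in> B.Odd"
  using D.T_EvOd by simp_all

lemma m1_c2 [simp]: "\<beta> \<in> \<Gamma>2' \<Longrightarrow> br m1 (c2 \<beta>) = 0"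
  by (simp add: D.van_m1a)

lemma br_smul:
  assumes "F \<in> T i j k" "f \<in> Cinf M"
  shows "\<beta> \<in> \<Gamma>2' \<Longrightarrow> br F (c2 (smul f \<beta>)) = gmult (br F (f0 f)) (c2 \<beta>) + gmult (f0 f) (br F (c2 \<beta>))"
    and "\<alpha> \<in> \<Gamma>1' \<Longrightarrow> br F (c1 (smul f \<alpha>)) = gmult (br F (f0 f)) (c1 \<alpha>) + gmult (f0 f) (br F (c1 \<alpha>))"
  using br_leibniz[OF assms(1), of f] smooth_on_subset[of UNIV f dm] assms(2)
  by (simp_all add: smul_gmult loc_sections Cinf_iff)

lemma gmult_neg: "gmult (- F) G = - gmult F G" "gmult F (- G) = - gmult F G"
  using gmult_bilinear(1)[of F "- F" G] gmult_bilinear(2)[of F G "- G"]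
  by (simp_all add: eq_neg_iff_add_eq_0 add.commute)

end

context twisted_algebroid
begin

section \<open>Linearity and skew symmetry of the induced operations\<close>

lemma lin2'I:
  assumes "\<And>s. s \<in> U \<Longrightarrow> L s \<in> \<Gamma>2'" "subspace U"
    and "\<And>c s t r. twisted_chart M A \<mu> H K c \<Longrightarrow> s \<in> U \<Longrightarrow> t \<in> U \<Longrightarrow>
      restrict_gfun (cdom c) (cosec2 (L (s + t)) c) = restrict_gfun (cdom c) (cosec2 (L s + L t) c) \<and>
      restrict_gfun (cdom c) (cosec2 (L (r *\<^sub>R s)) c) = restrict_gfun (cdom c) (cosec2 (r *\<^sub>R L s) c)"
  shows "lin_on U \<Gamma>2' L"
  unfolding lin_on_def using assms subspace_add[OF assms(2)] subspace_scale[OF assms(2)]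
  by (intro conjI ballI allI eq2'I) simp_all

lemma lin1'I:
  assumes "\<And>s. s \<in> U \<Longrightarrow> L s \<in> \<Gamma>1'" "subspace U"
    and "\<And>c s t r. twisted_chart M A \<mu> H K c \<Longrightarrow> s \<in> U \<Longrightarrow> t \<in> U \<Longrightarrow>
      restrict_gfun (cdom c) (cosec1 (L (s + t)) c) = restrict_gfun (cdom c) (cosec1 (L s + L t) c) \<and>
      restrict_gfun (cdom c) (cosec1 (L (r *\<^sub>R s)) c) = restrict_gfun (cdom c) (cosec1 (r *\<^sub>R L s) c)"
  shows "lin_on U \<Gamma>1' L"
  unfolding lin_on_def using assms subspace_add[OF assms(2)] subspace_scale[OF assms(2)]
  by (intro conjI ballI allI eq1'I) simp_all

lemma subspace_\<Gamma>': "subspace \<Gamma>1'" "subspace \<Gamma>2'"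
  using subspace_sections vector_bundle_dual bun1_bundle bun2_bundle by blast+

lemma lin_bra1: "lin_on \<Gamma>1' \<Gamma>2' (bra1 DA)"
proof (rule lin2'I)
  fix c s t and r :: real assume st: "s \<in> \<Gamma>1'" "t \<in> \<Gamma>1'" and "twisted_chart M A \<mu> H K c"
  then interpret twisted_chart M A \<mu> H K c by simp
  show "rs (cosec2 ((bra1 DA) (s + t)) c) = rs (cosec2 ((bra1 DA) s + (bra1 DA) t) c) \<and>
      rs (cosec2 ((bra1 DA) (r *\<^sub>R s)) c) = rs (cosec2 (r *\<^sub>R (bra1 DA) s) c)"
    using st by (simp add: rs_s c1_linear c2_linear dual_chart1 dual_chart2 dual_chart2m dual_chart3 B.br_linear)
qed (simp_all add: subspace_\<Gamma>')

lemma lin_bra2: "\<beta> \<in> \<Gamma>2' \<Longrightarrow> lin_on \<Gamma>2' \<Gamma>2' (bra2 DA \<beta>)"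
proof (rule lin2'I)
  assume p: "\<beta> \<in> \<Gamma>2'"
  fix c s t and r :: real assume st: "s \<in> \<Gamma>2'" "t \<in> \<Gamma>2'" and "twisted_chart M A \<mu> H K c"
  then interpret twisted_chart M A \<mu> H K c by simp
  show "rs (cosec2 ((bra2 DA \<beta>) (s + t)) c) = rs (cosec2 ((bra2 DA \<beta>) s + (bra2 DA \<beta>) t) c) \<and>
      rs (cosec2 ((bra2 DA \<beta>) (r *\<^sub>R s)) c) = rs (cosec2 (r *\<^sub>R (bra2 DA \<beta>) s) c)"
    using p st by (simp add: rs_s c1_linear c2_linear dual_chart1 dual_chart2 dual_chart2m dual_chart3 B.br_linear)
qed (simp_all add: subspace_\<Gamma>')

lemma lin_bra2m: "\<beta> \<in> \<Gamma>2' \<Longrightarrow> lin_on \<Gamma>1' \<Gamma>1' (bra2m DA \<beta>)"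
proof (rule lin1'I)
  assume p: "\<beta> \<in> \<Gamma>2'"
  fix c s t and r :: real assume st: "s \<in> \<Gamma>1'" "t \<in> \<Gamma>1'" and "twisted_chart M A \<mu> H K c"
  then interpret twisted_chart M A \<mu> H K c by simp
  show "rs (cosec1 ((bra2m DA \<beta>) (s + t)) c) = rs (cosec1 ((bra2m DA \<beta>) s + (bra2m DA \<beta>) t) c) \<and>
      rs (cosec1 ((bra2m DA \<beta>) (r *\<^sub>R s)) c) = rs (cosec1 (r *\<^sub>R (bra2m DA \<beta>) s) c)"
    using p st by (simp add: rs_s c1_linear c2_linear dual_chart1 dual_chart2 dual_chart2m dual_chart3 B.br_linear)
qed (simp_all add: subspace_\<Gamma>')

lemma lin_bra2m': "\<alpha> \<in> \<Gamma>1' \<Longrightarrow> lin_on \<Gamma>2' \<Gamma>1' (\<lambda>\<beta>. bra2m DA \<beta> \<alpha>)"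
proof (rule lin1'I)
  assume p: "\<alpha> \<in> \<Gamma>1'"
  fix c s t and r :: real assume st: "s \<in> \<Gamma>2'" "t \<in> \<Gamma>2'" and "twisted_chart M A \<mu> H K c"
  then interpret twisted_chart M A \<mu> H K c by simp
  show "rs (cosec1 ((\<lambda>\<beta>. bra2m DA \<beta> \<alpha>) (s + t)) c) = rs (cosec1 ((\<lambda>\<beta>. bra2m DA \<beta> \<alpha>) s + (\<lambda>\<beta>. bra2m DA \<beta> \<alpha>) t) c) \<and>
      rs (cosec1 ((\<lambda>\<beta>. bra2m DA \<beta> \<alpha>) (r *\<^sub>R s)) c) = rs (cosec1 (r *\<^sub>R (\<lambda>\<beta>. bra2m DA \<beta> \<alpha>) s) c)"
    using p st by (simp add: rs_s c1_linear c2_linear dual_chart1 dual_chart2 dual_chart2m dual_chart3 B.br_linear)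
qed (simp_all add: subspace_\<Gamma>')

lemma lin_bra3: "\<beta> \<in> \<Gamma>2' \<Longrightarrow> \<beta>' \<in> \<Gamma>2' \<Longrightarrow> lin_on \<Gamma>2' \<Gamma>1' (bra3 DA \<beta> \<beta>')"
proof (rule lin1'I)
  assume p: "\<beta> \<in> \<Gamma>2'" "\<beta>' \<in> \<Gamma>2'"
  fix c s t and r :: real assume st: "s \<in> \<Gamma>2'" "t \<in> \<Gamma>2'" and "twisted_chart M A \<mu> H K c"
  then interpret twisted_chart M A \<mu> H K c by simp
  show "rs (cosec1 ((bra3 DA \<beta> \<beta>') (s + t)) c) = rs (cosec1 ((bra3 DA \<beta> \<beta>') s + (bra3 DA \<beta> \<beta>') t) c) \<and>
      rs (cosec1 ((bra3 DA \<beta> \<beta>') (r *\<^sub>R s)) c) = rs (cosec1 (r *\<^sub>R (bra3 DA \<beta> \<beta>') s) c)"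
    using p st by (simp add: rs_s c1_linear c2_linear dual_chart1 dual_chart2 dual_chart2m dual_chart3 B.br_linear)
qed (simp_all add: subspace_\<Gamma>')

lemma dual_skew:
  "\<beta> \<in> \<Gamma>2' \<Longrightarrow> \<beta>' \<in> \<Gamma>2' \<Longrightarrow> bra2 DA \<beta> \<beta>' = - bra2 DA \<beta>' \<beta>"
  "\<beta> \<in> \<Gamma>2' \<Longrightarrow> \<beta>' \<in> \<Gamma>2' \<Longrightarrow> \<beta>'' \<in> \<Gamma>2' \<Longrightarrow> bra3 DA \<beta> \<beta>' \<beta>'' = - bra3 DA \<beta>' \<beta> \<beta>''"
  "\<beta> \<in> \<Gamma>2' \<Longrightarrow> \<beta>' \<in> \<Gamma>2' \<Longrightarrow> \<beta>'' \<in> \<Gamma>2' \<Longrightarrow> bra3 DA \<beta> \<beta>' \<beta>'' = - bra3 DA \<beta> \<beta>'' \<beta>'"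
proof -
  show "bra2 DA \<beta> \<beta>' = - bra2 DA \<beta>' \<beta>" if "\<beta> \<in> \<Gamma>2'" "\<beta>' \<in> \<Gamma>2'"
    using that by (simp add: dual_simps)
  assume *: "\<beta> \<in> \<Gamma>2'" "\<beta>' \<in> \<Gamma>2'" "\<beta>'' \<in> \<Gamma>2'"
  show "bra3 DA \<beta> \<beta>' \<beta>'' = - bra3 DA \<beta>' \<beta> \<beta>''"
  proof (rule eq1'I)
    fix c assume "twisted_chart M A \<mu> H K c"
    then interpret twisted_chart M A \<mu> H K c .
    show "rs (cosec1 (bra3 DA \<beta> \<beta>' \<beta>'') c) = rs (cosec1 (- bra3 DA \<beta>' \<beta> \<beta>'') c)"
      using * swap_c2[of D.g3 \<beta> \<beta>'] by (simp add: rs_s c1_linear dual_chart3)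
  qed (use * in simp_all)
  show "bra3 DA \<beta> \<beta>' \<beta>'' = - bra3 DA \<beta> \<beta>'' \<beta>'"
  proof (rule eq1'I)
    fix c assume "twisted_chart M A \<mu> H K c"
    then interpret twisted_chart M A \<mu> H K c .
    show "rs (cosec1 (bra3 DA \<beta> \<beta>' \<beta>'') c) = rs (cosec1 (- bra3 DA \<beta> \<beta>'' \<beta>') c)"
      using * swap_c2[of "br D.g3 (c2 \<beta>)" \<beta>' \<beta>''] by (simp add: rs_s c1_linear dual_chart3)
  qed (use * in simp_all)
qed

lemma lie2_components:
  "deg1 (section_lie2 M DA) = \<Gamma>2'" "deg2 (section_lie2 M DA) = \<Gamma>1'"
  "ldiff (section_lie2 M B) = bra1 B" "lbr2 (section_lie2 M B) = bra2 B" "lact (section_lie2 M B) = bra2m B" "lbr3 (section_lie2 M B) = bra3 B"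
  "deg1 (section_lie2 M A) = \<Gamma>1" "deg2 (section_lie2 M A) = \<Gamma>2"
  by (simp_all add: section_lie2_def dual_simps)

text \<open>Each identity is checked chart by chart with the corresponding lemma on derived brackets
  of \<open>m1\<close>, \<open>D.g2\<close>, \<open>D.g3\<close>. The brackets are the negatives of
  the derived ones, but every term of every identity contains exactly two brackets, so the signs
  cancel.\<close>

lemma section_lie2_dual: "lie2_algebra (section_lie2 M DA)"
proof
  let ?L = "section_lie2 M DA"
  note sub = subspace_\<Gamma>'
  show "subspace (deg1 ?L)" "subspace (deg2 ?L)" "lin_on (deg2 ?L) (deg1 ?L) (ldiff ?L)"
    unfolding lie2_components by (rule sub(2), rule sub(1), rule lin_bra1)
  show "skew2_on (deg1 ?L) (deg1 ?L) (lbr2 ?L)"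
    unfolding lie2_components skew2_on_def bilin_on_def
  proof (intro conjI ballI)
    show "lin_on \<Gamma>2' \<Gamma>2' (\<lambda>u. bra2 DA u v)" if "v \<in> \<Gamma>2'" for v
      by (rule lin_on_cong[OF sub(2) lin_on_neg[OF sub(2) lin_bra2[OF that]]]) (rule dual_skew(1)[OF _ that, symmetric])
    show "lin_on \<Gamma>2' \<Gamma>2' (bra2 DA u)" if "u \<in> \<Gamma>2'" for u
      by (rule lin_bra2[OF that])
    show "bra2 DA u v = - bra2 DA v u" if "u \<in> \<Gamma>2'" "v \<in> \<Gamma>2'" for u v
      using that by (rule dual_skew(1))
  qed
  show "bilin_on (deg1 ?L) (deg2 ?L) (deg2 ?L) (lact ?L)"
    unfolding lie2_components bilin_on_def using lin_bra2m lin_bra2m' by blast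
  show "skew3_on (deg1 ?L) (deg2 ?L) (lbr3 ?L)"
    unfolding lie2_components skew3_on_def
  proof (intro conjI ballI)
    fix u v assume uv: "u \<in> \<Gamma>2'" "v \<in> \<Gamma>2'"
    show "lin_on \<Gamma>2' \<Gamma>1' (bra3 DA u v)"
      by (rule lin_bra3[OF uv])
    show 1: "lin_on \<Gamma>2' \<Gamma>1' (\<lambda>w. bra3 DA u w v)"
      by (rule lin_on_cong[OF sub(2) lin_on_neg[OF sub(1) lin_bra3[OF uv]]]) (rule dual_skew(3)[OF uv(1) _ uv(2), symmetric])
    show "lin_on \<Gamma>2' \<Gamma>1' (\<lambda>w. bra3 DA w u v)"
      by (rule lin_on_cong[OF sub(2) lin_on_neg[OF sub(1) 1]]) (rule dual_skew(2)[OF _ uv, symmetric])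
  next
    show "bra3 DA u v w = - bra3 DA v u w" "bra3 DA u v w = - bra3 DA u w v" if "u \<in> \<Gamma>2'" "v \<in> \<Gamma>2'" "w \<in> \<Gamma>2'" for u v w
      using that dual_skew(2,3) by blast+
  qed
  fix x y z w m m'
  assume "x \<in> deg1 ?L" and "m \<in> deg2 ?L"
  then have x: "x \<in> \<Gamma>2'" and m: "m \<in> \<Gamma>1'"
    by (simp_all add: lie2_components)
  show "ldiff ?L (lact ?L x m) = lbr2 ?L x (ldiff ?L m)"
    unfolding lie2_components
  proof (rule eq2'I)
    fix c assume "twisted_chart M A \<mu> H K c"
    then interpret twisted_chart M A \<mu> H K c .
    show "rs (cosec2 (bra1 DA (bra2m DA x m)) c) = rs (cosec2 (bra2 DA x (bra1 DA m)) c)"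
      using x m B.derived_action[of m1 D.g2 "c2 x" "c1 m"] by (simp add: rs_s dual_chart1 dual_chart2 dual_chart2m D.g12)
  qed (use x m in simp_all)
next
  let ?L = "section_lie2 M DA"
  show "lact ?L (ldiff ?L m) m' = - lact ?L (ldiff ?L m') m" if "m \<in> deg2 ?L" "m' \<in> deg2 ?L" for m m'
    using that unfolding lie2_components
  proof (intro eq1'I)
    fix c assume m: "m \<in> \<Gamma>1'" "m' \<in> \<Gamma>1'" and "twisted_chart M A \<mu> H K c"
    then interpret twisted_chart M A \<mu> H K c by simp
    have "br (br D.g2 (c1 m)) (c1 m') = 0" "br (c1 m) (br m1 (c1 m')) = 0"
      by (rule D.van_g2pp[OF sec_T(3)[OF m(1)] sec_T(3)[OF m(2)]], rule D.van_pa[OF D.T_closed(5)[OF sec_T(3)[OF m(2)]] sec_T(3)[OF m(1)]])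
    then show "rs (cosec1 (bra2m DA (bra1 DA m) m') c) = rs (cosec1 (- bra2m DA (bra1 DA m') m) c)"
      using m B.derived_action_skew[of m1 D.g2 "c1 m" "c1 m'"] by (simp add: rs_s c1_linear dual_chart1 dual_chart2m D.g12)
  qed simp_all
  show "ldiff ?L (lbr3 ?L x y z) = lbr2 ?L x (lbr2 ?L y z) - lbr2 ?L (lbr2 ?L x y) z - lbr2 ?L y (lbr2 ?L x z)"
    if "x \<in> deg1 ?L" "y \<in> deg1 ?L" "z \<in> deg1 ?L" for x y z
    using that unfolding lie2_components
  proof (intro eq2'I)
    fix c assume m: "x \<in> \<Gamma>2'" "y \<in> \<Gamma>2'" "z \<in> \<Gamma>2'" and "twisted_chart M A \<mu> H K c"
    then interpret twisted_chart M A \<mu> H K c by simp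
    show "rs (cosec2 (bra1 DA (bra3 DA x y z)) c) =
        rs (cosec2 (bra2 DA x (bra2 DA y z) - bra2 DA (bra2 DA x y) z - bra2 DA y (bra2 DA x z)) c)"
      using m B.derived_jacobi[of m1 D.g2 D.g3 "c2 x" "c2 y" "c2 z"]
      by (simp add: rs_s c2_linear dual_chart1 dual_chart2 dual_chart3 D.g22)
  qed simp_all
  show "lbr3 ?L x y (ldiff ?L m) = lact ?L x (lact ?L y m) - lact ?L (lbr2 ?L x y) m - lact ?L y (lact ?L x m)"
    if "x \<in> deg1 ?L" "y \<in> deg1 ?L" "m \<in> deg2 ?L" for x y m
    using that unfolding lie2_components
  proof (intro eq1'I)
    fix c assume m: "x \<in> \<Gamma>2'" "y \<in> \<Gamma>2'" "m \<in> \<Gamma>1'" and "twisted_chart M A \<mu> H K c"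
    then interpret twisted_chart M A \<mu> H K c by simp
    show "rs (cosec1 (bra3 DA x y (bra1 DA m)) c) =
        rs (cosec1 (bra2m DA x (bra2m DA y m) - bra2m DA (bra2 DA x y) m - bra2m DA y (bra2m DA x m)) c)"
      using m B.derived_jacobi_action[of m1 D.g2 D.g3 "c2 x" "c2 y" "c1 m"] D.van_g3aap[of "c2 x" "c2 y" "c1 m"]
      by (simp add: rs_s c1_linear dual_chart1 dual_chart2 dual_chart2m dual_chart3 D.g22)
  qed simp_all
  show "lact ?L x (lbr3 ?L y z w) - lact ?L y (lbr3 ?L x z w) + lact ?L z (lbr3 ?L x y w) - lact ?L w (lbr3 ?L x y z)
      - lbr3 ?L (lbr2 ?L x y) z w - lbr3 ?L y (lbr2 ?L x z) w - lbr3 ?L y z (lbr2 ?L x w) + lbr3 ?L x (lbr2 ?L y z) w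
      + lbr3 ?L x z (lbr2 ?L y w) - lbr3 ?L x y (lbr2 ?L z w) = 0" (is "?S = 0")
    if xyzw: "x \<in> deg1 ?L" "y \<in> deg1 ?L" "z \<in> deg1 ?L" "w \<in> deg1 ?L" for x y z w
  proof (rule eq1'I)
    have m: "x \<in> \<Gamma>2'" "y \<in> \<Gamma>2'" "z \<in> \<Gamma>2'" "w \<in> \<Gamma>2'"
      using xyzw by (simp_all add: lie2_components)
    then show "?S \<in> \<Gamma>1'"
      by (simp add: lie2_components)
    fix c assume "twisted_chart M A \<mu> H K c"
    then interpret twisted_chart M A \<mu> H K c by simp
    have "br (br (br (br D.g3 (c2 x)) (c2 y)) (c2 z)) (c2 w) = 0"
      using m by (intro D.van_pa[OF _ D.T_closed(9)]) simp_all
    then show "rs (cosec1 ?S c) = rs (cosec1 0 c)"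
      using m B.derived_coherence[of D.g2 D.g3 "c2 x" "c2 y" "c2 z" "c2 w"]
      by (simp add: lie2_components rs_s c1_linear dual_chart2 dual_chart2m dual_chart3 D.g23)
  next
    show "0 \<in> \<Gamma>1'"
      by (rule subspace_0[OF subspace_sections[OF vector_bundle_dual[OF bun1_bundle]]])
  qed
qed

end

context twisted_chart
begin

lemma s2_neg: "Y \<in> \<Gamma>2 \<Longrightarrow> s2 (- Y) = - s2 Y"
  using s2_linear(3)[OF loc_sections loc_sections] .

lemma HK_rules':
  "\<beta> \<in> \<Gamma>2' \<Longrightarrow> s1 (sharp \<beta>) = br h (c2 \<beta>)" "\<alpha> \<in> \<Gamma>1' \<Longrightarrow> s2 (natural \<alpha>) = - br h (c1 \<alpha>)"
  "\<beta> \<in> \<Gamma>2' \<Longrightarrow> \<beta>' \<in> \<Gamma>2' \<Longrightarrow> s2 (flat \<beta> \<beta>') = - br (br \<kappa> (c2 \<beta>)) (c2 \<beta>')"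
  by (simp_all add: HK_rules)

end

context twisted_algebroid
begin

lemma subspace_dual_fibres: "subspace (fib (dual_bundle (bun1 A)) x)" "subspace (fib (dual_bundle (bun2 A)) x)"
  using subspace_fibre vector_bundle_dual bun1_bundle bun2_bundle by blast+

lemma lin_H_sharp: "lin_on (fib (dual_bundle (bun2 A)) x) (fib (bun1 A) x) (H_sharp A H x)"
proof -
  have "H_sharp A H x = (\<lambda>u. riesz (bun1 A) x (\<lambda>\<alpha>. H x \<alpha> u))"
    by (simp add: H_sharp_def riesz_def fun_eq_iff)
  then show ?thesis
    using H by (auto simp: sym12_sections_def bilin_on_def intro!: riesz_linear bun1_bundle subspace_dual_fibres)
qed

lemma lin_H_nat: "lin_on (fib (dual_bundle (bun1 A)) x) (fib (bun2 A) x) (H_nat A H x)"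
proof -
  have "H_nat A H x = (\<lambda>u. riesz (bun2 A) x (H x u))"
    by (simp add: H_nat_def riesz_def fun_eq_iff)
  then show ?thesis
    using H by (auto simp: sym12_sections_def bilin_on_def intro!: riesz_linear bun2_bundle subspace_dual_fibres)
qed

lemma skew_K_flat: "skew2_on (fib (dual_bundle (bun2 A)) x) (fib (bun2 A) x) (K_flat A K x)"
proof -
  let ?F = "fib (dual_bundle (bun2 A)) x"
  have r: "K_flat A K x u v = riesz (bun2 A) x (K x u v)" for u v
    by (simp add: K_flat_def riesz_def)
  have sk: "skew3_on ?F UNIV (K x)"
    using K by (simp add: wedge3_sections_def)
  have l: "lin_on ?F UNIV (K x u v)" "lin_on ?F UNIV (\<lambda>w. K x w u v)" if "u \<in> ?F" "v \<in> ?F" for u v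
    using sk that unfolding skew3_on_def by blast+
  have alt: "K x u v w = - K x v u w" if "u \<in> ?F" "v \<in> ?F" "w \<in> ?F" for u v w
    using sk that unfolding skew3_on_def by blast
  note S = riesz_bundle[OF bun2_bundle l(1), folded r]
  note sub = subspace_fibre[OF bun2_bundle, of x] subspace_dual_fibres(2)[of x]
  have neg: "K_flat A K x u v = - K_flat A K x v u" if u: "u \<in> ?F" and v: "v \<in> ?F" for u v
  proof (rule bundle_fib_eqI[OF bun2_bundle S(1)[OF u v] subspace_neg[OF sub(1) S(1)[OF v u]]])
    fix \<alpha> assume \<alpha>: "\<alpha> \<in> ?F"
    then have "lin_on (fib (bun2 A) x) UNIV \<alpha>"
      by (simp add: dual_bundle_def)
    then show "\<alpha> (K_flat A K x u v) = \<alpha> (- K_flat A K x v u)"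
      using S(2)[OF u v \<alpha>] S(2)[OF v u \<alpha>] alt[OF u v \<alpha>] lin_onD(3)[of _ _ \<alpha> "K_flat A K x v u" "-1"] S(1)[OF v u] by simp
  qed
  have l1: "lin_on ?F (fib (bun2 A) x) (\<lambda>u. K_flat A K x u v)" if v: "v \<in> ?F" for v
    unfolding r by (rule riesz_linear[OF bun2_bundle sub(2) l(1)[OF _ v] l(2)[OF v]])
  show ?thesis
    unfolding skew2_on_def bilin_on_def
  proof (intro conjI ballI)
    show "lin_on ?F (fib (bun2 A) x) (\<lambda>u. K_flat A K x u v)" if "v \<in> ?F" for v
      using that by (rule l1)
    show "K_flat A K x u v = - K_flat A K x v u" if "u \<in> ?F" "v \<in> ?F" for u v
      using that by (rule neg)
    show "lin_on ?F (fib (bun2 A) x) (K_flat A K x u)" if u: "u \<in> ?F" for u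
      by (rule lin_on_cong[OF sub(2) lin_on_neg[OF sub(1) l1[OF u]]]) (rule neg[OF u, symmetric])
  qed
qed

text \<open>All Leibniz rules come from the Leibniz rule of the Poisson bracket. The additional term
  is the bracket with \<open>f\<close>: for \<open>D.g2\<close> it is the anchor, for
  \<open>m1\<close> and \<open>D.g3\<close> it vanishes by tridegree, which gives linearity over
  functions.\<close>

theorem dual_algebroid: "split_lie2_algebroid M DA"
proof (intro split_lie2_algebroid.intro split_lie2_algebroid_axioms.intro)
  show "smooth_manifold M"
    by (rule smooth_manifold_axioms)
  show "vector_bundle M (bun1 DA)" "vector_bundle M (bun2 DA)"
    using vector_bundle_dual bun1_bundle bun2_bundle by (simp_all add: dual_simps)
  show "anchor DA x v \<in> tangent_vectors M x" if "v \<in> fib (bun1 DA) x" for v x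
    using that anchor_tangent[OF H_sharp_section(2)[OF bun1_bundle H]] by (simp add: dual_simps)
  show "lin_on (fib (bun1 DA) x) UNIV (\<lambda>v. anchor DA x v f)" if f: "f \<in> Cinf M" for f x
    using lin_onD[OF lin_H_sharp] lin_onD[OF anchor_linear[OF f]] by (simp add: dual_simps lin_on_def)
  show "rho DA X f \<in> Cinf M" if "X \<in> sections M (bun1 DA)" "f \<in> Cinf M" for X f
    using that by (simp add: dual_simps)
  show "lie2_algebra (section_lie2 M DA)"
    by (rule section_lie2_dual)
next
  fix \<beta> \<beta>' f assume "\<beta> \<in> sections M (bun1 DA)" "\<beta>' \<in> sections M (bun1 DA)" and f: "f \<in> Cinf M"
  then have \<beta>: "\<beta> \<in> \<Gamma>2'" "\<beta>' \<in> \<Gamma>2'"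
    by (simp_all add: dual_simps)
  have r: "rho DA \<beta> f \<in> Cinf M"
    using \<beta> f by (simp add: dual_simps)
  show "bra2 DA \<beta> (smul f \<beta>') = smul f (bra2 DA \<beta> \<beta>') + smul (rho DA \<beta> f) \<beta>'"
  proof (rule eq2'I)
    fix c assume "twisted_chart M A \<mu> H K c"
    then interpret twisted_chart M A \<mu> H K c .
    note T1 = T_br_closed[OF D.g2_T sec_T(4)[OF \<beta>(1)]]
    show "rs (cosec2 (bra2 DA \<beta> (smul f \<beta>')) c) = rs (cosec2 (smul f (bra2 DA \<beta> \<beta>') + smul (rho DA \<beta> f) \<beta>') c)"
      using \<beta> f by (simp add: rs_s c2_linear dual_chart2 dual_chart0 smul_gmult(2)[of "bra2 DA \<beta> \<beta>'"] smul_gmult(2)[of _ "rho DA \<beta> f"]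
          loc_sections gmult_neg br_smul[OF T1])
  qed (use \<beta> f r in simp_all)
next
  fix \<beta> \<alpha> f assume "\<beta> \<in> sections M (bun1 DA)" "\<alpha> \<in> sections M (bun2 DA)" and f: "f \<in> Cinf M"
  then have \<beta>: "\<beta> \<in> \<Gamma>2'" "\<alpha> \<in> \<Gamma>1'"
    by (simp_all add: dual_simps)
  have r: "rho DA \<beta> f \<in> Cinf M"
    using \<beta> f by (simp add: dual_simps)
  show "bra2m DA \<beta> (smul f \<alpha>) = smul f (bra2m DA \<beta> \<alpha>) + smul (rho DA \<beta> f) \<alpha>"
  proof (rule eq1'I)
    fix c assume "twisted_chart M A \<mu> H K c"
    then interpret twisted_chart M A \<mu> H K c .
    note T1 = T_br_closed[OF D.g2_T sec_T(4)[OF \<beta>(1)]]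
    show "rs (cosec1 (bra2m DA \<beta> (smul f \<alpha>)) c) = rs (cosec1 (smul f (bra2m DA \<beta> \<alpha>) + smul (rho DA \<beta> f) \<alpha>) c)"
      using \<beta> f by (simp add: rs_s c1_linear dual_chart2m dual_chart0 smul_gmult(1)[of "bra2m DA \<beta> \<alpha>"] smul_gmult(1)[of _ "rho DA \<beta> f"]
          loc_sections gmult_neg br_smul[OF T1])
  qed (use \<beta> f r in simp_all)
next
  fix \<alpha> f assume "\<alpha> \<in> sections M (bun2 DA)" and f: "f \<in> Cinf M"
  then have \<alpha>: "\<alpha> \<in> \<Gamma>1'"
    by (simp_all add: dual_simps)
  show "bra1 DA (smul f \<alpha>) = smul f (bra1 DA \<alpha>)"
  proof (rule eq2'I)
    fix c assume "twisted_chart M A \<mu> H K c"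
    then interpret twisted_chart M A \<mu> H K c .
    have z: "br m1 (f0 f) = 0"
      using T.T_zero[OF T_br_closed[OF m_T(1) sec_T(5)[OF f]]] by simp
    show "rs (cosec2 (bra1 DA (smul f \<alpha>)) c) = rs (cosec2 (smul f (bra1 DA \<alpha>)) c)"
      using \<alpha> f by (simp add: rs_s dual_chart1 smul_gmult(2) loc_sections gmult_neg br_smul[OF m_T(1)] z)
  qed (use \<alpha> f in simp_all)
next
  fix X Y Z f assume "X \<in> sections M (bun1 DA)" "Y \<in> sections M (bun1 DA)" "Z \<in> sections M (bun1 DA)" and f: "f \<in> Cinf M"
  then have X: "X \<in> \<Gamma>2'" "Y \<in> \<Gamma>2'" "Z \<in> \<Gamma>2'"
    by (simp_all add: dual_simps)
  have l: "bra3 DA X Y (smul f Z) = smul f (bra3 DA X Y Z)" if "X \<in> \<Gamma>2'" "Y \<in> \<Gamma>2'" "Z \<in> \<Gamma>2'" for X Y Z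
  proof (rule eq1'I)
    fix c assume "twisted_chart M A \<mu> H K c"
    then interpret twisted_chart M A \<mu> H K c .
    note T1 = T_br_closed[OF T_br_closed[OF D.g3_T sec_T(4)[OF that(1)]] sec_T(4)[OF that(2)]]
    have z: "br (br (br D.g3 (c2 X)) (c2 Y)) (f0 f) = 0"
      using T.T_zero[OF T_br_closed[OF T1 sec_T(5)[OF f]]] by simp
    show "rs (cosec1 (bra3 DA X Y (smul f Z)) c) = rs (cosec1 (smul f (bra3 DA X Y Z)) c)"
      using that f by (simp add: rs_s dual_chart3 smul_gmult(1) loc_sections gmult_neg br_smul[OF T1] z)
  qed (use that f in simp_all)
  have sn: "smul f (- s) = - smul f s" for s :: "'m \<Rightarrow> 'a \<Rightarrow> real"
    by (simp add: smul_def fun_eq_iff)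
  have "bra3 DA X (smul f Y) Z = smul f (bra3 DA X Y Z)" if "X \<in> \<Gamma>2'" "Y \<in> \<Gamma>2'" "Z \<in> \<Gamma>2'" for X Y Z
    using dual_skew(3)[of X "smul f Y" Z] dual_skew(3)[of X Y Z] l[of X Z Y] that f by (simp add: sn)
  moreover from this have "bra3 DA (smul f X) Y Z = smul f (bra3 DA X Y Z)"
    using dual_skew(2)[of "smul f X" Y Z] dual_skew(2)[of X Y Z] X f by (simp add: sn)
  ultimately show "bra3 DA (smul f X) Y Z = smul f (bra3 DA X Y Z) \<and> bra3 DA X (smul f Y) Z = smul f (bra3 DA X Y Z) \<and>
      bra3 DA X Y (smul f Z) = smul f (bra3 DA X Y Z)"
    using X l by simp
qed

text \<open>The minus signs turn all three maps into plain brackets: the first two are bracketing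
  with \<open>H\<close> on the two kinds of covectors, the third is double bracketing with
  \<open>K\<close>. The conditions are then the four identities obtained from the Maurer-Cartan
  equation.\<close>

theorem dual_morphism:
  "sl2_morphism M DA A (H_sharp A H) (\<lambda>x \<alpha>. - H_nat A H x \<alpha>) (\<lambda>x \<alpha> \<beta>. - K_flat A K x \<alpha> \<beta>)"
proof -
  let ?F2 = "\<lambda>\<alpha>. - natural \<alpha>" and ?F3 = "\<lambda>\<beta> \<beta>'. - flat \<beta> \<beta>'"
  have F: "(\<lambda>X x. H_sharp A H x (X x)) = sharp" "(\<lambda>Y x. - H_nat A H x (Y x)) = ?F2"
    "(\<lambda>X Y x. - K_flat A K x (X x) (Y x)) = ?F3"
    by (simp_all add: sharp_def natural_def flat_def fun_eq_iff)
  have sub: "subspace (fib (bun2 A) x)" for x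
    by (rule subspace_fibre[OF bun2_bundle])
  have b1: "bundle_map M (bun1 DA) (bun1 A) (H_sharp A H)"
    using lin_H_sharp sharp_closed(1) by (simp add: bundle_map_def dual_simps sharp_def)
  have b2: "bundle_map M (bun2 DA) (bun2 A) (\<lambda>x \<alpha>. - H_nat A H x \<alpha>)"
    using lin_on_neg[OF sub lin_H_nat] sections_closed(13)[OF sharp_closed(2)] by (simp add: bundle_map_def dual_simps natural_def fun_Compl_def)
  have b3: "bundle_map_wedge2 M (bun1 DA) (bun2 A) (\<lambda>x \<alpha> \<beta>. - K_flat A K x \<alpha> \<beta>)"
    using skew2_on_neg[OF sub skew_K_flat] sections_closed(13)[OF flat_closed]
    by (simp add: bundle_map_wedge2_def dual_simps flat_def fun_Compl_def)
  have "lie2_morphism (section_lie2 M DA) (section_lie2 M A) sharp ?F2 ?F3"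
  proof
    let ?L = "section_lie2 M DA" and ?L' = "section_lie2 M A"
    show "lin_on (deg1 ?L) (deg1 ?L') sharp" "lin_on (deg2 ?L) (deg2 ?L') ?F2" "skew2_on (deg1 ?L) (deg2 ?L') ?F3"
      using bundle_map_sections[OF b1] bundle_map_sections[OF b2] bundle_map_wedge2_sections[OF b3]
      by (simp_all add: F lie2_components dual_simps(1,2))
    show "sharp (ldiff ?L m) = ldiff ?L' (?F2 m)" if "m \<in> deg2 ?L" for m
      using that unfolding lie2_components
    proof (intro eq1I)
      fix c assume m: "m \<in> \<Gamma>1'" and "twisted_chart M A \<mu> H K c"
      then interpret twisted_chart M A \<mu> H K c by simp
      show "rs (sec1 (sharp (bra1 DA m)) c) = rs (sec1 (bra1 A (- natural m)) c)"
        using m D.morphism_differential[of "c1 m"]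
        by (simp add: rs_s HK_rules' structure_eqs dual_chart1 s2_neg)
    qed simp_all
    show "sharp (lbr2 ?L x y) - lbr2 ?L' (sharp x) (sharp y) = ldiff ?L' (?F3 x y)" if "x \<in> deg1 ?L" "y \<in> deg1 ?L" for x y
      using that unfolding lie2_components
    proof (intro eq1I)
      fix c assume m: "x \<in> \<Gamma>2'" "y \<in> \<Gamma>2'" and "twisted_chart M A \<mu> H K c"
      then interpret twisted_chart M A \<mu> H K c by simp
      show "rs (sec1 (sharp (bra2 DA x y) - bra2 A (sharp x) (sharp y)) c) = rs (sec1 (bra1 A (- flat x y)) c)"
        using m D.morphism_bracket[of "c2 x" "c2 y"]
        by (simp add: rs_s HK_rules' structure_eqs dual_chart2 s1_linear(4) loc_sections s2_neg)
    qed simp_all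
    show "?F2 (lact ?L x m) - lact ?L' (sharp x) (?F2 m) = ?F3 x (ldiff ?L m)" if "x \<in> deg1 ?L" "m \<in> deg2 ?L" for x m
      using that unfolding lie2_components
    proof (intro eq2I)
      fix c assume m: "x \<in> \<Gamma>2'" "m \<in> \<Gamma>1'" and "twisted_chart M A \<mu> H K c"
      then interpret twisted_chart M A \<mu> H K c by simp
      show "rs (sec2 (- natural (bra2m DA x m) - bra2m A (sharp x) (- natural m)) c) = rs (sec2 (- flat x (bra1 DA m)) c)"
        using m arg_cong[OF D.morphism_action[of "c2 x" "c1 m"], of uminus]
        by (simp add: rs_s HK_rules' structure_eqs dual_chart1 dual_chart2m s2_linear(4) loc_sections s2_neg)
    qed simp_all
    show "- ?F2 (lbr3 ?L x y z) + lact ?L' (sharp x) (?F3 y z) - lact ?L' (sharp y) (?F3 x z) + lact ?L' (sharp z) (?F3 x y)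
      - ?F3 (lbr2 ?L x y) z + ?F3 x (lbr2 ?L y z) - ?F3 y (lbr2 ?L x z) + lbr3 ?L' (sharp x) (sharp y) (sharp z) = 0" (is "?S = 0")
      if xyz: "x \<in> deg1 ?L" "y \<in> deg1 ?L" "z \<in> deg1 ?L" for x y z
    proof (rule eq2I)
      have m: "x \<in> \<Gamma>2'" "y \<in> \<Gamma>2'" "z \<in> \<Gamma>2'"
        using xyz by (simp_all add: lie2_components)
      then show "?S \<in> \<Gamma>2"
        by (simp add: lie2_components)
      show "0 \<in> \<Gamma>2"
        by (rule subspace_0[OF subspace_sections[OF bun2_bundle]])
      fix c assume "twisted_chart M A \<mu> H K c"
      then interpret twisted_chart M A \<mu> H K c by simp
      have 0: "s2 0 = 0"
        using s2_linear(2)[of 0 0 0] subspace_0[OF subspace_sections[OF bun2_bundle]] by (simp add: loc_sections)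
      show "rs (sec2 ?S c) = rs (sec2 0 c)"
        using m D.morphism_bra3[of "c2 x" "c2 y" "c2 z"]
        by (simp add: lie2_components rs_s HK_rules' structure_eqs dual_chart2 dual_chart3 s2_linear(1,4) loc_sections s2_neg 0 algebra_simps)
    qed
  qed
  with b1 b2 b3 show ?thesis
    unfolding sl2_morphism_def F by (simp add: dual_simps)
qed

end

section \<open>The bialgebroid condition\<close>

context structured_chart
begin

text \<open>The momenta in \<open>F\<close> are detected by \<open>{F, f}\<close>, which vanishes as \<open>{{F, f}, X} = \<plusminus>{{F, X}, f}\<close>.\<close>

lemma T_zero_121:
  assumes F: "F \<in> T 1 2 1"
    and z: "\<And>X f. X \<in> sections M (bun1 A) \<Longrightarrow> f \<in> Cinf M \<Longrightarrow> br (br F (s1 X)) (f0 f) = 0"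
      "\<And>X X'. X \<in> sections M (bun1 A) \<Longrightarrow> X' \<in> sections M (bun1 A) \<Longrightarrow> br (br F (s1 X)) (s1 X') = 0"
      "\<And>X Y. X \<in> sections M (bun1 A) \<Longrightarrow> Y \<in> sections M (bun2 A) \<Longrightarrow> br (br F (s1 X)) (s2 Y) = 0"
  shows "F = 0"
proof -
  note sT = s1_T[OF loc_sections]
  have FX: "br F (s1 X) = 0" if X: "X \<in> sections M (bun1 A)" for X
    by (rule T_zero_111) (use T_br_closed[OF F sT[OF X]] z X in simp_all)
  have "br F (f0 f) = 0" if f: "f \<in> Cinf M" for f
  proof (rule T_zero_s1)
    have fT: "f0 f \<in> T 0 0 0"
      using f smooth_on_subset[of UNIV f dm] by (simp add: Cinf_iff)
    show FT: "br F (f0 f) \<in> T 0 1 0"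
      using T_br_closed[OF F fT] by simp
    show "odiff (P_dn l) (br F (f0 f)) = 0" for l
      by (rule no_P[OF FT]) simp
    fix X assume X: "X \<in> sections M (bun1 A)"
    have "br (f0 f) (s1 X) = 0"
      using T.T_zero[OF T_br_closed[OF fT sT[OF X]]] by simp
    then show "br (br F (f0 f)) (s1 X) = 0"
      using B.right_oo[of F "f0 f" "s1 X"] T.T_Od[OF F] T.T_Od[OF fT] T.T_Od[OF sT[OF X]]
        T.T_Ev[OF F] FX[OF X] by auto
  qed simp
  then have P: "odiff (P_dn l) F = 0" for l
    by (rule detect_f0[OF F])
  show ?thesis
    by (rule T_zero_s1[OF F]) (use FX P in simp_all)
qed

text \<open>The mirror image of \<open>T_zero_121\<close>, with the two bundles replaced by the
  duals in exchanged roles.\<close>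

lemma T_zero_112:
  assumes F: "F \<in> T 1 1 2"
    and z: "\<And>X f. X \<in> sections M (dual_bundle (bun2 A)) \<Longrightarrow> f \<in> Cinf M \<Longrightarrow> br (br F (c2 X)) (f0 f) = 0"
      "\<And>X X'. X \<in> sections M (dual_bundle (bun2 A)) \<Longrightarrow> X' \<in> sections M (dual_bundle (bun2 A)) \<Longrightarrow> br (br F (c2 X)) (c2 X') = 0"
      "\<And>X Y. X \<in> sections M (dual_bundle (bun2 A)) \<Longrightarrow> Y \<in> sections M (dual_bundle (bun1 A)) \<Longrightarrow> br (br F (c2 X)) (c1 Y) = 0"
  shows "F = 0"
proof -
  note sT = c2_T[OF loc_sections]
  have FX: "br F (c2 X) = 0" if X: "X \<in> sections M (dual_bundle (bun2 A))" for X
    by (rule T_zero_111') (use T_br_closed[OF F sT[OF X]] z X in simp_all)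
  have "br F (f0 f) = 0" if f: "f \<in> Cinf M" for f
  proof (rule T_zero_c2)
    have fT: "f0 f \<in> T 0 0 0"
      using f smooth_on_subset[of UNIV f dm] by (simp add: Cinf_iff)
    show FT: "br F (f0 f) \<in> T 0 0 1"
      using T_br_closed[OF F fT] by simp
    show "odiff (P_dn l) (br F (f0 f)) = 0" for l
      by (rule no_P[OF FT]) simp
    fix X assume X: "X \<in> sections M (dual_bundle (bun2 A))"
    have "br (f0 f) (c2 X) = 0"
      using T.T_zero[OF T_br_closed[OF fT sT[OF X]]] by simp
    then show "br (br F (f0 f)) (c2 X) = 0"
      using B.right_oo[of F "f0 f" "c2 X"] T.T_Od[OF F] T.T_Od[OF fT] T.T_Od[OF sT[OF X]]
        T.T_Ev[OF F] FX[OF X] by auto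
  qed simp
  then have P: "odiff (P_dn l) F = 0" for l
    by (rule detect_f0[OF F])
  show ?thesis
    by (rule T_zero_c2[OF F]) (use FX P in simp_all)
qed

text \<open>First degree 0 excludes momenta at every stage, so the arguments can be stripped off one
  at a time.\<close>

lemma T_zero_031:
  assumes F: "F \<in> T 0 3 1"
    and z: "\<And>X X' X''. X \<in> sections M (bun1 A) \<Longrightarrow> X' \<in> sections M (bun1 A) \<Longrightarrow> X'' \<in> sections M (bun1 A) \<Longrightarrow>
      br (br (br F (s1 X)) (s1 X')) (s1 X'') = 0"
  shows "F = 0"
proof -
  note sT = s1_T[OF loc_sections]
  have 1: "G = 0" if G: "G \<in> T 0 j k" "0 < j" and z: "\<And>X. X \<in> sections M (bun1 A) \<Longrightarrow> br G (s1 X) = 0" for G j k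
    by (rule T_zero_s1[OF G(1)]) (use that no_P[OF G(1)] in simp_all)
  have 2: "br (br F (s1 X)) (s1 X') = 0" if "X \<in> sections M (bun1 A)" "X' \<in> sections M (bun1 A)" for X X'
    by (rule 1[of _ 1 1]) (use T_br_closed[OF T_br_closed[OF F sT[OF that(1)]] sT[OF that(2)]] that z in simp_all)
  have 3: "br F (s1 X) = 0" if "X \<in> sections M (bun1 A)" for X
    by (rule 1[of _ 2 1]) (use T_br_closed[OF F sT[OF that]] that 2 in simp_all)
  show ?thesis
    by (rule 1[of _ 3 1]) (use F 3 in simp_all)
qed

lemma T_zero_013:
  assumes F: "F \<in> T 0 1 3"
    and z: "\<And>X X' X''. X \<in> sections M (dual_bundle (bun2 A)) \<Longrightarrow> X' \<in> sections M (dual_bundle (bun2 A)) \<Longrightarrow>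
      X'' \<in> sections M (dual_bundle (bun2 A)) \<Longrightarrow> br (br (br F (c2 X)) (c2 X')) (c2 X'') = 0"
  shows "F = 0"
proof -
  note sT = c2_T[OF loc_sections]
  have 1: "G = 0" if G: "G \<in> T 0 j k" "0 < k" and z: "\<And>X. X \<in> sections M (dual_bundle (bun2 A)) \<Longrightarrow> br G (c2 X) = 0" for G j k
    by (rule T_zero_c2[OF G(1)]) (use that no_P[OF G(1)] in simp_all)
  have 2: "br (br F (c2 X)) (c2 X') = 0" if "X \<in> sections M (dual_bundle (bun2 A))" "X' \<in> sections M (dual_bundle (bun2 A))" for X X'
    by (rule 1[of _ 1 1]) (use T_br_closed[OF T_br_closed[OF F sT[OF that(1)]] sT[OF that(2)]] that z in simp_all)
  have 3: "br F (c2 X) = 0" if "X \<in> sections M (dual_bundle (bun2 A))" for X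
    by (rule 1[of _ 1 2]) (use T_br_closed[OF F sT[OF that]] that 2 in simp_all)
  show ?thesis
    by (rule 1[of _ 1 3]) (use F 3 in simp_all)
qed

lemma T_unique:
  assumes "F \<in> T i j k" "G \<in> T i j k" "F - G \<in> T i j k \<Longrightarrow> F - G = 0"
  shows "F = G"
  using assms T_diff by simp

text \<open>The difference of corresponding components has vanishing derived brackets and is
  annihilated by the matching detection lemma.\<close>

lemma structure_unique:
  assumes \<mu>': "structure_function M A \<mu>'"
  shows "rs (tri (2, 1, 1) \<mu>' c) = m1" "rs (\<mu>' c) = m1 + m2 + m3"
proof -
  interpret S': structured_chart M A c \<mu>'
    by unfold_locales (rule \<mu>')
  have d: "S'.m1 - m1 \<in> C" "S'.m2 - m2 \<in> C" "S'.m3 - m3 \<in> C"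
    by simp_all
  note [simp] = sec_C B.pb_diff_left
  have 1: "S'.m1 = m1"
  proof (rule T_unique[OF S'.m_T(1) m_T(1)])
    assume F: "S'.m1 - m1 \<in> T 2 1 1"
    show "S'.m1 - m1 = 0"
    proof (rule T_zero_s2[OF F])
      show "odiff (P_dn l) (S'.m1 - m1) = 0" for l
        by (rule no_P[OF F]) simp
      show "br (S'.m1 - m1) (s2 Y) = 0" if "Y \<in> sections M (bun2 A)" for Y
        using structure_eqs(1)[OF that] S'.structure_eqs(1)[OF that] that by simp
    qed simp
  qed
  have 2: "S'.m2 = m2"
  proof (rule T_unique[OF S'.m_T(2) m_T(2)], rule T_zero_121)
    show "br (br (S'.m2 - m2) (s1 X)) (f0 f) = 0" if "X \<in> sections M (bun1 A)" "f \<in> Cinf M" for X f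
      using structure_eqs(5)[OF that] S'.structure_eqs(5)[OF that] that by simp
    show "br (br (S'.m2 - m2) (s1 X)) (s1 X') = 0" if "X \<in> sections M (bun1 A)" "X' \<in> sections M (bun1 A)" for X X'
      using structure_eqs(2)[OF that] S'.structure_eqs(2)[OF that] that by simp
    show "br (br (S'.m2 - m2) (s1 X)) (s2 X') = 0" if "X \<in> sections M (bun1 A)" "X' \<in> sections M (bun2 A)" for X X'
      using structure_eqs(3)[OF that] S'.structure_eqs(3)[OF that] that by simp
  qed
  have 3: "S'.m3 = m3"
  proof (rule T_unique[OF S'.m_T(3) m_T(3)], rule T_zero_031)
    show "br (br (br (S'.m3 - m3) (s1 X)) (s1 X')) (s1 X'') = 0"
      if "X \<in> sections M (bun1 A)" "X' \<in> sections M (bun1 A)" "X'' \<in> sections M (bun1 A)" for X X' X''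
      using structure_eqs(4)[OF that] S'.structure_eqs(4)[OF that] that by simp
  qed
  show "rs (tri (2, 1, 1) \<mu>' c) = m1" "rs (\<mu>' c) = m1 + m2 + m3"
    using S'.rs_\<mu> S'.m1_def 1 2 3 by simp_all
qed

lemma tri_components:
  assumes F: "rs (F c) = a + b + d" and T: "a \<in> T (int i) (int j) (int k)" "b \<in> T (int i') (int j') (int k')" "d \<in> T (int i'') (int j'') (int k'')"
    and ne: "(i, j, k) \<noteq> (i', j', k')" "(i, j, k) \<noteq> (i'', j'', k'')" "(i', j', k') \<noteq> (i'', j'', k'')"
  shows "rs (tri (i, j, k) F c) = a" "rs (tri (i', j', k') F c) = b" "rs (tri (i'', j'', k'') F c) = d"
proof -
  have q: "rs (tri t F c) q x = (if tridegree q = t then (a + b + d) q x else 0)" for t q x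
    unfolding F[symmetric] by (simp add: restrict_gfun_def tri_def)
  have dg: "tridegree q = (i, j, k)" if "deg q = (int i, int j, int k)" for q i j k
    using that by (simp add: deg_def prod_eq_iff)
  have z: "a q \<noteq> 0 \<Longrightarrow> tridegree q = (i, j, k)" "b q \<noteq> 0 \<Longrightarrow> tridegree q = (i', j', k')" "d q \<noteq> 0 \<Longrightarrow> tridegree q = (i'', j'', k'')" for q
    using TD[OF T(1), of q] TD[OF T(2), of q] TD[OF T(3), of q] dg by blast+
  show "rs (tri (i, j, k) F c) = a"
  proof (intro ext)
    fix p x
    show "rs (tri (i, j, k) F c) p x = a p x"
      using z(1)[of p] z(2)[of p] z(3)[of p] ne unfolding q by (cases "a p = 0"; cases "b p = 0"; cases "d p = 0") auto
  qed
  show "rs (tri (i', j', k') F c) = b"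
  proof (intro ext)
    fix p x
    show "rs (tri (i', j', k') F c) p x = b p x"
      using z(1)[of p] z(2)[of p] z(3)[of p] ne unfolding q by (cases "a p = 0"; cases "b p = 0"; cases "d p = 0") auto
  qed
  show "rs (tri (i'', j'', k'') F c) = d"
  proof (intro ext)
    fix p x
    show "rs (tri (i'', j'', k'') F c) p x = d p x"
      using z(1)[of p] z(2)[of p] z(3)[of p] ne unfolding q by (cases "a p = 0"; cases "b p = 0"; cases "d p = 0") auto
  qed
qed

text \<open>There are finitely many odd variables, and each even variable contributes 1 to the first
  component of the tridegree, so the even part of a monomial has at most \<open>i\<close>
  factors.\<close>

lemma finite_T:
  assumes F: "F \<in> T i j k"
  shows "finite {q. F q \<noteq> 0}"
proof -
  let ?O = "P_dn ` {..<n} \<union> Xi_up ` {..<r1} \<union> Th_dn ` {..<r2}" and ?E = "Th_up ` {..<r2} \<union> Xi_dn ` {..<r1}"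
  have "(S, m) \<in> Pow ?O \<times> mset ` {xs. set xs \<subseteq> ?E \<and> length xs \<le> nat i}" if nz: "F (S, m) \<noteq> 0" for S m
  proof -
    have mi: "mono_in M c (S, m)" and d: "deg (S, m) = (i, j, k)"
      using TD[OF F nz] by auto
    have 1: "int (size m) \<le> fst (\<Sum>v\<in>#m. etriple v)"
      by (induction m) (auto simp: etriple_def split: evar.splits)
    have 2: "0 \<le> fst (\<Sum>v\<in>S. otriple v)"
      by (induction S rule: infinite_finite_induct) (auto simp: otriple_def split: ovar.splits)
    have "i = fst (\<Sum>v\<in>S. otriple v) + fst (\<Sum>v\<in>#m. etriple v)"
      using d by (simp add: deg_eq prod_eq_iff)
    then have sz: "size m \<le> nat i"
      using 1 2 by linarith
    obtain xs where xs: "mset xs = m"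
      using ex_mset by blast
    have "set xs \<subseteq> ?E" "length xs \<le> nat i"
      using mi sz xs by (auto simp: mono_in_def)
    then show ?thesis
      using mi xs by (auto simp: mono_in_def)
  qed
  then have "{q. F q \<noteq> 0} \<subseteq> Pow ?O \<times> mset ` {xs. set xs \<subseteq> ?E \<and> length xs \<le> nat i}"
    by (intro subsetI) (metis (mono_tags, lifting) mem_Collect_eq surj_pair)
  moreover have "finite (Pow ?O \<times> mset ` {xs. set xs \<subseteq> ?E \<and> length xs \<le> nat i})"
    by (intro finite_cartesian_product finite_imageI finite_lists_length_le) auto
  ultimately show ?thesis
    by (rule finite_subset)
qed

end

context structured_chart
begin

lemma bfun_in_chart:
  assumes rs: "rs (F c) = a + b + d" and T: "a \<in> T (int i) (int j) (int k)" "b \<in> T (int i') (int j') (int k')" "d \<in> T (int i'') (int j'') (int k'')"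
  shows "finite {q. \<exists>x\<in>dm. F c q x \<noteq> 0}" "smooth_on M dm (F c q)"
    "x \<in> dm \<Longrightarrow> F c q x \<noteq> 0 \<Longrightarrow> mono_in M c q \<and> tridegree q \<in> {(i, j, k), (i', j', k'), (i'', j'', k'')}"
proof -
  have eq: "F c q x = (a + b + d) q x" if "x \<in> dm" for q x
    using that unfolding rs[symmetric] by (simp add: restrict_gfun_def)
  have dg: "tridegree q = (i, j, k)" if "deg q = (int i, int j, int k)" for q i j k
    using that by (simp add: deg_def prod_eq_iff)
  have nz: "a q \<noteq> 0 \<or> b q \<noteq> 0 \<or> d q \<noteq> 0" if "x \<in> dm" "F c q x \<noteq> 0" for q x
    using that eq[of x q] by auto
  have "{q. \<exists>x\<in>dm. F c q x \<noteq> 0} \<subseteq> {q. a q \<noteq> 0} \<union> {q. b q \<noteq> 0} \<union> {q. d q \<noteq> 0}"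
    using nz by blast
  then show "finite {q. \<exists>x\<in>dm. F c q x \<noteq> 0}"
    using finite_T[OF T(1)] finite_T[OF T(2)] finite_T[OF T(3)] by (meson finite_UnI finite_subset)
  have "a + b + d \<in> C"
    using T by (simp add: T_carrier)
  then have "smooth_on M dm ((a + b + d) q)"
    using carrier_base[of "a + b + d" q] unfolding base_def by blast
  then show "smooth_on M dm (F c q)"
    by (rule smooth_on_cong[OF chartD(2), rotated]) (simp add: eq)
  show "x \<in> dm \<Longrightarrow> F c q x \<noteq> 0 \<Longrightarrow> mono_in M c q \<and> tridegree q \<in> {(i, j, k), (i', j', k'), (i'', j'', k'')}"
    using nz[of x q] TD[OF T(1), of q] TD[OF T(2), of q] TD[OF T(3), of q] dg by blast
qed

end

context twisted_algebroid
begin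

definition \<gamma> :: "('m, 'a, 'b) bfun" where
  "\<gamma> = tri (2, 1, 1) \<mu> + big_bracket M (tri (1, 2, 1) \<mu>) (sym12_fun A H)
     + (big_bracket M (tri (1, 2, 1) \<mu>) (wedge3_fun A K)
        + (1/2) *\<^sub>R big_bracket M (big_bracket M (tri (0, 3, 1) \<mu>) (sym12_fun A H)) (sym12_fun A H))"

end

context twisted_chart
begin

lemma rs_\<gamma>: "rs (\<gamma> c) = m1 + D.g2 + D.g3"
  unfolding \<gamma>_def D.g2_def D.g3_def by (simp add: rs_linear bb rs_s del: One_nat_def)

lemma \<gamma>_components: "rs (tri (2, 1, 1) \<gamma> c) = m1" "rs (tri (1, 1, 2) \<gamma> c) = D.g2" "rs (tri (0, 1, 3) \<gamma> c) = D.g3"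
  using tri_components[of \<gamma> m1 D.g2 D.g3 2 1 1 1 1 2 0 1 3] rs_\<gamma> m_T(1) D.g2_T D.g3_T by simp_all

lemma g_Od [simp]: "D.g2 \<in> B.Odd" "D.g3 \<in> B.Odd"
  using D.Od_g by simp_all

lemma \<gamma>_square: "br (m1 + D.g2 + D.g3) (m1 + D.g2 + D.g3) = 0"
proof -
  have 1: "br m1 m1 = 0" "br D.g3 D.g3 = 0"
    using T.T_zero[OF T_br_closed[OF m_T(1) m_T(1)]] T.T_zero[OF T_br_closed[OF D.g3_T D.g3_T]] by simp_all
  have 2: "br D.g2 m1 = br m1 D.g2" "br D.g3 m1 = br m1 D.g3" "br D.g3 D.g2 = br D.g2 D.g3"
    by (rule B.swap_oo; simp)+
  have "br (m1 + D.g2 + D.g3) (m1 + D.g2 + D.g3) = 2 *\<^sub>R br m1 D.g2 + (br D.g2 D.g2 + 2 *\<^sub>R br m1 D.g3) + 2 *\<^sub>R br D.g2 D.g3"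
    by (simp add: B.br_linear 1 2 scaleR_2 algebra_simps)
  then show ?thesis
    by (simp add: D.g12 D.g22 D.g23)
qed

text \<open>Both structure functions square to zero and share \<open>m1\<close>, so in the square of
  the total function the terms with \<open>m1\<close> cancel and twice the mixed brackets of the
  other components remain. The one of \<open>m3\<close> with \<open>D.g3\<close> vanishes, and the
  other three have different tridegrees.\<close>

lemma total_square:
  "br (m1 + m2 + m3 + (m1 + D.g2 + D.g3) - m1) (m1 + m2 + m3 + (m1 + D.g2 + D.g3) - m1) = 0 \<longleftrightarrow>
    br m1 (br m3 h) = 0 \<and> br m2 (br m3 h) = 0 \<and> br m3 (br m1 \<kappa>) = 0"
proof -
  define u where "u = m1 + m2 + m3"
  define v where "v = m1 + D.g2 + D.g3"
  have uv: "u \<in> B.Odd" "v \<in> B.Odd" "u \<in> C" "v \<in> C"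
    by (simp_all add: u_def v_def)
  have u2: "br u u = 0"
  proof -
    have 1: "br m1 m1 = 0" "br m3 m3 = 0"
      using T.T_zero[OF T_br_closed[OF m_T(1) m_T(1)]] T.T_zero[OF T_br_closed[OF m_T(3) m_T(3)]] by simp_all
    have 2: "br m2 m1 = br m1 m2" "br m3 m1 = br m1 m3" "br m3 m2 = br m2 m3"
      by (rule B.swap_oo; simp)+
    have "br u u = 2 *\<^sub>R br m1 m2 + (br m2 m2 + 2 *\<^sub>R br m1 m3) + 2 *\<^sub>R br m2 m3"
      by (simp add: u_def B.br_linear 1 2 scaleR_2 algebra_simps)
    then show ?thesis
      by (simp add: \<mu>_square)
  qed
  have v2: "br v v = 0"
    unfolding v_def by (rule \<gamma>_square)
  have m11: "br m1 m1 = 0" "br m3 D.g3 = 0"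
    using T.T_zero[OF T_br_closed[OF m_T(1) m_T(1)]] T.T_zero[OF T_br_closed[OF m_T(3) D.g3_T]] by simp_all
  have s: "br v u = br u v" "br m1 u = br u m1" "br m1 v = br v m1"
    using uv by (auto intro!: B.swap_oo)
  have um: "br u m1 = br m1 m3" "br v m1 = br m1 D.g3"
    using m11 \<mu>_square D.g12 by (simp_all add: u_def v_def B.br_linear B.swap_oo[of m2 m1] B.swap_oo[of m3 m1] B.swap_oo[of D.g2 m1] B.swap_oo[of D.g3 m1])
  have "br (u + v - m1) (u + v - m1) = 2 *\<^sub>R (br u v - br m1 m3 - br m1 D.g3)"
    using uv by (simp add: B.br_linear s u2 v2 um m11 scaleR_2 algebra_simps)
  also have "br u v = br m1 m3 + br m1 D.g3 + (br m2 D.g2 + br m3 D.g2 + br m2 D.g3)"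
    using m11 \<mu>_square D.g12 by (simp add: u_def v_def B.br_linear B.swap_oo[of m2 m1] B.swap_oo[of m3 m1] algebra_simps)
  also have "br m1 m3 + br m1 D.g3 + (br m2 D.g2 + br m3 D.g2 + br m2 D.g3) - br m1 m3 - br m1 D.g3 =
      br m2 D.g2 + br m3 D.g2 + br m2 D.g3"
    by (simp only: add_diff_eq add_diff_cancel_left' diff_diff_add)
  finally have e: "br (u + v - m1) (u + v - m1) = 2 *\<^sub>R (br m2 D.g2 + br m3 D.g2 + br m2 D.g3)" .
  have T: "br m2 D.g2 \<in> T 1 2 2" "br m3 D.g2 \<in> T 0 3 2" "br m2 D.g3 \<in> T 0 2 3"
    using T_br_closed[OF m_T(2) D.g2_T] T_br_closed[OF m_T(3) D.g2_T] T_br_closed[OF m_T(2) D.g3_T] by simp_all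
  have "br m2 D.g2 + br m3 D.g2 + br m2 D.g3 = 0 \<longleftrightarrow> br m2 D.g2 = 0 \<and> br m3 D.g2 = 0 \<and> br m2 D.g3 = 0"
    using T_independent[OF T] by auto
  then show ?thesis
    using D.bialgebroid_conditions unfolding u_def[symmetric] v_def[symmetric] e by simp
qed

lemma dual_unique:
  assumes \<gamma>': "dual_structure_function M A DA \<gamma>'"
  shows "rs (\<gamma>' c) = m1 + D.g2 + D.g3"
proof -
  note S = \<gamma>'[unfolded dual_structure_function_def dual_simps(1,2)]
  have tr: "bfun_of_tridegrees M A {(2, 1, 1), (1, 1, 2), (0, 1, 3)} \<gamma>'"
    using S by blast
  define n1 where "n1 = rs (tri (2, 1, 1) \<gamma>' c)"
  define n2 where "n2 = rs (tri (1, 1, 2) \<gamma>' c)"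
  define n3 where "n3 = rs (tri (0, 1, 3) \<gamma>' c)"
  have nT: "n1 \<in> T 2 1 1" "n2 \<in> T 1 1 2" "n3 \<in> T 0 1 3"
    using tri_T[OF tr, of 2 1 1] tri_T[OF tr, of 1 1 2] tri_T[OF tr, of 0 1 3] by (simp_all add: n1_def n2_def n3_def)
  note [simp] = nT[THEN T_carrier]
  note n = n1_def[symmetric] n2_def[symmetric] n3_def[symmetric]
  have e1: "c2 (bra1 DA \<alpha>) = - br n1 (c1 \<alpha>)" if "\<alpha> \<in> \<Gamma>1'" for \<alpha>
    using beqD[OF bspec[OF S[THEN conjunct2, THEN conjunct2, THEN conjunct1] that]] that by (simp add: bb rs_s rs_linear n del: One_nat_def)
  have e2: "c2 (bra2 DA \<beta> \<beta>') = - br (br n2 (c2 \<beta>)) (c2 \<beta>')" if "\<beta> \<in> \<Gamma>2'" "\<beta>' \<in> \<Gamma>2'" for \<beta> \<beta>'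
    using beqD[OF bspec[OF bspec[OF S[THEN conjunct2, THEN conjunct2, THEN conjunct2, THEN conjunct1] that(1)] that(2)]] that by (simp add: bb rs_s rs_linear n del: One_nat_def)
  have e2m: "c1 (bra2m DA \<beta> \<alpha>) = - br (br n2 (c2 \<beta>)) (c1 \<alpha>)" if "\<beta> \<in> \<Gamma>2'" "\<alpha> \<in> \<Gamma>1'" for \<beta> \<alpha>
    using beqD[OF bspec[OF bspec[OF S[THEN conjunct2, THEN conjunct2, THEN conjunct2, THEN conjunct2, THEN conjunct1] that(1)] that(2)]] that by (simp add: bb rs_s rs_linear n del: One_nat_def)
  have e3: "c1 (bra3 DA \<beta> \<beta>' \<beta>'') = - br (br (br n3 (c2 \<beta>)) (c2 \<beta>')) (c2 \<beta>'')" if "\<beta> \<in> \<Gamma>2'" "\<beta>' \<in> \<Gamma>2'" "\<beta>'' \<in> \<Gamma>2'" for \<beta> \<beta>' \<beta>''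
    using beqD[OF bspec[OF bspec[OF bspec[OF S[THEN conjunct2, THEN conjunct2, THEN conjunct2, THEN conjunct2, THEN conjunct2, THEN conjunct1] that(1)] that(2)] that(3)]] that by (simp add: bb rs_s rs_linear n del: One_nat_def)
  have e0: "f0 (rho DA \<beta> f) = - br (br n2 (c2 \<beta>)) (f0 f)" if "\<beta> \<in> \<Gamma>2'" "f \<in> Cinf M" for \<beta> f
    using beqD[OF bspec[OF bspec[OF S[THEN conjunct2, THEN conjunct2, THEN conjunct2, THEN conjunct2, THEN conjunct2, THEN conjunct2] that(1)] that(2)]] that by (simp add: bb rs_s rs_linear n del: One_nat_def)
  have 1: "n1 = m1"
  proof (rule T_unique[OF nT(1) m_T(1)])
    assume F: "n1 - m1 \<in> T 2 1 1"
    show "n1 - m1 = 0"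
    proof (rule T_zero_c1[OF F])
      show "odiff (P_dn l) (n1 - m1) = 0" for l
        by (rule no_P[OF F]) simp
      show "br (n1 - m1) (c1 \<alpha>) = 0" if "\<alpha> \<in> \<Gamma>1'" for \<alpha>
        using e1[OF that] dual_chart1[OF that] that by (simp add: B.pb_diff_left)
    qed simp
  qed
  have 2: "n2 = D.g2"
  proof (rule T_unique[OF nT(2) D.g2_T], rule T_zero_112)
    show "br (br (n2 - D.g2) (c2 \<beta>)) (f0 f) = 0" if "\<beta> \<in> \<Gamma>2'" "f \<in> Cinf M" for \<beta> f
      using e0[OF that] dual_chart0[OF that] that by (simp add: B.pb_diff_left)
    show "br (br (n2 - D.g2) (c2 \<beta>)) (c2 \<beta>') = 0" if "\<beta> \<in> \<Gamma>2'" "\<beta>' \<in> \<Gamma>2'" for \<beta> \<beta>'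
      using e2[OF that] dual_chart2[OF that] that by (simp add: B.pb_diff_left)
    show "br (br (n2 - D.g2) (c2 \<beta>)) (c1 \<alpha>) = 0" if "\<beta> \<in> \<Gamma>2'" "\<alpha> \<in> \<Gamma>1'" for \<beta> \<alpha>
      using e2m[OF that] dual_chart2m[OF that] that by (simp add: B.pb_diff_left)
  qed
  have 3: "n3 = D.g3"
  proof (rule T_unique[OF nT(3) D.g3_T], rule T_zero_013)
    show "br (br (br (n3 - D.g3) (c2 \<beta>)) (c2 \<beta>')) (c2 \<beta>'') = 0" if "\<beta> \<in> \<Gamma>2'" "\<beta>' \<in> \<Gamma>2'" "\<beta>'' \<in> \<Gamma>2'" for \<beta> \<beta>' \<beta>''
      using e3[OF that] dual_chart3[OF that] that by (simp add: B.pb_diff_left)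
  qed
  show ?thesis
    using tri_sum[OF tr] by (simp add: n 1 2 3 del: One_nat_def)
qed

end

context twisted_algebroid
begin

lemma dual_structure_\<gamma>: "dual_structure_function M A DA \<gamma>"
  unfolding dual_structure_function_def beq_iff dual_simps(1,2)
proof (intro conjI ballI allI impI)
  show "bfun_of_tridegrees M A {(2, 1, 1), (1, 1, 2), (0, 1, 3)} \<gamma>"
    unfolding bfun_of_tridegrees_def
  proof (intro allI impI)
    fix c assume "darboux_chart M A c"
    then interpret twisted_chart M A \<mu> H K c
      by (rule twisted_chart)
    have T: "m1 \<in> T (int 2) (int 1) (int 1)" "D.g2 \<in> T (int 1) (int 1) (int 2)" "D.g3 \<in> T (int 0) (int 1) (int 3)"
      using m_T(1) D.g2_T D.g3_T by simp_all
    show "finite {q. \<exists>x\<in>dm. \<gamma> c q x \<noteq> 0} \<and> (\<forall>q. smooth_on M dm (\<gamma> c q)) \<and>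
        (\<forall>q. \<forall>x\<in>dm. \<gamma> c q x \<noteq> 0 \<longrightarrow> mono_in M c q \<and> tridegree q \<in> {(2, 1, 1), (1, 1, 2), (0, 1, 3)})"
      using bfun_in_chart[of \<gamma> m1 D.g2 D.g3, OF rs_\<gamma> T] by blast
  qed
next
  fix c assume "darboux_chart M A c"
  then interpret twisted_chart M A \<mu> H K c
    by (rule twisted_chart)
  note [simp] = bb rs_s rs_linear \<gamma>_components and [simp del] = One_nat_def
  show "rs (big_bracket M \<gamma> \<gamma> c) = rs (0 c)"
    by (subst bb) (simp_all add: rs_\<gamma> \<gamma>_square)
  show "rs (cosec2 (bra1 DA \<alpha>) c) = rs ((- big_bracket M (tri (2, 1, 1) \<gamma>) (cosec1 \<alpha>)) c)" if "\<alpha> \<in> \<Gamma>1'" for \<alpha>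
    using that by (simp add: dual_chart1)
  show "rs (cosec2 (bra2 DA \<beta> \<beta>') c) = rs ((- big_bracket M (big_bracket M (tri (1, 1, 2) \<gamma>) (cosec2 \<beta>)) (cosec2 \<beta>')) c)"
    if "\<beta> \<in> \<Gamma>2'" "\<beta>' \<in> \<Gamma>2'" for \<beta> \<beta>'
    using that by (simp add: dual_chart2)
  show "rs (cosec1 (bra2m DA \<beta> \<alpha>) c) = rs ((- big_bracket M (big_bracket M (tri (1, 1, 2) \<gamma>) (cosec2 \<beta>)) (cosec1 \<alpha>)) c)"
    if "\<beta> \<in> \<Gamma>2'" "\<alpha> \<in> \<Gamma>1'" for \<beta> \<alpha>
    using that by (simp add: dual_chart2m)
  show "rs (cosec1 (bra3 DA \<beta> \<beta>' \<beta>'') c) = rs ((- big_bracket M (big_bracket M (big_bracket M (tri (0, 1, 3) \<gamma>) (cosec2 \<beta>)) (cosec2 \<beta>')) (cosec2 \<beta>'')) c)"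
    if "\<beta> \<in> \<Gamma>2'" "\<beta>' \<in> \<Gamma>2'" "\<beta>'' \<in> \<Gamma>2'" for \<beta> \<beta>' \<beta>''
    using that by (simp add: dual_chart3)
  show "rs (fun0 (rho DA \<beta> f) c) = rs ((- big_bracket M (big_bracket M (tri (1, 1, 2) \<gamma>) (cosec2 \<beta>)) (fun0 f)) c)"
    if "\<beta> \<in> \<Gamma>2'" "f \<in> Cinf M" for \<beta> f
    using that by (simp add: dual_chart0)
qed

abbreviation "obstruction1 \<equiv> big_bracket M (tri (2, 1, 1) \<mu>) (big_bracket M (tri (0, 3, 1) \<mu>) (sym12_fun A H))"
abbreviation "obstruction2 \<equiv> big_bracket M (tri (1, 2, 1) \<mu>) (big_bracket M (tri (0, 3, 1) \<mu>) (sym12_fun A H))"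
abbreviation "obstruction3 \<equiv> big_bracket M (tri (0, 3, 1) \<mu>) (big_bracket M (tri (2, 1, 1) \<mu>) (wedge3_fun A K))"

text \<open>Stated for arbitrary structure functions because the definition of a bialgebroid only
  asks that some pair exists; by uniqueness the condition does not depend on the pair.\<close>

lemma bialgebroid_bracket:
  assumes \<mu>': "structure_function M A \<mu>'" and \<gamma>': "dual_structure_function M A DA \<gamma>'"
  shows "beq M A (big_bracket M (\<mu>' + \<gamma>' - tri (2, 1, 1) \<mu>') (\<mu>' + \<gamma>' - tri (2, 1, 1) \<mu>')) 0 \<longleftrightarrow>
    beq M A obstruction1 0 \<and> beq M A obstruction2 0 \<and> beq M A obstruction3 0"
proof -
  have "restrict_gfun (cdom c) (big_bracket M (\<mu>' + \<gamma>' - tri (2, 1, 1) \<mu>') (\<mu>' + \<gamma>' - tri (2, 1, 1) \<mu>') c) = restrict_gfun (cdom c) (0 c) \<longleftrightarrow>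
      restrict_gfun (cdom c) (obstruction1 c) = restrict_gfun (cdom c) (0 c) \<and>
      restrict_gfun (cdom c) (obstruction2 c) = restrict_gfun (cdom c) (0 c) \<and>
      restrict_gfun (cdom c) (obstruction3 c) = restrict_gfun (cdom c) (0 c)" if "darboux_chart M A c" for c
  proof -
    interpret twisted_chart M A \<mu> H K c
      by (rule twisted_chart[OF that])
    have r: "rs ((\<mu>' + \<gamma>' - tri (2, 1, 1) \<mu>') c) = m1 + m2 + m3 + (m1 + D.g2 + D.g3) - m1"
      using structure_unique[OF \<mu>'] dual_unique[OF \<gamma>'] by (simp add: rs_linear del: One_nat_def)
    have C: "m1 + m2 + m3 + (m1 + D.g2 + D.g3) - m1 \<in> C"
      by simp
    have "rs (big_bracket M (\<mu>' + \<gamma>' - tri (2, 1, 1) \<mu>') (\<mu>' + \<gamma>' - tri (2, 1, 1) \<mu>') c) =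
        br (m1 + m2 + m3 + (m1 + D.g2 + D.g3) - m1) (m1 + m2 + m3 + (m1 + D.g2 + D.g3) - m1)"
      using bb(1)[of "\<mu>' + \<gamma>' - tri (2, 1, 1) \<mu>'" "\<mu>' + \<gamma>' - tri (2, 1, 1) \<mu>'"] C unfolding r by blast
    moreover have "rs (obstruction1 c) = br m1 (br m3 h)" "rs (obstruction2 c) = br m2 (br m3 h)" "rs (obstruction3 c) = br m3 (br m1 \<kappa>)"
      by (simp_all add: bb rs_s del: One_nat_def)
    moreover have "rs (0 c) = 0"
      by (simp add: rs_linear)
    ultimately show ?thesis
      using total_square by (simp only:)
  qed
  then show ?thesis
    unfolding beq_iff by blast
qed

theorem bialgebroid_iff:
  "split_lie2_bialgebroid M A DA \<longleftrightarrow> beq M A obstruction1 0 \<and> beq M A obstruction2 0 \<and> beq M A obstruction3 0"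
proof -
  have "beq M A (tri (2, 1, 1) \<mu>) (tri (2, 1, 1) \<gamma>)"
    unfolding beq_iff
  proof (intro allI impI)
    fix c assume "darboux_chart M A c"
    then interpret twisted_chart M A \<mu> H K c
      by (rule twisted_chart)
    show "rs (tri (2, 1, 1) \<mu> c) = rs (tri (2, 1, 1) \<gamma> c)"
      by (simp add: rs_s \<gamma>_components del: One_nat_def)
  qed
  then show ?thesis
    using bialgebroid_bracket \<mu> dual_structure_\<gamma> split_lie2_algebroid_axioms dual_algebroid
    unfolding split_lie2_bialgebroid_def dual_simps(1,2) by blast
qed

end

theorem theorem6p5:
  fixes M :: "'m::{t2_space, second_countable_topology} smfd"
    and A :: "('m, 'a::real_vector, 'b::real_vector) sl2"
    and \<mu> :: "('m, 'a, 'b) bfun"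
    and H :: "'m \<Rightarrow> ('a \<Rightarrow> real) \<Rightarrow> ('b \<Rightarrow> real) \<Rightarrow> real"
    and K :: "'m \<Rightarrow> ('b \<Rightarrow> real) \<Rightarrow> ('b \<Rightarrow> real) \<Rightarrow> ('b \<Rightarrow> real) \<Rightarrow> real"
  assumes A: "split_lie2_algebroid M A"
    and \<mu>: "structure_function M A \<mu>"
    and H: "H \<in> sym12_sections M A"
    and K: "K \<in> wedge3_sections M A"
    and MC: "maurer_cartan M A \<mu> (sym12_fun A H + wedge3_fun A K)"
  shows "split_lie2_algebroid M (dual_sl2 M A H K)
    \<and> sl2_morphism M (dual_sl2 M A H K) A
        (H_sharp A H) (\<lambda>x \<alpha>. - H_nat A H x \<alpha>) (\<lambda>x \<alpha> \<beta>. - K_flat A K x \<alpha> \<beta>)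
    \<and> (split_lie2_bialgebroid M A (dual_sl2 M A H K) \<longleftrightarrow>
        beq M A (big_bracket M (tri (2, 1, 1) \<mu>)
                  (big_bracket M (tri (0, 3, 1) \<mu>) (sym12_fun A H))) 0
        \<and> beq M A (big_bracket M (tri (1, 2, 1) \<mu>)
                  (big_bracket M (tri (0, 3, 1) \<mu>) (sym12_fun A H))) 0
        \<and> beq M A (big_bracket M (tri (0, 3, 1) \<mu>)
                  (big_bracket M (tri (2, 1, 1) \<mu>) (wedge3_fun A K))) 0)"
proof -
  interpret split_lie2_algebroid M A
    by (rule A)
  interpret twisted_algebroid M A \<mu> H K
    by unfold_locales (rule \<mu> H K MC)+
  show ?thesis
    using dual_algebroid dual_morphism bialgebroid_iff by blast
qed

end
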